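(* In the setting and notation of the context, assume that $\rho_0$ is not identically zero and that $\epsilon^d n$ converges as $n\to\infty$, with $$\alpha:=\lim_{n\to\infty}\epsilon^d n\,\lVert\rho_0\rVert_{L^1(\mathbb{T}^d)}\in[0,1).$$ Then the unidirectional flux $W^{(n)}$, viewed as a random element of $D(0,T;C^\infty(\mathbb{T}^d\times\{1,\dots,d\}\times\{+,-\})^* )$, converges narrowly in the Skorohod–Mitoma topology to the unique deterministic path $w=(w_{l,\pm})_{l=1,\dots,d;\,\pm\in\{+,-\}}$ satisfying, for every $l$ and $\pm$, $$\partial_t w_{l,\pm}(x,t)=\rho(x,t)-\frac{\alpha}{\lVert\rho_0\rVert_{L^1(\mathbb{T}^d)}}\,\rho^2(x,t),\qquad w_{l,\pm}(x,0)\equiv 0,$$ i.e. $w_{l,\pm}(dx,t)=\Big(\int_0^t\big(\rho(x,s)-\frac{\alpha}{\lVert\rho_0\rVert_{L^1}}\rho^2(x,s)\big)ds\Big)dx$.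
   Context: Fix $d\in\mathbb{N}$ and $T>0$. Let $\mathbb{T}^d=\mathbb{R}^d/\mathbb{Z}^d$. For each $n\in\mathbb{N}$ let $\epsilon=\epsilon_n\in\{1/N:N\in\mathbb{N}\}$ with $\epsilon_n\to0$ as $n\to\infty$, and let $\mathbb{T}_\epsilon^d=(\epsilon\mathbb{Z}/\mathbb{Z})^d$ (the discrete torus with $\epsilon^{-d}$ sites); $\mathds 1_l$ denotes the $l$-th unit vector. Write $x\sim y$ if $y=x\pm\epsilon\mathds1_l$ for some $l\in\{1,\dots,d\}$ and sign. Dynamics: $(\eta(t),\widetilde W(t),\widetilde C(t))$ is the continuous-time Markov process with $\eta(t)\in\{0,1\}^{\mathbb{T}_\epsilon^d}$ and $\widetilde W(t),\widetilde C(t)\in\mathbb{N}_0^{\mathbb{T}_\epsilon^d\times\mathbb{T}_\epsilon^d}$ such that for each ordered pair $(x,y)$ with $x\sim y$: at rate $\epsilon^{-2}\eta(x)(1-\eta(y))$ the particle at $x$ moves to $y$ ($\eta\mapsto\eta-\mathds1_x+\mathds1_y$) and $\widetilde W_{xy}$ increases by $1$; at rate $\epsilon^{-2}\eta(x)\eta(y)$ the collision count $\widetilde C_{xy}$ increases by $1$ (and $\eta$ is unchanged). Initial condition: $\rho_0\in C(\mathbb{T}^d)$ is a given nonnegative continuous density; the variables $\eta(x,0)$, $x\in\mathbb{T}_\epsilon^d$, are independent Bernoulli with parameter $n\int_{B_\epsilon(x)}\rho_0(y)\,dy\le 1$, where $B_\epsilon(x)=\prod_{i=1}^d[x_i-\epsilon/2,x_i+\epsilon/2]$;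 and $\widetilde W(0)=\widetilde C(0)=0$. $\rho(x,t)$ denotes the solution of $\partial_t\rho=\Delta\rho$ on $\mathbb{T}^d$ with $\rho(\cdot,0)=\rho_0$. Unidirectional flux: for $l=1,\dots,d$ and $\pm\in\{+,-\}$, $W^{(n)}_{l,\pm}(t)=\frac{\epsilon^2}{n}\sum_{x\in\mathbb{T}_\epsilon^d}\widetilde W_{x,x\pm\epsilon\mathds1_l}(t)\,\delta_{x\pm\frac{\epsilon}{2}\mathds1_l}$, a measure on $\mathbb{T}^d$; $W^{(n)}=(W^{(n)}_{l,\pm})$ is paired with $\phi\in C^\infty(\mathbb{T}^d\times\{1,\dots,d\}\times\{+,-\})$ via $\langle\phi,w\rangle=\sum_{l}\sum_{\pm}\int\phi_{l,\pm}\,dw_{l,\pm}$, thereby embedding measures into distributions. Topology: for a finite set $I$, $C^\infty(\mathbb{T}^d\times I)$ carries the Fréchet topology of uniform convergence of all derivatives, and its dual $C^\infty(\mathbb{T}^d\times I)^*$ carries the strong topology given by the seminorms $\lVert\xi\rVert_B=\sup_{\phi\in B}|\langle\phi,\xi\rangle|$, $B$ bounded. $D(0,T;C^\infty(\mathbb{T}^d\times I)^* )$ is the space of càdlàg paths with the Skorohod–Mitoma topology, generated by the metrics $d_B(\xi_1,\xi_2)=\inf_\tau\{\sup_t\lVert\xi_1(t)-\xi_2(\tau(t))\rVert_B+\sup_{s\neq t}|\log\frac{\tau(t)-\tau(s)}{t-s}|\}$ (infimum over strictly increasing continuous surjections $\tau$ of $[0,T]$), $B$ ranging over bounded subsets of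 $C^\infty(\mathbb{T}^d\times I)$. Narrow convergence means weak convergence of laws. *)

theory Defs
  imports "HOL-Probability.Probability" "HOL-Library.Countable"
begin

text \<open>The dimension d is the cardinality of the finite type 'd. Points of T^d are
  represented by points of R^d (real^'d) and functions on T^d by Z^d-periodic functions.
  The index set {1..d} x {+,-} is 'd x bool (True = +, False = -).\<close>

type_synonym 'd tf = "real^'d \<Rightarrow> 'd \<Rightarrow> bool \<Rightarrow> real"

definition pd :: "'d::finite \<Rightarrow> (real^'d \<Rightarrow> real) \<Rightarrow> (real^'d \<Rightarrow> real)" where
  "pd i f = (\<lambda>x. frechet_derivative f (at x) (axis i 1))"

definition pdl :: "'d::finite list \<Rightarrow> (real^'d \<Rightarrow> real) \<Rightarrow> (real^'d \<Rightarrow> real)" where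
  "pdl \<alpha> f = foldr pd \<alpha> f"

coinductive smooth_fun :: "(real^'d::finite \<Rightarrow> real) \<Rightarrow> bool" where
  "(\<forall>x. f differentiable (at x)) \<Longrightarrow> (\<forall>i. smooth_fun (pd i f)) \<Longrightarrow> smooth_fun f"

definition periodic_fun :: "(real^'d::finite \<Rightarrow> real) \<Rightarrow> bool" where
  "periodic_fun f \<longleftrightarrow> (\<forall>x i. f (x + axis i 1) = f x)"

definition test_fun :: "'d::finite tf \<Rightarrow> bool" where
  "test_fun \<phi> \<longleftrightarrow> (\<forall>l s. smooth_fun (\<lambda>x. \<phi> x l s) \<and> periodic_fun (\<lambda>x. \<phi> x l s))"

definition seminorm_k :: "nat \<Rightarrow> 'd::finite tf \<Rightarrow> real" where
  "seminorm_k k \<phi> = Sup {\<bar>pdl \<alpha> (\<lambda>y. \<phi> y l s) x\<bar> | \<alpha> x l s. length \<alpha> \<le> k}"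

definition bounded_tf :: "'d::finite tf set \<Rightarrow> bool" where
  "bounded_tf B \<longleftrightarrow> B \<subseteq> Collect test_fun \<and>
     (\<forall>\<alpha>. \<exists>C. \<forall>\<phi>\<in>B. \<forall>x l s. \<bar>pdl \<alpha> (\<lambda>y. \<phi> y l s) x\<bar> \<le> C)"

definition dual_elem :: "('d::finite tf \<Rightarrow> real) \<Rightarrow> bool" where
  "dual_elem \<xi> \<longleftrightarrow>
     (\<forall>\<phi> \<psi> a b. test_fun \<phi> \<longrightarrow> test_fun \<psi> \<longrightarrow>
        \<xi> (\<lambda>x l s. a * \<phi> x l s + b * \<psi> x l s) = a * \<xi> \<phi> + b * \<xi> \<psi>) \<and>
     (\<exists>k C. \<forall>\<phi>. test_fun \<phi> \<longrightarrow> \<bar>\<xi> \<phi>\<bar> \<le> C * seminorm_k k \<phi>)"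

definition normB :: "'d::finite tf set \<Rightarrow> ('d tf \<Rightarrow> real) \<Rightarrow> ereal" where
  "normB B \<xi> = Sup (insert 0 ((\<lambda>\<phi>. ereal \<bar>\<xi> \<phi>\<bar>) ` B))"

type_synonym 'd path = "real \<Rightarrow> 'd tf \<Rightarrow> real"

definition time_changes :: "real \<Rightarrow> (real \<Rightarrow> real) set" where
  "time_changes T = {\<tau>. strict_mono_on {0..T} \<tau> \<and> continuous_on {0..T} \<tau> \<and> \<tau> ` {0..T} = {0..T}}"

definition dSM :: "real \<Rightarrow> 'd::finite tf set \<Rightarrow> 'd path \<Rightarrow> 'd path \<Rightarrow> ereal" where
  "dSM T B \<xi>1 \<xi>2 = (INF \<tau>\<in>time_changes T.
      (SUP t\<in>{0..T}. normB B (\<lambda>\<phi>. \<xi>1 t \<phi> - \<xi>2 (\<tau> t) \<phi>)) +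
      (SUP st\<in>{(s,t). s \<in> {0..T} \<and> t \<in> {0..T} \<and> s \<noteq> t}.
          ereal \<bar>ln ((\<tau> (snd st) - \<tau> (fst st)) / (snd st - fst st))\<bar>))"

definition Dspace :: "real \<Rightarrow> 'd::finite path set" where
  "Dspace T = {\<xi>. (\<forall>t\<in>{0..T}. dual_elem (\<xi> t)) \<and>
     (\<forall>t\<in>{0..<T}. \<forall>B. bounded_tf B \<longrightarrow>
        ((\<lambda>s. normB B (\<lambda>\<phi>. \<xi> s \<phi> - \<xi> t \<phi>)) \<longlongrightarrow> 0) (at t within {t<..T})) \<and>
     (\<forall>t\<in>{0<..T}. \<exists>\<eta>. dual_elem \<eta> \<and> (\<forall>B. bounded_tf B \<longrightarrow>
        ((\<lambda>s. normB B (\<lambda>\<phi>. \<xi> s \<phi> - \<eta> \<phi>)) \<longlongrightarrow> 0) (at t within {0..<t})))}"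

definition SM_open :: "real \<Rightarrow> 'd::finite path set \<Rightarrow> bool" where
  "SM_open T U \<longleftrightarrow> U \<subseteq> Dspace T \<and>
     (\<forall>\<xi>\<in>U. \<exists>Bs r. finite Bs \<and> (\<forall>B\<in>Bs. bounded_tf B) \<and> r > 0 \<and>
        {\<eta>\<in>Dspace T. \<forall>B\<in>Bs. dSM T B \<xi> \<eta> < r} \<subseteq> U)"

definition SM_top :: "real \<Rightarrow> 'd::finite path topology" where
  "SM_top T = topology (SM_open T)"

definition narrow_conv_to_det ::
  "real \<Rightarrow> 'a measure \<Rightarrow> (nat \<Rightarrow> 'a \<Rightarrow> 'd::finite path) \<Rightarrow> 'd path \<Rightarrow> bool" where
  "narrow_conv_to_det T M X w \<longleftrightarrow> w \<in> Dspace T \<and>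
     (\<forall>F. continuous_map (SM_top T) euclideanreal F \<and> bounded (F ` Dspace T) \<longrightarrow>
        (\<forall>n. (\<lambda>\<omega>. F (X n \<omega>)) \<in> borel_measurable M) \<and>
        (\<lambda>n. \<integral>\<omega>. F (X n \<omega>) \<partial>M) \<longlonglongrightarrow> F w)"

definition heat_sol :: "real \<Rightarrow> (real^'d::finite \<Rightarrow> real) \<Rightarrow> (real^'d \<Rightarrow> real \<Rightarrow> real) \<Rightarrow> bool" where
  "heat_sol T \<rho>0 \<rho> \<longleftrightarrow>
     (\<forall>t. periodic_fun (\<lambda>x. \<rho> x t)) \<and>
     continuous_on (UNIV \<times> {0..T}) (\<lambda>(x,t). \<rho> x t) \<and>
     (\<forall>x. \<rho> x 0 = \<rho>0 x) \<and>
     (\<forall>t\<in>{0<..<T}. \<forall>x. (\<lambda>z. \<rho> z t) differentiable (at x) \<and>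
        (\<forall>i. pd i (\<lambda>z. \<rho> z t) differentiable (at x)) \<and>
        ((\<lambda>r. \<rho> x r) has_real_derivative (\<Sum>i\<in>UNIV. pd i (pd i (\<lambda>z. \<rho> z t)) x)) (at t))"

type_synonym 'd site = "'d \<Rightarrow> nat"
type_synonym 'd state = "('d site \<Rightarrow> bool) \<times> ('d site \<Rightarrow> 'd site \<Rightarrow> nat)"

definition sites :: "nat \<Rightarrow> 'd::finite site set" where
  "sites N = {x. \<forall>i. x i < N}"

definition shift :: "nat \<Rightarrow> 'd::finite \<Rightarrow> bool \<Rightarrow> 'd site \<Rightarrow> 'd site" where
  "shift N l s x = x(l := (if s then (x l + 1) mod N else (x l + N - 1) mod N))"

definition loc :: "nat \<Rightarrow> 'd::finite site \<Rightarrow> real^'d" where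
  "loc N x = (\<chi> i. real (x i) / real N)"

definition nbr_pairs :: "nat \<Rightarrow> ('d::finite site \<times> 'd site) set" where
  "nbr_pairs N = {(x,y). x \<in> sites N \<and> (\<exists>l s. y = shift N l s x)}"

definition pair_enum :: "nat \<Rightarrow> nat \<Rightarrow> 'd::finite site \<times> 'd site" where
  "pair_enum N = (SOME f::nat \<Rightarrow> 'd site \<times> 'd site.
      bij_betw f {..<card (nbr_pairs N :: ('d site \<times> 'd site) set)} (nbr_pairs N))"

text \<open>Uniform choice of an ordered neighbour pair from a uniform [0,1] variable.\<close>
definition pair_choice :: "nat \<Rightarrow> real \<Rightarrow> 'd::finite site \<times> 'd site" where
  "pair_choice N u = pair_enum N (min (nat \<lfloor>u * real (card (nbr_pairs (N::nat) :: ('d site \<times> 'd site) set))\<rfloor>)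
                                      (card (nbr_pairs N :: ('d site \<times> 'd site) set) - 1))"

definition clock_step :: "'d::finite state \<Rightarrow> 'd site \<times> 'd site \<Rightarrow> 'd state" where
  "clock_step st xy = (let (\<eta>, W) = st; (x, y) = xy in
     if \<eta> x \<and> \<not> \<eta> y then (\<eta>(x := False, y := True), W(x := (W x)(y := W x y + 1))) else (\<eta>, W))"

text \<open>Total clock rate: every ordered neighbour pair rings at rate eps^-2 = N^2.\<close>
definition total_rate :: "nat \<Rightarrow> 'd::finite itself \<Rightarrow> real" where
  "total_rate N _ = real (card (nbr_pairs N :: ('d site \<times> 'd site) set)) * real N ^ 2"

text \<open>Randomness: an i.i.d. sequence omega of Uniform[0,1] variables. omega(3k) gives the
  k-th Exp(1) holding variable, omega(3k+1) the k-th clock choice, and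
  omega(3 to_nat x + 2) the initial occupation variable of site x.\<close>
definition Omega :: "(nat \<Rightarrow> real) measure" where
  "Omega = PiM UNIV (\<lambda>_. uniform_measure lborel {0..1::real})"

definition init_param :: "(nat \<Rightarrow> nat) \<Rightarrow> (real^'d::finite \<Rightarrow> real) \<Rightarrow> nat \<Rightarrow> 'd site \<Rightarrow> real" where
  "init_param Nseq \<rho>0 n x = real n *
     integral (cbox (loc (Nseq n) x - (1 / (2 * real (Nseq n))) *\<^sub>R One)
                    (loc (Nseq n) x + (1 / (2 * real (Nseq n))) *\<^sub>R One)) \<rho>0"

primrec chain :: "(nat \<Rightarrow> nat) \<Rightarrow> (real^'d::finite \<Rightarrow> real) \<Rightarrow> nat \<Rightarrow> (nat \<Rightarrow> real) \<Rightarrow> nat \<Rightarrow> 'd state" where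
  "chain Nseq \<rho>0 n \<omega> 0 = ((\<lambda>x. \<omega> (3 * to_nat x + 2) < init_param Nseq \<rho>0 n x), (\<lambda>x y. 0))"
| "chain Nseq \<rho>0 n \<omega> (Suc j) = clock_step (chain Nseq \<rho>0 n \<omega> j) (pair_choice (Nseq n) (\<omega> (3 * j + 1)))"

text \<open>Time of the (k+1)-th clock ring.\<close>
definition ring_time :: "'d::finite itself \<Rightarrow> nat \<Rightarrow> (nat \<Rightarrow> real) \<Rightarrow> nat \<Rightarrow> real" where
  "ring_time D N \<omega> k = (\<Sum>i\<le>k. - ln (\<omega> (3 * i))) / total_rate N D"

text \<open>W~(t); on the null event of infinitely many rings before T the zero path is used.\<close>
definition Wtil :: "real \<Rightarrow> (nat \<Rightarrow> nat) \<Rightarrow> (real^'d::finite \<Rightarrow> real) \<Rightarrow> nat \<Rightarrow> (nat \<Rightarrow> real) \<Rightarrow> real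
                    \<Rightarrow> 'd site \<Rightarrow> 'd site \<Rightarrow> nat" where
  "Wtil T Nseq \<rho>0 n \<omega> t =
     (if infinite {k. ring_time TYPE('d) (Nseq n) \<omega> k \<le> T} then (\<lambda>x y. 0)
      else snd (chain Nseq \<rho>0 n \<omega> (card {k. ring_time TYPE('d) (Nseq n) \<omega> k \<le> t})))"

definition Wflux :: "real \<Rightarrow> (nat \<Rightarrow> nat) \<Rightarrow> (real^'d::finite \<Rightarrow> real) \<Rightarrow> nat \<Rightarrow> (nat \<Rightarrow> real) \<Rightarrow> 'd path" where
  "Wflux T Nseq \<rho>0 n \<omega> t \<phi> =
     (let N = Nseq n; \<epsilon> = 1 / real N in
      (\<epsilon>^2 / real n) * (\<Sum>x\<in>sites N. \<Sum>l\<in>UNIV. \<Sum>s\<in>UNIV.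
         real (Wtil T Nseq \<rho>0 n \<omega> t x (shift N l s x)) *
         \<phi> (loc N x + (if s then \<epsilon> / 2 else - \<epsilon> / 2) *\<^sub>R axis l 1) l s))"

definition wlim :: "(real^'d::finite \<Rightarrow> real \<Rightarrow> real) \<Rightarrow> real \<Rightarrow> real \<Rightarrow> 'd path" where
  "wlim \<rho> \<alpha> m t \<phi> = (\<Sum>l\<in>UNIV. \<Sum>s\<in>UNIV.
      integral (cbox 0 One) (\<lambda>x. \<phi> x l s * integral {0..t} (\<lambda>r. \<rho> x r - \<alpha> / m * (\<rho> x r)^2)))"

end

theory Submission
  imports Defs "HOL-Combinatorics.Transposition" "HOL-Number_Theory.Cong"
begin

text \<open>The chain embedded at the clock rings is a stirring process: the probability that one site or both
  sites of a pair are occupied evolves by an averaging walk on sites or on pairs. The flux through weighted bonds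
  becomes a martingale after adding a linear and a quadratic corrector in the occupation variables, both built
  from Green functions of these walks. Its variance is controlled by the time that pairs spend
  adjacent, which an energy estimate bounds. The mean is compared with the limit by approximating the
  initial density with trigonometric polynomials, whose discrete and continuous heat flows are explicit, and by
  the maximum principle. The law of large numbers for the exponential clocks transfers the convergence to
  continuous time; monotonicity of the counts makes it uniform in time, and finite nets in the supremum norm
  make it uniform over bounded sets of test functions. The limit is continuous in time, so only the identity time
  change is needed for the convergence itself. Genuine time changes enter in the measurability of
  continuous functionals, which are pointwise limits of functionals of time-discretized paths.\<close>

section \<open>Symmetric averaging walks\<close>

text \<open>The jump indicator \<open>\<eta> x (1 - \<eta> y)\<close> is a linear minus a quadratic
  statistic, and stirring preserves both classes, so no moment hierarchy has to be closed. What
  remains is to replace the two-point function of neighbouring sites by a product. At positive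
  density this is not a matter of rare encounters: the pair walk departs from two independent walks
  when a bond joins the pair, and adjacency must be shown to take a negligible share of the time. In
  low dimension the walk is recurrent and return probabilities are not summable; instead the mass on
  adjacent pairs is compared, along a lattice line, with the mass at distances up to
  \<open>M\<close>, which works in every dimension. The resulting error has the form 1/M + sqrt M /
  N, with \<open>M\<close> fixed after the approximating polynomial and before \<open>n\<close>. The
  chain at the rings isolates the combinatorics from the random clock; time \<open>t\<close>
  corresponds to about \<open>Lam * t\<close> rings. Test functions are first taken nonnegative, for
  positive Green functions and monotone fluxes; a constant shift removes the restriction.\<close>

locale involution_walk =
  fixes X :: "'b set" and C :: "'c set" and \<sigma> :: "'c \<Rightarrow> 'b \<Rightarrow> 'b"
  assumes finX: "finite X" and finC: "finite C" and neC: "C \<noteq> {}"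
    and closed: "\<And>c p. c \<in> C \<Longrightarrow> p \<in> X \<Longrightarrow> \<sigma> c p \<in> X"
    and invol: "\<And>c p. c \<in> C \<Longrightarrow> \<sigma> c (\<sigma> c p) = p"
begin

text \<open>Lazy walk: stay with probability 1/2, otherwise apply a uniformly chosen involution. The
  laziness comes from the dynamics, where of the two orders of a bond at most one moves a particle;
  it also puts the spectrum into the unit interval, which is the content of
  \<open>avg_square\<close>.\<close>

definition avg :: "('b \<Rightarrow> real) \<Rightarrow> 'b \<Rightarrow> real" where
  "avg f p = (f p + (\<Sum>c\<in>C. f (\<sigma> c p)) / card C) / 2"

definition energy :: "('b \<Rightarrow> real) \<Rightarrow> real" where
  "energy f = (\<Sum>c\<in>C. \<Sum>p\<in>X. (f (\<sigma> c p) - f p)\<^sup>2)"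

section \<open>Reversibility and the Dirichlet form\<close>

lemma cardC: "real (card C) > 0"
  using finC neC by (simp add: card_gt_0_iff)

lemma sum_\<sigma>: "c \<in> C \<Longrightarrow> (\<Sum>p\<in>X. f (\<sigma> c p)) = (\<Sum>p\<in>X. f p)"
  by (rule sum.reindex_bij_witness[of _ "\<sigma> c" "\<sigma> c"]) (auto simp: closed invol)

lemma sum_\<sigma>2: "c \<in> C \<Longrightarrow> (\<Sum>p\<in>X. f (\<sigma> c p) * g p) = (\<Sum>p\<in>X. f p * g (\<sigma> c p))"
  by (rule sum.reindex_bij_witness[of _ "\<sigma> c" "\<sigma> c"]) (auto simp: closed invol)

lemma avg_const: "avg (\<lambda>_. a) p = a"
  using cardC by (simp add: avg_def)

lemma avg_add: "avg (\<lambda>p. f p + g p) p = avg f p + avg g p"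
  by (simp add: avg_def sum.distrib add_divide_distrib)

lemma avg_scale: "avg (\<lambda>p. a * f p) p = a * avg f p"
  by (simp add: avg_def sum_distrib_left[symmetric] add_divide_distrib algebra_simps)

lemma avg_diff: "avg (\<lambda>p. f p - g p) p = avg f p - avg g p"
  by (simp add: avg_def sum_subtractf add_divide_distrib diff_divide_distrib)

lemma avg_sum: "avg (\<lambda>p. \<Sum>i\<in>I. f i p) p = (\<Sum>i\<in>I. avg (f i) p)"
proof -
  have "(\<Sum>c\<in>C. \<Sum>i\<in>I. f i (\<sigma> c p)) = (\<Sum>i\<in>I. \<Sum>c\<in>C. f i (\<sigma> c p))"
    by (rule sum.swap)
  then show ?thesis
    by (simp add: avg_def sum.distrib sum_divide_distrib[symmetric])
qed

lemma avg_cong: "p \<in> X \<Longrightarrow> (\<And>q. q \<in> X \<Longrightarrow> f q = g q) \<Longrightarrow> avg f p = avg g p"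
  by (auto simp: avg_def closed intro!: sum.cong arg_cong2[where f="(+)"])

lemma avg_mono:
  assumes "p \<in> X" "\<And>q. q \<in> X \<Longrightarrow> f q \<le> g q"
  shows "avg f p \<le> avg g p"
proof -
  have "(\<Sum>c\<in>C. f (\<sigma> c p)) / card C \<le> (\<Sum>c\<in>C. g (\<sigma> c p)) / card C"
    using assms cardC by (intro divide_right_mono sum_mono) (auto simp: closed)
  then show ?thesis using assms(2)[OF assms(1)]
    unfolding avg_def by (intro divide_right_mono[where c=2] add_mono) auto
qed

text \<open>Every \<open>\<sigma> c\<close> is its own inverse and permutes \<open>X\<close>, so
  counting measure is reversible for the walk.\<close>

lemma avg_adjoint: "(\<Sum>p\<in>X. avg f p * g p) = (\<Sum>p\<in>X. f p * avg g p)"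
proof -
  have eq: "(\<Sum>p\<in>X. avg f p * g p) =
    ((\<Sum>p\<in>X. f p * g p) + (\<Sum>c\<in>C. \<Sum>p\<in>X. f (\<sigma> c p) * g p) / card C) / 2" for f g
  proof -
    have "(\<Sum>c\<in>C. \<Sum>p\<in>X. f (\<sigma> c p) * g p) = (\<Sum>p\<in>X. (\<Sum>c\<in>C. f (\<sigma> c p)) * g p)"
      unfolding sum_distrib_right by (rule sum.swap)
    moreover have "avg f p * g p = f p * g p / 2 + (\<Sum>c\<in>C. f (\<sigma> c p)) * g p / (2 * card C)" for p
      by (simp add: avg_def field_simps)
    ultimately show ?thesis
      by (simp add: sum.distrib sum_divide_distrib[symmetric] add_divide_distrib mult.commute)
  qed
  have "(\<Sum>p\<in>X. f p * avg g p) = (\<Sum>p\<in>X. avg g p * f p)" by (simp add: mult.commute)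
  also have "\<dots> = ((\<Sum>p\<in>X. g p * f p) + (\<Sum>c\<in>C. \<Sum>p\<in>X. g (\<sigma> c p) * f p) / card C) / 2" by (rule eq)
  also have "(\<Sum>c\<in>C. \<Sum>p\<in>X. g (\<sigma> c p) * f p) = (\<Sum>c\<in>C. \<Sum>p\<in>X. f (\<sigma> c p) * g p)"
    using sum_\<sigma>2[of _ f g] by (intro sum.cong[OF refl, where A=C]) (simp add: mult.commute)
  finally show ?thesis unfolding eq by (simp add: mult.commute)
qed

lemma sum_avg: "(\<Sum>p\<in>X. avg f p) = (\<Sum>p\<in>X. f p)"
  using avg_adjoint[of f "\<lambda>_. 1"] by (simp add: avg_const)

text \<open>Expanding the squares in \<open>energy\<close> counts the squared norm twice per
  involution; with the factor 1/2 in \<open>avg\<close> this gives the constant 4.\<close>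

lemma dirichlet: "(\<Sum>p\<in>X. f p * (f p - avg f p)) = energy f / (4 * card C)"
proof -
  have s: "(\<Sum>p\<in>X. (f (\<sigma> c p) - f p)\<^sup>2) = 2 * (\<Sum>p\<in>X. (f p)\<^sup>2) - 2 * (\<Sum>p\<in>X. f p * f (\<sigma> c p))"
    if "c \<in> C" for c
    using sum_\<sigma>[OF that, of "\<lambda>p. (f p)\<^sup>2"]
    by (simp add: power2_diff sum.distrib sum_subtractf sum_distrib_left mult_ac)
  have "energy f = (\<Sum>c\<in>C. 2 * (\<Sum>p\<in>X. (f p)\<^sup>2) - 2 * (\<Sum>p\<in>X. f p * f (\<sigma> c p)))"
    unfolding energy_def using s by (intro sum.cong) auto
  also have "\<dots> = 2 * card C * (\<Sum>p\<in>X. (f p)\<^sup>2) - 2 * (\<Sum>c\<in>C. \<Sum>p\<in>X. f p * f (\<sigma> c p))"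
    by (simp add: sum_subtractf sum_distrib_left[symmetric])
  also have "(\<Sum>c\<in>C. \<Sum>p\<in>X. f p * f (\<sigma> c p)) = (\<Sum>p\<in>X. f p * (\<Sum>c\<in>C. f (\<sigma> c p)))"
    unfolding sum_distrib_left by (rule sum.swap)
  finally have e: "energy f = 2 * card C * (\<Sum>p\<in>X. (f p)\<^sup>2) - 2 * (\<Sum>p\<in>X. f p * (\<Sum>c\<in>C. f (\<sigma> c p)))" .
  have "f p * (f p - avg f p) = (f p)\<^sup>2 / 2 - f p * (\<Sum>c\<in>C. f (\<sigma> c p)) / (2 * card C)" for p
    using cardC by (simp add: avg_def field_simps power2_eq_square)
  then have "(\<Sum>p\<in>X. f p * (f p - avg f p)) =
     (\<Sum>p\<in>X. (f p)\<^sup>2) / 2 - (\<Sum>p\<in>X. f p * (\<Sum>c\<in>C. f (\<sigma> c p))) / (2 * card C)"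
    by (simp add: sum_subtractf sum_divide_distrib)
  then show ?thesis using e cardC by (simp add: field_simps)
qed

text \<open>\<open>avg f\<close> is the midpoint of \<open>f\<close> and the uniform average
  \<open>?S\<close>, so \<open>f * avg f - (avg f)\<^sup>2\<close> is a quarter of the difference of
  their squares; by Cauchy-Schwarz and invariance of sums, \<open>?S\<close> has no larger norm than
  \<open>f\<close>. This is where laziness enters.\<close>

lemma avg_square: "(\<Sum>p\<in>X. (avg f p)\<^sup>2) \<le> (\<Sum>p\<in>X. f p * avg f p)"
proof -
  let ?S = "\<lambda>p. (\<Sum>c\<in>C. f (\<sigma> c p)) / card C"
  have js: "(?S p)\<^sup>2 \<le> (\<Sum>c\<in>C. (f (\<sigma> c p))\<^sup>2) / card C" for p
  proof -
    have "(\<Sum>c\<in>C. f (\<sigma> c p) * 1)\<^sup>2 \<le> (\<Sum>c\<in>C. (f (\<sigma> c p))\<^sup>2) * (\<Sum>c\<in>C. 1\<^sup>2)"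
      by (rule Cauchy_Schwarz_ineq_sum)
    then show ?thesis using cardC by (simp add: power_divide power2_eq_square field_simps)
  qed
  have "(\<Sum>p\<in>X. (?S p)\<^sup>2) \<le> (\<Sum>p\<in>X. (\<Sum>c\<in>C. (f (\<sigma> c p))\<^sup>2) / card C)"
    by (rule sum_mono) (rule js)
  also have "\<dots> = (\<Sum>c\<in>C. \<Sum>p\<in>X. (f (\<sigma> c p))\<^sup>2) / card C"
    by (subst sum.swap) (simp add: sum_divide_distrib)
  also have "\<dots> = (\<Sum>p\<in>X. (f p)\<^sup>2)"
    using cardC sum_\<sigma>[of _ "\<lambda>p. (f p)\<^sup>2"] by simp
  finally have S: "(\<Sum>p\<in>X. (?S p)\<^sup>2) \<le> (\<Sum>p\<in>X. (f p)\<^sup>2)" .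
  have "f p * avg f p - (avg f p)\<^sup>2 = ((f p)\<^sup>2 - (?S p)\<^sup>2) / 4" for p
  proof -
    have "a * ((a + b) / 2) - ((a + b) / 2)\<^sup>2 = (a\<^sup>2 - b\<^sup>2) / 4" for a b :: real
      by (simp add: field_simps power2_eq_square)
    then show ?thesis unfolding avg_def .
  qed
  then have "(\<Sum>p\<in>X. f p * avg f p - (avg f p)\<^sup>2) = (\<Sum>p\<in>X. ((f p)\<^sup>2 - (?S p)\<^sup>2) / 4)"
    by (intro sum.cong refl)
  also have "\<dots> = ((\<Sum>p\<in>X. (f p)\<^sup>2) - (\<Sum>p\<in>X. (?S p)\<^sup>2)) / 4"
    by (simp only: sum_divide_distrib sum_subtractf diff_divide_distrib)
  finally have "(\<Sum>p\<in>X. f p * avg f p) - (\<Sum>p\<in>X. (avg f p)\<^sup>2) = ((\<Sum>p\<in>X. (f p)\<^sup>2) - (\<Sum>p\<in>X. (?S p)\<^sup>2)) / 4"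
    by (simp only: sum_subtractf)
  moreover have "0 \<le> ((\<Sum>p\<in>X. (f p)\<^sup>2) - (\<Sum>p\<in>X. (?S p)\<^sup>2)) / 4"
    by (rule divide_nonneg_pos) (rule diff_ge_0_iff_ge[THEN iffD2, OF S], simp)
  ultimately have "0 \<le> (\<Sum>p\<in>X. f p * avg f p) - (\<Sum>p\<in>X. (avg f p)\<^sup>2)" by (simp only:)
  then show ?thesis by (simp only: diff_ge_0_iff_ge)
qed

section \<open>Iterates of the walk, total energy and Green functions\<close>

abbreviation pow :: "nat \<Rightarrow> ('b \<Rightarrow> real) \<Rightarrow> 'b \<Rightarrow> real" where
  "pow k f \<equiv> (avg ^^ k) f"

lemma pow_Suc2: "pow (Suc k) f = pow k (avg f)"
  by (simp add: funpow_swap1)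

lemma pow_const: "pow k (\<lambda>_. a) = (\<lambda>_. a)"
  by (induction k) (simp_all add: avg_const[abs_def])

lemma pow_add: "pow k (\<lambda>p. f p + g p) = (\<lambda>p. pow k f p + pow k g p)"
  by (induction k) (simp_all add: avg_add)

lemma pow_diff: "pow k (\<lambda>p. f p - g p) = (\<lambda>p. pow k f p - pow k g p)"
  by (induction k) (simp_all add: avg_diff)

lemma pow_scale: "pow k (\<lambda>p. a * f p) = (\<lambda>p. a * pow k f p)"
  by (induction k) (simp_all add: avg_scale)

lemma pow_mono:
  "(\<And>q. q \<in> X \<Longrightarrow> f q \<le> g q) \<Longrightarrow> p \<in> X \<Longrightarrow> pow k f p \<le> pow k g p"
  by (induction k arbitrary: p) (auto intro!: avg_mono)

lemma pow_cong:
  "(\<And>q. q \<in> X \<Longrightarrow> f q = g q) \<Longrightarrow> p \<in> X \<Longrightarrow> pow k f p = pow k g p"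
  by (induction k arbitrary: p) (auto intro!: avg_cong)

lemma pow_le: "(\<And>q. q \<in> X \<Longrightarrow> f q \<le> a) \<Longrightarrow> p \<in> X \<Longrightarrow> pow k f p \<le> a"
  using pow_mono[of f "\<lambda>_. a" p k] by (simp add: pow_const)

lemma pow_ge: "(\<And>q. q \<in> X \<Longrightarrow> a \<le> f q) \<Longrightarrow> p \<in> X \<Longrightarrow> a \<le> pow k f p"
  using pow_mono[of "\<lambda>_. a" f p k] by (simp add: pow_const)

lemma pow_abs_diff_le:
  assumes "\<And>q. q \<in> X \<Longrightarrow> \<bar>f q - g q\<bar> \<le> a" "p \<in> X"
  shows "\<bar>pow k f p - pow k g p\<bar> \<le> a"
proof -
  have "pow k (\<lambda>q. f q - g q) p \<le> a" "- a \<le> pow k (\<lambda>q. f q - g q) p"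
    using assms by (auto intro!: pow_le pow_ge simp: abs_le_iff minus_le_iff) force
  then show ?thesis by (simp add: pow_diff)
qed

lemma pow_adjoint: "(\<Sum>p\<in>X. pow k f p * g p) = (\<Sum>p\<in>X. f p * pow k g p)"
proof (induction k arbitrary: f)
  case (Suc k)
  have "(\<Sum>p\<in>X. pow (Suc k) f p * g p) = (\<Sum>p\<in>X. avg f p * pow k g p)"
    using Suc[of "avg f"] by (simp add: funpow_swap1)
  also have "\<dots> = (\<Sum>p\<in>X. f p * pow (Suc k) g p)" by (simp add: avg_adjoint)
  finally show ?case .
qed simp

lemma sum_pow: "(\<Sum>p\<in>X. pow k f p) = (\<Sum>p\<in>X. f p)"
  by (induction k) (simp_all add: sum_avg)

text \<open>Each step lowers the squared norm by at least its Dirichlet form, so the energies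
  telescope against the initial norm, uniformly in the number of steps.\<close>

lemma sum_energy_pow:
  fixes f :: "'b \<Rightarrow> real"
  shows "(\<Sum>k<K. energy (pow k f)) \<le> 4 * real (card C) * (\<Sum>p\<in>X. (f p)\<^sup>2)"
proof -
  have "(\<Sum>k<K. energy (pow k f)) / (4 * card C) + (\<Sum>p\<in>X. (pow K f p)\<^sup>2) \<le> (\<Sum>p\<in>X. (f p)\<^sup>2)"
  proof (induction K)
    case (Suc K)
    let ?g = "pow K f"
    have "energy ?g / (4 * card C) = (\<Sum>p\<in>X. (?g p)\<^sup>2) - (\<Sum>p\<in>X. ?g p * avg ?g p)"
      unfolding dirichlet[symmetric] by (simp add: sum_subtractf right_diff_distrib power2_eq_square)
    with avg_square[of ?g] have "energy ?g / (4 * card C) + (\<Sum>p\<in>X. (avg ?g p)\<^sup>2) \<le> (\<Sum>p\<in>X. (?g p)\<^sup>2)"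
      by linarith
    with Suc show ?case by (simp add: add_divide_distrib)
  qed simp
  moreover have "0 \<le> (\<Sum>p\<in>X. (pow K f p)\<^sup>2)" by (simp add: sum_nonneg)
  ultimately have "(\<Sum>k<K. energy (pow k f)) / (4 * card C) \<le> (\<Sum>p\<in>X. (f p)\<^sup>2)" by linarith
  then show ?thesis using cardC by (simp add: field_simps)
qed

text \<open>Green function up to a finite horizon. Constants are fixed by \<open>avg\<close>, so the
  infinite sum would diverge; the horizon will be the number of rings still to come.\<close>

definition green :: "nat \<Rightarrow> ('b \<Rightarrow> real) \<Rightarrow> 'b \<Rightarrow> real" where
  "green m f p = (\<Sum>k<m. pow k f p)"

lemma green_Suc: "green (Suc m) f p = f p + avg (green m f) p"
proof -
  have "green (Suc m) f p = (\<Sum>k<Suc m. pow k f p)" by (simp add: green_def)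
  also have "\<dots> = f p + (\<Sum>k<m. pow (Suc k) f p)" by (subst sum.lessThan_Suc_shift) simp
  also have "(\<Sum>k<m. pow (Suc k) f p) = avg (green m f) p"
    by (simp add: green_def[abs_def] avg_sum)
  finally show ?thesis .
qed

text \<open>\<open>green\<close> solves a Poisson equation with right side
  \<open>f - pow m f\<close>. Testing the equation against the solution gives the energy; positivity
  lets the term with \<open>pow m f\<close> be dropped.\<close>

lemma energy_green:
  assumes "\<And>p. p \<in> X \<Longrightarrow> 0 \<le> f p"
  shows "energy (green m f) \<le> 4 * real (card C) * (\<Sum>k<m. \<Sum>p\<in>X. f p * pow k f p)"
proof -
  have g: "green m f p - avg (green m f) p = f p - pow m f p" for p
    using green_Suc[of m f p] by (simp add: green_def)
  have nn: "0 \<le> green m f p" "0 \<le> pow m f p" if "p \<in> X" for p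
    using that assms by (auto simp: green_def intro!: sum_nonneg pow_ge)
  have "energy (green m f) / (4 * card C) = (\<Sum>p\<in>X. green m f p * (f p - pow m f p))"
    unfolding dirichlet[symmetric] g ..
  also have "\<dots> \<le> (\<Sum>p\<in>X. green m f p * f p)"
    using nn by (intro sum_mono mult_left_mono) auto
  also have "\<dots> = (\<Sum>k<m. \<Sum>p\<in>X. f p * pow k f p)"
    unfolding green_def by (subst sum.swap) (simp add: sum_distrib_left mult.commute)
  finally show ?thesis using cardC by (simp add: field_simps)
qed

end

section \<open>Walks on the discrete torus\<close>

lemma sites_eq_PiE: "sites N = PiE UNIV (\<lambda>_. {..<N})"
  by (auto simp: sites_def PiE_def)

lemma finite_sites [simp]: "finite (sites N :: 'd::finite site set)"
  unfolding sites_eq_PiE by (intro finite_PiE) auto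

lemma card_sites: "card (sites N :: 'd::finite site set) = N ^ CARD('d)"
  unfolding sites_eq_PiE by (simp add: card_PiE)

section \<open>Neighbours, lattice lines and ordered neighbour pairs\<close>

lemma shift_eq: "N \<ge> 1 \<Longrightarrow> shift N l s x = x(l := (x l + (if s then 1 else N - 1)) mod N)"
  by (auto simp: shift_def)

lemma shift_sites: "N \<ge> 1 \<Longrightarrow> x \<in> sites N \<Longrightarrow> shift N l s x \<in> sites N"
  by (auto simp: shift_eq sites_def)

lemma shift_shift: "N \<ge> 1 \<Longrightarrow> x \<in> sites N \<Longrightarrow> shift N l (\<not> s) (shift N l s x) = x"
  by (auto simp: shift_eq sites_def fun_eq_iff mod_simps)

lemma shift_iff:
  assumes "N \<ge> 1" "x \<in> sites N" "z \<in> sites N"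
  shows "shift N l s z = x \<longleftrightarrow> z = shift N l (\<not> s) x"
  using shift_shift[OF assms(1,3), of l s] shift_shift[OF assms(1,2), of l "\<not> s"] by auto

lemma mod_step:
  fixes a N :: nat
  assumes "a < N"
  shows "(a + 1) mod N = (if a + 1 = N then 0 else a + 1)"
    "(a + (N - 1)) mod N = (if a = 0 then N - 1 else a - 1)"
proof -
  show "(a + 1) mod N = (if a + 1 = N then 0 else a + 1)" using assms by auto
  show "(a + (N - 1)) mod N = (if a = 0 then N - 1 else a - 1)"
  proof (cases "a = 0")
    case False
    then have "(a + (N - 1)) mod N = ((a - 1) + N) mod N" using assms by (intro arg_cong2[where f="(mod)"]) auto
    then show ?thesis using assms False by (simp only: mod_add_self2 mod_less) simp
  qed (use assms in auto)
qed

lemma shift_funpow: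
  assumes "N \<ge> 1" "x \<in> sites N"
  shows "(shift N l s ^^ i) x = x(l := (x l + i * (if s then 1 else N - 1)) mod N)"
proof (induction i)
  case 0
  then show ?case using assms by (auto simp: sites_def fun_eq_iff)
next
  case (Suc i)
  have m: "((x l + i * a) mod N + a) mod N = (x l + Suc i * a) mod N" for a
    by (simp add: mod_simps add_ac)
  show ?case unfolding funpow.simps o_apply Suc by (subst shift_eq[OF assms(1)]) (simp only: m fun_upd_same fun_upd_upd)
qed

lemma shift_funpow_sites: "N \<ge> 1 \<Longrightarrow> x \<in> sites N \<Longrightarrow> (shift N l s ^^ i) x \<in> sites N"
  by (induction i) (auto simp: shift_sites)

text \<open>The step length 1 or \<open>N - 1\<close> is coprime to \<open>N\<close>, so a lattice
  line visits \<open>N\<close> distinct sites before it closes up.\<close>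

lemma shift_funpow_inj:
  assumes "N \<ge> 1" "x \<in> sites N" "i < N" "j < N" "(shift N l s ^^ i) x = (shift N l s ^^ j) x"
  shows "i = j"
proof -
  let ?a = "if s then 1 else N - 1"
  have "[x l + i * ?a = x l + j * ?a] (mod N)"
    using fun_cong[OF assms(5), of l] by (simp add: shift_funpow[OF assms(1,2)] cong_def)
  then have "[i * ?a = j * ?a] (mod N)" by (simp only: cong_add_lcancel_nat)
  moreover have "coprime ?a N" using assms(1) using coprime_diff_one_left_nat[of N] by auto
  ultimately have "[i = j] (mod N)" by (simp only: cong_mult_rcancel_nat)
  then show ?thesis using assms(3,4) by (simp add: cong_def)
qed

lemma nbr_pairs_image:
  "nbr_pairs N = (\<lambda>(x,l,s). (x, shift N l s x)) ` (sites N \<times> UNIV \<times> UNIV)"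
proof (rule set_eqI)
  fix c show "c \<in> nbr_pairs N \<longleftrightarrow> c \<in> (\<lambda>(x,l,s). (x, shift N l s x)) ` (sites N \<times> UNIV \<times> UNIV)"
    by (cases c) (simp only: nbr_pairs_def image_iff, auto)
qed

lemma finite_nbr_pairs [simp]: "finite (nbr_pairs N :: ('d::finite site \<times> 'd site) set)"
  unfolding nbr_pairs_image by auto

lemma nbr_pairs_nonempty: "N \<ge> 1 \<Longrightarrow> nbr_pairs N \<noteq> ({} :: ('d::finite site \<times> 'd site) set)"
proof -
  assume "N \<ge> 1"
  then have "(\<lambda>_. 0) \<in> (sites N :: 'd site set)" by (auto simp: sites_def)
  then show ?thesis unfolding nbr_pairs_image by blast
qed

lemma nbr_pairs_sites: "N \<ge> 1 \<Longrightarrow> (x, y) \<in> nbr_pairs N \<Longrightarrow> x \<in> sites N \<and> y \<in> sites N"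
  by (auto simp: nbr_pairs_def shift_sites)

lemma nbr_pairs_sym:
  assumes "N \<ge> 1" "(x, y) \<in> nbr_pairs N"
  shows "(y, x) \<in> nbr_pairs N"
proof -
  obtain l s where x: "x \<in> sites N" and y: "y = shift N l s x"
    using assms(2) by (auto simp: nbr_pairs_def)
  have "x = shift N l (\<not> s) y" using shift_shift[OF assms(1) x, of l s] by (simp add: y)
  then show ?thesis using shift_sites[OF assms(1) x, of l s] y by (auto simp: nbr_pairs_def)
qed

lemma shift_neq: "N \<ge> 2 \<Longrightarrow> shift N l s x \<noteq> x"
proof
  assume N: "N \<ge> 2" and "shift N l s x = x"
  moreover have "shift N l s x l = (x l + (if s then 1 else N - 1)) mod N"
    using N by (simp add: shift_eq)
  ultimately have e: "(x l + (if s then 1 else N - 1)) mod N = x l" by (simp only:)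
  have "x l < N" by (subst e[symmetric]) (use N in simp)
  then show False using e N mod_step[of "x l" N] by (cases s) (simp_all only: if_True if_False, (simp split: if_splits)+)
qed

text \<open>For \<open>N = 2\<close> the two opposite neighbours coincide; from \<open>N = 3\<close>
  on a neighbour determines direction and sign. Hence pairs correspond bijectively to triples of
  site, direction and sign.\<close>

lemma shift_inj:
  assumes N: "N \<ge> 3" "x \<in> sites N" and e: "shift N l s x = shift N l' s' x"
  shows "l = l' \<and> s = s'"
proof -
  have "l = l'"
  proof (rule ccontr)
    assume "l \<noteq> l'"
    then have "shift N l s x l = x l" using fun_cong[OF e, of l] N(1) by (simp add: shift_eq)
    then have "shift N l s x = x" using N(1) by (auto simp: shift_eq fun_eq_iff)
    then show False using shift_neq[of N l s x] N(1) by simp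
  qed
  moreover have "s = s'"
  proof (rule ccontr)
    assume "s \<noteq> s'"
    then have "(x l + 1) mod N = (x l + (N - 1)) mod N"
      using fun_cong[OF e, of l] \<open>l = l'\<close> N(1) by (cases s; cases s') (auto simp: shift_eq)
    moreover have "x l < N" using N(2) by (auto simp: sites_def)
    ultimately show False using N(1) mod_step[of "x l" N] by (simp split: if_splits)
  qed
  ultimately show ?thesis ..
qed

lemma nbr_inj:
  "N \<ge> 3 \<Longrightarrow> inj_on (\<lambda>(x,l,s). (x, shift N l s x)) (sites N \<times> UNIV \<times> UNIV)"
  by (rule inj_onI) (clarsimp, blast dest: shift_inj)

lemma card_nbr_pairs:
  assumes "N \<ge> 3"
  shows "card (nbr_pairs N :: ('d::finite site \<times> 'd site) set) = 2 * CARD('d) * N ^ CARD('d)"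
  unfolding nbr_pairs_image
  by (subst card_image[OF nbr_inj[OF assms]]) (simp add: card_cartesian_product card_sites)

section \<open>Transpositions, stirring and statistics of the configuration\<close>

definition swp :: "'d site \<times> 'd site \<Rightarrow> 'd site \<Rightarrow> 'd site" where
  "swp c = Transposition.transpose (fst c) (snd c)"

definition swp2 :: "'d site \<times> 'd site \<Rightarrow> 'd site \<times> 'd site \<Rightarrow> 'd site \<times> 'd site" where
  "swp2 c p = (swp c (fst p), swp c (snd p))"

definition move :: "('d site \<Rightarrow> bool) \<Rightarrow> 'd site \<times> 'd site \<Rightarrow> 'd site \<Rightarrow> bool" where
  "move \<eta> c = (if \<eta> (fst c) \<and> \<not> \<eta> (snd c) then \<eta>(fst c := False, snd c := True) else \<eta>)"

lemma fst_clock_step: "fst (clock_step st c) = move (fst st) c"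
  by (auto simp: clock_step_def move_def split: prod.splits)

text \<open>A ring of (x,y) or of (y,x) exchanges the contents of x and y in exactly one of the two
  cases when they differ, so the particle configuration is a lazy stirring process.\<close>
lemma move_sym:
  "g (move \<eta> (x,y)) + g (move \<eta> (y,x)) = g \<eta> + g (\<eta> \<circ> swp (x,y))" for g :: "_ \<Rightarrow> real"
proof -
  consider "\<eta> x = \<eta> y" | "\<eta> x" "\<not> \<eta> y" | "\<not> \<eta> x" "\<eta> y" by blast
  then show ?thesis
  proof cases
    case 1
    then have "\<eta> \<circ> swp (x,y) = \<eta>" by (intro ext) (auto simp: swp_def Transposition.transpose_def)
    with 1 show ?thesis by (simp add: move_def)
  next
    case 2
    then have "move \<eta> (x,y) = \<eta> \<circ> swp (x,y)"
      by (intro ext) (auto simp: move_def swp_def Transposition.transpose_def)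
    moreover from 2 have "move \<eta> (y,x) = \<eta>" by (simp add: move_def)
    ultimately show ?thesis by simp
  next
    case 3
    then have "move \<eta> (y,x) = \<eta> \<circ> swp (x,y)"
      by (intro ext) (auto simp: move_def swp_def Transposition.transpose_def)
    moreover from 3 have "move \<eta> (x,y) = \<eta>" by (simp add: move_def)
    ultimately show ?thesis by simp
  qed
qed

definition q1 :: "nat \<Rightarrow> ('d::finite site \<Rightarrow> real) \<Rightarrow> ('d site \<Rightarrow> bool) \<Rightarrow> real" where
  "q1 N G \<eta> = (\<Sum>x\<in>sites N. G x * of_bool (\<eta> x))"

text \<open>The diagonal is included, where the summand reduces to a one-site occupation. This makes
  the product of two linear statistics quadratic (\<open>q1_mult\<close>), and swaps preserve the
  diagonal.\<close>

definition q2 :: "nat \<Rightarrow> ('d::finite site \<times> 'd site \<Rightarrow> real) \<Rightarrow> ('d site \<Rightarrow> bool) \<Rightarrow> real" where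
  "q2 N F \<eta> = (\<Sum>p\<in>sites N \<times> sites N. F p * of_bool (\<eta> (fst p) \<and> \<eta> (snd p)))"

lemma q1_add: "q1 N (\<lambda>x. G x + H x) \<eta> = q1 N G \<eta> + q1 N H \<eta>"
  by (simp only: q1_def distrib_right sum.distrib)

lemma q2_add: "q2 N (\<lambda>x. G x + H x) \<eta> = q2 N G \<eta> + q2 N H \<eta>"
  by (simp only: q2_def distrib_right sum.distrib)

lemma q1_divide: "q1 N (\<lambda>x. G x / a) \<eta> = q1 N G \<eta> / a"
  by (simp only: q1_def times_divide_eq_left sum_divide_distrib)

lemma q2_divide: "q2 N (\<lambda>x. G x / a) \<eta> = q2 N G \<eta> / a"
  by (simp only: q2_def times_divide_eq_left sum_divide_distrib)

section \<open>The one-site walk and the pair walk\<close>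

locale torus =
  fixes N :: nat and D :: "'d::finite itself"
  assumes N3: "N \<ge> 3"
begin

lemma N1: "N \<ge> 1" using N3 by simp

abbreviation sitesN :: "'d site set" where "sitesN \<equiv> sites N"
abbreviation pairsN :: "('d site \<times> 'd site) set" where "pairsN \<equiv> nbr_pairs N"

sublocale S1: involution_walk sitesN pairsN swp
  using nbr_pairs_nonempty[OF N1]
  by unfold_locales (auto simp: swp_def Transposition.transpose_def dest!: nbr_pairs_sites[OF N1])

text \<open>Both coordinates are moved by the same transposition, so they behave like two stirred
  particles and not like two independent walks. For distinct sites a bond acts on both at once only
  if it joins them.\<close>

sublocale S2: involution_walk "sitesN \<times> sitesN" pairsN swp2
  using S1.closed S1.invol by unfold_locales (auto simp: swp2_def S1.neC)

text \<open>Averaging a bond with its reversal turns the directed jump into identity or swap with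
  equal weights, by \<open>move_sym\<close>. This is what lets the exclusion rule act on statistics
  as a linear walk.\<close>

lemma sum_move:
  fixes g :: "('d site \<Rightarrow> bool) \<Rightarrow> real"
  shows "(\<Sum>c\<in>pairsN. g (move \<eta> c)) = (\<Sum>c\<in>pairsN. g \<eta> + g (\<eta> \<circ> swp c)) / 2"
proof -
  have "(\<Sum>c\<in>pairsN. g (move \<eta> c)) = (\<Sum>c\<in>pairsN. g (move \<eta> (prod.swap c)))"
    by (rule sum.reindex_bij_witness[of _ prod.swap prod.swap]) (auto intro: nbr_pairs_sym[OF N1])
  then have "2 * (\<Sum>c\<in>pairsN. g (move \<eta> c)) = (\<Sum>c\<in>pairsN. g (move \<eta> c) + g (move \<eta> (prod.swap c)))"
    by (simp add: sum.distrib)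
  also have "\<dots> = (\<Sum>c\<in>pairsN. g \<eta> + g (\<eta> \<circ> swp c))"
    by (intro sum.cong refl) (auto simp: move_sym)
  finally show ?thesis by simp
qed

lemma q1_swp: "c \<in> pairsN \<Longrightarrow> q1 N G (\<eta> \<circ> swp c) = q1 N (\<lambda>x. G (swp c x)) \<eta>"
  unfolding q1_def using S1.sum_\<sigma>2[of c G "\<lambda>x. of_bool (\<eta> x)"] by simp

lemma q2_swp: "c \<in> pairsN \<Longrightarrow> q2 N F (\<eta> \<circ> swp c) = q2 N (\<lambda>p. F (swp2 c p)) \<eta>"
  unfolding q2_def using S2.sum_\<sigma>2[of c F "\<lambda>p. of_bool (\<eta> (fst p) \<and> \<eta> (snd p))"]
  by (simp add: swp2_def)

text \<open>Self-duality: a swap of the configuration can be transferred to the coefficients, so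
  linear statistics form a closed class. The quadratic case below is the same argument for the pair
  walk.\<close>

lemma avg_q1_move: "(\<Sum>c\<in>pairsN. q1 N G (move \<eta> c)) / card pairsN
   = q1 N (S1.avg G) (\<eta> :: 'd site \<Rightarrow> bool)"
proof -
  have "(\<Sum>c\<in>pairsN. q1 N G (\<eta> \<circ> swp c)) = q1 N (\<lambda>x. \<Sum>c\<in>pairsN. G (swp c x)) \<eta>"
    proof -
    have "(\<Sum>c\<in>pairsN. q1 N G (\<eta> \<circ> swp c)) = (\<Sum>c\<in>pairsN. q1 N (\<lambda>x. G (swp c x)) \<eta>)"
      by (intro sum.cong refl q1_swp)
    also have "\<dots> = q1 N (\<lambda>x. \<Sum>c\<in>pairsN. G (swp c x)) \<eta>"
      unfolding q1_def sum_distrib_right by (rule sum.swap)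
    finally show ?thesis .
  qed
  moreover have "q1 N (S1.avg G) \<eta> = (q1 N G \<eta> + q1 N (\<lambda>x. \<Sum>c\<in>pairsN. G (swp c x)) \<eta> / card pairsN) / 2"
    unfolding S1.avg_def[abs_def] by (simp add: q1_add q1_divide)
  ultimately show ?thesis using S1.neC
    by (simp add: sum_move sum.distrib add_divide_distrib)
qed

lemma avg_q2_move: "(\<Sum>c\<in>pairsN. q2 N F (move \<eta> c)) / card pairsN
   = q2 N (S2.avg F) (\<eta> :: 'd site \<Rightarrow> bool)"
proof -
  have "(\<Sum>c\<in>pairsN. q2 N F (\<eta> \<circ> swp c)) = q2 N (\<lambda>x. \<Sum>c\<in>pairsN. F (swp2 c x)) \<eta>"
    proof -
    have "(\<Sum>c\<in>pairsN. q2 N F (\<eta> \<circ> swp c)) = (\<Sum>c\<in>pairsN. q2 N (\<lambda>x. F (swp2 c x)) \<eta>)"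
      by (intro sum.cong refl q2_swp)
    also have "\<dots> = q2 N (\<lambda>x. \<Sum>c\<in>pairsN. F (swp2 c x)) \<eta>"
      unfolding q2_def sum_distrib_right by (rule sum.swap)
    finally show ?thesis .
  qed
  moreover have "q2 N (S2.avg F) \<eta> = (q2 N F \<eta> + q2 N (\<lambda>x. \<Sum>c\<in>pairsN. F (swp2 c x)) \<eta> / card pairsN) / 2"
    unfolding S2.avg_def[abs_def] by (simp add: q2_add q2_divide)
  ultimately show ?thesis using S2.neC
    by (simp add: sum_move sum.distrib add_divide_distrib)
qed

lemma sum_pairs: "(\<Sum>c\<in>pairsN. g c) = (\<Sum>l\<in>UNIV. \<Sum>s\<in>UNIV. \<Sum>x\<in>sitesN. g (x, shift N l s x))"
  for g :: "_ \<Rightarrow> real"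
proof -
  have "(\<Sum>c\<in>pairsN. g c) = (\<Sum>(x,l,s)\<in>sitesN \<times> UNIV \<times> UNIV. g (x, shift N l s x))"
    unfolding nbr_pairs_image by (subst sum.reindex[OF nbr_inj[OF N3]]) (simp add: case_prod_unfold)
  also have "\<dots> = (\<Sum>x\<in>sitesN. \<Sum>l\<in>UNIV. \<Sum>s\<in>UNIV. g (x, shift N l s x))"
    by (simp add: sum.cartesian_product)
  also have "\<dots> = (\<Sum>l\<in>UNIV. \<Sum>x\<in>sitesN. \<Sum>s\<in>UNIV. g (x, shift N l s x))"
    by (rule sum.swap)
  also have "\<dots> = (\<Sum>l\<in>UNIV. \<Sum>s\<in>UNIV. \<Sum>x\<in>sitesN. g (x, shift N l s x))"
    by (intro sum.cong refl) (rule sum.swap)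
  finally show ?thesis .
qed

text \<open>For each \<open>l\<close> and \<open>s\<close> two ordered pairs touch \<open>x\<close>,
  one starting and one ending there; this factor 2 cancels the laziness. So \<open>avg\<close> is an
  explicit Euler step of the lattice heat equation.\<close>

lemma avg_laplacian:
  assumes x: "x \<in> sitesN"
  shows "S1.avg f x = f x + (\<Sum>l\<in>UNIV. \<Sum>s\<in>UNIV. f (shift N l s x) - f x) / card pairsN"
proof -
  have one: "(\<Sum>z\<in>sitesN. f (swp (z, shift N l s z) x) - f x) =
     (f (shift N l s x) - f x) + (f (shift N l (\<not> s) x) - f x)" for l s
  proof -
    let ?y = "shift N l (\<not> s) x"
    have y: "?y \<in> sitesN" "?y \<noteq> x" using shift_sites[OF N1 x] shift_neq[of N l "\<not> s" x] N3 by auto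
    have "(\<Sum>z\<in>sitesN. f (swp (z, shift N l s z) x) - f x) = (\<Sum>z\<in>{x, ?y}. f (swp (z, shift N l s z) x) - f x)"
      using x y shift_iff[OF N1 x, of _ l s]
      by (intro sum.mono_neutral_right) (auto simp: swp_def Transposition.transpose_def)
    also have "\<dots> = (f (shift N l s x) - f x) + (f ?y - f x)"
      using y shift_iff[OF N1 x y(1), of l s] by (simp add: swp_def)
    finally show ?thesis .
  qed
  have sw: "(\<Sum>l\<in>UNIV. \<Sum>s\<in>UNIV. f (shift N l (\<not> s) x) - f x) = (\<Sum>l\<in>UNIV. \<Sum>s\<in>UNIV. f (shift N l s x) - f x)"
    by (simp add: UNIV_bool add.commute)
  have "(\<Sum>c\<in>pairsN. f (swp c x) - f x) = 2 * (\<Sum>l\<in>UNIV. \<Sum>s\<in>UNIV. f (shift N l s x) - f x)"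
    unfolding sum_pairs one by (simp only: sum.distrib sw mult_2)
  moreover have "S1.avg f x = f x + (\<Sum>c\<in>pairsN. f (swp c x) - f x) / card pairsN / 2"
    using S1.neC by (simp add: S1.avg_def sum_subtractf diff_divide_distrib add_divide_distrib)
  ultimately show ?thesis by simp
qed

text \<open>Return estimate: a pair function started from adjacent pairs spreads out along the line
  through its second argument, since its total energy over time is bounded.\<close>
lemma return_estimate:
  fixes V :: "'d site \<times> 'd site \<Rightarrow> real" and A :: real
  assumes V0: "\<And>p. p \<in> sitesN \<times> sitesN \<Longrightarrow> 0 \<le> V p"
    and A1: "(\<Sum>p\<in>sitesN \<times> sitesN. V p) \<le> A" and A2: "(\<Sum>p\<in>sitesN \<times> sitesN. (V p)\<^sup>2) \<le> A"
    and M: "1 \<le> M" "M < N"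
  shows "(\<Sum>k<K. \<Sum>x\<in>sitesN. S2.pow k V (x, shift N l s x))
     \<le> K * A / M + sqrt (K * real N ^ CARD('d) * M) * sqrt (4 * card pairsN * A)"
proof -
  define f where "f k = S2.pow k V" for k
  define L where "L i x = (shift N l s ^^ i) x" for i and x :: "'d site"
  have f0: "0 \<le> f k p" if "p \<in> sitesN \<times> sitesN" for k p
    unfolding f_def using that V0 by (intro S2.pow_ge)
  have Ls: "L i x \<in> sitesN" if "x \<in> sitesN" for i x
    unfolding L_def using that by (rule shift_funpow_sites[OF N1])
  have Linj: "i = j" if "x \<in> sitesN" "L i x = L j x" "i < N" "j < N" for i j x
    using shift_funpow_inj[OF N1 that(1,3,4)] that(2) by (simp add: L_def)
  \<comment> \<open>The increment of \<open>f k\<close> when the second site advances by one along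
    the line through the first.\<close>
  define d where "d k x i = \<bar>f k (x, L (Suc i) x) - f k (x, L i x)\<bar>" for k x i
  \<comment> \<open>The value on an adjacent pair is compared with the value at every distance
    \<open>m\<close> up to \<open>M\<close>; summing over \<open>m\<close> will turn the first term
    into total mass.\<close>
  have tel: "f k (x, L 1 x) \<le> f k (x, L m x) + (\<Sum>i\<in>{1..<M}. d k x i)" if m: "m \<in> {1..M}" for k x m
  proof -
    have "\<bar>f k (x, L m x) - f k (x, L 1 x)\<bar> = \<bar>\<Sum>i\<in>{1..<m}. f k (x, L (Suc i) x) - f k (x, L i x)\<bar>"
      using m by (subst sum_Suc_diff') auto
    also have "\<dots> \<le> (\<Sum>i\<in>{1..<m}. d k x i)" unfolding d_def by (rule sum_abs)
    also have "\<dots> \<le> (\<Sum>i\<in>{1..<M}. d k x i)" using m by (intro sum_mono2) (auto simp: d_def)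
    finally show ?thesis by linarith
  qed
  have "M * (\<Sum>k<K. \<Sum>x\<in>sitesN. f k (x, L 1 x)) = (\<Sum>m\<in>{1..M}. \<Sum>k<K. \<Sum>x\<in>sitesN. f k (x, L 1 x))"
    by simp
  also have "\<dots> \<le> (\<Sum>m\<in>{1..M}. \<Sum>k<K. \<Sum>x\<in>sitesN. f k (x, L m x) + (\<Sum>i\<in>{1..<M}. d k x i))"
    by (intro sum_mono tel)
  also have "\<dots> = (\<Sum>m\<in>{1..M}. \<Sum>k<K. \<Sum>x\<in>sitesN. f k (x, L m x)) + M * (\<Sum>k<K. \<Sum>x\<in>sitesN. \<Sum>i\<in>{1..<M}. d k x i)"
    by (simp add: sum.distrib)
  also have "(\<Sum>m\<in>{1..M}. \<Sum>k<K. \<Sum>x\<in>sitesN. f k (x, L m x)) \<le> K * A"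
  proof -
    have "(\<Sum>m\<in>{1..M}. \<Sum>k<K. \<Sum>x\<in>sitesN. f k (x, L m x)) = (\<Sum>k<K. \<Sum>m\<in>{1..M}. \<Sum>x\<in>sitesN. f k (x, L m x))"
      by (rule sum.swap)
    also have "\<dots> \<le> (\<Sum>k<K. A)"
    proof (rule sum_mono)
      fix k
      \<comment> \<open>Since \<open>M < N\<close>, the pairs at distances 1 to \<open>M\<close> are
        distinct, so together they carry at most the conserved mass.\<close>
      have inj: "inj_on (\<lambda>(m,x). (x, L m x)) ({1..M} \<times> sitesN)"
        using Linj M by (force simp: inj_on_def)
      have "(\<Sum>m\<in>{1..M}. \<Sum>x\<in>sitesN. f k (x, L m x)) = (\<Sum>(m,x)\<in>{1..M} \<times> sitesN. f k (x, L m x))"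
        by (simp add: sum.cartesian_product)
      also have "\<dots> = sum (f k) ((\<lambda>(m,x). (x, L m x)) ` ({1..M} \<times> sitesN))"
        by (subst sum.reindex[OF inj]) (simp add: case_prod_unfold)
      also have "\<dots> \<le> sum (f k) (sitesN \<times> sitesN)"
        using Ls f0 by (intro sum_mono2) auto
      also have "\<dots> \<le> A" unfolding f_def S2.sum_pow by (rule A1)
      finally show "(\<Sum>m\<in>{1..M}. \<Sum>x\<in>sitesN. f k (x, L m x)) \<le> A" .
    qed
    finally show ?thesis by simp
  qed
  finally have main: "M * (\<Sum>k<K. \<Sum>x\<in>sitesN. f k (x, L 1 x)) \<le> K * A + M * (\<Sum>k<K. \<Sum>x\<in>sitesN. \<Sum>i\<in>{1..<M}. d k x i)"
    by simp
  let ?I = "{..<K} \<times> sitesN \<times> {1..<M}"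
  \<comment> \<open>Advancing the second site is a swap across one bond which leaves
    \<open>x\<close> alone, because \<open>x\<close> is on neither end of that bond. The squared
    increments are therefore distinct summands of the Dirichlet form.\<close>
  have en: "(\<Sum>x\<in>sitesN. \<Sum>i\<in>{1..<M}. (d k x i)\<^sup>2) \<le> S2.energy (f k)" for k
  proof -
    let ?h = "\<lambda>(x,i). ((L i x, L (Suc i) x), (x, L i x))"
    have inj: "inj_on ?h (sitesN \<times> {1..<M})"
      using Linj M by (force simp: inj_on_def)
    have "(\<Sum>x\<in>sitesN. \<Sum>i\<in>{1..<M}. (d k x i)\<^sup>2)
        = (\<Sum>(x,i)\<in>sitesN \<times> {1..<M}. (f k (swp2 (L i x, L (Suc i) x) (x, L i x)) - f k (x, L i x))\<^sup>2)"
      unfolding sum.cartesian_product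
    proof (intro sum.cong refl, clarify)
      fix x i assume x: "x \<in> sitesN" and i: "i \<in> {1..<M}"
      have "x \<noteq> L i x" "x \<noteq> L (Suc i) x"
        using Linj[OF x, of 0 i] Linj[OF x, of 0 "Suc i"] i M by (auto simp: L_def)
      then have "swp2 (L i x, L (Suc i) x) (x, L i x) = (x, L (Suc i) x)"
        by (simp add: swp2_def swp_def Transposition.transpose_def)
      then show "(d k x i)\<^sup>2 = (f k (swp2 (L i x, L (Suc i) x) (x, L i x)) - f k (x, L i x))\<^sup>2"
        by (simp add: d_def)
    qed
    also have "\<dots> = (\<Sum>(c,p)\<in>?h ` (sitesN \<times> {1..<M}). (f k (swp2 c p) - f k p)\<^sup>2)"
      by (subst sum.reindex[OF inj]) (simp add: case_prod_unfold)
    also have "\<dots> \<le> (\<Sum>(c,p)\<in>pairsN \<times> (sitesN \<times> sitesN). (f k (swp2 c p) - f k p)\<^sup>2)"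
    proof (rule sum_mono2)
      show "?h ` (sitesN \<times> {1..<M}) \<subseteq> pairsN \<times> (sitesN \<times> sitesN)"
        using Ls by (auto simp: nbr_pairs_def L_def)
    qed auto
    also have "\<dots> = S2.energy (f k)" by (simp add: S2.energy_def sum.cartesian_product)
    finally show ?thesis .
  qed
  \<comment> \<open>Cauchy-Schwarz over step, site and distance. The energy summed over all steps is
    bounded by the initial norm independently of \<open>K\<close>, so only the number of terms
    contributes a growing factor.\<close>
  have "(\<Sum>k<K. \<Sum>x\<in>sitesN. \<Sum>i\<in>{1..<M}. d k x i) = (\<Sum>(k,x,i)\<in>?I. \<bar>d k x i\<bar> * \<bar>1\<bar>)"
    by (simp add: sum.cartesian_product d_def)
  also have "\<dots> \<le> L2_set (\<lambda>(k,x,i). d k x i) ?I * L2_set (\<lambda>_. 1) ?I"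
    using L2_set_mult_ineq[of "\<lambda>(k,x,i). d k x i" "\<lambda>_. 1" ?I] by (simp add: case_prod_unfold)
  also have "L2_set (\<lambda>_. 1) ?I = sqrt (K * real N ^ CARD('d) * (M - 1))"
    by (simp add: L2_set_def card_sites mult.assoc)
  also have "\<dots> \<le> sqrt (K * real N ^ CARD('d) * M)" by (intro real_sqrt_le_mono mult_left_mono) auto
  also have "L2_set (\<lambda>(k,x,i). d k x i) ?I \<le> sqrt (4 * card pairsN * A)"
  proof -
    have "(\<Sum>(k,x,i)\<in>?I. (d k x i)\<^sup>2) = (\<Sum>k<K. \<Sum>x\<in>sitesN. \<Sum>i\<in>{1..<M}. (d k x i)\<^sup>2)"
      by (simp add: sum.cartesian_product)
    also have "\<dots> \<le> (\<Sum>k<K. S2.energy (f k))" by (intro sum_mono en)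
    also have "\<dots> \<le> 4 * card pairsN * (\<Sum>p\<in>sitesN \<times> sitesN. (V p)\<^sup>2)"
      unfolding f_def using S2.sum_energy_pow[of V K] by simp
    also have "\<dots> \<le> 4 * card pairsN * A" using A2 by (intro mult_left_mono) auto
    finally show ?thesis unfolding L2_set_def by (intro real_sqrt_le_mono) (simp add: case_prod_unfold)
  qed
  finally have cs: "(\<Sum>k<K. \<Sum>x\<in>sitesN. \<Sum>i\<in>{1..<M}. d k x i) \<le> sqrt (4 * card pairsN * A) * sqrt (K * real N ^ CARD('d) * M)"
    by (simp add: L2_set_nonneg mult_right_mono mult_left_mono)
  have "(\<Sum>k<K. \<Sum>x\<in>sitesN. f k (x, L 1 x)) \<le> K * A / M + (\<Sum>k<K. \<Sum>x\<in>sitesN. \<Sum>i\<in>{1..<M}. d k x i)"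
    using main M by (simp add: field_simps)
  with cs show ?thesis by (simp add: f_def L_def mult.commute)
qed

end

section \<open>The driving randomness\<close>

abbreviation Unif :: "real measure" where
  "Unif \<equiv> uniform_measure lborel {0..1::real}"

lemma prob_space_Unif: "prob_space Unif"
  by (rule prob_space_uniform_measure) auto

lemma sets_Unif [simp, measurable_cong]: "sets Unif = sets borel"
  by simp

lemma space_Unif [simp]: "space Unif = UNIV"
  by simp

lemma prob_space_Omega: "prob_space Omega"
  unfolding Omega_def by (intro prob_space_PiM prob_space_Unif)

interpretation Om: prob_space Omega by (rule prob_space_Omega)

lemma space_Omega [simp]: "space Omega = UNIV"
  by (simp add: Omega_def space_PiM PiE_def)

lemma prob_UNIV [simp]: "Om.prob UNIV = 1"
  using Om.prob_space by simp

lemma coord_measurable [measurable]: "(\<lambda>\<omega>. \<omega> i) \<in> borel_measurable Omega"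
proof -
  have "(\<lambda>\<omega>. \<omega> i) \<in> measurable Omega Unif"
    unfolding Omega_def by (rule measurable_component_singleton) simp
  then show ?thesis by (simp cong: measurable_cong_sets)
qed

lemma Omega_resample:
  "distr (Unif \<Otimes>\<^sub>M Omega) Omega (\<lambda>(x, \<omega>). fun_upd \<omega> i x) = Omega"
  using distr_pair_PiM_eq_PiM[of UNIV "\<lambda>_. Unif" i] prob_space_Unif
  by (simp add: Omega_def)

lemma upd_measurable: "(\<lambda>(x, \<omega>). fun_upd \<omega> i x) \<in> measurable (Unif \<Otimes>\<^sub>M Omega) Omega"
proof -
  have "(\<lambda>(x, \<omega>). fun_upd \<omega> i x) \<in> measurable (Unif \<Otimes>\<^sub>M PiM UNIV (\<lambda>_. Unif)) (PiM (insert i UNIV) (\<lambda>_. Unif))"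
    by measurable
  then show ?thesis by (simp add: Omega_def)
qed

text \<open>Overwriting coordinate \<open>i\<close> by a fresh uniform variable preserves the law
  (\<open>Omega_resample\<close>). A variable that ignores this coordinate is unaffected, so the
  integral factors by Fubini. Later uses of independence all pass through this rule.\<close>

lemma indep_coord:
  fixes f :: "real \<Rightarrow> real" and Y :: "(nat \<Rightarrow> real) \<Rightarrow> real"
  assumes f: "integrable Unif f" and Y: "integrable Omega Y"
    and inv: "\<And>\<omega> x. Y (fun_upd \<omega> i x) = Y \<omega>"
  shows "integrable Omega (\<lambda>\<omega>. f (\<omega> i) * Y \<omega>)"
    and "(\<integral>\<omega>. f (\<omega> i) * Y \<omega> \<partial>Omega) = (\<integral>x. f x \<partial>Unif) * (\<integral>\<omega>. Y \<omega> \<partial>Omega)"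
proof -
  interpret U: prob_space Unif by (rule prob_space_Unif)
  interpret P: pair_prob_space Unif Omega by unfold_locales
  note [measurable] = borel_measurable_integrable[OF f] borel_measurable_integrable[OF Y]
  have [measurable]: "f \<in> borel_measurable borel"
    using borel_measurable_integrable[OF f] by (simp cong: measurable_cong_sets)
  have Z: "(\<lambda>\<omega>. f (\<omega> i) * Y \<omega>) \<in> borel_measurable Omega" by measurable
  have int: "integrable (Unif \<Otimes>\<^sub>M Omega) (\<lambda>(x, \<omega>). f x * Y \<omega>)"
  proof (rule P.Fubini_integrable)
    show "(\<lambda>(x, \<omega>). f x * Y \<omega>) \<in> borel_measurable (Unif \<Otimes>\<^sub>M Omega)"
      by measurable
    show "integrable Unif (\<lambda>x. \<integral>y. norm (case (x, y) of (x, \<omega>) \<Rightarrow> f x * Y \<omega>) \<partial>Omega)"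
      using f Y by (simp add: abs_mult)
    show "AE x in Unif. integrable Omega (\<lambda>y. case (x, y) of (x, \<omega>) \<Rightarrow> f x * Y \<omega>)"
      using Y by simp
  qed
  have eq: "(\<lambda>\<omega>. f (\<omega> i) * Y \<omega>) \<circ> (\<lambda>(x, \<omega>). fun_upd \<omega> i x) = (\<lambda>(x, \<omega>). f x * Y \<omega>)"
    using inv by (auto simp: fun_eq_iff)
  have "integrable (distr (Unif \<Otimes>\<^sub>M Omega) Omega (\<lambda>(x, \<omega>). fun_upd \<omega> i x)) (\<lambda>\<omega>. f (\<omega> i) * Y \<omega>)"
    using int unfolding eq[symmetric] o_def by (subst integrable_distr_eq[OF upd_measurable Z]) 
  then show "integrable Omega (\<lambda>\<omega>. f (\<omega> i) * Y \<omega>)" unfolding Omega_resample .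
  have "(\<integral>\<omega>. f (\<omega> i) * Y \<omega> \<partial>Omega) =
     (\<integral>\<omega>. f (\<omega> i) * Y \<omega> \<partial>distr (Unif \<Otimes>\<^sub>M Omega) Omega (\<lambda>(x, \<omega>). fun_upd \<omega> i x))"
    unfolding Omega_resample ..
  also have "\<dots> = (\<integral>p. ((\<lambda>\<omega>. f (\<omega> i) * Y \<omega>) \<circ> (\<lambda>(x, \<omega>). fun_upd \<omega> i x)) p \<partial>(Unif \<Otimes>\<^sub>M Omega))"
    unfolding o_def by (rule integral_distr[OF upd_measurable Z])
  also have "\<dots> = (\<integral>x. (\<integral>\<omega>. f x * Y \<omega> \<partial>Omega) \<partial>Unif)"
    unfolding eq using P.integral_fst'[OF int] by simp
  finally show "(\<integral>\<omega>. f (\<omega> i) * Y \<omega> \<partial>Omega) = (\<integral>x. f x \<partial>Unif) * (\<integral>\<omega>. Y \<omega> \<partial>Omega)"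
    by simp
qed

lemma integral_coord:
  assumes "integrable Unif f"
  shows "integrable Omega (\<lambda>\<omega>. f (\<omega> i) :: real)" "(\<integral>\<omega>. f (\<omega> i) \<partial>Omega) = (\<integral>x. f x \<partial>Unif)"
  using indep_coord[OF assms, of "\<lambda>_. 1" i] by (auto simp: Om.prob_space)

lemma measure_Unif: "A \<in> sets borel \<Longrightarrow> measure Unif A = measure lborel ({0..1} \<inter> A)"
  by (simp add: measure_uniform_measure)

lemma measure_Unif_less:
  assumes "0 \<le> a" "a \<le> 1"
  shows "measure Unif {u. u < a} = a"
proof -
  have "{0..1} \<inter> {u. u < a} = {0..<a}" using assms by auto
  then show ?thesis using assms by (subst measure_Unif) auto
qed

section \<open>Uniform choice of an ordered pair\<close>

lemma pair_enum_bij: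
  "bij_betw (pair_enum N) {..<card (nbr_pairs N :: ('d::finite site \<times> 'd site) set)} (nbr_pairs N :: ('d site \<times> 'd site) set)"
proof -
  have "\<exists>f :: nat \<Rightarrow> 'd site \<times> 'd site. bij_betw f {..<card (nbr_pairs N :: ('d site \<times> 'd site) set)} (nbr_pairs N)"
    using ex_bij_betw_nat_finite[OF finite_nbr_pairs] by (simp add: atLeast0LessThan)
  then show ?thesis unfolding pair_enum_def by (rule someI_ex)
qed

lemma pair_choice_in: "N \<ge> 1 \<Longrightarrow> pair_choice N u \<in> (nbr_pairs N :: ('d::finite site \<times> 'd site) set)"
proof -
  assume "N \<ge> 1"
  then have "card (nbr_pairs N :: ('d site \<times> 'd site) set) > 0"
    using nbr_pairs_nonempty by (simp add: card_gt_0_iff)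
  then show ?thesis unfolding pair_choice_def
    by (intro bij_betwE[OF pair_enum_bij, rule_format]) (simp add: min_less_iff_disj)
qed

lemma pair_choice_measurable [measurable]:
  "pair_choice N \<in> measurable borel (count_space (UNIV :: ('d::finite site \<times> 'd site) set))"
proof -
  have "(\<lambda>u. nat \<lfloor>u * real (card (nbr_pairs N :: ('d site \<times> 'd site) set))\<rfloor>) \<in> measurable borel (count_space UNIV)"
    by measurable
  then show ?thesis unfolding pair_choice_def by measurable
qed

lemma pair_choice_prob:
  fixes c :: "'d::finite site \<times> 'd site"
  assumes c: "c \<in> nbr_pairs N"
  shows "measure Unif {u. pair_choice N u = c} = 1 / card (nbr_pairs N :: ('d site \<times> 'd site) set)"
proof -
  let ?m = "card (nbr_pairs N :: ('d site \<times> 'd site) set)"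
  have m: "?m > 0" using c by (auto simp: card_gt_0_iff)
  obtain j where j: "j < ?m" "c = pair_enum N j"
    using pair_enum_bij[of N, where 'd='d] c by (auto simp: bij_betw_def)
  have inj: "pair_enum N i = c \<longleftrightarrow> i = j" if "i < ?m" for i
    using that j pair_enum_bij[of N, where 'd='d] by (auto simp: bij_betw_def inj_on_def)
  \<comment> \<open>Pair number \<open>j\<close> is picked exactly on the half-open interval from
    \<open>j / ?m\<close> to \<open>(j + 1) / ?m\<close>; within the unit interval the
    \<open>min\<close> in the definition takes effect only at \<open>u = 1\<close>.\<close>
  have iff: "pair_choice N u = c \<longleftrightarrow> j / ?m \<le> u \<and> u < (j + 1) / ?m" if u: "0 \<le> u" "u < 1" for u
  proof -
    have "u * ?m < ?m" using u m by simp
    then have b: "nat \<lfloor>u * ?m\<rfloor> < ?m" using u by (simp add: nat_less_iff floor_less_iff)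
    then have "(pair_choice N u :: 'd site \<times> 'd site) = pair_enum N (nat \<lfloor>u * ?m\<rfloor>)"
      unfolding pair_choice_def by (intro arg_cong[of _ _ "pair_enum N"]) auto
    then have "pair_choice N u = c \<longleftrightarrow> nat \<lfloor>u * ?m\<rfloor> = j" using inj[OF b] by simp
    also have "\<dots> \<longleftrightarrow> \<lfloor>u * ?m\<rfloor> = int j" using u by (simp add: nat_eq_iff)
    also have "\<dots> \<longleftrightarrow> j \<le> u * ?m \<and> u * ?m < j + 1" by (simp add: floor_eq_iff add.commute)
    finally show ?thesis using m by (simp add: field_simps)
  qed
  have le: "(j + 1) / ?m \<le> (1::real)" "0 \<le> j / real ?m" using j m by (auto simp: field_simps)
  have "measure Unif {u. pair_choice N u = c} = measure lborel ({0..1} \<inter> {u. pair_choice N u = c})"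
    by (rule measure_Unif) measurable
  \<comment> \<open>The exceptional endpoint 1 is removed as a null set.\<close>
  also have "\<dots> = measure lborel ({0..<1} \<inter> {u. pair_choice N u = c})"
  proof (rule measure_eq_AE)
    show "AE x in lborel. (x \<in> {0..1} \<inter> {u. pair_choice N u = c}) = (x \<in> {0..<1} \<inter> {u. pair_choice N u = c})"
      using AE_lborel_singleton[of "1::real"] by eventually_elim auto
  qed measurable
  also have "{0..<1} \<inter> {u. pair_choice N u = c} = {j / ?m..<(j + 1) / ?m}"
  proof (rule set_eqI)
    fix x
    have "j / ?m \<le> x \<Longrightarrow> x < (j + 1) / ?m \<Longrightarrow> 0 \<le> x \<and> x < 1" using le by linarith
    then show "x \<in> {0..<1} \<inter> {u. pair_choice N u = c} \<longleftrightarrow> x \<in> {j / ?m..<(j + 1) / ?m}"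
      using iff[of x] by auto
  qed
  also have "measure lborel \<dots> = 1 / ?m" using m by (simp add: divide_right_mono diff_divide_distrib[symmetric])
  finally show ?thesis .
qed

lemma integral_Unif_indicator:
  "A \<in> sets borel \<Longrightarrow> (\<integral>x. indicator A x \<partial>Unif) = measure Unif A"
  "A \<in> sets borel \<Longrightarrow> integrable Unif (indicator A :: real \<Rightarrow> real)"
proof -
  interpret U: prob_space Unif by (rule prob_space_Unif)
  assume "A \<in> sets borel"
  then show "(\<integral>x. indicator A x \<partial>Unif) = measure Unif A" "integrable Unif (indicator A :: real \<Rightarrow> real)"
    by (auto simp: U.emeasure_eq_measure)
qed

section \<open>The embedded chain and its initial law\<close>

lemma clock_step_snd:
  "snd (clock_step st c) x y = snd st x y + of_bool (fst st (fst c) \<and> \<not> fst st (snd c) \<and> x = fst c \<and> y = snd c)"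
  by (auto simp: clock_step_def split: prod.splits)

text \<open>The first \<open>j\<close> steps read the clock coordinates \<open>3 * i + 1\<close>
  with \<open>i < j\<close>, and the initial state reads only coordinates congruent to 2 modulo 3.
  So choice number \<open>m\<close> with \<open>j \<le> m\<close> is still fresh.\<close>

lemma chain_choice_inv:
  "j \<le> m \<Longrightarrow> chain Nseq \<rho>0 n (fun_upd \<omega> (3 * m + 1) x) j = chain Nseq \<rho>0 n \<omega> j"
proof (induction j)
  case 0
  have "3 * to_nat a + 2 \<noteq> 3 * m + 1" for a :: "'a site" by presburger
  then show ?case by simp
next
  case (Suc j)
  then show ?case by simp
qed

lemma chain_measurable:
  fixes \<rho>0 :: "real^'d::finite \<Rightarrow> real"
  shows "Measurable.pred Omega (\<lambda>\<omega>. fst (chain Nseq \<rho>0 n \<omega> j) x)"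
    and "(\<lambda>\<omega>. snd (chain Nseq \<rho>0 n \<omega> j) x y) \<in> measurable Omega (count_space UNIV)"
proof (induction j arbitrary: x y)
  case 0
  {
    case 1 show ?case by simp
  next
    case 2 show ?case by simp
  }
next
  case (Suc j)
  note [measurable] = Suc
  let ?c = "\<lambda>\<omega>. pair_choice (Nseq n) (\<omega> (3 * j + 1)) :: 'd site \<times> 'd site"
  have c [measurable]: "?c \<in> measurable Omega (count_space UNIV)"
    by (rule measurable_compose[OF coord_measurable pair_choice_measurable])
  let ?R = "range (pair_choice (Nseq n)) :: ('d site \<times> 'd site) set"
  have fin: "countable ?R"
  proof -
    have "?R \<subseteq> range (pair_enum (Nseq n))" by (auto simp: pair_choice_def)
    then show ?thesis by (rule countable_subset) simp
  qed
  \<comment> \<open>The random pair takes countably many values, so a predicate with this pair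
    inserted is a countable disjunction over the values.\<close>
  have A: "Measurable.pred Omega (\<lambda>\<omega>. P (?c \<omega>) \<omega>)" if "\<And>c. Measurable.pred Omega (P c)" for P
  proof -
    have "(\<lambda>\<omega>. P (?c \<omega>) \<omega>) = (\<lambda>\<omega>. \<exists>c\<in>?R. ?c \<omega> = c \<and> P c \<omega>)" by auto
    moreover have "Measurable.pred Omega (\<lambda>\<omega>. \<exists>c\<in>?R. ?c \<omega> = c \<and> P c \<omega>)"
      using that by (intro pred_intros_countable_bounded fin) measurable
    ultimately show ?thesis by simp
  qed
  {
    case 1
    have "Measurable.pred Omega (\<lambda>\<omega>. move (fst (chain Nseq \<rho>0 n \<omega> j)) c x)" for c
      unfolding move_def fun_upd_def if_distrib[where f="\<lambda>f. f x"] by measurable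
    from A[OF this] show ?case by (simp add: fst_clock_step)
  next
    case 2
    have "Measurable.pred Omega (\<lambda>\<omega>. (\<lambda>c \<omega>. fst (chain Nseq \<rho>0 n \<omega> j) (fst c) \<and> \<not> fst (chain Nseq \<rho>0 n \<omega> j) (snd c) \<and> x = fst c \<and> y = snd c) (?c \<omega>) \<omega>)"
      by (rule A) measurable
    then have [measurable]: "Measurable.pred Omega (\<lambda>\<omega>. fst (chain Nseq \<rho>0 n \<omega> j) (fst (?c \<omega>)) \<and> \<not> fst (chain Nseq \<rho>0 n \<omega> j) (snd (?c \<omega>)) \<and> x = fst (?c \<omega>) \<and> y = snd (?c \<omega>))" .
    show ?case unfolding chain.simps clock_step_snd of_bool_def by measurable
  }
qed

text \<open>Integrated Markov property: the pair chosen at step \<open>j\<close> is uniform and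
  independent of the state before it, so the next expectation is an average over all pairs.\<close>

lemma chain_step_integral:
  fixes G :: "'d::finite state \<Rightarrow> real"
  assumes N: "Nseq n \<ge> 1"
    and int: "\<And>c. c \<in> nbr_pairs (Nseq n) \<Longrightarrow> integrable Omega (\<lambda>\<omega>. G (clock_step (chain Nseq \<rho>0 n \<omega> j) c))"
  shows "integrable Omega (\<lambda>\<omega>. G (chain Nseq \<rho>0 n \<omega> (Suc j)))"
    and "(\<integral>\<omega>. G (chain Nseq \<rho>0 n \<omega> (Suc j)) \<partial>Omega) =
     (\<integral>\<omega>. (\<Sum>c\<in>nbr_pairs (Nseq n). G (clock_step (chain Nseq \<rho>0 n \<omega> j) c)) / card (nbr_pairs (Nseq n) :: ('d site \<times> 'd site) set) \<partial>Omega)"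
proof -
  let ?C = "nbr_pairs (Nseq n) :: ('d site \<times> 'd site) set"
  let ?A = "\<lambda>c :: 'd site \<times> 'd site. {u. pair_choice (Nseq n) u = c}"
  have dec: "G (chain Nseq \<rho>0 n \<omega> (Suc j)) =
     (\<Sum>c\<in>?C. indicator (?A c) (\<omega> (3 * j + 1)) * G (clock_step (chain Nseq \<rho>0 n \<omega> j) c))" for \<omega>
  proof -
    let ?c0 = "pair_choice (Nseq n) (\<omega> (3 * j + 1)) :: 'd site \<times> 'd site"
    have "?c0 \<in> ?C" by (rule pair_choice_in[OF N])
    then have "(\<Sum>c\<in>?C. indicator (?A c) (\<omega> (3 * j + 1)) * G (clock_step (chain Nseq \<rho>0 n \<omega> j) c))
      = (\<Sum>c\<in>?C. if c = ?c0 then G (clock_step (chain Nseq \<rho>0 n \<omega> j) c) else 0)"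
      by (intro sum.cong) (auto simp: indicator_def)
    also have "\<dots> = G (clock_step (chain Nseq \<rho>0 n \<omega> j) ?c0)"
      using \<open>?c0 \<in> ?C\<close> by (subst sum.delta) auto
    finally show ?thesis by simp
  qed
  have A: "?A c \<in> sets borel" for c by measurable
  have inv: "G (clock_step (chain Nseq \<rho>0 n (fun_upd \<omega> (3 * j + 1) x) j) c) = G (clock_step (chain Nseq \<rho>0 n \<omega> j) c)" for \<omega> x c
    by (simp only: chain_choice_inv[OF order_refl])
  note ic = indep_coord[OF integral_Unif_indicator(2)[OF A] int inv]
  show "integrable Omega (\<lambda>\<omega>. G (chain Nseq \<rho>0 n \<omega> (Suc j)))"
    unfolding dec by (intro Bochner_Integration.integrable_sum ic)
  have "(\<integral>\<omega>. G (chain Nseq \<rho>0 n \<omega> (Suc j)) \<partial>Omega) =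
    (\<Sum>c\<in>?C. \<integral>\<omega>. indicator (?A c) (\<omega> (3 * j + 1)) * G (clock_step (chain Nseq \<rho>0 n \<omega> j) c) \<partial>Omega)"
    unfolding dec by (intro Bochner_Integration.integral_sum ic)
  also have "\<dots> = (\<Sum>c\<in>?C. (1 / card ?C) * (\<integral>\<omega>. G (clock_step (chain Nseq \<rho>0 n \<omega> j) c) \<partial>Omega))"
    by (intro sum.cong refl) (simp only: ic(2) integral_Unif_indicator(1)[OF A] pair_choice_prob)
  also have "\<dots> = (\<integral>\<omega>. (\<Sum>c\<in>?C. G (clock_step (chain Nseq \<rho>0 n \<omega> j) c)) / card ?C \<partial>Omega)"
    using int by (simp add: Bochner_Integration.integral_sum sum_divide_distrib)
  finally show "(\<integral>\<omega>. G (chain Nseq \<rho>0 n \<omega> (Suc j)) \<partial>Omega) =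
     (\<integral>\<omega>. (\<Sum>c\<in>nbr_pairs (Nseq n). G (clock_step (chain Nseq \<rho>0 n \<omega> j) c)) / card (nbr_pairs (Nseq n) :: ('d site \<times> 'd site) set) \<partial>Omega)" .
qed

text \<open>Injectivity of \<open>to_nat\<close> gives each site its own uniform variable, so the
  sites can be split off one at a time.\<close>

lemma init_moment:
  fixes \<rho>0 :: "real^'d::finite \<Rightarrow> real"
  assumes A: "finite A" and u: "\<And>x. x \<in> A \<Longrightarrow> 0 \<le> init_param Nseq \<rho>0 n x \<and> init_param Nseq \<rho>0 n x \<le> 1"
  shows "integrable Omega (\<lambda>\<omega>. of_bool (\<forall>x\<in>A. fst (chain Nseq \<rho>0 n \<omega> 0) x) :: real) \<and>
    (\<integral>\<omega>. of_bool (\<forall>x\<in>A. fst (chain Nseq \<rho>0 n \<omega> 0) x) \<partial>Omega) = (\<Prod>x\<in>A. init_param Nseq \<rho>0 n x)"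
  using A u
proof (induction A)
  case empty
  show ?case by (simp add: Om.prob_space)
next
  case (insert a A)
  let ?B = "{u. u < init_param Nseq \<rho>0 n a}"
  have B: "?B \<in> sets borel" by simp
  have eq: "of_bool (\<forall>x\<in>insert a A. fst (chain Nseq \<rho>0 n \<omega> 0) x) =
    indicator ?B (\<omega> (3 * to_nat a + 2)) * (of_bool (\<forall>x\<in>A. fst (chain Nseq \<rho>0 n \<omega> 0) x) :: real)" for \<omega>
    by (simp add: indicator_def)
  have inv: "of_bool (\<forall>x\<in>A. fst (chain Nseq \<rho>0 n (fun_upd \<omega> (3 * to_nat a + 2) y) 0) x) = (of_bool (\<forall>x\<in>A. fst (chain Nseq \<rho>0 n \<omega> 0) x) :: real)" for \<omega> y
    using insert.hyps by (intro arg_cong[of _ _ of_bool] ball_cong refl) auto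
  have IH: "integrable Omega (\<lambda>\<omega>. of_bool (\<forall>x\<in>A. fst (chain Nseq \<rho>0 n \<omega> 0) x) :: real)"
    "(\<integral>\<omega>. of_bool (\<forall>x\<in>A. fst (chain Nseq \<rho>0 n \<omega> 0) x) \<partial>Omega) = (\<Prod>x\<in>A. init_param Nseq \<rho>0 n x)"
    using insert by auto
  note ic = indep_coord[OF integral_Unif_indicator(2)[OF B] IH(1) inv]
  have val: "(\<integral>x. indicator ?B x \<partial>Unif) = init_param Nseq \<rho>0 n a"
    unfolding integral_Unif_indicator(1)[OF B] using insert.prems[of a] by (intro measure_Unif_less) auto
  show ?case unfolding eq using ic insert.hyps IH unfolding val
    by (simp del: chain.simps)
qed

section \<open>Correlations of the exclusion process\<close>

text \<open>Polynomials in occupations and counts. The class survives a clock ring and consists of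
  functions that are bounded and measurable along the chain at each fixed step, so integrability
  becomes a matter of syntax.\<close>

inductive obs :: "('d::finite state \<Rightarrow> real) \<Rightarrow> bool" where
  obs_const: "obs (\<lambda>_. a)"
| obs_occ: "obs (\<lambda>st. of_bool (fst st x))"
| obs_cnt: "obs (\<lambda>st. real (snd st x y))"
| obs_add: "obs G \<Longrightarrow> obs H \<Longrightarrow> obs (\<lambda>st. G st + H st)"
| obs_mult: "obs G \<Longrightarrow> obs H \<Longrightarrow> obs (\<lambda>st. G st * H st)"

lemma obs_scale: "obs G \<Longrightarrow> obs (\<lambda>st. a * G st)"
  by (rule obs_mult[OF obs_const])

lemma obs_diff: "obs G \<Longrightarrow> obs H \<Longrightarrow> obs (\<lambda>st. G st - H st)"
  using obs_add[OF _ obs_scale[of H "-1"]] by simp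

lemma obs_divide: "obs G \<Longrightarrow> obs (\<lambda>st. G st / a)"
  using obs_scale[of G "1 / a"] by simp

lemma obs_power2: "obs G \<Longrightarrow> obs (\<lambda>st. (G st)\<^sup>2)"
  using obs_mult[of G G] by (simp add: power2_eq_square)

lemma obs_sum: "finite I \<Longrightarrow> (\<And>i. i \<in> I \<Longrightarrow> obs (G i)) \<Longrightarrow> obs (\<lambda>st. \<Sum>i\<in>I. G i st)"
proof (induction rule: finite_induct)
  case empty
  then show ?case using obs_const[of 0] by simp
next
  case (insert i I)
  then show ?case using obs_add[of "G i" "\<lambda>st. \<Sum>i\<in>I. G i st"] by simp
qed

lemma obs_occ2: "obs (\<lambda>st. of_bool (fst st x \<and> fst st y))"
  using obs_mult[OF obs_occ[of x] obs_occ[of y]] by (simp add: of_bool_conj)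

lemma obs_q1: "obs (\<lambda>st. q1 N G (fst st))"
  unfolding q1_def by (intro obs_sum obs_scale obs_occ) auto

lemma obs_q2: "obs (\<lambda>st. q2 N F (fst st))"
  unfolding q2_def by (intro obs_sum obs_scale obs_occ2) auto

text \<open>After a ring of \<open>(a, b)\<close> the occupation of \<open>b\<close> is the
  disjunction of the two old ones and that of \<open>a\<close> their conjunction; both are
  polynomials. The case \<open>x = b\<close> comes first so that it also covers a degenerate
  pair.\<close>

lemma obs_clock: "obs G \<Longrightarrow> obs (\<lambda>st. G (clock_step st c))"
proof (induction rule: obs.induct)
  case (obs_occ x)
  obtain a b where c: "c = (a, b)" by (cases c)
  consider "x = b" | "x = a" "x \<noteq> b" | "x \<noteq> a" "x \<noteq> b" by blast
  then show ?case
  proof cases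
    case 1
    then have "(\<lambda>st. of_bool (fst (clock_step st c) x) :: real) =
      (\<lambda>st. of_bool (fst st a) + of_bool (fst st b) - of_bool (fst st a) * of_bool (fst st b))"
      by (intro ext) (auto simp: fst_clock_step move_def c)
    then show ?thesis by (simp only:) (intro obs_diff obs_add obs_mult obs.obs_occ)
  next
    case 2
    then have "(\<lambda>st. of_bool (fst (clock_step st c) x) :: real) = (\<lambda>st. of_bool (fst st a) * of_bool (fst st b))"
      by (intro ext) (auto simp: fst_clock_step move_def c)
    then show ?thesis by (simp only:) (intro obs_mult obs.obs_occ)
  next
    case 3
    then have "(\<lambda>st. of_bool (fst (clock_step st c) x) :: real) = (\<lambda>st. of_bool (fst st x))"
      by (intro ext) (auto simp: fst_clock_step move_def c)
    then show ?thesis by (simp only: obs.obs_occ)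
  qed
next
  case (obs_cnt x y)
  have "(\<lambda>st. real (snd (clock_step st c) x y)) = (\<lambda>st. real (snd st x y) +
     of_bool (x = fst c \<and> y = snd c) * (of_bool (fst st (fst c)) - of_bool (fst st (fst c)) * of_bool (fst st (snd c))))"
    by (auto simp: fun_eq_iff clock_step_snd)
  then show ?case by (simp only:) (intro obs_add obs_scale obs_diff obs_mult obs.obs_occ obs.obs_cnt)
qed (auto intro: obs.intros)

lemma chain_count_le: "snd (chain Nseq \<rho>0 n \<omega> j) x y \<le> j"
  by (induction j) (auto simp: clock_step_snd of_bool_def le_SucI)

lemma obs_bounded:
  fixes \<rho>0 :: "real^'d::finite \<Rightarrow> real"
  shows "obs G \<Longrightarrow> (\<lambda>\<omega>. G (chain Nseq \<rho>0 n \<omega> j)) \<in> borel_measurable Omega \<and> (\<exists>b. \<forall>\<omega>. \<bar>G (chain Nseq \<rho>0 n \<omega> j)\<bar> \<le> b)"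
proof (induction rule: obs.induct)
  case (obs_occ x)
  note [measurable] = chain_measurable(1)[of Nseq \<rho>0 n j x]
  show ?case by (auto intro!: exI[of _ 1])
next
  case (obs_cnt x y)
  note [measurable] = chain_measurable(2)[of Nseq \<rho>0 n j x y]
  show ?case using chain_count_le[of Nseq \<rho>0 n _ j x y] by (auto intro!: exI[of _ "real j"])
next
  case (obs_add G H)
  then obtain a b where "\<forall>\<omega>. \<bar>G (chain Nseq \<rho>0 n \<omega> j)\<bar> \<le> a" "\<forall>\<omega>. \<bar>H (chain Nseq \<rho>0 n \<omega> j)\<bar> \<le> b" by blast
  then have "\<forall>\<omega>. \<bar>G (chain Nseq \<rho>0 n \<omega> j) + H (chain Nseq \<rho>0 n \<omega> j)\<bar> \<le> a + b"
    by (meson abs_triangle_ineq add_mono order_trans)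
  with obs_add show ?case by (auto intro!: borel_measurable_add)
next
  case (obs_mult G H)
  then obtain a b where "\<forall>\<omega>. \<bar>G (chain Nseq \<rho>0 n \<omega> j)\<bar> \<le> a" "\<forall>\<omega>. \<bar>H (chain Nseq \<rho>0 n \<omega> j)\<bar> \<le> b" by blast
  then have "\<forall>\<omega>. \<bar>G (chain Nseq \<rho>0 n \<omega> j) * H (chain Nseq \<rho>0 n \<omega> j)\<bar> \<le> a * b"
    by (metis abs_ge_zero abs_mult mult_mono order_trans)
  with obs_mult show ?case by (auto intro!: borel_measurable_times)
qed auto

lemma obs_integrable:
  "obs G \<Longrightarrow> integrable Omega (\<lambda>\<omega>. G (chain Nseq \<rho>0 n \<omega> j))"
proof -
  assume "obs G"
  from obs_bounded[OF this, of Nseq \<rho>0 n j] obtain b where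
    "(\<lambda>\<omega>. G (chain Nseq \<rho>0 n \<omega> j)) \<in> borel_measurable Omega" "\<And>\<omega>. \<bar>G (chain Nseq \<rho>0 n \<omega> j)\<bar> \<le> b" by blast
  then show ?thesis by (intro Om.integrable_const_bound[where B=b]) auto
qed

section \<open>Expectations along the embedded chain\<close>

locale ssep = torus N D for N and D :: "'d::finite itself" +
  fixes Nseq :: "nat \<Rightarrow> nat" and \<rho>0 :: "real^'d \<Rightarrow> real" and n :: nat and \<kappa> :: real
  assumes Nn: "Nseq n = N"
    and u01: "\<And>x. x \<in> sitesN \<Longrightarrow> 0 \<le> init_param Nseq \<rho>0 n x \<and> init_param Nseq \<rho>0 n x \<le> 1"
    and u_le: "\<And>x. x \<in> sitesN \<Longrightarrow> init_param Nseq \<rho>0 n x \<le> \<kappa>"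
begin

abbreviation u :: "'d site \<Rightarrow> real" where "u \<equiv> init_param Nseq \<rho>0 n"

definition Ex :: "('d state \<Rightarrow> real) \<Rightarrow> nat \<Rightarrow> real" where
  "Ex G j = (\<integral>\<omega>. G (chain Nseq \<rho>0 n \<omega> j) \<partial>Omega)"

lemma \<kappa>_nonneg: "0 \<le> \<kappa>"
proof -
  have "(\<lambda>_. 0) \<in> sitesN" using N1 by (simp add: sites_def)
  from u01[OF this] u_le[OF this] show ?thesis by linarith
qed

lemma Ex_add: "obs G \<Longrightarrow> obs H \<Longrightarrow> Ex (\<lambda>st. G st + H st) j = Ex G j + Ex H j"
  unfolding Ex_def by (intro Bochner_Integration.integral_add obs_integrable)

lemma Ex_scale: "Ex (\<lambda>st. a * G st) j = a * Ex G j"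
  unfolding Ex_def by simp

lemma Ex_divide: "Ex (\<lambda>st. G st / a) j = Ex G j / a"
  unfolding Ex_def by simp

lemma Ex_const: "Ex (\<lambda>st. a) j = a"
  unfolding Ex_def by simp

lemma Ex_sum: "(\<And>i. i \<in> I \<Longrightarrow> obs (G i)) \<Longrightarrow> Ex (\<lambda>st. \<Sum>i\<in>I. G i st) j = (\<Sum>i\<in>I. Ex (G i) j)"
  unfolding Ex_def by (intro Bochner_Integration.integral_sum obs_integrable)

lemma Ex_mono: "obs G \<Longrightarrow> obs H \<Longrightarrow> (\<And>st. G st \<le> H st) \<Longrightarrow> Ex G j \<le> Ex H j"
  unfolding Ex_def by (intro integral_mono obs_integrable)

lemma Ex_step:
  assumes "obs G"
  shows "Ex G (Suc j) = Ex (\<lambda>st. (\<Sum>c\<in>pairsN. G (clock_step st c)) / card pairsN) j"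
  unfolding Ex_def
  by (rule chain_step_integral(2)[where Nseq=Nseq and n=n, unfolded Nn])
     (simp_all only: N1 obs_integrable[OF obs_clock[OF assms]])

lemma Ex_q1_step: "Ex (\<lambda>st. q1 N G (fst st)) (Suc j) = Ex (\<lambda>st. q1 N (S1.avg G) (fst st)) j"
  by (subst Ex_step[OF obs_q1]) (simp add: fst_clock_step avg_q1_move)

lemma Ex_q2_step: "Ex (\<lambda>st. q2 N F (fst st)) (Suc j) = Ex (\<lambda>st. q2 N (S2.avg F) (fst st)) j"
  by (subst Ex_step[OF obs_q2]) (simp add: fst_clock_step avg_q2_move)

lemma Ex_occ0: "finite A \<Longrightarrow> A \<subseteq> sitesN \<Longrightarrow> Ex (\<lambda>st. of_bool (\<forall>x\<in>A. fst st x)) 0 = (\<Prod>x\<in>A. u x)"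
  unfolding Ex_def using init_moment[of A Nseq \<rho>0 n] u01 by (auto simp del: chain.simps)

lemma Ex_occ0_le: "finite A \<Longrightarrow> A \<subseteq> sitesN \<Longrightarrow> Ex (\<lambda>st. of_bool (\<forall>x\<in>A. fst st x)) 0 \<le> \<kappa> ^ card A"
  unfolding Ex_occ0 prod_constant[symmetric] using u01 u_le by (intro prod_mono) auto

text \<open>Two-point function of the initial law. On the diagonal it is of first order in the
  density, since an occupation equals its square.\<close>

definition b0 :: "'d site \<times> 'd site \<Rightarrow> real" where
  "b0 p = (if fst p = snd p then u (fst p) else u (fst p) * u (snd p))"

lemma Ex_occ2: "p \<in> sitesN \<times> sitesN \<Longrightarrow> Ex (\<lambda>st. of_bool (fst st (fst p) \<and> fst st (snd p))) 0 = b0 p"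
  using Ex_occ0[of "{fst p, snd p}"] by (auto simp: b0_def)

lemma Ex_q1_0: "Ex (\<lambda>st. q1 N G (fst st)) 0 = (\<Sum>x\<in>sitesN. G x * u x)"
proof -
  have "Ex (\<lambda>st. of_bool (fst st x)) 0 = u x" if "x \<in> sitesN" for x
    using Ex_occ0[of "{x}"] that by simp
  then show ?thesis unfolding q1_def
    by (subst Ex_sum) (auto intro!: obs_scale obs_occ simp: Ex_scale)
qed

lemma Ex_q2_0: "Ex (\<lambda>st. q2 N F (fst st)) 0 = (\<Sum>p\<in>sitesN \<times> sitesN. F p * b0 p)"
  unfolding q2_def by (subst Ex_sum) (auto intro!: obs_scale obs_occ2 sum.cong simp: Ex_scale Ex_occ2[unfolded])

text \<open>The induction peels off the last ring and transfers it to the coefficient, which is why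
  \<open>G\<close> must stay arbitrary.\<close>

lemma Ex_q1: "Ex (\<lambda>st. q1 N G (fst st)) j = (\<Sum>x\<in>sitesN. S1.pow j G x * u x)"
proof (induction j arbitrary: G)
  case 0
  show ?case by (simp add: Ex_q1_0)
next
  case (Suc j)
  show ?case unfolding Ex_q1_step Suc S1.pow_Suc2 ..
qed

lemma Ex_q2: "Ex (\<lambda>st. q2 N F (fst st)) j = (\<Sum>p\<in>sitesN \<times> sitesN. S2.pow j F p * b0 p)"
proof (induction j arbitrary: F)
  case 0
  show ?case by (simp add: Ex_q2_0)
next
  case (Suc j)
  show ?case unfolding Ex_q2_step Suc S2.pow_Suc2 ..
qed

lemma Ex_q1_le:
  assumes "\<And>x. x \<in> sitesN \<Longrightarrow> 0 \<le> G x"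
  shows "Ex (\<lambda>st. q1 N G (fst st)) j \<le> \<kappa> * (\<Sum>x\<in>sitesN. G x)"
proof -
  have "(\<Sum>x\<in>sitesN. S1.pow j G x * u x) \<le> (\<Sum>x\<in>sitesN. S1.pow j G x * \<kappa>)"
    using assms u_le by (intro sum_mono mult_left_mono S1.pow_ge) auto
  then show ?thesis unfolding Ex_q1 sum_distrib_right[symmetric] S1.sum_pow by (simp add: mult.commute)
qed

text \<open>The majorant takes one value on the diagonal and one off it, and swaps preserve the
  diagonal, so \<open>avg\<close> fixes it. A bound of product type at time 0 thus propagates to all
  times by symmetry and positivity of the walk.\<close>

lemma Ex_q2_le:
  assumes "\<And>p. p \<in> sitesN \<times> sitesN \<Longrightarrow> 0 \<le> F p"
  shows "Ex (\<lambda>st. q2 N F (fst st)) j \<le> (\<Sum>p\<in>sitesN \<times> sitesN. F p * (\<kappa>\<^sup>2 + \<kappa> * of_bool (fst p = snd p)))"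
proof -
  let ?b = "\<lambda>p :: 'd site \<times> 'd site. \<kappa>\<^sup>2 + \<kappa> * of_bool (fst p = snd p)"
  have inv: "?b (swp2 c p) = ?b p" if "c \<in> pairsN" for c p
    using S1.invol[OF that] by (simp add: swp2_def) metis
  have avg: "S2.avg ?b = ?b"
  proof
    fix p
    have "(\<Sum>c\<in>pairsN. ?b (swp2 c p)) = (\<Sum>c\<in>pairsN. ?b p)" by (intro sum.cong refl inv)
    then show "S2.avg ?b p = ?b p" using S1.neC unfolding S2.avg_def by (simp only:) simp
  qed
  have pow: "S2.pow j ?b = ?b" by (induction j) (simp_all add: avg)
  have b0: "b0 p \<le> ?b p" if p: "p \<in> sitesN \<times> sitesN" for p
  proof (cases "fst p = snd p")
    case True
    then show ?thesis using u_le p by (auto simp: b0_def intro: add_increasing)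
  next
    case False
    have "u (fst p) * u (snd p) \<le> \<kappa> * \<kappa>" using u_le u01 p \<kappa>_nonneg by (intro mult_mono) auto
    then show ?thesis using False by (simp add: b0_def power2_eq_square)
  qed
  have "Ex (\<lambda>st. q2 N F (fst st)) j \<le> (\<Sum>p\<in>sitesN \<times> sitesN. S2.pow j F p * ?b p)"
    unfolding Ex_q2 using assms b0 by (intro sum_mono mult_left_mono S2.pow_ge) auto
  also have "\<dots> = (\<Sum>p\<in>sitesN \<times> sitesN. F p * ?b p)"
    by (simp only: S2.pow_adjoint pow)
  finally show ?thesis .
qed

lemma q1_mult: "q1 N g \<eta> * q1 N h \<eta> = q2 N (\<lambda>p. g (fst p) * h (snd p)) \<eta>"
  unfolding q1_def q2_def sum_product sum.cartesian_product
  by (intro sum.cong refl) auto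

lemma Ex_q1_square: "Ex (\<lambda>st. (q1 N g (fst st))\<^sup>2) j \<le> (\<kappa>\<^sup>2 * N ^ CARD('d) + \<kappa>) * (\<Sum>x\<in>sitesN. (g x)\<^sup>2)"
proof -
  let ?F = "\<lambda>p. \<bar>g (fst p)\<bar> * \<bar>g (snd p)\<bar>"
  have "(q1 N g \<eta>)\<^sup>2 \<le> q2 N ?F \<eta>" for \<eta>
  proof -
    have "\<bar>q1 N g \<eta>\<bar> \<le> q1 N (\<lambda>x. \<bar>g x\<bar>) \<eta>"
      unfolding q1_def by (rule order_trans[OF sum_abs]) (simp add: abs_mult)
    then have "(q1 N g \<eta>)\<^sup>2 \<le> (q1 N (\<lambda>x. \<bar>g x\<bar>) \<eta>)\<^sup>2"
      by (metis abs_ge_zero power2_abs power_mono)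
    then show ?thesis by (simp add: power2_eq_square q1_mult)
  qed
  then have "Ex (\<lambda>st. (q1 N g (fst st))\<^sup>2) j \<le> Ex (\<lambda>st. q2 N ?F (fst st)) j"
    by (intro Ex_mono obs_power2 obs_q1 obs_q2)
  also have "\<dots> \<le> (\<Sum>p\<in>sitesN \<times> sitesN. ?F p * (\<kappa>\<^sup>2 + \<kappa> * of_bool (fst p = snd p)))"
    by (rule Ex_q2_le) auto
  also have "\<dots> = \<kappa>\<^sup>2 * (\<Sum>x\<in>sitesN. \<Sum>y\<in>sitesN. \<bar>g x\<bar> * \<bar>g y\<bar>) + \<kappa> * (\<Sum>x\<in>sitesN. \<Sum>y\<in>sitesN. if y = x then \<bar>g x\<bar> * \<bar>g y\<bar> else 0)"
    unfolding sum_distrib_left sum.distrib[symmetric] sum.cartesian_product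
    by (intro sum.cong) (auto simp: algebra_simps)
  also have "(\<Sum>x\<in>sitesN. \<Sum>y\<in>sitesN. if y = x then \<bar>g x\<bar> * \<bar>g y\<bar> else 0) = (\<Sum>x\<in>sitesN. (g x)\<^sup>2)"
    by (intro sum.cong refl) (simp add: power2_eq_square abs_mult[symmetric])
  finally have main: "Ex (\<lambda>st. (q1 N g (fst st))\<^sup>2) j \<le>
    \<kappa>\<^sup>2 * (\<Sum>x\<in>sitesN. \<Sum>y\<in>sitesN. \<bar>g x\<bar> * \<bar>g y\<bar>) + \<kappa> * (\<Sum>x\<in>sitesN. (g x)\<^sup>2)" .
  \<comment> \<open>The squared sum norm is traded for the square norm at the cost of the number of
    sites; this is the origin of the term with \<open>\<kappa>\<^sup>2\<close>.\<close>
  have "(\<Sum>x\<in>sitesN. \<Sum>y\<in>sitesN. \<bar>g x\<bar> * \<bar>g y\<bar>) = (\<Sum>x\<in>sitesN. \<bar>g x\<bar> * 1)\<^sup>2"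
    by (simp add: power2_eq_square sum_product)
  also have "\<dots> \<le> (\<Sum>x\<in>sitesN. \<bar>g x\<bar>\<^sup>2) * (\<Sum>x\<in>sitesN. 1\<^sup>2)"
    by (rule Cauchy_Schwarz_ineq_sum)
  also have "\<dots> = N ^ CARD('d) * (\<Sum>x\<in>sitesN. (g x)\<^sup>2)"
    by (simp add: card_sites mult.commute)
  finally have "\<kappa>\<^sup>2 * (\<Sum>x\<in>sitesN. \<Sum>y\<in>sitesN. \<bar>g x\<bar> * \<bar>g y\<bar>) \<le> \<kappa>\<^sup>2 * (N ^ CARD('d) * (\<Sum>x\<in>sitesN. (g x)\<^sup>2))"
    by (rule mult_left_mono) simp
  with main show ?thesis by (simp add: distrib_right mult.assoc)
qed

end

section \<open>Variance of the flux\<close>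

text \<open>The mean square about \<open>q\<close> is squared bias plus variance, and the variance
  is at most the mean square about any \<open>y\<close>. In the application \<open>y\<close> is the
  value before the ring, so that increments appear.\<close>

lemma avg_square_dev:
  fixes z :: "'c \<Rightarrow> real"
  assumes "finite C" "C \<noteq> {}"
  shows "(\<Sum>c\<in>C. (z c - q)\<^sup>2) / card C \<le> ((\<Sum>c\<in>C. z c) / card C - q)\<^sup>2 + (\<Sum>c\<in>C. (z c - y)\<^sup>2) / card C"
proof -
  let ?m = "real (card C)" let ?\<mu> = "(\<Sum>c\<in>C. z c) / ?m"
  have m: "?m > 0" using assms by (simp add: card_gt_0_iff)
  have e: "(\<Sum>c\<in>C. (z c - a)\<^sup>2) = (\<Sum>c\<in>C. (z c)\<^sup>2) - 2 * a * (\<Sum>c\<in>C. z c) + ?m * a\<^sup>2" for a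
  proof -
    have "(z c - a)\<^sup>2 = (z c)\<^sup>2 - 2 * a * z c + a\<^sup>2" for c by (simp add: power2_diff)
    then show ?thesis by (simp only: sum.distrib sum_subtractf sum_distrib_left[symmetric] sum_constant)
  qed
  have s: "(\<Sum>c\<in>C. z c) = ?m * ?\<mu>" using m by simp
  have "?m * (?\<mu> - q)\<^sup>2 + (\<Sum>c\<in>C. (z c - y)\<^sup>2) - (\<Sum>c\<in>C. (z c - q)\<^sup>2) = ?m * (?\<mu> - y)\<^sup>2"
    unfolding e by (subst s, subst (2) s) (simp only: power2_diff, simp add: algebra_simps power2_eq_square)
  then have "?m * (?\<mu> - q)\<^sup>2 + (\<Sum>c\<in>C. (z c - y)\<^sup>2) \<ge> (\<Sum>c\<in>C. (z c - q)\<^sup>2)"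
    using m by (metis diff_ge_0_iff_ge less_eq_real_def mult_nonneg_nonneg zero_le_power2)
  then show ?thesis using m by (simp add: field_simps)
qed

lemma square_sum3: "(a + b - c)\<^sup>2 \<le> 3 * (a\<^sup>2 + b\<^sup>2 + c\<^sup>2)" for a b c :: real
proof -
  have "0 \<le> (a - b)\<^sup>2 + (a + c)\<^sup>2 + (b + c)\<^sup>2" by simp
  then show ?thesis by (simp add: power2_eq_square algebra_simps)
qed

lemma square_sum4: "(a + b + c + d)\<^sup>2 \<le> 4 * (a\<^sup>2 + b\<^sup>2 + c\<^sup>2 + d\<^sup>2)" for a b c d :: real
proof -
  have "0 \<le> (a - b)\<^sup>2 + (a - c)\<^sup>2 + (a - d)\<^sup>2 + (b - c)\<^sup>2 + (b - d)\<^sup>2 + (c - d)\<^sup>2" by simp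
  then show ?thesis by (simp add: power2_eq_square algebra_simps)
qed

section \<open>Effect of one ring on linear and quadratic statistics\<close>

context ssep
begin

lemma q1_diff_swp:
  assumes c: "c \<in> pairsN"
  shows "q1 N G (\<eta> \<circ> swp c) - q1 N G \<eta> = q1 N (\<lambda>x. G (swp c x) - G x) \<eta>"
  unfolding q1_swp[OF c] by (simp only: q1_def left_diff_distrib sum_subtractf)

lemma q2_diff_swp:
  assumes c: "c \<in> pairsN"
  shows "q2 N F (\<eta> \<circ> swp c) - q2 N F \<eta> = q2 N (\<lambda>p. F (swp2 c p) - F p) \<eta>"
  unfolding q2_swp[OF c] by (simp only: q2_def left_diff_distrib sum_subtractf)

lemma pair_sites: "c \<in> pairsN \<Longrightarrow> fst c \<in> sitesN \<and> snd c \<in> sitesN"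
  using nbr_pairs_sites[OF N1, of "fst c" "snd c"] by simp

text \<open>Only the two ends of the bond change, so Cauchy-Schwarz costs a factor 2. Squaring an
  occupation changes nothing, hence the bound is again linear and needs only first moments.\<close>

lemma q1_grad:
  assumes c: "c \<in> pairsN"
  shows "(q1 N G (\<eta> \<circ> swp c) - q1 N G \<eta>)\<^sup>2 \<le> 2 * q1 N (\<lambda>x. (G (swp c x) - G x)\<^sup>2) \<eta>"
proof -
  let ?D = "\<lambda>x. G (swp c x) - G x" let ?S = "{fst c, snd c}"
  have S: "?S \<subseteq> sitesN" using pair_sites[OF c] by auto
  have D0: "?D x = 0" if "x \<notin> ?S" for x using that by (simp add: swp_def Transposition.transpose_def)
  have "q1 N ?D \<eta> = (\<Sum>x\<in>?S. ?D x * of_bool (\<eta> x))"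
    unfolding q1_def using S D0 by (intro sum.mono_neutral_right) auto
  then have "(q1 N ?D \<eta>)\<^sup>2 = (\<Sum>x\<in>?S. (?D x * of_bool (\<eta> x)) * 1)\<^sup>2" by simp
  also have "\<dots> \<le> (\<Sum>x\<in>?S. (?D x * of_bool (\<eta> x))\<^sup>2) * (\<Sum>x\<in>?S. 1\<^sup>2)"
    by (rule Cauchy_Schwarz_ineq_sum)
  also have "\<dots> \<le> (\<Sum>x\<in>?S. (?D x * of_bool (\<eta> x))\<^sup>2) * 2"
    by (intro mult_left_mono sum_nonneg) (auto simp: card_insert_if)
  also have "(\<Sum>x\<in>?S. (?D x * of_bool (\<eta> x))\<^sup>2) = q1 N (\<lambda>x. (?D x)\<^sup>2) \<eta>"
  proof -
    have "(\<Sum>x\<in>?S. (?D x * of_bool (\<eta> x))\<^sup>2) = (\<Sum>x\<in>?S. (?D x)\<^sup>2 * of_bool (\<eta> x))"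
      by (intro sum.cong refl) auto
    also have "\<dots> = q1 N (\<lambda>x. (?D x)\<^sup>2) \<eta>"
      unfolding q1_def using S D0 by (intro sum.mono_neutral_left) auto
    finally show ?thesis .
  qed
  finally show ?thesis unfolding q1_diff_swp[OF c] by simp
qed

text \<open>A pair contributes only if it meets the bond, that is, lies in one of two rows or two
  columns. There the occupation at the bond is estimated by 1, which leaves a linear statistic of
  the other site.\<close>

lemma q2_grad:
  assumes c: "c \<in> pairsN"
  defines "DD \<equiv> \<lambda>F p. F (swp2 c p) - F p"
  shows "(q2 N F (\<eta> \<circ> swp c) - q2 N F \<eta>)\<^sup>2 \<le>
    4 * ((q1 N (\<lambda>y. \<bar>DD F (fst c, y)\<bar>) \<eta>)\<^sup>2 + (q1 N (\<lambda>x. \<bar>DD F (x, fst c)\<bar>) \<eta>)\<^sup>2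
       + (q1 N (\<lambda>y. \<bar>DD F (snd c, y)\<bar>) \<eta>)\<^sup>2 + (q1 N (\<lambda>x. \<bar>DD F (x, snd c)\<bar>) \<eta>)\<^sup>2)"
proof -
  obtain a b where ab: "c = (a, b)" by (cases c)
  have S: "a \<in> sitesN" "b \<in> sitesN" using pair_sites[OF c] ab by auto
  define d where "d p = \<bar>DD F p\<bar>" for p
  have d0: "d p = 0" if "fst p \<noteq> a" "fst p \<noteq> b" "snd p \<noteq> a" "snd p \<noteq> b" for p
    using that by (simp add: d_def DD_def swp2_def swp_def ab Transposition.transpose_def)
  have dn: "0 \<le> d p" for p by (simp add: d_def)
  let ?o = "\<lambda>x. of_bool (\<eta> x) :: real"
  have row: "(\<Sum>p\<in>sitesN \<times> sitesN. if fst p = z then d p * ?o (snd p) else 0) = q1 N (\<lambda>y. d (z, y)) \<eta>" if "z \<in> sitesN" for z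
  proof -
    have "(\<Sum>p\<in>sitesN \<times> sitesN. if fst p = z then d p * ?o (snd p) else 0) = (\<Sum>x\<in>sitesN. \<Sum>y\<in>sitesN. if x = z then d (x, y) * ?o y else 0)"
      unfolding sum.cartesian_product by (intro sum.cong refl) auto
    also have "\<dots> = (\<Sum>x\<in>sitesN. if x = z then (\<Sum>y\<in>sitesN. d (x, y) * ?o y) else 0)"
      by (intro sum.cong) auto
    also have "\<dots> = q1 N (\<lambda>y. d (z, y)) \<eta>" using that by (simp add: q1_def)
    finally show ?thesis .
  qed
  have col: "(\<Sum>p\<in>sitesN \<times> sitesN. if snd p = z then d p * ?o (fst p) else 0) = q1 N (\<lambda>x. d (x, z)) \<eta>" if "z \<in> sitesN" for z
  proof -
    have "(\<Sum>p\<in>sitesN \<times> sitesN. if snd p = z then d p * ?o (fst p) else 0) = (\<Sum>x\<in>sitesN. \<Sum>y\<in>sitesN. if y = z then d (x, y) * ?o x else 0)"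
      unfolding sum.cartesian_product by (intro sum.cong refl) auto
    also have "\<dots> = q1 N (\<lambda>x. d (x, z)) \<eta>" using that by (simp add: q1_def)
    finally show ?thesis .
  qed
  have "\<bar>q2 N (DD F) \<eta>\<bar> \<le> (\<Sum>p\<in>sitesN \<times> sitesN. d p * (?o (fst p) * ?o (snd p)))"
    unfolding q2_def by (rule order_trans[OF sum_abs]) (auto simp: abs_mult d_def of_bool_conj simp del: sum_of_bool_mult_eq sum_mult_of_bool_eq intro!: sum_mono)
  also have "\<dots> \<le> (\<Sum>p\<in>sitesN \<times> sitesN. (if fst p = a then d p * ?o (snd p) else 0) + (if snd p = a then d p * ?o (fst p) else 0)
      + (if fst p = b then d p * ?o (snd p) else 0) + (if snd p = b then d p * ?o (fst p) else 0))"
  proof (rule sum_mono)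
    fix p
    have A: "0 \<le> (if P then d p * ?o x else 0)" for P x using dn[of p] by simp
    have B: "d p * (?o x * ?o y) \<le> d p * ?o x" "d p * (?o x * ?o y) \<le> d p * ?o y" for x y
      using dn[of p] by auto
    define t where "t = d p * (?o (fst p) * ?o (snd p))"
    define e1 e2 e3 e4 where "e1 = (if fst p = a then d p * ?o (snd p) else 0)"
      and "e2 = (if snd p = a then d p * ?o (fst p) else 0)"
      and "e3 = (if fst p = b then d p * ?o (snd p) else 0)"
      and "e4 = (if snd p = b then d p * ?o (fst p) else 0)"
    note e_defs = e1_def e2_def e3_def e4_def
    have nn: "0 \<le> e1" "0 \<le> e2" "0 \<le> e3" "0 \<le> e4" unfolding e_defs by (rule A)+
    consider "fst p = a" | "snd p = a" | "fst p = b" | "snd p = b"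
      | "fst p \<noteq> a" "fst p \<noteq> b" "snd p \<noteq> a" "snd p \<noteq> b" by blast
    then have "t \<le> e1 \<or> t \<le> e2 \<or> t \<le> e3 \<or> t \<le> e4"
    proof cases
      case 5
      then have "t = 0" using d0[of p] by (simp add: t_def)
      then show ?thesis using nn by simp
    qed (use B[of "fst p" "snd p"] in \<open>simp_all add: t_def e_defs del: of_bool_eq_1_iff\<close>)
    then have "t \<le> e1 + e2 + e3 + e4" using nn by linarith
    then show "d p * (?o (fst p) * ?o (snd p)) \<le> (if fst p = a then d p * ?o (snd p) else 0) + (if snd p = a then d p * ?o (fst p) else 0)
      + (if fst p = b then d p * ?o (snd p) else 0) + (if snd p = b then d p * ?o (fst p) else 0)"
      unfolding t_def e_defs .
  qed
  also have "\<dots> = q1 N (\<lambda>y. d (a, y)) \<eta> + q1 N (\<lambda>x. d (x, a)) \<eta> + q1 N (\<lambda>y. d (b, y)) \<eta> + q1 N (\<lambda>x. d (x, b)) \<eta>"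
    by (simp only: sum.distrib row[OF S(1)] row[OF S(2)] col[OF S(1)] col[OF S(2)])
  finally have "\<bar>q2 N (DD F) \<eta>\<bar> \<le> \<dots>" .
  then have "(q2 N (DD F) \<eta>)\<^sup>2 \<le> (q1 N (\<lambda>y. d (a, y)) \<eta> + q1 N (\<lambda>x. d (x, a)) \<eta> + q1 N (\<lambda>y. d (b, y)) \<eta> + q1 N (\<lambda>x. d (x, b)) \<eta>)\<^sup>2"
    by (metis abs_ge_zero power2_abs power_mono)
  note fin = order_trans[OF this square_sum4]
  have "q2 N F (\<eta> \<circ> swp c) - q2 N F \<eta> = q2 N (DD F) \<eta>"
    unfolding q2_diff_swp[OF c] DD_def ..
  then show ?thesis using fin by (simp add: ab d_def)
qed

text \<open>The second moment factor of a linear statistic, as found in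
  \<open>Ex_q1_square\<close>.\<close>

definition flux_var :: "real" where
  "flux_var = \<kappa>\<^sup>2 * N ^ CARD('d) + \<kappa>"

lemma flux_var_nonneg: "0 \<le> flux_var"
  using \<kappa>_nonneg by (simp add: flux_var_def)

lemma Ex_q2_grad:
  assumes c: "c \<in> pairsN"
  shows "Ex (\<lambda>st. (q2 N F (fst st \<circ> swp c) - q2 N F (fst st))\<^sup>2) j
    \<le> 16 * flux_var * (\<Sum>p\<in>sitesN \<times> sitesN. (F (swp2 c p) - F p)\<^sup>2)"
proof -
  let ?D = "\<lambda>p. F (swp2 c p) - F p"
  have S: "fst c \<in> sitesN" "snd c \<in> sitesN" using pair_sites[OF c] by auto
  have e: "Ex (\<lambda>st. (q1 N (\<lambda>y. \<bar>g y\<bar>) (fst st))\<^sup>2) j \<le> flux_var * (\<Sum>p\<in>sitesN \<times> sitesN. (?D p)\<^sup>2)"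
    if g: "(\<Sum>y\<in>sitesN. (g y)\<^sup>2) \<le> (\<Sum>p\<in>sitesN \<times> sitesN. (?D p)\<^sup>2)" for g
  proof -
    have "Ex (\<lambda>st. (q1 N (\<lambda>y. \<bar>g y\<bar>) (fst st))\<^sup>2) j \<le> flux_var * (\<Sum>x\<in>sitesN. (g x)\<^sup>2)"
      using Ex_q1_square[of "\<lambda>y. \<bar>g y\<bar>" j] by (simp add: flux_var_def)
    also have "\<dots> \<le> flux_var * (\<Sum>p\<in>sitesN \<times> sitesN. (?D p)\<^sup>2)"
      by (rule mult_left_mono[OF g flux_var_nonneg])
    finally show ?thesis .
  qed
  have r: "(\<Sum>y\<in>sitesN. (?D (z, y))\<^sup>2) \<le> (\<Sum>p\<in>sitesN \<times> sitesN. (?D p)\<^sup>2)" if "z \<in> sitesN" for z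
  proof -
    have "(\<Sum>y\<in>sitesN. (?D (z, y))\<^sup>2) = (\<Sum>p\<in>{z} \<times> sitesN. (?D p)\<^sup>2)"
      by (rule sum.reindex_bij_witness[of _ snd "\<lambda>y. (z, y)"]) auto
    also have "\<dots> \<le> (\<Sum>p\<in>sitesN \<times> sitesN. (?D p)\<^sup>2)" using that by (intro sum_mono2) auto
    finally show ?thesis .
  qed
  have cl: "(\<Sum>x\<in>sitesN. (?D (x, z))\<^sup>2) \<le> (\<Sum>p\<in>sitesN \<times> sitesN. (?D p)\<^sup>2)" if "z \<in> sitesN" for z
  proof -
    have "(\<Sum>x\<in>sitesN. (?D (x, z))\<^sup>2) = (\<Sum>p\<in>sitesN \<times> {z}. (?D p)\<^sup>2)"
      by (rule sum.reindex_bij_witness[of _ fst "\<lambda>x. (x, z)"]) auto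
    also have "\<dots> \<le> (\<Sum>p\<in>sitesN \<times> sitesN. (?D p)\<^sup>2)" using that by (intro sum_mono2) auto
    finally show ?thesis .
  qed
  have o: "obs (\<lambda>st. (q1 N g (fst st))\<^sup>2)" for g :: "'d site \<Rightarrow> real" by (intro obs_power2 obs_q1)
  have "Ex (\<lambda>st. (q2 N F (fst st \<circ> swp c) - q2 N F (fst st))\<^sup>2) j \<le>
    Ex (\<lambda>st. 4 * ((q1 N (\<lambda>y. \<bar>?D (fst c, y)\<bar>) (fst st))\<^sup>2 + (q1 N (\<lambda>x. \<bar>?D (x, fst c)\<bar>) (fst st))\<^sup>2
       + (q1 N (\<lambda>y. \<bar>?D (snd c, y)\<bar>) (fst st))\<^sup>2 + (q1 N (\<lambda>x. \<bar>?D (x, snd c)\<bar>) (fst st))\<^sup>2)) j"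
  proof (rule Ex_mono)
    show "obs (\<lambda>st. (q2 N F (fst st \<circ> swp c) - q2 N F (fst st))\<^sup>2)"
      unfolding q2_diff_swp[OF c] by (intro obs_power2 obs_q2)
    show "obs (\<lambda>st. 4 * ((q1 N (\<lambda>y. \<bar>?D (fst c, y)\<bar>) (fst st))\<^sup>2 + (q1 N (\<lambda>x. \<bar>?D (x, fst c)\<bar>) (fst st))\<^sup>2
       + (q1 N (\<lambda>y. \<bar>?D (snd c, y)\<bar>) (fst st))\<^sup>2 + (q1 N (\<lambda>x. \<bar>?D (x, snd c)\<bar>) (fst st))\<^sup>2))"
      by (intro obs_scale obs_add o)
  qed (rule q2_grad[OF c])
  also have "\<dots> = 4 * (Ex (\<lambda>st. (q1 N (\<lambda>y. \<bar>?D (fst c, y)\<bar>) (fst st))\<^sup>2) j + Ex (\<lambda>st. (q1 N (\<lambda>x. \<bar>?D (x, fst c)\<bar>) (fst st))\<^sup>2) j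
       + Ex (\<lambda>st. (q1 N (\<lambda>y. \<bar>?D (snd c, y)\<bar>) (fst st))\<^sup>2) j + Ex (\<lambda>st. (q1 N (\<lambda>x. \<bar>?D (x, snd c)\<bar>) (fst st))\<^sup>2) j)"
    by (simp only: Ex_scale Ex_add obs_add o)
  \<comment> \<open>Each of the four rows and columns is bounded by the full sum, and 4 times 4
    gives 16.\<close>
  also have "\<dots> \<le> 16 * flux_var * (\<Sum>p\<in>sitesN \<times> sitesN. (?D p)\<^sup>2)"
  proof -
    have "4 * (w + x + y + z) \<le> 16 * m" if "w \<le> m" "x \<le> m" "y \<le> m" "z \<le> m" for w x y z m :: real
    proof -
      have "4 * (w + x + y + z) \<le> 4 * (m + m + m + m)" using that by (intro mult_left_mono add_mono) auto
      then show ?thesis by simp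
    qed
    from this[OF e[OF r[OF S(1)]] e[OF cl[OF S(1)]] e[OF r[OF S(2)]] e[OF cl[OF S(2)]]]
    show ?thesis by (simp only: mult.assoc)
  qed
  finally show ?thesis .
qed

lemma Ex_sum_move:
  fixes h :: "('d site \<Rightarrow> bool) \<Rightarrow> real"
  shows "(\<Sum>c\<in>pairsN. (h (move \<eta> c) - h \<eta>)\<^sup>2) = (\<Sum>c\<in>pairsN. (h (\<eta> \<circ> swp c) - h \<eta>)\<^sup>2) / 2"
  using sum_move[of "\<lambda>\<zeta>. (h \<zeta> - h \<eta>)\<^sup>2" \<eta>] by simp

text \<open>The constant drops from 16 to 8 because a ring performs the swap with weight one
  half.\<close>

lemma Ex_q2_move: "Ex (\<lambda>st. \<Sum>c\<in>pairsN. (q2 N F (move (fst st) c) - q2 N F (fst st))\<^sup>2) j \<le> 8 * flux_var * S2.energy F"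
proof -
  have "Ex (\<lambda>st. \<Sum>c\<in>pairsN. (q2 N F (fst st \<circ> swp c) - q2 N F (fst st))\<^sup>2) j
     = (\<Sum>c\<in>pairsN. Ex (\<lambda>st. (q2 N F (fst st \<circ> swp c) - q2 N F (fst st))\<^sup>2) j)"
    by (rule Ex_sum) (simp only: q2_diff_swp obs_power2 obs_q2)
  also have "\<dots> \<le> (\<Sum>c\<in>pairsN. 16 * flux_var * (\<Sum>p\<in>sitesN \<times> sitesN. (F (swp2 c p) - F p)\<^sup>2))"
    by (intro sum_mono Ex_q2_grad)
  also have "\<dots> = 16 * flux_var * S2.energy F"
    by (simp add: S2.energy_def sum_distrib_left)
  finally show ?thesis unfolding Ex_sum_move Ex_divide by simp
qed

lemma Ex_q1_move: "Ex (\<lambda>st. \<Sum>c\<in>pairsN. (q1 N G (move (fst st) c) - q1 N G (fst st))\<^sup>2) j \<le> \<kappa> * S1.energy G"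
proof -
  have "Ex (\<lambda>st. \<Sum>c\<in>pairsN. (q1 N G (fst st \<circ> swp c) - q1 N G (fst st))\<^sup>2) j
     = (\<Sum>c\<in>pairsN. Ex (\<lambda>st. (q1 N G (fst st \<circ> swp c) - q1 N G (fst st))\<^sup>2) j)"
    by (rule Ex_sum) (simp only: q1_diff_swp obs_power2 obs_q1)
  also have "\<dots> \<le> (\<Sum>c\<in>pairsN. 2 * (\<kappa> * (\<Sum>x\<in>sitesN. (G (swp c x) - G x)\<^sup>2)))"
  proof (rule sum_mono)
    fix c assume c: "c \<in> pairsN"
    have "Ex (\<lambda>st. (q1 N G (fst st \<circ> swp c) - q1 N G (fst st))\<^sup>2) j \<le> Ex (\<lambda>st. 2 * q1 N (\<lambda>x. (G (swp c x) - G x)\<^sup>2) (fst st)) j"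
      using q1_grad[OF c] by (intro Ex_mono) (simp_all only: q1_diff_swp[OF c] obs_power2 obs_q1 obs_scale)
    also have "\<dots> \<le> 2 * (\<kappa> * (\<Sum>x\<in>sitesN. (G (swp c x) - G x)\<^sup>2))"
      unfolding Ex_scale by (intro mult_left_mono Ex_q1_le) auto
    finally show "Ex (\<lambda>st. (q1 N G (fst st \<circ> swp c) - q1 N G (fst st))\<^sup>2) j \<le> 2 * (\<kappa> * (\<Sum>x\<in>sitesN. (G (swp c x) - G x)\<^sup>2))" .
  qed
  also have "\<dots> = 2 * \<kappa> * S1.energy G"
    by (simp add: S1.energy_def sum_distrib_left mult.assoc)
  finally show ?thesis unfolding Ex_sum_move Ex_divide by simp
qed

end

lemma square_cancel: "C > 0 \<Longrightarrow> 4 * C * X / C\<^sup>2 = 4 * X / C" for C X :: real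
  by (simp add: power2_eq_square)

lemma square_sum2: "(a - b)\<^sup>2 \<le> 2 * a\<^sup>2 + 2 * b\<^sup>2" for a b :: real
  using zero_le_power2[of "a + b"] by (simp add: power2_eq_square algebra_simps)

section \<open>The flux in one direction and its Doob martingale\<close>

locale ssep_flux = ssep N D Nseq \<rho>0 n \<kappa>
  for N and D :: "'d::finite itself" and Nseq :: "nat \<Rightarrow> nat" and \<rho>0 :: "real^'d \<Rightarrow> real" and n :: nat and \<kappa> :: real +
  fixes l :: 'd and s :: bool and \<phi> :: "'d site \<Rightarrow> real" and B :: real
  assumes \<phi>: "\<And>x. x \<in> sitesN \<Longrightarrow> 0 \<le> \<phi> x \<and> \<phi> x \<le> B"
begin

abbreviation sh :: "'d site \<Rightarrow> 'd site" where "sh \<equiv> shift N l s"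

lemma B_nonneg: "0 \<le> B"
proof -
  have "(\<lambda>_. 0) \<in> sitesN" using N1 by (simp add: sites_def)
  from \<phi>[OF this] show ?thesis by linarith
qed

definition V1 :: "'d site \<times> 'd site \<Rightarrow> real" where "V1 p = of_bool (snd p = sh (fst p))"
definition V :: "'d site \<times> 'd site \<Rightarrow> real" where "V p = \<phi> (fst p) * V1 p"

definition flux :: "'d state \<Rightarrow> real" where
  "flux st = (\<Sum>x\<in>sitesN. \<phi> x * real (snd st x (sh x)))"

text \<open>A ring picks a given pair with probability \<open>1 / card pairsN\<close>; this is the
  factor in front of the Green functions of both correctors.\<close>

definition G :: "nat \<Rightarrow> 'd site \<Rightarrow> real" where "G m x = (1 / card pairsN) * S1.green m \<phi> x"
definition F :: "nat \<Rightarrow> 'd site \<times> 'd site \<Rightarrow> real" where "F m p = (1 / card pairsN) * S2.green m V p"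

text \<open>The conditional mean of the flux after \<open>m\<close> further rings, given the present
  state. Along the chain, \<open>Z (K - j)\<close> at step \<open>j\<close> is thus the Doob
  martingale of the flux at step \<open>K\<close>.\<close>

definition Z :: "nat \<Rightarrow> 'd state \<Rightarrow> real" where
  "Z m st = flux st + q1 N (G m) (fst st) - q2 N (F m) (fst st)"

lemma obs_flux: "obs flux"
  unfolding flux_def[abs_def] by (intro obs_sum obs_scale obs_cnt) auto

lemma obs_Z: "obs (Z m)"
  unfolding Z_def[abs_def] by (intro obs_diff obs_add obs_flux obs_q1 obs_q2)

lemma obs_clock_Z: "obs (\<lambda>st. Z m (clock_step st c))"
  by (rule obs_clock[OF obs_Z])

lemma obs_clock_flux: "obs (\<lambda>st. flux (clock_step st c))"
  by (rule obs_clock[OF obs_flux])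

lemma V_nonneg: "p \<in> sitesN \<times> sitesN \<Longrightarrow> 0 \<le> V p"
  using \<phi> by (auto simp: V_def V1_def)

lemma V_le: "p \<in> sitesN \<times> sitesN \<Longrightarrow> V p \<le> B * V1 p"
  using \<phi> by (auto simp: V_def V1_def)

lemma sum_V1: "(\<Sum>p\<in>sitesN \<times> sitesN. g p * V1 p) = (\<Sum>x\<in>sitesN. g (x, sh x))"
proof -
  have "(\<Sum>p\<in>sitesN \<times> sitesN. g p * V1 p) = (\<Sum>x\<in>sitesN. \<Sum>y\<in>sitesN. if y = sh x then g (x, y) else 0)"
    unfolding sum.cartesian_product by (intro sum.cong) (auto simp: V1_def)
  also have "\<dots> = (\<Sum>x\<in>sitesN. g (x, sh x))"
    by (intro sum.cong refl) (simp add: shift_sites[OF N1])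
  finally show ?thesis .
qed

lemma sum_pairs_line: "(\<Sum>c\<in>pairsN. if snd c = sh (fst c) then g (fst c) else 0) = (\<Sum>x\<in>sitesN. g x)"
  for g :: "'d site \<Rightarrow> real"
proof -
  have "(\<Sum>c\<in>pairsN. if snd c = sh (fst c) then g (fst c) else 0) = (\<Sum>c\<in>{c\<in>pairsN. snd c = sh (fst c)}. g (fst c))"
    by (rule sum.inter_filter[symmetric]) simp
  also have "\<dots> = (\<Sum>x\<in>sitesN. g x)"
    by (rule sum.reindex_bij_witness[of _ "\<lambda>x. (x, sh x)" fst]) (auto simp: nbr_pairs_def)
  finally show ?thesis .
qed

lemma flux_step:
  assumes c: "c \<in> pairsN"
  shows "flux (clock_step st c) - flux st =
    (if snd c = sh (fst c) then \<phi> (fst c) * of_bool (fst st (fst c) \<and> \<not> fst st (sh (fst c))) else 0)"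
proof -
  have "flux (clock_step st c) - flux st = (\<Sum>x\<in>sitesN. \<phi> x * of_bool (fst st (fst c) \<and> \<not> fst st (snd c) \<and> x = fst c \<and> sh x = snd c))"
    unfolding flux_def clock_step_snd by (simp add: sum_subtractf[symmetric] distrib_left)
  also have "\<dots> = (\<Sum>x\<in>sitesN. if x = fst c then \<phi> x * of_bool (fst st (fst c) \<and> \<not> fst st (snd c) \<and> sh x = snd c) else 0)"
    by (intro sum.cong) auto
  also have "\<dots> = \<phi> (fst c) * of_bool (fst st (fst c) \<and> \<not> fst st (snd c) \<and> sh (fst c) = snd c)"
    using pair_sites[OF c] by simp
  finally show ?thesis by auto
qed

lemma q2_V: "q2 N V \<eta> = (\<Sum>x\<in>sitesN. \<phi> x * of_bool (\<eta> x \<and> \<eta> (sh x)))"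
proof -
  have "q2 N V \<eta> = (\<Sum>p\<in>sitesN \<times> sitesN. (\<phi> (fst p) * of_bool (\<eta> (fst p) \<and> \<eta> (snd p))) * V1 p)"
    unfolding q2_def V_def by (intro sum.cong) auto
  then show ?thesis unfolding sum_V1 by simp
qed

lemma sum_flux_step: "(\<Sum>c\<in>pairsN. flux (clock_step st c) - flux st) = q1 N \<phi> (fst st) - q2 N V (fst st)"
proof -
  have "(\<Sum>c\<in>pairsN. flux (clock_step st c) - flux st) = (\<Sum>x\<in>sitesN. \<phi> x * of_bool (fst st x \<and> \<not> fst st (sh x)))"
    unfolding sum_pairs_line[symmetric] by (intro sum.cong refl flux_step)
  also have "\<dots> = q1 N \<phi> (fst st) - q2 N V (fst st)"
    unfolding q2_V q1_def sum_subtractf[symmetric] by (intro sum.cong) auto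
  finally show ?thesis .
qed

text \<open>Dropping the requirement of an empty target leaves the particle number times the bound
  for a squared weight.\<close>

lemma sum_flux_step2: "(\<Sum>c\<in>pairsN. (flux (clock_step st c) - flux st)\<^sup>2) \<le> B\<^sup>2 * q1 N (\<lambda>_. 1) (fst st)"
proof -
  have "(\<Sum>c\<in>pairsN. (flux (clock_step st c) - flux st)\<^sup>2) =
     (\<Sum>c\<in>pairsN. if snd c = sh (fst c) then (\<phi> (fst c) * of_bool (fst st (fst c) \<and> \<not> fst st (sh (fst c))))\<^sup>2 else 0)"
    by (intro sum.cong refl) (simp add: flux_step)
  also have "\<dots> = (\<Sum>x\<in>sitesN. (\<phi> x * of_bool (fst st x \<and> \<not> fst st (sh x)))\<^sup>2)"
    by (rule sum_pairs_line)
  also have "\<dots> \<le> (\<Sum>x\<in>sitesN. B\<^sup>2 * of_bool (fst st x))"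
  proof (rule sum_mono)
    fix x assume "x \<in> sitesN"
    then have "(\<phi> x)\<^sup>2 \<le> B\<^sup>2" using \<phi> by (intro power_mono) auto
    then show "(\<phi> x * of_bool (fst st x \<and> \<not> fst st (sh x)))\<^sup>2 \<le> B\<^sup>2 * of_bool (fst st x)" by simp
  qed
  finally show ?thesis by (simp only: q1_def sum_distrib_left mult_1_left)
qed

text \<open>The drift of \<open>flux\<close> is exactly the new summand that
  \<open>green_Suc\<close> adds to the two correctors, so averaging over a ring raises the horizon
  by one.\<close>

lemma Z_martingale: "(\<Sum>c\<in>pairsN. Z m (clock_step st c)) / card pairsN = Z (Suc m) st"
proof -
  let ?C = "real (card pairsN)"
  have C: "?C > 0" by (rule S1.cardC)
  have f: "(\<Sum>c\<in>pairsN. flux (clock_step st c)) / ?C = flux st + (q1 N \<phi> (fst st) - q2 N V (fst st)) / ?C"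
    unfolding sum_flux_step[symmetric] using S1.neC by (simp add: sum_subtractf diff_divide_distrib)
  have G: "G (Suc m) = (\<lambda>x. \<phi> x / ?C + S1.avg (G m) x)"
    unfolding G_def[abs_def] S1.avg_scale S1.green_Suc by (simp add: distrib_left)
  have F: "F (Suc m) = (\<lambda>p. V p / ?C + S2.avg (F m) p)"
    unfolding F_def[abs_def] S2.avg_scale S2.green_Suc by (simp add: distrib_left)
  have "(\<Sum>c\<in>pairsN. Z m (clock_step st c)) / ?C =
    (\<Sum>c\<in>pairsN. flux (clock_step st c)) / ?C + (\<Sum>c\<in>pairsN. q1 N (G m) (move (fst st) c)) / ?C - (\<Sum>c\<in>pairsN. q2 N (F m) (move (fst st) c)) / ?C"
    unfolding Z_def fst_clock_step by (simp only: sum.distrib sum_subtractf add_divide_distrib diff_divide_distrib)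
  also have "\<dots> = Z (Suc m) st"
    unfolding f avg_q1_move avg_q2_move Z_def G F q1_add q2_add q1_divide q2_divide
    by (simp add: diff_divide_distrib)
  finally show ?thesis .
qed

text \<open>Expected number of returns of the pair walk to adjacency in the given direction, summed
  over the starting sites. It governs the part of the variance that is not of order
  \<open>1 / n\<close>.\<close>

definition occ_time :: "nat \<Rightarrow> real" where
  "occ_time K = (\<Sum>k<K. \<Sum>x\<in>sitesN. S2.pow k V1 (x, sh x))"

lemma occ_time_mono: "m \<le> K \<Longrightarrow> occ_time m \<le> occ_time K"
  unfolding occ_time_def by (intro sum_mono2) (auto simp: V1_def intro!: sum_nonneg S2.pow_ge shift_sites[OF N1])

text \<open>For the linear corrector the crude estimate suffices: every summand of the Green sum is
  at most \<open>B * B\<close>.\<close>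

lemma energy_G: "S1.energy (G m) \<le> 4 * real m * B\<^sup>2 * N ^ CARD('d) / card pairsN"
proof -
  let ?C = "real (card pairsN)"
  have C: "?C > 0" by (rule S1.cardC)
  have "S1.energy (G m) = S1.energy (S1.green m \<phi>) / ?C\<^sup>2"
    by (simp add: S1.energy_def G_def diff_divide_distrib[symmetric] power_divide sum_divide_distrib[symmetric])
  also have "S1.energy (S1.green m \<phi>) \<le> 4 * ?C * (\<Sum>k<m. \<Sum>p\<in>sitesN. \<phi> p * S1.pow k \<phi> p)"
    using \<phi> by (intro S1.energy_green) auto
  also have "(\<Sum>k<m. \<Sum>p\<in>sitesN. \<phi> p * S1.pow k \<phi> p) \<le> (\<Sum>k<m. \<Sum>p\<in>sitesN. B * B)"
    using \<phi> B_nonneg by (intro sum_mono mult_mono S1.pow_le S1.pow_ge) auto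
  also have "\<dots> = m * B\<^sup>2 * N ^ CARD('d)"
    by (simp add: card_sites power2_eq_square)
  finally have "S1.energy (G m) \<le> 4 * ?C * (real m * B\<^sup>2 * N ^ CARD('d)) / ?C\<^sup>2"
    using C by (simp add: divide_right_mono del: of_nat_eq_0_iff card_0_eq)
  also have "\<dots> = 4 * (m * B\<^sup>2 * N ^ CARD('d)) / ?C" by (rule square_cancel[OF C])
  finally show ?thesis by (simp add: mult.assoc)
qed

text \<open>The crude estimate used for \<open>G\<close> would leave a variance of order one here.
  The sum is therefore kept as a return count, to which \<open>return_estimate\<close>
  applies.\<close>

lemma energy_F:
  assumes "m \<le> K"
  shows "S2.energy (F m) \<le> 4 * B\<^sup>2 * occ_time K / card pairsN"
proof -
  let ?C = "real (card pairsN)"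
  have C: "?C > 0" by (rule S1.cardC)
  have "S2.energy (F m) = S2.energy (S2.green m V) / ?C\<^sup>2"
    by (simp add: S2.energy_def F_def diff_divide_distrib[symmetric] power_divide sum_divide_distrib[symmetric])
  also have "S2.energy (S2.green m V) \<le> 4 * ?C * (\<Sum>k<m. \<Sum>p\<in>sitesN \<times> sitesN. V p * S2.pow k V p)"
    by (intro S2.energy_green V_nonneg)
  also have "(\<Sum>k<m. \<Sum>p\<in>sitesN \<times> sitesN. V p * S2.pow k V p) \<le> (\<Sum>k<m. \<Sum>p\<in>sitesN \<times> sitesN. (B * V1 p) * (B * S2.pow k V1 p))"
  proof (intro sum_mono mult_mono V_le)
    fix k and p :: "'d site \<times> 'd site" assume p: "p \<in> sitesN \<times> sitesN"
    show "S2.pow k V p \<le> B * S2.pow k V1 p"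
      using S2.pow_mono[of V "\<lambda>p. B * V1 p" p k] V_le p by (simp add: S2.pow_scale)
    show "0 \<le> B * V1 p" using B_nonneg by (simp add: V1_def)
    show "0 \<le> S2.pow k V p" using p by (intro S2.pow_ge V_nonneg)
  qed
  also have "\<dots> = B\<^sup>2 * (\<Sum>k<m. \<Sum>p\<in>sitesN \<times> sitesN. S2.pow k V1 p * V1 p)"
    unfolding sum_distrib_left by (intro sum.cong refl) (simp add: power2_eq_square)
  also have "\<dots> = B\<^sup>2 * occ_time m" unfolding sum_V1 occ_time_def ..
  also have "\<dots> \<le> B\<^sup>2 * occ_time K" by (intro mult_left_mono occ_time_mono assms) simp
  finally have "S2.energy (F m) \<le> 4 * ?C * (B\<^sup>2 * occ_time K) / ?C\<^sup>2"
    using C by (simp add: divide_right_mono del: of_nat_eq_0_iff card_0_eq)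
  also have "\<dots> = 4 * (B\<^sup>2 * occ_time K) / ?C" by (rule square_cancel[OF C])
  finally show ?thesis by (simp add: mult.assoc)
qed

text \<open>The three terms stem from the jump of the flux, the linear and the quadratic corrector;
  3 comes from \<open>square_sum3\<close>, and 32 is 8 from \<open>Ex_q2_move\<close> times 4 from
  \<open>energy_F\<close>.\<close>

definition step_var :: "nat \<Rightarrow> real" where
  "step_var K = 3 * B\<^sup>2 * (\<kappa> * N ^ CARD('d) / card pairsN + 4 * \<kappa> * K * N ^ CARD('d) / (card pairsN)\<^sup>2
     + 32 * flux_var * occ_time K / (card pairsN)\<^sup>2)"

lemma Z_increment:
  assumes m: "m \<le> K"
  shows "Ex (\<lambda>st. (\<Sum>c\<in>pairsN. (Z m (clock_step st c) - Z m st)\<^sup>2) / card pairsN) j \<le> step_var K"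
proof -
  let ?C = "real (card pairsN)"
  have C: "?C > 0" by (rule S1.cardC)
  let ?a = "\<lambda>st. \<Sum>c\<in>pairsN. (flux (clock_step st c) - flux st)\<^sup>2"
  let ?b = "\<lambda>st. \<Sum>c\<in>pairsN. (q1 N (G m) (move (fst st) c) - q1 N (G m) (fst st))\<^sup>2"
  let ?d = "\<lambda>st. \<Sum>c\<in>pairsN. (q2 N (F m) (move (fst st) c) - q2 N (F m) (fst st))\<^sup>2"
  have m1: "obs (\<lambda>st. q1 N g (move (fst st) c))" for g and c :: "'d site \<times> 'd site"
    using obs_clock[OF obs_q1[of N g], of c] by (simp add: fst_clock_step)
  have m2: "obs (\<lambda>st. q2 N g (move (fst st) c))" for g and c :: "'d site \<times> 'd site"
    using obs_clock[OF obs_q2[of N g], of c] by (simp add: fst_clock_step)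
  have o: "obs ?a" "obs ?b" "obs ?d"
    by (intro obs_sum obs_power2 obs_diff obs_clock_flux obs_flux obs_q1 obs_q2 m1 m2 finite_nbr_pairs)+
  have "Ex (\<lambda>st. (\<Sum>c\<in>pairsN. (Z m (clock_step st c) - Z m st)\<^sup>2) / ?C) j \<le> Ex (\<lambda>st. 3 * (?a st + ?b st + ?d st) / ?C) j"
  proof (rule Ex_mono)
    show "obs (\<lambda>st. (\<Sum>c\<in>pairsN. (Z m (clock_step st c) - Z m st)\<^sup>2) / ?C)"
      by (intro obs_divide obs_sum obs_power2 obs_diff obs_clock_Z obs_Z finite_nbr_pairs)
    show "obs (\<lambda>st. 3 * (?a st + ?b st + ?d st) / ?C)"
      by (intro obs_divide obs_scale obs_add o)
    fix st
    have "(\<Sum>c\<in>pairsN. (Z m (clock_step st c) - Z m st)\<^sup>2) \<le> (\<Sum>c\<in>pairsN. 3 * ((flux (clock_step st c) - flux st)\<^sup>2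
      + (q1 N (G m) (move (fst st) c) - q1 N (G m) (fst st))\<^sup>2 + (q2 N (F m) (move (fst st) c) - q2 N (F m) (fst st))\<^sup>2))"
    proof (rule sum_mono)
      fix c
      have "Z m (clock_step st c) - Z m st = (flux (clock_step st c) - flux st) + (q1 N (G m) (move (fst st) c) - q1 N (G m) (fst st))
         - (q2 N (F m) (move (fst st) c) - q2 N (F m) (fst st))"
        by (simp add: Z_def fst_clock_step)
      then show "(Z m (clock_step st c) - Z m st)\<^sup>2 \<le> 3 * ((flux (clock_step st c) - flux st)\<^sup>2
      + (q1 N (G m) (move (fst st) c) - q1 N (G m) (fst st))\<^sup>2 + (q2 N (F m) (move (fst st) c) - q2 N (F m) (fst st))\<^sup>2)"
        using square_sum3 by simp
    qed
    also have "\<dots> = 3 * (?a st + ?b st + ?d st)"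
      by (simp only: sum.distrib sum_distrib_left[symmetric])
    finally show "(\<Sum>c\<in>pairsN. (Z m (clock_step st c) - Z m st)\<^sup>2) / ?C \<le> 3 * (?a st + ?b st + ?d st) / ?C"
      by (rule divide_right_mono) simp
  qed
  also have "\<dots> = 3 * (Ex ?a j + Ex ?b j + Ex ?d j) / ?C"
    by (simp only: Ex_divide Ex_scale Ex_add o obs_add)
  also have "\<dots> \<le> 3 * (B\<^sup>2 * (\<kappa> * N ^ CARD('d)) + \<kappa> * (4 * real K * B\<^sup>2 * N ^ CARD('d) / ?C) + 8 * flux_var * (4 * B\<^sup>2 * occ_time K / ?C)) / ?C"
  proof (intro divide_right_mono mult_left_mono add_mono)
    have "Ex ?a j \<le> Ex (\<lambda>st. B\<^sup>2 * q1 N (\<lambda>_. 1) (fst st)) j"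
      by (intro Ex_mono o obs_scale obs_q1 sum_flux_step2)
    also have "\<dots> \<le> B\<^sup>2 * (\<kappa> * N ^ CARD('d))"
      unfolding Ex_scale using Ex_q1_le[of "\<lambda>_. 1" j] by (intro mult_left_mono) (auto simp: card_sites)
    finally show "Ex ?a j \<le> B\<^sup>2 * (\<kappa> * N ^ CARD('d))" .
    have "Ex ?b j \<le> \<kappa> * S1.energy (G m)" by (rule Ex_q1_move)
    also have "\<dots> \<le> \<kappa> * (4 * real K * B\<^sup>2 * N ^ CARD('d) / ?C)"
      using m C by (intro mult_left_mono \<kappa>_nonneg order_trans[OF energy_G] divide_right_mono mult_right_mono) auto
    finally show "Ex ?b j \<le> \<kappa> * (4 * real K * B\<^sup>2 * N ^ CARD('d) / ?C)" .
    have "Ex ?d j \<le> 8 * flux_var * S2.energy (F m)" by (rule Ex_q2_move)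
    also have "\<dots> \<le> 8 * flux_var * (4 * B\<^sup>2 * occ_time K / ?C)"
      using energy_F[OF m] flux_var_nonneg by (intro mult_left_mono) auto
    finally show "Ex ?d j \<le> 8 * flux_var * (4 * B\<^sup>2 * occ_time K / ?C)" .
  qed auto
  also have "\<dots> = step_var K"
  proof -
    have "3 * (b * (k * w) + k * (4 * m * b * w / D) + 8 * v * (4 * b * r / D)) / D =
      3 * b * (k * w / D + 4 * k * m * w / D\<^sup>2 + 32 * v * r / D\<^sup>2)" if "D > 0" for b k w m v r D :: real
      using that by (simp add: power2_eq_square field_simps)
    from this[OF C] show ?thesis unfolding step_var_def by (simp only: of_nat_power)
  qed
  finally show ?thesis .
qed

text \<open>Martingale increments add in mean square. At each ring \<open>avg_square_dev\<close> is
  used with the same \<open>Z ?m\<close> evaluated before the ring as reference value.\<close>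

lemma Z_variance:
  assumes "j \<le> K"
  shows "Ex (\<lambda>st. (Z (K - j) st - q)\<^sup>2) j \<le> Ex (\<lambda>st. (Z K st - q)\<^sup>2) 0 + j * step_var K"
  using assms
proof (induction j)
  case 0
  then show ?case by simp
next
  case (Suc j)
  let ?m = "K - Suc j"
  have m: "Suc ?m = K - j" using Suc.prems by simp
  have "Ex (\<lambda>st. (Z ?m st - q)\<^sup>2) (Suc j) = Ex (\<lambda>st. (\<Sum>c\<in>pairsN. (Z ?m (clock_step st c) - q)\<^sup>2) / card pairsN) j"
    by (intro Ex_step obs_power2 obs_diff obs_Z obs_const)
  also have "\<dots> \<le> Ex (\<lambda>st. (Z (K - j) st - q)\<^sup>2 + (\<Sum>c\<in>pairsN. (Z ?m (clock_step st c) - Z ?m st)\<^sup>2) / card pairsN) j"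
    using avg_square_dev[OF S1.finC S1.neC] unfolding m[symmetric] Z_martingale[symmetric]
    by (intro Ex_mono obs_add obs_divide obs_sum obs_power2 obs_diff obs_clock_Z obs_Z obs_const finite_nbr_pairs)
  also have "\<dots> = Ex (\<lambda>st. (Z (K - j) st - q)\<^sup>2) j + Ex (\<lambda>st. (\<Sum>c\<in>pairsN. (Z ?m (clock_step st c) - Z ?m st)\<^sup>2) / card pairsN) j"
    by (intro Ex_add obs_add obs_divide obs_sum obs_power2 obs_diff obs_clock_Z obs_Z obs_const finite_nbr_pairs)
  also have "\<dots> \<le> (Ex (\<lambda>st. (Z K st - q)\<^sup>2) 0 + j * step_var K) + step_var K"
    using Suc Z_increment[of ?m K j] by (intro add_mono) auto
  finally show ?case by (simp add: algebra_simps)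
qed

text \<open>The exact mean of the flux after \<open>K\<close> rings. The product may stand in for
  the initial two-point function \<open>b0\<close> because the quadratic corrector vanishes on the
  diagonal.\<close>

definition mean_flux :: "nat \<Rightarrow> real" where
  "mean_flux K = (\<Sum>k<K. (\<Sum>x\<in>sitesN. \<phi> x * (S1.pow k u x - S2.pow k (\<lambda>p. u (fst p) * u (snd p)) (x, sh x)))) / card pairsN"

section \<open>Variance of the initial state\<close>

lemma Ex_dev: "obs H \<Longrightarrow> Ex (\<lambda>st. (H st - m)\<^sup>2) j = Ex (\<lambda>st. (H st)\<^sup>2) j - 2 * m * Ex H j + m\<^sup>2"
proof -
  assume H: "obs H"
  have "(\<lambda>st. (H st - m)\<^sup>2) = (\<lambda>st. ((H st)\<^sup>2 + (- 2 * m) * H st) + m\<^sup>2)"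
    by (simp add: power2_diff algebra_simps)
  then show ?thesis
    by (simp only: Ex_add obs_add obs_power2 obs_scale obs_const H Ex_scale Ex_const)
qed

lemma init_var_q1:
  "Ex (\<lambda>st. (q1 N g (fst st) - (\<Sum>x\<in>sitesN. g x * u x))\<^sup>2) 0 \<le> \<kappa> * (\<Sum>x\<in>sitesN. (g x)\<^sup>2)"
proof -
  let ?m = "\<Sum>x\<in>sitesN. g x * u x"
  have "Ex (\<lambda>st. (q1 N g (fst st))\<^sup>2) 0 = (\<Sum>p\<in>sitesN \<times> sitesN. g (fst p) * g (snd p) * b0 p)"
    unfolding power2_eq_square q1_mult Ex_q2_0 ..
  also have "\<dots> = (\<Sum>p\<in>sitesN \<times> sitesN. (g (fst p) * u (fst p)) * (g (snd p) * u (snd p)))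
     + (\<Sum>p\<in>sitesN \<times> sitesN. if snd p = fst p then (g (fst p))\<^sup>2 * (u (fst p) - (u (fst p))\<^sup>2) else 0)"
    unfolding sum.distrib[symmetric] by (intro sum.cong refl) (auto simp: b0_def power2_eq_square algebra_simps)
  also have "(\<Sum>p\<in>sitesN \<times> sitesN. (g (fst p) * u (fst p)) * (g (snd p) * u (snd p))) = ?m\<^sup>2"
    unfolding power2_eq_square sum_product sum.cartesian_product by (intro sum.cong refl) auto
  also have "(\<Sum>p\<in>sitesN \<times> sitesN. if snd p = fst p then (g (fst p))\<^sup>2 * (u (fst p) - (u (fst p))\<^sup>2) else 0)
     = (\<Sum>x\<in>sitesN. \<Sum>y\<in>sitesN. if y = x then (g x)\<^sup>2 * (u x - (u x)\<^sup>2) else 0)"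
    unfolding sum.cartesian_product by (intro sum.cong refl) auto
  also have "\<dots> = (\<Sum>x\<in>sitesN. (g x)\<^sup>2 * (u x - (u x)\<^sup>2))" by simp
  also have "\<dots> \<le> (\<Sum>x\<in>sitesN. (g x)\<^sup>2 * \<kappa>)"
  proof (intro sum_mono mult_left_mono)
    fix x assume "x \<in> sitesN"
    then show "u x - (u x)\<^sup>2 \<le> \<kappa>" using u_le[of x] zero_le_power2[of "u x"] by linarith
  qed simp
  finally have "Ex (\<lambda>st. (q1 N g (fst st))\<^sup>2) 0 \<le> ?m\<^sup>2 + \<kappa> * (\<Sum>x\<in>sitesN. (g x)\<^sup>2)"
    by (simp only: sum_distrib_left mult.commute[of \<kappa>])
  moreover have "2 * ?m * ?m = 2 * ?m\<^sup>2" by (simp add: power2_eq_square)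
  ultimately show ?thesis unfolding Ex_dev[OF obs_q1] Ex_q1_0 by linarith
qed

text \<open>Variance of a second order statistic of independent Bernoulli variables. Disjoint pairs
  are uncorrelated; one common site costs \<open>\<kappa> ^ 3\<close>, the same two sites cost
  \<open>\<kappa>\<^sup>2\<close>. For fixed \<open>p\<close> the remaining sum over
  \<open>p'\<close> runs over rows, columns or single entries, each at most
  \<open>S\<close>.\<close>

lemma init_var_q2:
  assumes f0: "\<And>p. p \<in> sitesN \<times> sitesN \<Longrightarrow> 0 \<le> f p" and fd: "\<And>x. x \<in> sitesN \<Longrightarrow> f (x, x) = 0"
    and row: "\<And>x. x \<in> sitesN \<Longrightarrow> (\<Sum>y\<in>sitesN. f (x, y)) \<le> S"
    and col: "\<And>y. y \<in> sitesN \<Longrightarrow> (\<Sum>x\<in>sitesN. f (x, y)) \<le> S"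
    and fS: "\<And>p. p \<in> sitesN \<times> sitesN \<Longrightarrow> f p \<le> S"
  shows "Ex (\<lambda>st. (q2 N f (fst st) - (\<Sum>p\<in>sitesN \<times> sitesN. f p * (u (fst p) * u (snd p))))\<^sup>2) 0
    \<le> (4 * \<kappa> ^ 3 + 2 * \<kappa>\<^sup>2) * S * (\<Sum>p\<in>sitesN \<times> sitesN. f p)"
proof -
  let ?X = "sitesN \<times> sitesN" let ?u = "\<lambda>p. u (fst p) * u (snd p)"
  let ?m = "\<Sum>p\<in>?X. f p * ?u p"
  \<comment> \<open>Collecting the sites in a set counts repeated sites once, so that the joint
    moment is a product over distinct sites.\<close>
  let ?A = "\<lambda>p p'. {fst p, snd p, fst p', snd p'}"
  let ?t = "\<lambda>p p'. Ex (\<lambda>st. of_bool (\<forall>x\<in>?A p p'. fst st x)) 0"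
  have o: "obs (\<lambda>st. of_bool (\<forall>x\<in>?A p p'. fst st x))" for p p' :: "'d site \<times> 'd site"
    using obs_mult[OF obs_occ2[of "fst p" "snd p"] obs_occ2[of "fst p'" "snd p'"]] by (simp add: of_bool_conj mult.assoc)
  have mean: "Ex (\<lambda>st. q2 N f (fst st)) 0 = ?m"
    unfolding Ex_q2_0 using fd by (intro sum.cong refl) (auto simp: b0_def)
  have "Ex (\<lambda>st. (q2 N f (fst st))\<^sup>2) 0 = Ex (\<lambda>st. \<Sum>p\<in>?X. \<Sum>p'\<in>?X. (f p * f p') * of_bool (\<forall>x\<in>?A p p'. fst st x)) 0"
    unfolding power2_eq_square q2_def sum_product
    by (intro arg_cong2[where f=Ex] refl ext sum.cong) (auto simp: of_bool_conj)
  also have "\<dots> = (\<Sum>p\<in>?X. \<Sum>p'\<in>?X. (f p * f p') * ?t p p')"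
    by (subst Ex_sum, intro obs_sum obs_scale o finite_SigmaI finite_sites, intro sum.cong refl,
        subst Ex_sum, intro obs_scale o, simp only: Ex_scale)
  finally have sq: "Ex (\<lambda>st. (q2 N f (fst st))\<^sup>2) 0 = (\<Sum>p\<in>?X. \<Sum>p'\<in>?X. (f p * f p') * ?t p p')" .
  have m2: "?m\<^sup>2 = (\<Sum>p\<in>?X. \<Sum>p'\<in>?X. (f p * f p') * (?u p * ?u p'))"
    unfolding power2_eq_square sum_product by (intro sum.cong refl) (simp add: mult_ac)
  let ?i = "\<lambda>b. of_bool b :: real"
  \<comment> \<open>Four ways to share a site, and two ways to be the same unordered pair.\<close>
  let ?e = "\<lambda>p p'. \<kappa> ^ 3 * (?i (fst p' = fst p) + ?i (fst p' = snd p) + ?i (snd p' = fst p) + ?i (snd p' = snd p))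
      + \<kappa>\<^sup>2 * (?i (p' = p) + ?i (p' = prod.swap p))"
  have tm: "(f p * f p') * (?t p p' - ?u p * ?u p') \<le> (f p * f p') * ?e p p'" if p: "p \<in> ?X" "p' \<in> ?X" for p p'
  proof (cases "fst p = snd p \<or> fst p' = snd p'")
    case True
    then have "f p = 0 \<or> f p' = 0" using fd p by (cases p; cases p') auto
    then show ?thesis by auto
  next
    case ne: False
    have A: "finite (?A p p')" "?A p p' \<subseteq> sitesN" using p by auto
    have u0: "0 \<le> ?u p * ?u p'" using u01 p by auto
    have le: "?t p p' \<le> \<kappa> ^ card (?A p p')" using A by (rule Ex_occ0_le)
    have k: "0 \<le> \<kappa> ^ 3" "0 \<le> \<kappa>\<^sup>2" using \<kappa>_nonneg by auto
    have "?t p p' - ?u p * ?u p' \<le> ?e p p'"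
    proof (cases "fst p' \<in> {fst p, snd p} \<or> snd p' \<in> {fst p, snd p}")
      case False
      then have "?t p p' = ?u p * ?u p'"
        using ne by (subst Ex_occ0[OF A]) (auto simp: mult.assoc)
      then show ?thesis using k by simp
    next
      case True
      show ?thesis
      proof (cases "p' = p \<or> p' = prod.swap p")
        case eq: True
        then have "card (?A p p') = 2" using ne by (auto simp: insert_commute)
        then have "?t p p' \<le> \<kappa>\<^sup>2" using le by simp
        moreover have "\<kappa>\<^sup>2 \<le> ?e p p'" using eq k by (auto intro!: add_increasing)
        ultimately show ?thesis using u0 by linarith
      next
        case nq: False
        have "card (?A p p') = 3" using True nq ne
          by (cases p; cases p') (auto simp: insert_commute card_insert_if)
        then have "?t p p' \<le> \<kappa> ^ 3" using le by simp
        moreover have "\<kappa> ^ 3 * 1 \<le> \<kappa> ^ 3 * (?i (fst p' = fst p) + ?i (fst p' = snd p) + ?i (snd p' = fst p) + ?i (snd p' = snd p))"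
          using True by (intro mult_left_mono k) auto
        moreover have "0 \<le> \<kappa>\<^sup>2 * (?i (p' = p) + ?i (p' = prod.swap p))" using k by auto
        ultimately show ?thesis using u0 by linarith
      qed
    qed
    then show ?thesis using f0 p by (intro mult_left_mono) auto
  qed
  have fib: "(\<Sum>p'\<in>?X. f p' * ?i (fst p' = z)) = (\<Sum>y\<in>sitesN. f (z, y))" if "z \<in> sitesN" for z
  proof -
    have "(\<Sum>p'\<in>?X. f p' * ?i (fst p' = z)) = (\<Sum>x\<in>sitesN. \<Sum>y\<in>sitesN. if x = z then f (x, y) else 0)"
      unfolding sum.cartesian_product by (intro sum.cong refl) auto
    also have "\<dots> = (\<Sum>x\<in>sitesN. if x = z then (\<Sum>y\<in>sitesN. f (x, y)) else 0)"
      by (intro sum.cong refl) auto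
    finally show ?thesis using that by simp
  qed
  have fib': "(\<Sum>p'\<in>?X. f p' * ?i (snd p' = z)) = (\<Sum>x\<in>sitesN. f (x, z))" if "z \<in> sitesN" for z
  proof -
    have "(\<Sum>p'\<in>?X. f p' * ?i (snd p' = z)) = (\<Sum>x\<in>sitesN. \<Sum>y\<in>sitesN. if y = z then f (x, y) else 0)"
      unfolding sum.cartesian_product by (intro sum.cong refl) auto
    then show ?thesis using that by simp
  qed
  have pt: "(\<Sum>p'\<in>?X. f p' * ?i (p' = p)) = f p" if "p \<in> ?X" for p
  proof -
    have "(\<Sum>p'\<in>?X. f p' * ?i (p' = p)) = (\<Sum>p'\<in>?X. if p' = p then f p' else 0)"
      by (intro sum.cong refl) auto
    then show ?thesis using that by simp
  qed
  have inner: "(\<Sum>p'\<in>?X. f p' * ?e p p') \<le> (4 * \<kappa> ^ 3 + 2 * \<kappa>\<^sup>2) * S" if p: "p \<in> ?X" for p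
  proof -
    have p12: "fst p \<in> sitesN" "snd p \<in> sitesN" "prod.swap p \<in> ?X" using p by auto
    have "(\<Sum>p'\<in>?X. f p' * ?e p p') = \<kappa> ^ 3 * ((\<Sum>y\<in>sitesN. f (fst p, y)) + (\<Sum>y\<in>sitesN. f (snd p, y))
       + (\<Sum>x\<in>sitesN. f (x, fst p)) + (\<Sum>x\<in>sitesN. f (x, snd p))) + \<kappa>\<^sup>2 * (f p + f (prod.swap p))"
      unfolding fib[OF p12(1), symmetric] fib[OF p12(2), symmetric] fib'[OF p12(1), symmetric] fib'[OF p12(2), symmetric]
        pt[OF p, symmetric] pt[OF p12(3), symmetric] sum_distrib_left sum.distrib[symmetric]
      by (intro sum.cong refl) (simp only: distrib_left mult_ac)
    also have "\<dots> \<le> \<kappa> ^ 3 * (S + S + S + S) + \<kappa>\<^sup>2 * (S + S)"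
      using \<kappa>_nonneg by (intro add_mono mult_left_mono row col fS p12 p) auto
    finally show ?thesis by (simp add: algebra_simps)
  qed
  have "Ex (\<lambda>st. (q2 N f (fst st) - ?m)\<^sup>2) 0 = (\<Sum>p\<in>?X. \<Sum>p'\<in>?X. (f p * f p') * ?t p p') - ?m\<^sup>2"
    unfolding Ex_dev[OF obs_q2] sq mean by (simp add: power2_eq_square)
  also have "\<dots> = (\<Sum>p\<in>?X. \<Sum>p'\<in>?X. (f p * f p') * (?t p p' - ?u p * ?u p'))"
    unfolding m2 by (simp only: right_diff_distrib sum_subtractf)
  also have "\<dots> \<le> (\<Sum>p\<in>?X. \<Sum>p'\<in>?X. (f p * f p') * ?e p p')"
    by (intro sum_mono tm)
  also have "\<dots> = (\<Sum>p\<in>?X. f p * (\<Sum>p'\<in>?X. f p' * ?e p p'))"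
    by (simp only: sum_distrib_left mult.assoc)
  also have "\<dots> \<le> (\<Sum>p\<in>?X. f p * ((4 * \<kappa> ^ 3 + 2 * \<kappa>\<^sup>2) * S))"
    using f0 by (intro sum_mono mult_left_mono inner)
  also have "\<dots> = (\<Sum>p\<in>?X. f p) * ((4 * \<kappa> ^ 3 + 2 * \<kappa>\<^sup>2) * S)"
    by (rule sum_distrib_right[symmetric])
  finally show ?thesis by (simp only: mult.commute)
qed

text \<open>A swap permutes the second coordinate, so summing it out forgets it; the first
  coordinate alone performs the one-site walk.\<close>

lemma pow_row:
  assumes "x \<in> sitesN"
  shows "(\<Sum>y\<in>sitesN. S2.pow k f (x, y)) = S1.pow k (\<lambda>x. \<Sum>y\<in>sitesN. f (x, y)) x"
  using assms
proof (induction k arbitrary: x)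
  case (Suc k)
  have "(\<Sum>y\<in>sitesN. S2.pow (Suc k) f (x, y)) = ((\<Sum>y\<in>sitesN. S2.pow k f (x, y)) + (\<Sum>c\<in>pairsN. \<Sum>y\<in>sitesN. S2.pow k f (swp c x, swp c y)) / card pairsN) / 2"
    unfolding funpow.simps o_apply S2.avg_def swp2_def fst_conv snd_conv
      sum_divide_distrib[symmetric] sum.distrib by (subst sum.swap) (rule refl)
  also have "(\<Sum>c\<in>pairsN. \<Sum>y\<in>sitesN. S2.pow k f (swp c x, swp c y)) = (\<Sum>c\<in>pairsN. \<Sum>y\<in>sitesN. S2.pow k f (swp c x, y))"
    by (intro sum.cong refl S1.sum_\<sigma>)
  also have "\<dots> = (\<Sum>c\<in>pairsN. S1.pow k (\<lambda>x. \<Sum>y\<in>sitesN. f (x, y)) (swp c x))"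
    using Suc.prems by (intro sum.cong refl Suc.IH S1.closed)
  finally show ?case unfolding Suc.IH[OF Suc.prems] unfolding funpow.simps o_apply S1.avg_def[of "S1.pow k _"] .
qed simp

lemma pow_col:
  assumes "y \<in> sitesN"
  shows "(\<Sum>x\<in>sitesN. S2.pow k f (x, y)) = S1.pow k (\<lambda>y. \<Sum>x\<in>sitesN. f (x, y)) y"
  using assms
proof (induction k arbitrary: y)
  case (Suc k)
  have "(\<Sum>x\<in>sitesN. S2.pow (Suc k) f (x, y)) = ((\<Sum>x\<in>sitesN. S2.pow k f (x, y)) + (\<Sum>c\<in>pairsN. \<Sum>x\<in>sitesN. S2.pow k f (swp c x, swp c y)) / card pairsN) / 2"
    unfolding funpow.simps o_apply S2.avg_def swp2_def fst_conv snd_conv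
      sum_divide_distrib[symmetric] sum.distrib by (subst sum.swap) (rule refl)
  also have "(\<Sum>c\<in>pairsN. \<Sum>x\<in>sitesN. S2.pow k f (swp c x, swp c y)) = (\<Sum>c\<in>pairsN. \<Sum>x\<in>sitesN. S2.pow k f (x, swp c y))"
  proof (rule sum.cong[OF refl])
    fix c assume "c \<in> pairsN"
    from S1.sum_\<sigma>[OF this, of "\<lambda>x. S2.pow k f (x, swp c y)"]
    show "(\<Sum>x\<in>sitesN. S2.pow k f (swp c x, swp c y)) = (\<Sum>x\<in>sitesN. S2.pow k f (x, swp c y))" .
  qed
  also have "\<dots> = (\<Sum>c\<in>pairsN. S1.pow k (\<lambda>y. \<Sum>x\<in>sitesN. f (x, y)) (swp c y))"
    using Suc.prems by (intro sum.cong refl Suc.IH S1.closed)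
  finally show ?case unfolding Suc.IH[OF Suc.prems] unfolding funpow.simps o_apply S1.avg_def[of "S1.pow k _"] .
qed simp

text \<open>Swaps map the diagonal into itself, so the values there evolve without influence from
  other pairs.\<close>

lemma pow_diag:
  assumes "\<And>x. x \<in> sitesN \<Longrightarrow> f (x, x) = 0" "x \<in> sitesN"
  shows "S2.pow k f (x, x) = 0"
  using assms(2)
proof (induction k arbitrary: x)
  case (Suc k)
  have "S2.pow k f (swp2 c (x, x)) = 0" if "c \<in> pairsN" for c
  proof -
    have "swp2 c (x, x) = (swp c x, swp c x)" by (simp add: swp2_def)
    then show ?thesis using Suc.IH[OF S1.closed[OF that Suc.prems]] by metis
  qed
  then have "(\<Sum>c\<in>pairsN. S2.pow k f (swp2 c (x, x))) = 0" by (rule sum.neutral[rule_format])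
  then show ?case unfolding funpow.simps o_apply S2.avg_def[of "S2.pow k f"] using Suc.IH[OF Suc.prems] by simp
qed (use assms in simp)

lemma V_row: "x \<in> sitesN \<Longrightarrow> (\<Sum>y\<in>sitesN. V (x, y)) \<le> B"
proof -
  assume x: "x \<in> sitesN"
  have "(\<Sum>y\<in>sitesN. V (x, y)) = (\<Sum>y\<in>sitesN. if y = sh x then \<phi> x else 0)"
    by (intro sum.cong refl) (auto simp: V_def V1_def)
  also have "\<dots> = \<phi> x" using x by (simp add: shift_sites[OF N1])
  finally show ?thesis using \<phi>[OF x] by simp
qed

lemma V_col: "y \<in> sitesN \<Longrightarrow> (\<Sum>x\<in>sitesN. V (x, y)) \<le> B"
proof -
  assume y: "y \<in> sitesN"
  let ?z = "shift N l (\<not> s) y"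
  have z: "?z \<in> sitesN" using y by (rule shift_sites[OF N1])
  have "(\<Sum>x\<in>sitesN. V (x, y)) = (\<Sum>x\<in>sitesN. if x = ?z then \<phi> x else 0)"
  proof (intro sum.cong refl)
    fix x assume "x \<in> sitesN"
    then show "V (x, y) = (if x = ?z then \<phi> x else 0)"
      using shift_iff[OF N1 y, of x l s] by (auto simp: V_def V1_def)
  qed
  also have "\<dots> = \<phi> ?z" using z by simp
  finally show ?thesis using \<phi>[OF z] by simp
qed

text \<open>Row and column sums of the pair flow are one-site flows of those of \<open>V\<close>,
  hence stay below \<open>B\<close>; the \<open>K\<close> terms of the Green sum give the bound. A
  single entry is at most its row sum because entries are nonnegative.\<close>

lemma F_props:
  defines "S \<equiv> \<lambda>K. K * B / card pairsN"
  shows "p \<in> sitesN \<times> sitesN \<Longrightarrow> 0 \<le> F K p" "x \<in> sitesN \<Longrightarrow> F K (x, x) = 0"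
    "x \<in> sitesN \<Longrightarrow> (\<Sum>y\<in>sitesN. F K (x, y)) \<le> S K"
    "x \<in> sitesN \<Longrightarrow> (\<Sum>y\<in>sitesN. F K (y, x)) \<le> S K"
    "p \<in> sitesN \<times> sitesN \<Longrightarrow> F K p \<le> S K"
proof -
  have nn: "0 \<le> F K p" if "p \<in> sitesN \<times> sitesN" for p
    unfolding F_def S2.green_def using that by (intro mult_nonneg_nonneg sum_nonneg S2.pow_ge V_nonneg) auto
  have S: "(1 / card pairsN) * (\<Sum>k<K. B) = S K" by (simp add: S_def)
  have row: "(\<Sum>y\<in>sitesN. F K (x, y)) \<le> S K" if x: "x \<in> sitesN" for x
  proof -
    have "(\<Sum>y\<in>sitesN. F K (x, y)) = (1 / card pairsN) * (\<Sum>k<K. \<Sum>y\<in>sitesN. S2.pow k V (x, y))"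
      unfolding F_def S2.green_def sum_distrib_left[symmetric] by (subst sum.swap) (rule refl)
    also have "\<dots> \<le> (1 / card pairsN) * (\<Sum>k<K. B)"
      unfolding pow_row[OF x] by (intro mult_left_mono sum_mono S1.pow_le V_row x) auto
    finally show ?thesis unfolding S .
  qed
  have col: "(\<Sum>y\<in>sitesN. F K (y, x)) \<le> S K" if x: "x \<in> sitesN" for x
  proof -
    have "(\<Sum>y\<in>sitesN. F K (y, x)) = (1 / card pairsN) * (\<Sum>k<K. \<Sum>y\<in>sitesN. S2.pow k V (y, x))"
      unfolding F_def S2.green_def sum_distrib_left[symmetric] by (subst sum.swap) (rule refl)
    also have "\<dots> \<le> (1 / card pairsN) * (\<Sum>k<K. B)"
      unfolding pow_col[OF x] by (intro mult_left_mono sum_mono S1.pow_le V_col x) auto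
    finally show ?thesis unfolding S .
  qed
  show "p \<in> sitesN \<times> sitesN \<Longrightarrow> 0 \<le> F K p" by (rule nn)
  show "x \<in> sitesN \<Longrightarrow> (\<Sum>y\<in>sitesN. F K (x, y)) \<le> S K" by (rule row)
  show "x \<in> sitesN \<Longrightarrow> (\<Sum>y\<in>sitesN. F K (y, x)) \<le> S K" by (rule col)
  have "V (x, x) = 0" for x using shift_neq[of N l s x] N3 by (auto simp: V_def V1_def)
  then show "x \<in> sitesN \<Longrightarrow> F K (x, x) = 0"
    unfolding F_def S2.green_def using pow_diag[of V x] by simp
  show "F K p \<le> S K" if p: "p \<in> sitesN \<times> sitesN"
  proof -
    have "F K p \<le> (\<Sum>y\<in>sitesN. F K (fst p, y))"
      using p nn member_le_sum[of "snd p" sitesN "\<lambda>y. F K (fst p, y)"] by auto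
    also have "\<dots> \<le> S K" using p by (intro row) auto
    finally show ?thesis .
  qed
qed

lemma init_variance:
  "Ex (\<lambda>st. (Z K st - mean_flux K)\<^sup>2) 0 \<le> 2 * real N ^ CARD('d) * (K * B / card pairsN)\<^sup>2 * (\<kappa> + 4 * \<kappa> ^ 3 + 2 * \<kappa>\<^sup>2)"
proof -
  let ?S = "K * B / card pairsN"
  let ?a = "\<Sum>x\<in>sitesN. G K x * u x" let ?b = "\<Sum>p\<in>sitesN \<times> sitesN. F K p * (u (fst p) * u (snd p))"
  have C: "real (card pairsN) > 0" by (rule S1.cardC)
  have a: "?a = (\<Sum>k<K. \<Sum>x\<in>sitesN. \<phi> x * S1.pow k u x) / card pairsN"
  proof -
    have "?a = (\<Sum>x\<in>sitesN. \<Sum>k<K. S1.pow k \<phi> x * u x) / card pairsN"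
      by (simp add: G_def S1.green_def sum_distrib_right sum_divide_distrib)
    also have "(\<Sum>x\<in>sitesN. \<Sum>k<K. S1.pow k \<phi> x * u x) = (\<Sum>k<K. \<Sum>x\<in>sitesN. \<phi> x * S1.pow k u x)"
      by (subst sum.swap) (intro sum.cong refl S1.pow_adjoint)
    finally show ?thesis .
  qed
  have b: "?b = (\<Sum>k<K. \<Sum>x\<in>sitesN. \<phi> x * S2.pow k (\<lambda>p. u (fst p) * u (snd p)) (x, sh x)) / card pairsN"
  proof -
    have "?b = (\<Sum>p\<in>sitesN \<times> sitesN. \<Sum>k<K. S2.pow k V p * (u (fst p) * u (snd p))) / card pairsN"
      by (simp add: F_def S2.green_def sum_distrib_right sum_divide_distrib)
    also have "(\<Sum>p\<in>sitesN \<times> sitesN. \<Sum>k<K. S2.pow k V p * (u (fst p) * u (snd p))) =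
      (\<Sum>k<K. \<Sum>p\<in>sitesN \<times> sitesN. V p * S2.pow k (\<lambda>p. u (fst p) * u (snd p)) p)"
      by (subst sum.swap) (intro sum.cong refl S2.pow_adjoint)
    also have "\<dots> = (\<Sum>k<K. \<Sum>x\<in>sitesN. \<phi> x * S2.pow k (\<lambda>p. u (fst p) * u (snd p)) (x, sh x))"
    proof (intro sum.cong refl)
      fix k
      have "(\<Sum>p\<in>sitesN \<times> sitesN. V p * S2.pow k (\<lambda>p. u (fst p) * u (snd p)) p)
        = (\<Sum>p\<in>sitesN \<times> sitesN. (\<phi> (fst p) * S2.pow k (\<lambda>p. u (fst p) * u (snd p)) p) * V1 p)"
        by (intro sum.cong refl) (simp add: V_def)
      then show "(\<Sum>p\<in>sitesN \<times> sitesN. V p * S2.pow k (\<lambda>p. u (fst p) * u (snd p)) p) = (\<Sum>x\<in>sitesN. \<phi> x * S2.pow k (\<lambda>p. u (fst p) * u (snd p)) (x, sh x))"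
        unfolding sum_V1 by simp
    qed
    finally show ?thesis .
  qed
  have mean: "mean_flux K = ?a - ?b"
    unfolding a b mean_flux_def by (simp add: right_diff_distrib sum_subtractf diff_divide_distrib)
  have GS: "\<bar>G K x\<bar> \<le> ?S" if x: "x \<in> sitesN" for x
  proof -
    have "0 \<le> G K x" unfolding G_def S1.green_def using \<phi> x by (intro mult_nonneg_nonneg sum_nonneg S1.pow_ge) auto
    moreover have "G K x \<le> (1 / card pairsN) * (\<Sum>k<K. B)"
      unfolding G_def S1.green_def using \<phi> x by (intro mult_left_mono sum_mono S1.pow_le) auto
    ultimately show ?thesis by simp
  qed
  have S0: "0 \<le> ?S" using B_nonneg by simp
  have k0: "0 \<le> 4 * \<kappa> ^ 3 + 2 * \<kappa>\<^sup>2" using \<kappa>_nonneg by simp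
  have G2: "(\<Sum>x\<in>sitesN. (G K x)\<^sup>2) \<le> N ^ CARD('d) * ?S\<^sup>2"
  proof -
    have "(\<Sum>x\<in>sitesN. (G K x)\<^sup>2) \<le> (\<Sum>x\<in>sitesN. ?S\<^sup>2)"
      by (intro sum_mono) (metis GS abs_ge_zero power2_abs power_mono)
    then show ?thesis by (simp add: card_sites)
  qed
  have F1: "(\<Sum>p\<in>sitesN \<times> sitesN. F K p) \<le> N ^ CARD('d) * ?S"
  proof -
    have "(\<Sum>p\<in>sitesN \<times> sitesN. F K p) = (\<Sum>x\<in>sitesN. \<Sum>y\<in>sitesN. F K (x, y))"
      by (simp add: sum.cartesian_product)
    also have "\<dots> \<le> (\<Sum>x\<in>sitesN. ?S)" by (intro sum_mono F_props)
    finally show ?thesis by (simp add: card_sites)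
  qed
  \<comment> \<open>Counts start at zero, so at step 0 only the two correctors are random.\<close>
  have "Ex (\<lambda>st. (Z K st - mean_flux K)\<^sup>2) 0 = Ex (\<lambda>st. ((q1 N (G K) (fst st) - ?a) - (q2 N (F K) (fst st) - ?b))\<^sup>2) 0"
    unfolding Ex_def Z_def flux_def mean
    by (intro Bochner_Integration.integral_cong refl arg_cong[of _ _ "\<lambda>x. x\<^sup>2"]) simp
  also have "\<dots> \<le> Ex (\<lambda>st. 2 * (q1 N (G K) (fst st) - ?a)\<^sup>2 + 2 * (q2 N (F K) (fst st) - ?b)\<^sup>2) 0"
    by (intro Ex_mono obs_add obs_scale obs_power2 obs_diff obs_q1 obs_q2 obs_const square_sum2)
  also have "\<dots> = 2 * Ex (\<lambda>st. (q1 N (G K) (fst st) - ?a)\<^sup>2) 0 + 2 * Ex (\<lambda>st. (q2 N (F K) (fst st) - ?b)\<^sup>2) 0"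
    by (subst Ex_add) (intro obs_scale obs_power2 obs_diff obs_q1 obs_q2 obs_const, intro obs_scale obs_power2 obs_diff obs_q1 obs_q2 obs_const, simp only: Ex_scale)
  also have "\<dots> \<le> 2 * (\<kappa> * (N ^ CARD('d) * ?S\<^sup>2)) + 2 * ((4 * \<kappa> ^ 3 + 2 * \<kappa>\<^sup>2) * ?S * (N ^ CARD('d) * ?S))"
  proof (intro add_mono mult_left_mono)
    show "Ex (\<lambda>st. (q1 N (G K) (fst st) - ?a)\<^sup>2) 0 \<le> \<kappa> * (N ^ CARD('d) * ?S\<^sup>2)"
      by (rule order_trans[OF init_var_q1 mult_left_mono[OF G2 \<kappa>_nonneg]])
    have "Ex (\<lambda>st. (q2 N (F K) (fst st) - ?b)\<^sup>2) 0 \<le> (4 * \<kappa> ^ 3 + 2 * \<kappa>\<^sup>2) * ?S * (\<Sum>p\<in>sitesN \<times> sitesN. F K p)"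
      by (rule init_var_q2) (intro F_props; assumption)+
    also have "\<dots> \<le> (4 * \<kappa> ^ 3 + 2 * \<kappa>\<^sup>2) * ?S * (N ^ CARD('d) * ?S)"
      by (rule mult_left_mono[OF F1]) (intro mult_nonneg_nonneg k0 S0)
    finally show "Ex (\<lambda>st. (q2 N (F K) (fst st) - ?b)\<^sup>2) 0 \<le> (4 * \<kappa> ^ 3 + 2 * \<kappa>\<^sup>2) * ?S * (N ^ CARD('d) * ?S)" .
  qed auto
  also have "\<dots> = 2 * real N ^ CARD('d) * ?S\<^sup>2 * (\<kappa> + 4 * \<kappa> ^ 3 + 2 * \<kappa>\<^sup>2)"
  proof -
    have "2 * (k * (w * t\<^sup>2)) + 2 * ((4 * k ^ 3 + 2 * k\<^sup>2) * t * (w * t)) = 2 * w * t\<^sup>2 * (k + 4 * k ^ 3 + 2 * k\<^sup>2)" for k w t :: real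
      by (simp add: algebra_simps power2_eq_square)
    then show ?thesis by (simp only: of_nat_power)
  qed
  finally show ?thesis .
qed

text \<open>With no rings left both correctors vanish and \<open>Z 0\<close> is the flux itself; the
  total is the initial variance plus \<open>K\<close> increments.\<close>

theorem flux_variance:
  "Ex (\<lambda>st. (flux st - mean_flux K)\<^sup>2) K \<le>
    2 * real N ^ CARD('d) * (K * B / card pairsN)\<^sup>2 * (\<kappa> + 4 * \<kappa> ^ 3 + 2 * \<kappa>\<^sup>2) + K * step_var K"
proof -
  have "Z 0 = flux"
    by (rule ext) (simp add: Z_def G_def[abs_def] F_def[abs_def] S1.green_def S2.green_def q1_def q2_def)
  then have "Ex (\<lambda>st. (flux st - mean_flux K)\<^sup>2) K \<le> Ex (\<lambda>st. (Z K st - mean_flux K)\<^sup>2) 0 + K * step_var K"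
    using Z_variance[of K K "mean_flux K"] by simp
  also note init_variance[of K]
  finally show ?thesis by simp
qed

end

section \<open>Products of one-particle evolutions\<close>

context torus
begin

definition adj :: "'d \<Rightarrow> bool \<Rightarrow> 'd site \<times> 'd site \<Rightarrow> real" where
  "adj l s p = of_bool (snd p = shift N l s (fst p))"

lemma adj_sums:
  "(\<Sum>p\<in>sitesN \<times> sitesN. adj l s p) = real N ^ CARD('d)" "(\<Sum>p\<in>sitesN \<times> sitesN. (adj l s p)\<^sup>2) = real N ^ CARD('d)"
proof -
  have "(\<Sum>p\<in>sitesN \<times> sitesN. adj l s p) = (\<Sum>x\<in>sitesN. \<Sum>y\<in>sitesN. if y = shift N l s x then 1 else 0)"
    unfolding sum.cartesian_product by (intro sum.cong refl) (auto simp: adj_def)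
  also have "\<dots> = (\<Sum>x\<in>sitesN. 1)"
    by (intro sum.cong refl) (simp add: shift_sites[OF N1])
  finally show "(\<Sum>p\<in>sitesN \<times> sitesN. adj l s p) = real N ^ CARD('d)" by (simp add: card_sites)
  moreover have "(adj l s p)\<^sup>2 = adj l s p" for p by (simp add: adj_def)
  ultimately show "(\<Sum>p\<in>sitesN \<times> sitesN. (adj l s p)\<^sup>2) = real N ^ CARD('d)" by simp
qed

text \<open>The right side of \<open>return_estimate\<close> with \<open>A\<close> equal to the
  number of sites, and this number factored out.\<close>

definition ret_bound :: "nat \<Rightarrow> nat \<Rightarrow> real" where
  "ret_bound M K = real N ^ CARD('d) * (K / M + 2 * sqrt (K * M * card pairsN))"

lemma adj_return:
  assumes "1 \<le> M" "M < N"
  shows "(\<Sum>k<K. \<Sum>x\<in>sitesN. S2.pow k (adj l' s') (x, shift N l s x)) \<le> ret_bound M K"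
proof -
  have "(\<Sum>k<K. \<Sum>x\<in>sitesN. S2.pow k (adj l' s') (x, shift N l s x))
     \<le> K * real N ^ CARD('d) / M + sqrt (K * real N ^ CARD('d) * M) * sqrt (4 * card pairsN * real N ^ CARD('d))"
    using assms by (intro return_estimate) (auto simp: adj_sums, simp add: adj_def)
  also have "sqrt (K * real N ^ CARD('d) * M) * sqrt (4 * card pairsN * real N ^ CARD('d)) = real N ^ CARD('d) * (2 * sqrt (K * M * card pairsN))"
  proof -
    have "sqrt (k * w * m) * sqrt (4 * c * w) = w * (2 * sqrt (k * m * c))" if "w \<ge> 0" for k w m c :: real
    proof -
      have "sqrt (k * w * m) * sqrt (4 * c * w) = sqrt (4 * w\<^sup>2 * (k * m * c))"
        by (simp add: real_sqrt_mult[symmetric] power2_eq_square mult_ac)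
      also have "\<dots> = 2 * w * sqrt (k * m * c)"
        using that by (simp add: real_sqrt_mult)
      finally show ?thesis by simp
    qed
    then show ?thesis by simp
  qed
  finally show ?thesis by (simp add: ret_bound_def distrib_left mult_ac)
qed

text \<open>The product of two independent one-particle evolutions solves the two-particle equation up to
  a source supported on adjacent pairs, up to a second order time discretization error and up to
  the irrelevant diagonal.\<close>
lemma product_source:
  fixes w :: "'d site \<Rightarrow> real"
  assumes grad: "\<And>x l s. x \<in> sitesN \<Longrightarrow> \<bar>w (shift N l s x) - w x\<bar> \<le> \<delta>"
    and lap: "\<And>x. x \<in> sitesN \<Longrightarrow> \<bar>S1.avg w x - w x\<bar> \<le> e"
    and p: "p \<in> sitesN \<times> sitesN" "fst p \<noteq> snd p"
  shows "\<bar>S2.avg (\<lambda>p. w (fst p) * w (snd p)) p - S1.avg w (fst p) * S1.avg w (snd p)\<bar>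
    \<le> \<delta>\<^sup>2 / card pairsN * (\<Sum>l\<in>UNIV. \<Sum>s\<in>UNIV. adj l s p) + e\<^sup>2"
proof -
  obtain x y where xy: "p = (x, y)" by (cases p)
  have x: "x \<in> sitesN" "y \<in> sitesN" "x \<noteq> y" using p xy by auto
  let ?C = "real (card pairsN)"
  have C: "?C > 0" by (rule S1.cardC)
  define a where "a z = (\<Sum>c\<in>pairsN. w (swp c z) - w z) / ?C" for z
  have avg1: "S1.avg w z = w z + a z / 2" for z
    using S1.neC by (simp add: S1.avg_def a_def sum_subtractf diff_divide_distrib add_divide_distrib)
  have a_le: "\<bar>a z\<bar> \<le> 2 * e" if "z \<in> sitesN" for z
    using lap[OF that] by (simp add: avg1)
  \<comment> \<open>\<open>D\<close> collects the bonds that move both sites at once. Without it the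
    averages would multiply up to a term quadratic in the time increments, namely
    \<open>a x * a y / 4\<close>.\<close>
  define D where "D = (\<Sum>c\<in>pairsN. (w (swp c x) - w x) * (w (swp c y) - w y)) / ?C"
  have "S2.avg (\<lambda>p. w (fst p) * w (snd p)) p = w x * w y + (w x * a y + w y * a x + D) / 2"
  proof -
    have "(\<Sum>c\<in>pairsN. w (swp c x) * w (swp c y)) = (\<Sum>c\<in>pairsN. w x * w y + w x * (w (swp c y) - w y) + w y * (w (swp c x) - w x)
        + (w (swp c x) - w x) * (w (swp c y) - w y))"
      by (intro sum.cong refl) (simp add: algebra_simps)
    also have "\<dots> = ?C * (w x * w y) + w x * (?C * a y) + w y * (?C * a x) + ?C * D"
      using S1.neC by (simp add: sum.distrib sum_distrib_left[symmetric] a_def D_def)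
    finally have "(\<Sum>c\<in>pairsN. w (swp c x) * w (swp c y)) / ?C = w x * w y + w x * a y + w y * a x + D"
      using S1.neC by (simp add: add_divide_distrib)
    then show ?thesis by (simp add: S2.avg_def swp2_def xy)
  qed
  then have eq: "S2.avg (\<lambda>p. w (fst p) * w (snd p)) p - S1.avg w (fst p) * S1.avg w (snd p) = D / 2 - a x * a y / 4"
    by (simp add: avg1 xy algebra_simps)
  have e0: "0 \<le> e" using a_le[OF x(1)] by linarith
  have e: "\<bar>a x * a y / 4\<bar> \<le> e\<^sup>2"
  proof -
    have "\<bar>a x * a y\<bar> \<le> (2 * e) * (2 * e)"
      unfolding abs_mult using a_le x e0 by (intro mult_mono) auto
    then show ?thesis by (simp add: power2_eq_square)
  qed
  have d0: "0 \<le> \<delta>" using grad[OF x(1)] by (rule order_trans[OF abs_ge_zero])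
  have "\<bar>D\<bar> \<le> (\<Sum>c\<in>pairsN. \<bar>(w (swp c x) - w x) * (w (swp c y) - w y)\<bar>) / ?C"
    unfolding D_def abs_divide by (simp add: divide_right_mono sum_abs)
  also have "\<dots> \<le> (\<Sum>c\<in>pairsN. \<delta>\<^sup>2 * (of_bool (c = (x, y)) + of_bool (c = (y, x)))) / ?C"
  proof (intro divide_right_mono sum_mono)
    fix c assume c: "c \<in> pairsN"
    obtain b1 b2 where b: "c = (b1, b2)" by (cases c)
    have nb: "\<bar>w b2 - w b1\<bar> \<le> \<delta>"
      using c grad unfolding b by (auto simp: nbr_pairs_def)
    have nb': "\<bar>w b1 - w b2\<bar> \<le> \<delta>" using nb by (simp add: abs_minus_commute)
    have sq: "\<bar>w b2 - w b1\<bar> * \<bar>w b1 - w b2\<bar> \<le> \<delta>\<^sup>2" "\<bar>w b1 - w b2\<bar> * \<bar>w b2 - w b1\<bar> \<le> \<delta>\<^sup>2"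
      unfolding power2_eq_square by (intro mult_mono nb nb' d0 abs_ge_zero)+
    consider "x = b1" "y = b2" | "x = b2" "y = b1" | "x \<notin> {b1, b2} \<or> y \<notin> {b1, b2}" using x(3) by blast
    then show "\<bar>(w (swp c x) - w x) * (w (swp c y) - w y)\<bar> \<le> \<delta>\<^sup>2 * (of_bool (c = (x, y)) + of_bool (c = (y, x)))"
    proof cases
      case 1
      then show ?thesis using x(3) sq by (simp add: b swp_def abs_mult)
    next
      case 2
      then show ?thesis using x(3) sq by (simp add: b swp_def abs_mult)
    next
      case 3
      then have "swp c x = x \<or> swp c y = y" by (auto simp: b swp_def Transposition.transpose_def)
      then have z: "(w (swp c x) - w x) * (w (swp c y) - w y) = 0" by auto
      show ?thesis unfolding z abs_zero by (intro mult_nonneg_nonneg add_nonneg_nonneg zero_le_power2 zero_less_eq_of_bool)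
    qed
  qed simp
  also have "(\<Sum>c\<in>pairsN. \<delta>\<^sup>2 * (of_bool (c = (x, y)) + of_bool (c = (y, x)))) =
      \<delta>\<^sup>2 * (of_bool ((x, y) \<in> pairsN) + of_bool ((y, x) \<in> pairsN))"
  proof -
    have "(\<Sum>c\<in>pairsN. of_bool (c = z)) = (of_bool (z \<in> pairsN) :: real)" for z
      by (subst sum.cong[where B=pairsN and h="\<lambda>c. if c = z then 1 else 0"]) auto
    then show ?thesis by (simp only: sum_distrib_left[symmetric] sum.distrib)
  qed
  also have "\<delta>\<^sup>2 * (of_bool ((x, y) \<in> pairsN) + of_bool ((y, x) \<in> pairsN)) / ?C
      \<le> \<delta>\<^sup>2 * (2 * (\<Sum>l\<in>UNIV. \<Sum>s\<in>UNIV. adj l s p)) / ?C"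
  proof (intro divide_right_mono mult_left_mono)
    have iff: "(y, x) \<in> pairsN \<longleftrightarrow> (x, y) \<in> pairsN" using nbr_pairs_sym[OF N1] by blast
    show "of_bool ((x, y) \<in> pairsN) + of_bool ((y, x) \<in> pairsN) \<le> 2 * (\<Sum>l\<in>UNIV. \<Sum>s\<in>UNIV. adj l s p)"
    proof (cases "(x, y) \<in> pairsN")
      case True
      then obtain l s where "y = shift N l s x" by (auto simp: nbr_pairs_def)
      then have "1 = adj l s p" by (simp add: adj_def xy)
      also have "\<dots> \<le> (\<Sum>s\<in>UNIV. adj l s p)" by (intro member_le_sum) (auto simp: adj_def)
      also have "\<dots> \<le> (\<Sum>l\<in>UNIV. \<Sum>s\<in>UNIV. adj l s p)"
        by (intro member_le_sum[of l UNIV "\<lambda>l. \<Sum>s\<in>UNIV. adj l s p"]) (auto simp: adj_def intro!: sum_nonneg)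
      finally show ?thesis using True iff by simp
    next
      case False
      then show ?thesis using iff by (auto simp: adj_def intro!: sum_nonneg mult_nonneg_nonneg)
    qed
  qed simp_all
  finally have "\<bar>D\<bar> \<le> \<delta>\<^sup>2 * (2 * (\<Sum>l\<in>UNIV. \<Sum>s\<in>UNIV. adj l s p)) / ?C" .
  moreover have "a * (2 * b) / c = 2 * (a / c * b)" for a b c :: real by simp
  ultimately have "\<bar>D\<bar> \<le> 2 * (\<delta>\<^sup>2 / ?C * (\<Sum>l\<in>UNIV. \<Sum>s\<in>UNIV. adj l s p))" by (simp only:)
  moreover have "\<bar>d / 2 - f\<bar> \<le> a + g" if "\<bar>d\<bar> \<le> 2 * a" "\<bar>f\<bar> \<le> g" for d f a g :: real
    using that by linarith
  ultimately show ?thesis unfolding eq using e by blast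
qed

lemma offdiag_closed:
  assumes "c \<in> pairsN" "fst p \<noteq> snd p" shows "fst (swp2 c p) \<noteq> snd (swp2 c p)"
proof
  assume "fst (swp2 c p) = snd (swp2 c p)"
  then have "swp c (swp c (fst p)) = swp c (swp c (snd p))" by (simp add: swp2_def)
  then show False using assms(2) unfolding S1.invol[OF assms(1)] by simp
qed

text \<open>A pair off the diagonal stays off it, so comparisons are required only there. This fits
  \<open>product_source\<close>, which says nothing about the diagonal.\<close>

lemma pow_mono_offdiag:
  assumes "\<And>q. q \<in> sitesN \<times> sitesN \<Longrightarrow> fst q \<noteq> snd q \<Longrightarrow> f q \<le> g q"
    and p: "p \<in> sitesN \<times> sitesN" "fst p \<noteq> snd p"
  shows "S2.pow k f p \<le> S2.pow k g p"
  using p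
proof (induction k arbitrary: p)
  case (Suc k)
  have "(\<Sum>c\<in>pairsN. S2.pow k f (swp2 c p)) \<le> (\<Sum>c\<in>pairsN. S2.pow k g (swp2 c p))"
    using Suc.prems by (intro sum_mono Suc.IH S2.closed offdiag_closed)
  then have "(\<Sum>c\<in>pairsN. S2.pow k f (swp2 c p)) / card pairsN \<le> (\<Sum>c\<in>pairsN. S2.pow k g (swp2 c p)) / card pairsN"
    by (rule divide_right_mono) simp
  then show ?case unfolding funpow.simps o_apply S2.avg_def[of "S2.pow k f"] S2.avg_def[of "S2.pow k g"]
    by (intro divide_right_mono[where c=2] add_mono Suc.IH Suc.prems) auto
qed (use assms(1) in simp)

text \<open>Duhamel's principle: the defect created at each step is transported by the pair walk.
  Its main part sits on adjacent pairs, so its later value at an adjacent pair counts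
  returns.\<close>

lemma product_error:
  fixes w :: "'d site \<Rightarrow> real"
  assumes grad: "\<And>k x l s. x \<in> sitesN \<Longrightarrow> \<bar>S1.pow k w (shift N l s x) - S1.pow k w x\<bar> \<le> \<delta>"
    and lap: "\<And>k x. x \<in> sitesN \<Longrightarrow> \<bar>S1.pow (Suc k) w x - S1.pow k w x\<bar> \<le> e"
    and p: "p \<in> sitesN \<times> sitesN" "fst p \<noteq> snd p"
  shows "\<bar>S2.pow k (\<lambda>p. w (fst p) * w (snd p)) p - S1.pow k w (fst p) * S1.pow k w (snd p)\<bar>
    \<le> (\<Sum>i<k. \<delta>\<^sup>2 / card pairsN * (\<Sum>l\<in>UNIV. \<Sum>s\<in>UNIV. S2.pow i (adj l s) p)) + k * e\<^sup>2"
  using p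
proof (induction k arbitrary: p)
  case (Suc k)
  let ?C = "real (card pairsN)"
  let ?P = "\<lambda>k p. S1.pow k w (fst p) * S1.pow k w (snd p)"
  let ?b = "\<lambda>k p. (\<Sum>i<k. \<delta>\<^sup>2 / ?C * (\<Sum>l\<in>UNIV. \<Sum>s\<in>UNIV. S2.pow i (adj l s) p)) + k * e\<^sup>2"
  let ?R = "\<lambda>p. S2.pow k (\<lambda>p. w (fst p) * w (snd p)) p - ?P k p"
  have src: "\<bar>S2.avg (?P k) p - ?P (Suc k) p\<bar> \<le> \<delta>\<^sup>2 / ?C * (\<Sum>l\<in>UNIV. \<Sum>s\<in>UNIV. adj l s p) + e\<^sup>2"
    using product_source[of "S1.pow k w" \<delta> e p, OF grad _ Suc.prems] lap[of _ k] by simp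
  have le1: "S2.pow 1 ?R p \<le> S2.pow 1 (?b k) p"
  proof (rule pow_mono_offdiag[OF _ Suc.prems])
    fix q assume "q \<in> sitesN \<times> sitesN" "fst q \<noteq> snd q"
    from Suc.IH[OF this] show "?R q \<le> ?b k q" unfolding abs_le_iff by (rule conjunct1)
  qed
  have le2: "S2.pow 1 (\<lambda>q. - ?R q) p \<le> S2.pow 1 (?b k) p"
  proof (rule pow_mono_offdiag[OF _ Suc.prems])
    fix q assume "q \<in> sitesN \<times> sitesN" "fst q \<noteq> snd q"
    from Suc.IH[OF this] show "- ?R q \<le> ?b k q" unfolding abs_le_iff by (rule conjunct2)
  qed
  have p1: "S2.pow 1 f = S2.avg f" for f by simp
  note le = le1[unfolded p1] le2[unfolded p1]
  have neg: "S2.avg (\<lambda>q. - ?R q) p = - S2.avg ?R p"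
    using S2.avg_scale[of "-1" ?R p] by (simp only: mult_minus1)
  have R: "\<bar>S2.avg ?R p\<bar> \<le> S2.avg (?b k) p"
    using le unfolding neg by (rule abs_leI)
  have b: "S2.avg (?b k) p + (\<delta>\<^sup>2 / ?C * (\<Sum>l\<in>UNIV. \<Sum>s\<in>UNIV. adj l s p) + e\<^sup>2) = ?b (Suc k) p"
  proof -
    have "S2.avg (?b k) p = (\<Sum>i<k. \<delta>\<^sup>2 / ?C * (\<Sum>l\<in>UNIV. \<Sum>s\<in>UNIV. S2.pow (Suc i) (adj l s) p)) + k * e\<^sup>2"
      by (simp only: S2.avg_add S2.avg_sum S2.avg_scale S2.avg_const funpow.simps o_apply)
    moreover have "(\<Sum>i<Suc k. \<delta>\<^sup>2 / ?C * (\<Sum>l\<in>UNIV. \<Sum>s\<in>UNIV. S2.pow i (adj l s) p)) =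
      \<delta>\<^sup>2 / ?C * (\<Sum>l\<in>UNIV. \<Sum>s\<in>UNIV. S2.pow 0 (adj l s) p) + (\<Sum>i<k. \<delta>\<^sup>2 / ?C * (\<Sum>l\<in>UNIV. \<Sum>s\<in>UNIV. S2.pow (Suc i) (adj l s) p))"
      by (rule sum.lessThan_Suc_shift)
    ultimately show ?thesis by (simp add: algebra_simps)
  qed
  have "S2.pow (Suc k) (\<lambda>p. w (fst p) * w (snd p)) p = S2.avg ?R p + S2.avg (?P k) p"
    by (simp add: S2.avg_diff)
  then have "\<bar>S2.pow (Suc k) (\<lambda>p. w (fst p) * w (snd p)) p - ?P (Suc k) p\<bar> \<le>
    \<bar>S2.avg ?R p\<bar> + \<bar>S2.avg (?P k) p - ?P (Suc k) p\<bar>" by linarith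
  also have "\<dots> \<le> S2.avg (?b k) p + (\<delta>\<^sup>2 / ?C * (\<Sum>l\<in>UNIV. \<Sum>s\<in>UNIV. adj l s p) + e\<^sup>2)"
    by (rule add_mono[OF R src])
  also have "\<dots> = ?b (Suc k) p" by (rule b)
  finally show ?case .
qed simp

text \<open>Source and point of evaluation are both adjacent pairs, so summation over sites and
  steps produces the quantity bounded in \<open>adj_return\<close>, once for each direction of the
  source.\<close>

lemma product_error_sum:
  fixes w :: "'d site \<Rightarrow> real"
  assumes grad: "\<And>k x l s. x \<in> sitesN \<Longrightarrow> \<bar>S1.pow k w (shift N l s x) - S1.pow k w x\<bar> \<le> \<delta>"
    and lap: "\<And>k x. x \<in> sitesN \<Longrightarrow> \<bar>S1.pow (Suc k) w x - S1.pow k w x\<bar> \<le> e"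
    and M: "1 \<le> M" "M < N"
  shows "(\<Sum>k<K. \<Sum>x\<in>sitesN. \<bar>S2.pow k (\<lambda>p. w (fst p) * w (snd p)) (x, shift N l s x) - S1.pow k w x * S1.pow k w (shift N l s x)\<bar>)
    \<le> K * (\<delta>\<^sup>2 / card pairsN * (2 * CARD('d) * ret_bound M K) + real N ^ CARD('d) * K * e\<^sup>2)"
proof -
  let ?C = "real (card pairsN)" let ?sh = "shift N l s"
  have ne: "x \<noteq> ?sh x" for x using shift_neq[of N l s x] N3 by auto
  let ?a = "\<lambda>i x. \<Sum>l\<in>UNIV. \<Sum>s\<in>UNIV. S2.pow i (adj l s) (x, ?sh x)"
  have a0: "0 \<le> ?a i x" if "x \<in> sitesN" for i x
    using that by (intro sum_nonneg S2.pow_ge) (auto simp: adj_def shift_sites[OF N1])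
  have "(\<Sum>k<K. \<Sum>x\<in>sitesN. \<bar>S2.pow k (\<lambda>p. w (fst p) * w (snd p)) (x, ?sh x) - S1.pow k w x * S1.pow k w (?sh x)\<bar>)
    \<le> (\<Sum>k<K. \<Sum>x\<in>sitesN. (\<Sum>i<K. \<delta>\<^sup>2 / ?C * ?a i x) + K * e\<^sup>2)"
  proof (intro sum_mono)
    fix k x assume k: "k \<in> {..<K}" and x: "x \<in> sitesN"
    have "\<bar>S2.pow k (\<lambda>p. w (fst p) * w (snd p)) (x, ?sh x) - S1.pow k w x * S1.pow k w (?sh x)\<bar> \<le> (\<Sum>i<k. \<delta>\<^sup>2 / ?C * ?a i x) + k * e\<^sup>2"
      using product_error[OF grad lap, of "(x, ?sh x)" k] x ne by (simp add: shift_sites[OF N1])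
    also have "\<dots> \<le> (\<Sum>i<K. \<delta>\<^sup>2 / ?C * ?a i x) + K * e\<^sup>2"
      using k a0[OF x] by (intro add_mono sum_mono2 mult_right_mono mult_nonneg_nonneg) auto
    finally show "\<bar>S2.pow k (\<lambda>p. w (fst p) * w (snd p)) (x, ?sh x) - S1.pow k w x * S1.pow k w (?sh x)\<bar> \<le> (\<Sum>i<K. \<delta>\<^sup>2 / ?C * ?a i x) + K * e\<^sup>2" .
  qed
  also have "\<dots> = \<delta>\<^sup>2 / ?C * (real K * (\<Sum>x\<in>sitesN. \<Sum>i<K. ?a i x)) + real K * (real N ^ CARD('d) * (real K * e\<^sup>2))"
    by (simp only: sum.distrib sum_distrib_left[symmetric] sum_constant card_sites card_lessThan of_nat_power mult.assoc distrib_left)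
  also have "\<dots> = K * (\<delta>\<^sup>2 / ?C * (\<Sum>x\<in>sitesN. \<Sum>i<K. ?a i x) + real N ^ CARD('d) * K * e\<^sup>2)"
  proof -
    have "c * (k * a) + k * (w * (k * z)) = k * (c * a + w * k * z)" for c k a w z :: real
      by (simp add: algebra_simps)
    then show ?thesis .
  qed
  also have "(\<Sum>x\<in>sitesN. \<Sum>i<K. ?a i x) = (\<Sum>l'\<in>UNIV. \<Sum>s'\<in>UNIV. \<Sum>i<K. \<Sum>x\<in>sitesN. S2.pow i (adj l' s') (x, ?sh x))"
  proof -
    have "(\<Sum>x\<in>sitesN. \<Sum>i<K. ?a i x) = (\<Sum>x\<in>sitesN. \<Sum>l'\<in>UNIV. \<Sum>i<K. \<Sum>s'\<in>UNIV. S2.pow i (adj l' s') (x, ?sh x))"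
      by (rule sum.cong[OF refl]) (rule sum.swap)
    also have "\<dots> = (\<Sum>l'\<in>UNIV. \<Sum>x\<in>sitesN. \<Sum>i<K. \<Sum>s'\<in>UNIV. S2.pow i (adj l' s') (x, ?sh x))"
      by (rule sum.swap)
    also have "\<dots> = (\<Sum>l'\<in>UNIV. \<Sum>x\<in>sitesN. \<Sum>s'\<in>UNIV. \<Sum>i<K. S2.pow i (adj l' s') (x, ?sh x))"
      by (rule sum.cong[OF refl], rule sum.cong[OF refl]) (rule sum.swap)
    also have "\<dots> = (\<Sum>l'\<in>UNIV. \<Sum>s'\<in>UNIV. \<Sum>x\<in>sitesN. \<Sum>i<K. S2.pow i (adj l' s') (x, ?sh x))"
      by (rule sum.cong[OF refl]) (rule sum.swap)
    also have "\<dots> = (\<Sum>l'\<in>UNIV. \<Sum>s'\<in>UNIV. \<Sum>i<K. \<Sum>x\<in>sitesN. S2.pow i (adj l' s') (x, ?sh x))"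
      by (rule sum.cong[OF refl], rule sum.cong[OF refl]) (rule sum.swap)
    finally show ?thesis .
  qed
  also have "K * (\<delta>\<^sup>2 / ?C * (\<Sum>l'\<in>UNIV. \<Sum>s'\<in>UNIV. \<Sum>i<K. \<Sum>x\<in>sitesN. S2.pow i (adj l' s') (x, ?sh x)) + real N ^ CARD('d) * K * e\<^sup>2)
    \<le> K * (\<delta>\<^sup>2 / ?C * (\<Sum>l'\<in>(UNIV::'d set). \<Sum>s'\<in>(UNIV::bool set). ret_bound M K) + real N ^ CARD('d) * K * e\<^sup>2)"
    by (intro mult_left_mono add_mono sum_mono adj_return M) auto
  finally show ?thesis by (simp add: mult_ac)
qed

end

section \<open>The heat equation and the maximum principle\<close>

lemma periodic_int:
  assumes "periodic_fun f"
  shows "f (x + of_int m *\<^sub>R axis i 1) = f x"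
proof -
  have nat: "f (x + real k *\<^sub>R axis i 1) = f x" for x k
  proof (induction k)
    case (Suc k)
    have "x + real (Suc k) *\<^sub>R axis i 1 = (x + real k *\<^sub>R axis i 1) + axis i 1"
      by (simp add: algebra_simps)
    moreover have "f ((x + real k *\<^sub>R axis i 1) + axis i 1) = f (x + real k *\<^sub>R axis i 1)"
      using assms unfolding periodic_fun_def by blast
    ultimately show ?case using Suc by (simp only:)
  qed simp
  show ?thesis
  proof (cases "m \<ge> 0")
    case True
    then show ?thesis using nat[of x "nat m"] by simp
  next
    case False
    then show ?thesis using nat[of "x + of_int m *\<^sub>R axis i 1" "nat (- m)"] by simp
  qed
qed

lemma periodic_int_vec:
  fixes f :: "real^'d::finite \<Rightarrow> real"
  assumes "periodic_fun f"
  shows "f (x + (\<chi> i. of_int (m i))) = f x"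
proof -
  have "f (x + (\<Sum>i\<in>A. of_int (m i) *\<^sub>R axis i 1)) = f x" if "finite A" for A
    using that
  proof (induction A)
    case (insert a A)
    have "x + (\<Sum>i\<in>insert a A. of_int (m i) *\<^sub>R axis i 1) = (x + (\<Sum>i\<in>A. of_int (m i) *\<^sub>R axis i 1)) + of_int (m a) *\<^sub>R axis a 1"
      using insert by (simp add: algebra_simps)
    then show ?case using insert.IH periodic_int[OF assms] by (simp only:)
  qed simp
  moreover have "(\<Sum>i\<in>UNIV. of_int (m i) *\<^sub>R axis i 1) = (\<chi> i. real_of_int (m i))"
    by (simp add: vec_eq_iff sum_component axis_def if_distrib cong: if_cong)
  ultimately show ?thesis using finite[of "UNIV::'d set"] by metis
qed

definition frac_vec :: "real^'d::finite \<Rightarrow> real^'d" where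
  "frac_vec x = (\<chi> i. frac (x $ i))"

lemma periodic_frac:
  assumes "periodic_fun f" shows "f (frac_vec x) = f x"
proof -
  have "frac_vec x + (\<chi> i. of_int \<lfloor>x $ i\<rfloor>) = x"
    by (simp add: vec_eq_iff frac_vec_def frac_def)
  then show ?thesis using periodic_int_vec[OF assms, of "frac_vec x" "\<lambda>i. \<lfloor>x $ i\<rfloor>"] by simp
qed

abbreviation (input) ucube :: "(real^'d::finite) set" where "ucube \<equiv> cbox 0 One"

lemma One_component [simp]: "(One :: real^'d::finite) $ i = 1"
proof -
  have "(One :: real^'d) $ i = (One :: real^'d) \<bullet> axis i 1" by (rule cart_eq_inner_axis)
  also have "\<dots> = (\<Sum>b\<in>Basis. if b = axis i (1::real) then 1 else 0)"
    unfolding inner_sum_left by (intro sum.cong refl) (simp add: inner_Basis)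
  also have "\<dots> = 1" by simp
  finally show ?thesis .
qed

lemma mem_ucube: "x \<in> ucube \<longleftrightarrow> (\<forall>i. 0 \<le> x $ i \<and> x $ i \<le> 1)"
  by (simp only: mem_box_cart zero_index One_component)

lemma frac_vec_ucube: "frac_vec x \<in> ucube"
  by (simp add: mem_ucube frac_vec_def less_imp_le[OF frac_lt_1])

text \<open>At the maximum the first derivative vanishes; a positive second derivative would make it
  positive just to the right, and the mean value theorem would give a larger value.\<close>

lemma second_deriv_max:
  fixes f :: "real \<Rightarrow> real"
  assumes f: "\<And>s. (f has_real_derivative f' s) (at s)" and f': "(f' has_real_derivative D) (at 0)"
    and max: "\<And>s. f s \<le> f 0"
  shows "D \<le> 0"
proof (rule ccontr)
  assume "\<not> D \<le> 0"
  then have D: "D > 0" by simp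
  have z: "f' 0 = 0" by (rule DERIV_local_max[OF f zero_less_one]) (use max in auto)
  obtain d where d: "d > 0" "\<And>h. 0 < h \<Longrightarrow> h < d \<Longrightarrow> f' 0 < f' (0 + h)"
    using DERIV_pos_inc_right[OF f' D] by auto
  have "\<exists>z. 0 < z \<and> z < d / 2 \<and> f (d / 2) - f 0 = (d / 2 - 0) * f' z"
    using d f by (intro MVT2) auto
  then obtain s where s: "0 < s" "s < d / 2" "f (d / 2) - f 0 = d / 2 * f' s" by auto
  then have "f' s > 0" using d(2)[of s] z d(1) by simp
  then have "f (d / 2) > f 0" using s d(1) by (smt (verit) mult_pos_pos half_gt_zero)
  then show False using max[of "d / 2"] by simp
qed

lemma pd_eq:
  fixes f :: "real^'d::finite \<Rightarrow> real"
  assumes "(f has_derivative f') (at x)"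
  shows "pd i f x = f' (axis i 1)"
  using frechet_derivative_at[OF assms] by (simp add: pd_def)

lemma pd_line:
  fixes f :: "real^'d::finite \<Rightarrow> real"
  assumes "f differentiable (at (x + s *\<^sub>R axis i 1))"
  shows "((\<lambda>s. f (x + s *\<^sub>R axis i 1)) has_real_derivative pd i f (x + s *\<^sub>R axis i 1)) (at s)"
proof -
  let ?D = "frechet_derivative f (at (x + s *\<^sub>R axis i 1))"
  have f: "(f has_derivative ?D) (at (x + s *\<^sub>R axis i 1))"
    using assms frechet_derivative_works by blast
  have "((\<lambda>s. f (x + s *\<^sub>R axis i 1)) has_derivative (\<lambda>h. ?D (h *\<^sub>R axis i 1))) (at s)"
  proof (rule has_derivative_compose[of "\<lambda>s. x + s *\<^sub>R axis i 1" "\<lambda>h. h *\<^sub>R axis i 1" s UNIV f ?D, OF _ f])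
    show "((\<lambda>s. x + s *\<^sub>R axis i 1) has_derivative (\<lambda>h. h *\<^sub>R axis i 1)) (at s)"
      by (auto intro!: derivative_eq_intros)
  qed
  moreover have "(\<lambda>h. ?D (h *\<^sub>R axis i 1)) = (\<lambda>h. h * pd i f (x + s *\<^sub>R axis i 1))"
    using linear_scale[OF has_derivative_linear[OF f]] by (simp add: pd_def fun_eq_iff)
  ultimately show ?thesis by (simp add: has_field_derivative_def mult_commute_abs)
qed

lemma pd_diff:
  fixes f g :: "real^'d::finite \<Rightarrow> real"
  assumes "f differentiable (at x)" "g differentiable (at x)"
  shows "pd i (\<lambda>z. f z - g z) x = pd i f x - pd i g x"
proof -
  have "((\<lambda>z. f z - g z) has_derivative (\<lambda>h. frechet_derivative f (at x) h - frechet_derivative g (at x) h)) (at x)"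
    using assms by (intro derivative_intros) (auto simp: frechet_derivative_works[symmetric])
  from pd_eq[OF this] show ?thesis by (simp add: pd_def)
qed

text \<open>Maximum principle for the difference of two solutions. The equation holds only at times
  in the open interval, so the maximum is sought up to an interior time; periodicity supplies
  compactness in space.\<close>

lemma heat_sol_le:
  fixes \<rho> v :: "real^'d::finite \<Rightarrow> real \<Rightarrow> real"
  assumes T: "T > 0" and \<rho>: "heat_sol T \<rho>0 \<rho>" and v: "heat_sol T p v"
    and le: "\<And>x. \<rho>0 x - p x \<le> \<delta>" and t: "t \<in> {0..T}"
  shows "\<rho> x t - v x t \<le> \<delta>"
proof (rule ccontr)
  assume neg: "\<not> \<rho> x t - v x t \<le> \<delta>"
  define w where "w x t = \<rho> x t - v x t" for x t
  have contw: "continuous_on (UNIV \<times> {0..T}) (\<lambda>(x, t). w x t)"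
    using \<rho> v unfolding heat_sol_def w_def case_prod_unfold by (intro continuous_on_diff) auto
  have per: "periodic_fun (\<lambda>x. w x t)" for t
    using \<rho> v unfolding heat_sol_def w_def periodic_fun_def by simp
  have w0: "w x 0 \<le> \<delta>" for x using \<rho> v le unfolding heat_sol_def w_def by simp
  \<comment> \<open>If the excess is found at \<open>T\<close>, where no equation is available,
    continuity yields it at a slightly earlier time.\<close>
  obtain t1 where t1: "0 < t1" "t1 < T" "w x t1 > \<delta>"
  proof -
    have ct: "continuous_on {0..T} (w x)"
      by (rule continuous_on_compose2[OF contw, of _ "\<lambda>t. (x, t)", simplified]) (auto intro!: continuous_intros)
    have wt: "w x t > \<delta>" using neg by (simp add: w_def)
    have tp: "t > 0" using wt w0[of x] t by (cases "t = 0") auto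
    show thesis
    proof (cases "t < T")
      case True
      then show thesis using that tp wt by auto
    next
      case False
      then have tT: "t = T" using t by simp
      have "((w x) \<longlongrightarrow> w x T) (at T within {0..T})"
        using ct T by (auto simp: continuous_on_def)
      then have "(w x \<longlongrightarrow> w x T) (at_left T)"
        using T by (simp add: at_within_Icc_at_left)
      then have ev: "eventually (\<lambda>s. w x s > \<delta>) (at_left T)"
        using wt tT by (auto dest: order_tendstoD(1))
      moreover have "eventually (\<lambda>s. s \<in> {0<..<T}) (at_left T)"
        using T by (rule eventually_at_leftI[rotated]) auto
      ultimately have "eventually (\<lambda>s. w x s > \<delta> \<and> s \<in> {0<..<T}) (at_left T)" by (rule eventually_conj)
      then obtain s where "w x s > \<delta>" "s \<in> {0<..<T}"
        using eventually_happens'[OF trivial_limit_at_left_real] by blast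
      then show thesis using that by auto
    qed
  qed
  \<comment> \<open>The tilt is half the slope that would absorb the excess at \<open>t1\<close>, so
    the tilted function still exceeds \<open>\<delta>\<close> there.\<close>
  define c where "c = (w x t1 - \<delta>) / (2 * t1)"
  have c: "c > 0" using t1 by (simp add: c_def)
  define g where "g p = w (fst p) (snd p) - c * snd p" for p
  have cg: "continuous_on (ucube \<times> {0..t1}) g"
  proof -
    have "continuous_on (ucube \<times> {0..t1}) (\<lambda>(x, t). w x t)"
      using t1 by (intro continuous_on_subset[OF contw]) auto
    then show ?thesis unfolding g_def case_prod_unfold by (intro continuous_intros)
  qed
  have ne: "ucube \<times> {0..t1} \<noteq> {}" using t1 frac_vec_ucube[of x] by auto
  obtain p0 where p0: "p0 \<in> ucube \<times> {0..t1}" "\<And>p. p \<in> ucube \<times> {0..t1} \<Longrightarrow> g p \<le> g p0"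
    using continuous_attains_sup[OF compact_Times[OF compact_cbox compact_Icc] ne cg] by auto
  obtain x0 t0 where xt: "p0 = (x0, t0)" by (cases p0)
  have t0: "0 \<le> t0" "t0 \<le> t1" using p0 xt by auto
  have gmax: "w y s - c * s \<le> w x0 t0 - c * t0" if "0 \<le> s" "s \<le> t1" for y s
    using p0(2)[of "(frac_vec y, s)"] that frac_vec_ucube[of y] periodic_frac[OF per[of s], of y] by (simp add: g_def xt)
  have "w x t1 - c * t1 > \<delta>" using t1 by (simp add: c_def field_simps)
  then have gt: "w x0 t0 - c * t0 > \<delta>" using gmax[of t1 x] t1 by simp
  have t0p: "t0 > 0" using gt w0[of x0] t0 by (cases "t0 = 0") auto
  have t0T: "t0 \<in> {0<..<T}" using t0p t0 t1 by simp
  have d1: "(\<lambda>z. \<rho> z t0) differentiable (at z)" "(\<lambda>z. v z t0) differentiable (at z)" for z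
    using \<rho> v t0T unfolding heat_sol_def by auto
  have d2: "pd i (\<lambda>z. \<rho> z t0) differentiable (at z)" "pd i (\<lambda>z. v z t0) differentiable (at z)" for z i
    using \<rho> v t0T unfolding heat_sol_def by auto
  have pw: "pd i (\<lambda>z. w z t0) = (\<lambda>z. pd i (\<lambda>z. \<rho> z t0) z - pd i (\<lambda>z. v z t0) z)" for i
    unfolding w_def by (rule ext) (rule pd_diff[OF d1])
  have pww: "pd i (pd i (\<lambda>z. w z t0)) x0 = pd i (pd i (\<lambda>z. \<rho> z t0)) x0 - pd i (pd i (\<lambda>z. v z t0)) x0" for i
    unfolding pw by (rule pd_diff[OF d2])
  have dw1: "(\<lambda>z. w z t0) differentiable (at z)" for z unfolding w_def by (intro differentiable_diff d1)
  have dw2: "pd i (\<lambda>z. w z t0) differentiable (at z)" for z i unfolding pw by (intro differentiable_diff d2)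
  have lap: "pd i (pd i (\<lambda>z. w z t0)) x0 \<le> 0" for i
  proof (rule second_deriv_max)
    show "((\<lambda>s. w (x0 + s *\<^sub>R axis i 1) t0) has_real_derivative pd i (\<lambda>z. w z t0) (x0 + s *\<^sub>R axis i 1)) (at s)" for s
      by (rule pd_line[OF dw1])
    show "((\<lambda>s. pd i (\<lambda>z. w z t0) (x0 + s *\<^sub>R axis i 1)) has_real_derivative pd i (pd i (\<lambda>z. w z t0)) x0) (at 0)"
      using pd_line[OF dw2[of i "x0 + 0 *\<^sub>R axis i 1"]] by simp
    show "w (x0 + s *\<^sub>R axis i 1) t0 \<le> w (x0 + 0 *\<^sub>R axis i 1) t0" for s
      using gmax[of t0 "x0 + s *\<^sub>R axis i 1"] t0 by simp
  qed
  let ?L = "\<Sum>i\<in>UNIV. pd i (pd i (\<lambda>z. w z t0)) x0"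
  have tder: "((\<lambda>r. w x0 r - c * r) has_real_derivative (?L - c)) (at t0)"
  proof -
    have "((\<lambda>r. \<rho> x0 r) has_real_derivative (\<Sum>i\<in>UNIV. pd i (pd i (\<lambda>z. \<rho> z t0)) x0)) (at t0)"
      "((\<lambda>r. v x0 r) has_real_derivative (\<Sum>i\<in>UNIV. pd i (pd i (\<lambda>z. v z t0)) x0)) (at t0)"
      using \<rho> v t0T unfolding heat_sol_def by auto
    from DERIV_diff[OF this] have "(w x0 has_real_derivative ?L) (at t0)"
      unfolding w_def[abs_def] pww[unfolded w_def[abs_def]] sum_subtractf by simp
    then show ?thesis by (auto intro!: derivative_eq_intros)
  qed
  have L: "?L \<le> 0" by (intro sum_nonpos lap)
  \<comment> \<open>A strictly negative time derivative makes the tilted function larger just before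
    \<open>t0\<close>, against maximality.\<close>
  then have "?L - c < 0" using c by simp
  from DERIV_neg_dec_left[OF tder this] obtain d where
    d: "d > 0" "\<And>h. 0 < h \<Longrightarrow> h < d \<Longrightarrow> w x0 (t0 - h) - c * (t0 - h) > w x0 t0 - c * t0" by auto
  define h where "h = min (d / 2) (t0 / 2)"
  have "0 < h" "h < d" "h < t0" using d(1) t0p by (auto simp: h_def min_def)
  then show False using d(2)[of h] gmax[of "t0 - h" x0] t0 by auto
qed

lemma heat_sol_close:
  assumes "T > 0" "heat_sol T \<rho>0 \<rho>" "heat_sol T p v" "\<And>x. \<bar>\<rho>0 x - p x\<bar> \<le> \<delta>" "t \<in> {0..T}"
  shows "\<bar>\<rho> x t - v x t\<bar> \<le> \<delta>"
proof -
  have "\<rho>0 y - p y \<le> \<delta>" "p y - \<rho>0 y \<le> \<delta>" for y using assms(4)[of y] by linarith+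
  then show ?thesis using heat_sol_le[OF assms(1,2,3) _ assms(5), of \<delta> x] heat_sol_le[OF assms(1,3,2) _ assms(5), of \<delta> x]
    by (intro abs_leI) auto
qed

section \<open>Plane waves and their heat flow\<close>

definition wave :: "('d::finite \<Rightarrow> int) \<Rightarrow> real \<Rightarrow> real^'d \<Rightarrow> real" where
  "wave q \<theta> x = cos (2 * pi * (\<Sum>i\<in>UNIV. of_int (q i) * x $ i) + \<theta>)"

definition rate :: "('d::finite \<Rightarrow> int) \<Rightarrow> real" where
  "rate q = 4 * pi\<^sup>2 * (\<Sum>i\<in>UNIV. (of_int (q i))\<^sup>2)"

lemma wave_shift: "wave q \<theta> (x + h *\<^sub>R axis i 1) = wave q (\<theta> + 2 * pi * of_int (q i) * h) x"
proof -
  have "(\<Sum>j\<in>UNIV. of_int (q j) * (x + h *\<^sub>R axis i 1) $ j) = (\<Sum>j\<in>UNIV. of_int (q j) * x $ j) + (\<Sum>j\<in>UNIV. if j = i then of_int (q i) * h else 0)"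
    unfolding sum.distrib[symmetric] by (intro sum.cong refl) (auto simp: axis_def algebra_simps)
  then show ?thesis by (simp add: wave_def algebra_simps)
qed

lemma wave_periodic: "periodic_fun (wave q \<theta>)"
  unfolding periodic_fun_def
proof (intro allI)
  fix x :: "real^'a" and i
  have "wave q \<theta> (x + axis i 1) = wave q (\<theta> + 2 * pi * of_int (q i)) x"
    using wave_shift[of q \<theta> x 1 i] by simp
  also have "\<dots> = wave q \<theta> x"
  proof -
    have "cos (a + (\<theta> + 2 * pi * of_int m)) = cos (a + \<theta>)" for a and m :: int
      using cos.plus_of_int[of "a + \<theta>" m] by (simp add: algebra_simps)
    then show ?thesis unfolding wave_def .
  qed
  finally show "wave q \<theta> (x + axis i 1) = wave q \<theta> x" .
qed

lemma wave_has_derivative: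
  "(wave q \<theta> has_derivative (\<lambda>h. - sin (2 * pi * (\<Sum>i\<in>UNIV. of_int (q i) * x $ i) + \<theta>) * (2 * pi * (\<Sum>i\<in>UNIV. of_int (q i) * h $ i)))) (at x)"
proof -
  let ?S = "\<lambda>x::real^'a. \<Sum>i\<in>UNIV. of_int (q i) * x $ i"
  have lin: "(?S has_derivative ?S) (at x)"
    by (intro has_derivative_sum has_derivative_mult_right bounded_linear_imp_has_derivative bounded_linear_vec_nth)
  have "((\<lambda>x. 2 * pi * ?S x + \<theta>) has_derivative (\<lambda>h. 2 * pi * ?S h)) (at x)"
    using has_derivative_add[OF has_derivative_mult_right[OF lin, of "2 * pi"] has_derivative_const[of \<theta>]] by simp
  from DERIV_cos[THEN DERIV_compose_FDERIV, OF this] show ?thesis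
    unfolding wave_def[abs_def] by (simp only: mult.commute)
qed

text \<open>Carrying the phase in \<open>wave\<close> lets differentiation act as a shift by a
  quarter period, so one family covers sine and cosine.\<close>

lemma pd_wave: "pd i (wave q \<theta>) = (\<lambda>x. (2 * pi * of_int (q i)) * wave q (\<theta> + pi / 2) x)"
proof
  fix x
  have "(\<Sum>j\<in>UNIV. of_int (q j) * axis i 1 $ j) = (\<Sum>j\<in>UNIV. if j = i then real_of_int (q i) else 0)"
    by (intro sum.cong refl) (auto simp: axis_def)
  then have "pd i (wave q \<theta>) x = - sin (2 * pi * (\<Sum>i\<in>UNIV. of_int (q i) * x $ i) + \<theta>) * (2 * pi * of_int (q i))"
    by (subst pd_eq[OF wave_has_derivative]) simp
  moreover have "- sin a = cos (a + pi / 2)" for a :: real by (simp add: cos_add)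
  ultimately show "pd i (wave q \<theta>) x = (2 * pi * of_int (q i)) * wave q (\<theta> + pi / 2) x"
    by (simp add: wave_def add.assoc)
qed

section \<open>Trigonometric polynomials\<close>

lemma pd_lin:
  fixes f g :: "real^'d::finite \<Rightarrow> real"
  assumes "f differentiable (at x)" "g differentiable (at x)"
  shows "pd i (\<lambda>z. a * f z + b * g z) x = a * pd i f x + b * pd i g x"
proof -
  have "((\<lambda>z. a * f z + b * g z) has_derivative (\<lambda>h. a * frechet_derivative f (at x) h + b * frechet_derivative g (at x) h)) (at x)"
    using assms by (intro derivative_intros) (auto simp: frechet_derivative_works[symmetric])
  from pd_eq[OF this] show ?thesis by (simp add: pd_def)
qed

lemma heat_sol_lin:
  assumes f: "heat_sol T p v" and g: "heat_sol T p' v'"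
  shows "heat_sol T (\<lambda>x. a * p x + b * p' x) (\<lambda>x t. a * v x t + b * v' x t)"
  unfolding heat_sol_def
proof (intro conjI ballI allI)
  show "periodic_fun (\<lambda>x. a * v x t + b * v' x t)" for t
    using f g by (auto simp: heat_sol_def periodic_fun_def)
  show "continuous_on (UNIV \<times> {0..T}) (\<lambda>(x, t). a * v x t + b * v' x t)"
    using f g unfolding heat_sol_def case_prod_unfold by (intro continuous_intros) auto
  show "a * v x 0 + b * v' x 0 = a * p x + b * p' x" for x
    using f g by (auto simp: heat_sol_def)
  fix t x assume t: "t \<in> {0<..<T}"
  have d: "(\<lambda>z. v z t) differentiable (at x)" "(\<lambda>z. v' z t) differentiable (at x)" for x
    using f g t by (auto simp: heat_sol_def)
  have d2: "pd i (\<lambda>z. v z t) differentiable (at x)" "pd i (\<lambda>z. v' z t) differentiable (at x)" for x i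
    using f g t by (auto simp: heat_sol_def)
  have pw: "pd i (\<lambda>z. a * v z t + b * v' z t) = (\<lambda>z. a * pd i (\<lambda>z. v z t) z + b * pd i (\<lambda>z. v' z t) z)" for i
    by (rule ext) (rule pd_lin[OF d])
  show "(\<lambda>z. a * v z t + b * v' z t) differentiable (at x)"
    by (intro differentiable_add differentiable_mult differentiable_const d)
  show "pd i (\<lambda>z. a * v z t + b * v' z t) differentiable (at x)" for i
    unfolding pw by (intro differentiable_add differentiable_mult differentiable_const d2)
  have "((\<lambda>r. v x r) has_real_derivative (\<Sum>i\<in>UNIV. pd i (pd i (\<lambda>z. v z t)) x)) (at t)"
    "((\<lambda>r. v' x r) has_real_derivative (\<Sum>i\<in>UNIV. pd i (pd i (\<lambda>z. v' z t)) x)) (at t)"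
    using f g t by (auto simp: heat_sol_def)
  from DERIV_add[OF DERIV_cmult[OF this(1), of a] DERIV_cmult[OF this(2), of b]]
  show "((\<lambda>r. a * v x r + b * v' x r) has_real_derivative (\<Sum>i\<in>UNIV. pd i (pd i (\<lambda>z. a * v z t + b * v' z t)) x)) (at t)"
    unfolding pw pd_lin[OF d2] by (simp add: sum.distrib sum_distrib_left)
qed

lemma wave_differentiable: "wave q \<theta> differentiable (at x)"
  using wave_has_derivative differentiable_def by blast

lemma wave_continuous: "continuous_on S (wave q \<theta>)"
  unfolding wave_def[abs_def] by (intro continuous_intros)

definition heat_wave :: "('d::finite \<Rightarrow> int) \<Rightarrow> real \<Rightarrow> real^'d \<Rightarrow> real \<Rightarrow> real" where
  "heat_wave q \<theta> x t = exp (- rate q * t) * wave q \<theta> x"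

lemma pd_scale_wave: "pd i (\<lambda>z. c * wave q \<theta> z) = (\<lambda>z. (c * (2 * pi * of_int (q i))) * wave q (\<theta> + pi / 2) z)"
  using pd_lin[where f="wave q \<theta>" and g="wave q \<theta>" and i=i and a=c and b=0, OF wave_differentiable wave_differentiable]
  by (intro ext) (simp add: pd_wave mult.assoc)

lemma wave_pi: "wave q (\<theta> + pi) x = - wave q \<theta> x"
  unfolding wave_def add.assoc[symmetric] by simp

lemma heat_wave_sol: "heat_sol T (wave q \<theta>) (heat_wave q \<theta>)"
  unfolding heat_sol_def
proof (intro conjI ballI allI)
  show "periodic_fun (\<lambda>x. heat_wave q \<theta> x t)" for t
    using wave_periodic[of q \<theta>] by (simp add: heat_wave_def periodic_fun_def)
  show "continuous_on (UNIV \<times> {0..T}) (\<lambda>(x, t). heat_wave q \<theta> x t)"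
    unfolding heat_wave_def case_prod_unfold
    by (intro continuous_intros continuous_on_compose2[OF wave_continuous[of UNIV]]) auto
  show "heat_wave q \<theta> x 0 = wave q \<theta> x" for x by (simp add: heat_wave_def)
  fix t x
  show "(\<lambda>z. heat_wave q \<theta> z t) differentiable (at x)"
    unfolding heat_wave_def by (intro differentiable_mult differentiable_const wave_differentiable)
  show "pd i (\<lambda>z. heat_wave q \<theta> z t) differentiable (at x)" for i
    unfolding heat_wave_def pd_scale_wave by (intro differentiable_mult differentiable_const wave_differentiable)
  have "pd i (pd i (\<lambda>z. heat_wave q \<theta> z t)) x = - (4 * pi\<^sup>2 * (of_int (q i))\<^sup>2) * heat_wave q \<theta> x t" for i
  proof -
    have "\<theta> + pi / 2 + pi / 2 = \<theta> + pi" by simp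
    then have "wave q (\<theta> + pi / 2 + pi / 2) x = - wave q \<theta> x" by (simp only: wave_pi)
    then show ?thesis unfolding heat_wave_def pd_scale_wave by (simp add: power2_eq_square)
  qed
  then have "(\<Sum>i\<in>UNIV. pd i (pd i (\<lambda>z. heat_wave q \<theta> z t)) x) = - rate q * heat_wave q \<theta> x t"
    by (simp add: rate_def sum_distrib_left sum_distrib_right sum_negf)
  moreover have "((\<lambda>r. heat_wave q \<theta> x r) has_real_derivative (- rate q * heat_wave q \<theta> x t)) (at t)"
    unfolding heat_wave_def by (auto intro!: derivative_eq_intros)
  ultimately show "((\<lambda>r. heat_wave q \<theta> x r) has_real_derivative (\<Sum>i\<in>UNIV. pd i (pd i (\<lambda>z. heat_wave q \<theta> z t)) x)) (at t)"
    by simp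
qed

inductive trig :: "(real^'d::finite \<Rightarrow> real) \<Rightarrow> bool" where
  trig_wave: "trig (\<lambda>x. c * wave q \<theta> x)"
| trig_add: "trig f \<Longrightarrow> trig g \<Longrightarrow> trig (\<lambda>x. f x + g x)"

lemma trig_const: "trig (\<lambda>_. c)"
  using trig_wave[of c "\<lambda>_. 0" 0] by (simp add: wave_def)

lemma trig_wave1: "trig (wave q \<theta>)"
  using trig_wave[of 1 q \<theta>] by simp

lemma wave_mult: "wave q \<theta> x * wave q' \<theta>' x =
  1/2 * wave (\<lambda>i. q i - q' i) (\<theta> - \<theta>') x + 1/2 * wave (\<lambda>i. q i + q' i) (\<theta> + \<theta>') x"
proof -
  have "wave q \<theta> x * wave q' \<theta>' x = (cos ((2 * pi * (\<Sum>i\<in>UNIV. of_int (q i) * x $ i) + \<theta>) - (2 * pi * (\<Sum>i\<in>UNIV. of_int (q' i) * x $ i) + \<theta>'))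
    + cos ((2 * pi * (\<Sum>i\<in>UNIV. of_int (q i) * x $ i) + \<theta>) + (2 * pi * (\<Sum>i\<in>UNIV. of_int (q' i) * x $ i) + \<theta>'))) / 2"
    unfolding wave_def by (rule cos_times_cos)
  then show ?thesis
    by (simp add: wave_def left_diff_distrib distrib_right sum_subtractf sum.distrib algebra_simps)
qed

text \<open>Product-to-sum formula: frequencies add and subtract and remain integers. This gives the
  algebra for the Stone-Weierstrass theorem.\<close>

lemma trig_mult:
  assumes "trig f" "trig g" shows "trig (\<lambda>x. f x * g x)"
  using assms(1)
proof induction
  case (trig_wave c q \<theta>)
  show ?case using assms(2)
  proof induction
    case (trig_wave c' q' \<theta>')
    have "(\<lambda>x. c * wave q \<theta> x * (c' * wave q' \<theta>' x)) =
      (\<lambda>x. (c * c' / 2) * wave (\<lambda>i. q i - q' i) (\<theta> - \<theta>') x + (c * c' / 2) * wave (\<lambda>i. q i + q' i) (\<theta> + \<theta>') x)"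
    proof
      fix x
      have "c * wave q \<theta> x * (c' * wave q' \<theta>' x) = (c * c') * (wave q \<theta> x * wave q' \<theta>' x)" by simp
      then show "c * wave q \<theta> x * (c' * wave q' \<theta>' x) = (c * c' / 2) * wave (\<lambda>i. q i - q' i) (\<theta> - \<theta>') x + (c * c' / 2) * wave (\<lambda>i. q i + q' i) (\<theta> + \<theta>') x"
        unfolding wave_mult by (simp add: algebra_simps)
    qed
    then show ?case by (simp only:) (intro trig.intros)
  next
    case (trig_add f g)
    then show ?case using trig.trig_add by (simp add: distrib_left)
  qed
next
  case (trig_add f g)
  then show ?case using trig.trig_add by (simp add: distrib_right)
qed

text \<open>Embeds the torus as a product of unit circles. Periodic functions become functions on a
  compact image, where the coordinates separate points.\<close>

definition circ :: "real^'d::finite \<Rightarrow> complex^'d" where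
  "circ x = (\<chi> i. cis (2 * pi * x $ i))"

lemma circ_continuous: "continuous_on S circ"
  unfolding circ_def cis_conv_exp by (intro continuous_intros)

lemma circ_eq_periodic:
  assumes f: "periodic_fun f" and e: "circ x = circ y" shows "f x = f y"
proof -
  have "\<exists>m::int. x $ i = y $ i + of_int m" for i
  proof -
    have "cis (2 * pi * x $ i) = cis (2 * pi * y $ i)"
      using e by (simp add: circ_def vec_eq_iff)
    then have "sin (2 * pi * x $ i) = sin (2 * pi * y $ i)" "cos (2 * pi * x $ i) = cos (2 * pi * y $ i)"
      by (auto simp: complex_eq_iff)
    then have "sin (2 * pi * x $ i) = sin (2 * pi * y $ i) \<and> cos (2 * pi * x $ i) = cos (2 * pi * y $ i)" by blast
    then obtain n :: int where n: "2 * pi * x $ i = 2 * pi * y $ i + 2 * pi * n"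
      unfolding sin_cos_eq_iff by auto
    have "2 * pi * (x $ i) = 2 * pi * (y $ i + n)" using n by (simp add: algebra_simps)
    then have "x $ i = y $ i + n" by simp
    then show ?thesis by blast
  qed
  then obtain m :: "'a \<Rightarrow> int" where "\<And>i. x $ i = y $ i + of_int (m i)" by metis
  then have "x = y + (\<chi> i. real_of_int (m i))" by (simp add: vec_eq_iff)
  then show ?thesis using periodic_int_vec[OF f] by simp
qed

lemma trig_dense:
  fixes f :: "real^'d::finite \<Rightarrow> real"
  assumes f: "continuous_on UNIV f" "periodic_fun f" and e: "e > 0"
  shows "\<exists>p. trig p \<and> (\<forall>x. \<bar>f x - p x\<bar> < e)"
proof -
  let ?S = "circ ` (ucube :: (real^'d) set)"
  define R :: "(complex^'d \<Rightarrow> real) set" where "R = {g. continuous_on ?S g \<and> trig (\<lambda>x. g (circ x))}"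
  have cS: "compact ?S" by (intro compact_continuous_image circ_continuous compact_cbox)
  \<comment> \<open>Real and imaginary parts of the coordinates are waves of frequency one with
    phases 0 and \<open>- pi / 2\<close>.\<close>
  have co: "(\<lambda>z. Re (z $ i)) \<in> R" "(\<lambda>z. Im (z $ i)) \<in> R" for i
  proof -
    let ?q = "\<lambda>j. if j = i then 1 else 0 :: int"
    have s: "(\<Sum>j\<in>UNIV. of_int (?q j) * x $ j) = x $ i" for x :: "real^'d"
    proof -
      have "(\<Sum>j\<in>UNIV. of_int (?q j) * x $ j) = (\<Sum>j\<in>UNIV. if j = i then x $ j else 0)"
        by (intro sum.cong refl) auto
      then show ?thesis by simp
    qed
    have "(\<lambda>x. Re (circ x $ i)) = (\<lambda>x. 1 * wave ?q 0 x)"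
      unfolding wave_def s by (simp add: circ_def)
    moreover have "(\<lambda>x. Im (circ x $ i)) = (\<lambda>x. 1 * wave ?q (- pi / 2) x)"
      unfolding wave_def s by (simp add: circ_def cos_diff)
    ultimately show "(\<lambda>z. Re (z $ i)) \<in> R" "(\<lambda>z. Im (z $ i)) \<in> R"
      unfolding R_def using trig_wave1 by (auto intro!: continuous_intros)
  qed
  interpret function_ring_on R ?S
  proof
    show "compact ?S" by (rule cS)
    show "continuous_on ?S g" if "g \<in> R" for g using that by (simp add: R_def)
    show "(\<lambda>x. g x + h x) \<in> R" if "g \<in> R" "h \<in> R" for g h
      using that by (auto simp: R_def intro: continuous_on_add trig_add)
    show "(\<lambda>x. g x * h x) \<in> R" if "g \<in> R" "h \<in> R" for g h
      using that by (auto simp: R_def intro: continuous_on_mult trig_mult)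
    show "(\<lambda>_. c) \<in> R" for c by (simp add: R_def trig_const)
    fix x y :: "complex^'d" assume "x \<noteq> y"
    then obtain i where "x $ i \<noteq> y $ i" by (auto simp: vec_eq_iff)
    then have "Re (x $ i) \<noteq> Re (y $ i) \<or> Im (x $ i) \<noteq> Im (y $ i)" by (simp add: complex_eq_iff)
    then show "\<exists>f\<in>R. f x \<noteq> f y"
      by (elim disjE) (rule bexI[OF _ co(1)[of i]], assumption, rule bexI[OF _ co(2)[of i]], assumption)
  qed
  \<comment> \<open>\<open>f\<close> pushed down to the image of the cube; periodicity makes the
    choice of the preimage immaterial.\<close>
  define g where "g z = f (SOME x. x \<in> ucube \<and> circ x = z)" for z
  have gc: "g (circ x) = f x" for x
  proof -
    let ?y = "frac_vec x"
    have p: "frac_vec x + (\<chi> i. real_of_int \<lfloor>x $ i\<rfloor>) = x"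
      by (simp add: vec_eq_iff frac_vec_def frac_def)
    have "circ (frac_vec x) = circ x"
    proof -
      have "cis (2 * pi * frac (x $ i)) = cis (2 * pi * x $ i)" for i
      proof -
        have "2 * pi * x $ i = 2 * pi * frac (x $ i) + of_int \<lfloor>x $ i\<rfloor> * (2 * pi)"
          by (simp add: frac_def algebra_simps)
        then show ?thesis
          using cos.plus_of_int[of "2 * pi * frac (x $ i)" "\<lfloor>x $ i\<rfloor>"] sin.plus_of_int[of "2 * pi * frac (x $ i)" "\<lfloor>x $ i\<rfloor>"]
          by (simp add: complex_eq_iff)
      qed
      then show ?thesis by (simp add: circ_def vec_eq_iff frac_vec_def)
    qed
    then have "\<exists>y. y \<in> ucube \<and> circ y = circ x" using frac_vec_ucube by blast
    from someI_ex[OF this] have "circ (SOME y. y \<in> ucube \<and> circ y = circ x) = circ x" by blast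
    from circ_eq_periodic[OF f(2) this] show ?thesis by (simp add: g_def)
  qed
  \<comment> \<open>The preimage of a closed set under \<open>g\<close> is the image of a compact
    part of the cube, hence closed.\<close>
  have cg: "continuous_on ?S g"
    unfolding continuous_on_closed_vimage[OF compact_imp_closed[OF cS]]
  proof (intro allI impI)
    fix B :: "real set" assume B: "closed B"
    have eq: "g -` B \<inter> ?S = circ ` (f -` B \<inter> ucube)" by (auto simp: gc)
    have "closed (f -` B \<inter> ucube)"
      using continuous_on_closed_vimage[OF closed_cbox, of 0 One f] continuous_on_subset[OF f(1)] B by blast
    then have "compact (f -` B \<inter> ucube)"
      by (metis compact_Int_closed compact_cbox inf.absorb2 inf_le2)
    then show "closed (g -` B \<inter> ?S)" unfolding eq
      by (intro compact_imp_closed compact_continuous_image circ_continuous)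
  qed
  obtain h where h: "h \<in> R" "\<And>z. z \<in> ?S \<Longrightarrow> \<bar>g z - h z\<bar> < e"
    using Stone_Weierstrass_basic[OF cg e] by blast
  let ?p = "\<lambda>x. h (circ x)"
  have t: "trig ?p" using h(1) by (simp add: R_def)
  have per: "periodic_fun ?p" 
  proof -
    have "periodic_fun p" if "trig p" for p :: "real^'d \<Rightarrow> real" using that
      by induction (use wave_periodic in \<open>auto simp: periodic_fun_def\<close>)
    then show ?thesis using t by blast
  qed
  have "\<bar>f x - ?p x\<bar> < e" for x
  proof -
    have "\<bar>g (circ (frac_vec x)) - h (circ (frac_vec x))\<bar> < e"
      by (rule h(2)) (use frac_vec_ucube in blast)
    then show ?thesis using gc[of "frac_vec x"] periodic_frac[OF f(2), of x] periodic_frac[OF per, of x] by simp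
  qed
  then show ?thesis using t by blast
qed

text \<open>Wrapping around changes one coordinate by an integer, which a periodic function does not
  see.\<close>

lemma loc_shift:
  assumes f: "periodic_fun f" and N: "N \<ge> 1" and x: "x \<in> sites N"
  shows "f (loc N (shift N l s x)) = f (loc N x + ((if s then 1 else - 1) / real N) *\<^sub>R axis l 1)"
proof -
  have "\<exists>m::int. loc N x + ((if s then 1 else - 1) / real N) *\<^sub>R axis l 1 = loc N (shift N l s x) + of_int m *\<^sub>R axis l 1"
  proof -
    have xl: "x l < N" using x by (simp add: sites_def)
    have N0: "real N > 0" using N by simp
    have e: "\<exists>m::int. real (x l) + (if s then 1 else - 1) = real (shift N l s x l) + of_int m * real N"
    proof (cases s)
      case True
      then show ?thesis using N mod_step(1)[OF xl]
        by (cases "x l + 1 = N") (auto simp: shift_eq intro: exI[of _ 1] exI[of _ 0])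
    next
      case False
      show ?thesis
      proof (cases "x l = 0")
        case True
        then show ?thesis using N False mod_step(2)[OF xl] by (intro exI[of _ "-1"]) (simp add: shift_eq of_nat_diff)
      next
        case f: False
        then show ?thesis using N False mod_step(2)[OF xl] by (intro exI[of _ 0]) (simp add: shift_eq of_nat_diff)
      qed
    qed
    then obtain m :: int where m: "real (x l) + (if s then 1 else - 1) = real (shift N l s x l) + of_int m * real N" by blast
    have "real (x l) / N + (if s then 1 else - 1) / N = real (shift N l s x l) / N + of_int m"
      using m N0 by (simp add: add_divide_distrib[symmetric] divide_simps) 
    moreover have "shift N l s x j = x j" if "j \<noteq> l" for j using that N by (simp add: shift_eq)
    ultimately show ?thesis
      by (intro exI[of _ m]) (cases s; auto simp: vec_eq_iff loc_def axis_def)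
  qed
  then show ?thesis using periodic_int[OF f] by metis
qed

section \<open>Taylor remainders of cosine and exponential\<close>

lemma cos_cubic_bound: "\<bar>2 * cos a - 2 + a\<^sup>2\<bar> \<le> \<bar>a\<bar> ^ 3 / 3" for a :: real
proof -
  obtain t where t: "cos a = (\<Sum>m<3. cos_coeff m * a ^ m) + cos (t + 1/2 * real 3 * pi) / fact 3 * a ^ 3"
    using Maclaurin_cos_expansion[of a 3] by blast
  have "(\<Sum>m<3. cos_coeff m * a ^ m) = 1 - a\<^sup>2 / 2"
    by (simp add: cos_coeff_def eval_nat_numeral)
  moreover define X where "X = cos (t + 1/2 * real 3 * pi)"
  ultimately have e: "2 * cos a - 2 + a\<^sup>2 = X * a ^ 3 / 3"
    using t by (simp add: fact_numeral)
  have "\<bar>2 * cos a - 2 + a\<^sup>2\<bar> = \<bar>X\<bar> * \<bar>a\<bar> ^ 3 / 3"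
    unfolding e by (simp add: abs_mult power_abs)
  also have "\<dots> \<le> 1 * \<bar>a\<bar> ^ 3 / 3" unfolding X_def by (intro divide_right_mono mult_right_mono abs_cos_le_one) auto
  finally show ?thesis by simp
qed

lemma one_minus_cos_le: "2 * (1 - cos a) \<le> a\<^sup>2" for a :: real
proof -
  have "cos a = 1 - 2 * (sin (a / 2))\<^sup>2" using cos_double_sin[of "a / 2"] by simp
  moreover have "(sin (a / 2))\<^sup>2 \<le> (a / 2)\<^sup>2"
    using abs_sin_x_le_abs_x[of "a / 2"] by (metis abs_ge_zero power2_abs power_mono)
  ultimately show ?thesis by (simp add: power_divide)
qed

text \<open>The upper bound combines \<open>exp y \<ge> 1 + y + y\<^sup>2 / 2\<close> with the
  identity \<open>(1 - y + y\<^sup>2 / 2) * (1 + y + y\<^sup>2 / 2) = 1 + y ^ 4 / 4\<close>.\<close>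

lemma exp_minus_quadratic:
  fixes y :: real
  assumes "0 \<le> y" shows "\<bar>exp (- y) - 1 + y\<bar> \<le> y\<^sup>2 / 2"
proof -
  have p: "0 < 1 + y + y\<^sup>2 / 2" using assms by (auto intro: add_pos_nonneg)
  have "exp (- y) = 1 / exp y" by (simp add: exp_minus inverse_eq_divide)
  also have "\<dots> \<le> 1 / (1 + y + y\<^sup>2 / 2)"
    using exp_lower_Taylor_quadratic[OF assms] p by (intro divide_left_mono) auto
  also have "\<dots> \<le> 1 - y + y\<^sup>2 / 2"
  proof -
    have "(1 - y + y\<^sup>2 / 2) * (1 + y + y\<^sup>2 / 2) = 1 + (y\<^sup>2)\<^sup>2 / 4"
      by (simp add: field_simps power2_eq_square)
    then have "1 \<le> (1 - y + y\<^sup>2 / 2) * (1 + y + y\<^sup>2 / 2)" by simp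
    then show ?thesis using p by (simp add: pos_divide_le_eq)
  qed
  finally have "exp (- y) - 1 + y \<le> y\<^sup>2 / 2" by simp
  moreover have "0 \<le> exp (- y) - 1 + y" using exp_ge_add_one_self[of "- y"] by simp
  ultimately show ?thesis by simp
qed

lemma cos_lipschitz: "\<bar>cos (a + b) - cos a\<bar> \<le> \<bar>b\<bar>" for a b :: real
proof -
  have "\<bar>cos (a + b) - cos a\<bar> = \<bar>2 * sin ((a + b + a) / 2) * sin ((a - (a + b)) / 2)\<bar>"
    by (simp add: cos_diff_cos)
  also have "\<dots> \<le> 2 * 1 * \<bar>(a - (a + b)) / 2\<bar>"
    unfolding abs_mult by (intro mult_mono abs_sin_x_le_abs_x) auto
  finally show ?thesis by simp
qed

section \<open>Discrete heat flow of plane waves\<close>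

context torus
begin

text \<open>Total rate of all clocks; one ring advances macroscopic time by \<open>1 / Lam\<close>
  on average.\<close>

definition Lam :: real where "Lam = real (card pairsN) * (real N)\<^sup>2"

lemma card_pairs_ge: "real (card pairsN) \<ge> 6 * CARD('d)"
proof -
  have "3 ^ 1 \<le> N ^ CARD('d)"
    using N3 by (intro order_trans[OF power_mono[of 3 N 1] power_increasing]) (auto simp: Suc_le_eq)
  then have "6 * CARD('d) \<le> card pairsN"
    unfolding card_nbr_pairs[OF N3] by simp
  then show ?thesis by (metis of_nat_le_iff of_nat_mult of_nat_numeral)
qed

lemma card_pairs_ge1: "real (card pairsN) \<ge> 1"
  using S1.cardC by (simp add: Suc_le_eq)

lemma Lam_ge: "Lam \<ge> real N"
proof -
  have "1 * (real N * 1) \<le> real (card pairsN) * (real N * real N)"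
    using card_pairs_ge1 N1 by (intro mult_mono) auto
  then show ?thesis by (simp add: Lam_def power2_eq_square)
qed

lemma Lam_pos: "Lam > 0"
  using Lam_ge N1 by linarith

definition eigen :: "('d \<Rightarrow> int) \<Rightarrow> real" where
  "eigen q = 1 + (\<Sum>l\<in>UNIV. 2 * (cos (2 * pi * of_int (q l) / N) - 1)) / card pairsN"

lemma avg_wave:
  assumes x: "x \<in> sitesN"
  shows "S1.avg (\<lambda>x. wave q \<theta> (loc N x)) x = eigen q * wave q \<theta> (loc N x)"
proof -
  have "(\<Sum>s\<in>UNIV. wave q \<theta> (loc N (shift N l s x)) - wave q \<theta> (loc N x)) =
    2 * (cos (2 * pi * of_int (q l) / N) - 1) * wave q \<theta> (loc N x)" for l
  proof -
    let ?A = "2 * pi * (\<Sum>i\<in>UNIV. of_int (q i) * loc N x $ i) + \<theta>" let ?b = "2 * pi * of_int (q l) / N"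
    have "wave q \<theta> (loc N (shift N l True x)) = cos (?A + ?b)" "wave q \<theta> (loc N (shift N l False x)) = cos (?A - ?b)"
      unfolding loc_shift[OF wave_periodic N1 x] wave_shift by (simp_all add: wave_def algebra_simps)
    moreover have "wave q \<theta> (loc N x) = cos ?A" by (simp add: wave_def)
    moreover have "(cos (a - b) - cos a) + (cos (a + b) - cos a) = 2 * (cos b - 1) * cos a" for a b :: real
      by (simp add: cos_add cos_diff algebra_simps)
    ultimately show ?thesis by (simp add: UNIV_bool)
  qed
  then have "S1.avg (\<lambda>x. wave q \<theta> (loc N x)) x = wave q \<theta> (loc N x) +
     (\<Sum>l\<in>UNIV. 2 * (cos (2 * pi * of_int (q l) / N) - 1) * wave q \<theta> (loc N x)) / card pairsN"
    by (simp only: avg_laplacian[OF x])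
  then show ?thesis
    unfolding sum_distrib_right[symmetric] eigen_def by (simp add: distrib_right)
qed

lemma pow_wave: "x \<in> sitesN \<Longrightarrow> S1.pow k (\<lambda>x. wave q \<theta> (loc N x)) x = eigen q ^ k * wave q \<theta> (loc N x)"
proof (induction k arbitrary: x)
  case (Suc k)
  have "S1.pow (Suc k) (\<lambda>x. wave q \<theta> (loc N x)) x = S1.avg (\<lambda>x. eigen q ^ k * wave q \<theta> (loc N x)) x"
    unfolding funpow.simps o_apply using Suc by (intro S1.avg_cong) auto
  then show ?case using Suc.prems by (simp add: S1.avg_scale avg_wave)
qed simp

lemma sum_sq_rate: "(\<Sum>l\<in>UNIV. (2 * pi * of_int (q l) / N)\<^sup>2) = rate q / (real N)\<^sup>2"
  by (simp add: rate_def power_divide power_mult_distrib sum_divide_distrib sum_distrib_left)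

lemma rate_nonneg: "0 \<le> rate q"
  by (simp add: rate_def sum_nonneg)

lemma eigen_bounds: "0 \<le> eigen q" "eigen q \<le> 1" "1 - eigen q \<le> rate q / Lam"
proof -
  let ?C = "real (card pairsN)" let ?a = "\<lambda>l. 2 * pi * of_int (q l) / N"
  have C: "?C > 0" by (rule S1.cardC)
  have e: "1 - eigen q = (\<Sum>l\<in>UNIV. 2 * (1 - cos (?a l))) / ?C"
  proof -
    have "(\<Sum>l\<in>UNIV. 2 * (1 - cos (?a l))) = - (\<Sum>l\<in>UNIV. 2 * (cos (?a l) - 1))"
      unfolding sum_negf[symmetric] by (intro sum.cong refl) simp
    then show ?thesis by (simp add: eigen_def)
  qed
  have "0 \<le> (\<Sum>l\<in>UNIV. 2 * (1 - cos (?a l))) / ?C" by (intro divide_nonneg_nonneg sum_nonneg) auto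
  then show "eigen q \<le> 1" using e by linarith
  \<comment> \<open>Each direction contributes at most 4, and there are at least
    \<open>4 * CARD('d)\<close> pairs; this keeps the eigenvalue nonnegative.\<close>
  have "(\<Sum>l\<in>UNIV. 2 * (1 - cos (?a l))) \<le> (\<Sum>l\<in>(UNIV :: 'd set). 4)"
  proof (intro sum_mono)
    fix l show "2 * (1 - cos (?a l)) \<le> 4" using cos_ge_minus_one[of "?a l"] by argo
  qed
  also have "\<dots> \<le> ?C" using card_pairs_ge by simp
  finally have "(\<Sum>l\<in>UNIV. 2 * (1 - cos (?a l))) / ?C \<le> 1" using C by (simp only: divide_le_eq_1_pos)
  then show "0 \<le> eigen q" using e by linarith
  have "(\<Sum>l\<in>UNIV. 2 * (1 - cos (?a l))) \<le> (\<Sum>l\<in>UNIV. (?a l)\<^sup>2)"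
    by (intro sum_mono one_minus_cos_le)
  then have "(\<Sum>l\<in>UNIV. 2 * (1 - cos (?a l))) / ?C \<le> rate q / (real N)\<^sup>2 / ?C"
    unfolding sum_sq_rate by (rule divide_right_mono) simp
  then show "1 - eigen q \<le> rate q / Lam" unfolding e by (simp add: Lam_def mult.commute)
qed

text \<open>The two remainders in \<open>eigen_exp\<close>: third order for the cosine, second order
  for the exponential, the latter weakened from \<open>1 / (Lam * Lam)\<close> to
  \<open>1 / (N * Lam)\<close>.\<close>

definition cubic :: "('d \<Rightarrow> int) \<Rightarrow> real" where
  "cubic q = (\<Sum>l\<in>UNIV. \<bar>2 * pi * of_int (q l)\<bar> ^ 3) / 3 + (rate q)\<^sup>2 / 2"

lemma eigen_exp: "\<bar>eigen q - exp (- (rate q / Lam))\<bar> \<le> cubic q / (N * Lam)"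
proof -
  let ?C = "real (card pairsN)" let ?a = "\<lambda>l. 2 * pi * of_int (q l) / N" let ?y = "rate q / Lam"
  have C: "?C > 0" by (rule S1.cardC)
  have N0: "real N > 0" using N1 by simp
  have "eigen q - 1 + ?y = (\<Sum>l\<in>UNIV. 2 * cos (?a l) - 2 + (?a l)\<^sup>2) / ?C"
  proof -
    have "(\<Sum>l\<in>UNIV. 2 * cos (?a l) - 2 + (?a l)\<^sup>2) = (\<Sum>l\<in>UNIV. 2 * (cos (?a l) - 1)) + (\<Sum>l\<in>UNIV. (?a l)\<^sup>2)"
      unfolding sum.distrib[symmetric] by (intro sum.cong refl) simp
    moreover have "rate q / (real N)\<^sup>2 / ?C = ?y" by (simp add: Lam_def mult.commute)
    ultimately show ?thesis unfolding sum_sq_rate by (simp only: add_divide_distrib eigen_def)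
  qed
  then have "\<bar>eigen q - 1 + ?y\<bar> = \<bar>\<Sum>l\<in>UNIV. 2 * cos (?a l) - 2 + (?a l)\<^sup>2\<bar> / ?C" by simp
  also have "\<dots> \<le> (\<Sum>l\<in>UNIV. \<bar>?a l\<bar> ^ 3 / 3) / ?C"
    by (intro divide_right_mono order_trans[OF sum_abs] sum_mono cos_cubic_bound) simp
  also have "\<dots> = (\<Sum>l\<in>UNIV. \<bar>2 * pi * of_int (q l)\<bar> ^ 3) / 3 / (N * Lam)"
  proof -
    have "\<bar>?a l\<bar> ^ 3 = \<bar>2 * pi * of_int (q l)\<bar> ^ 3 / (real N) ^ 3" for l
      using N0 by (simp add: abs_divide power_divide)
    then have "(\<Sum>l\<in>UNIV. \<bar>?a l\<bar> ^ 3 / 3) = (\<Sum>l\<in>UNIV. \<bar>2 * pi * of_int (q l)\<bar> ^ 3) / 3 / (real N) ^ 3"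
      by (simp only: sum_divide_distrib[symmetric]) simp
    then show ?thesis by (simp add: Lam_def power2_eq_square power3_eq_cube mult_ac)
  qed
  finally have 1: "\<bar>eigen q - 1 + ?y\<bar> \<le> (\<Sum>l\<in>UNIV. \<bar>2 * pi * of_int (q l)\<bar> ^ 3) / 3 / (N * Lam)" .
  have "\<bar>exp (- ?y) - 1 + ?y\<bar> \<le> ?y\<^sup>2 / 2"
    by (intro exp_minus_quadratic divide_nonneg_pos rate_nonneg Lam_pos)
  also have "\<dots> = (rate q)\<^sup>2 / 2 / (Lam * Lam)" by (simp add: power_divide power2_eq_square)
  also have "\<dots> \<le> (rate q)\<^sup>2 / 2 / (N * Lam)"
    using Lam_ge Lam_pos N0 by (intro divide_left_mono mult_right_mono mult_pos_pos) auto
  finally have 2: "\<bar>exp (- ?y) - 1 + ?y\<bar> \<le> (rate q)\<^sup>2 / 2 / (N * Lam)" .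
  have "cubic q / (N * Lam) = (\<Sum>l\<in>UNIV. \<bar>2 * pi * of_int (q l)\<bar> ^ 3) / 3 / (N * Lam) + (rate q)\<^sup>2 / 2 / (N * Lam)"
    unfolding cubic_def by (simp only: add_divide_distrib)
  with 1 2 show ?thesis by linarith
qed

text \<open>What the comparison of pair flow and product requires, for every number of steps:
  closeness to the heat flow, lattice gradients of order \<open>1 / N\<close>, and time increments
  of order \<open>1 / Lam\<close>.\<close>

definition approx_at :: "(real^'d \<Rightarrow> real) \<Rightarrow> (real^'d \<Rightarrow> real \<Rightarrow> real) \<Rightarrow> real \<Rightarrow> bool" where
  "approx_at p v L \<longleftrightarrow> (\<forall>k. \<forall>x\<in>sitesN.
     \<bar>S1.pow k (\<lambda>x. p (loc N x)) x - v (loc N x) (k / Lam)\<bar> \<le> L * (k / Lam) / N \<and>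
     (\<forall>l s. \<bar>S1.pow k (\<lambda>x. p (loc N x)) (shift N l s x) - S1.pow k (\<lambda>x. p (loc N x)) x\<bar> \<le> L / N) \<and>
     \<bar>S1.pow (Suc k) (\<lambda>x. p (loc N x)) x - S1.pow k (\<lambda>x. p (loc N x)) x\<bar> \<le> L / Lam)"

lemma wave_le_1: "\<bar>wave q \<theta> x\<bar> \<le> 1"
  by (simp add: wave_def)

lemma approx_wave:
  "approx_at (wave q \<theta>) (heat_wave q \<theta>) (cubic q + rate q + (\<Sum>l\<in>UNIV. \<bar>2 * pi * of_int (q l)\<bar>))"
  (is "approx_at _ _ ?L")
  unfolding approx_at_def
proof (intro allI ballI conjI)
  fix k x assume x: "x \<in> sitesN"
  let ?w = "wave q \<theta> (loc N x)"
  have c0: "0 \<le> cubic q" unfolding cubic_def by (intro add_nonneg_nonneg divide_nonneg_nonneg sum_nonneg) auto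
  have s0: "0 \<le> (\<Sum>l\<in>(UNIV::'d set). \<bar>2 * pi * of_int (q l)\<bar>)" by (intro sum_nonneg) auto
  have L: "cubic q \<le> ?L" "rate q \<le> ?L" "(\<Sum>l\<in>UNIV. \<bar>2 * pi * of_int (q l)\<bar>) \<le> ?L"
    using c0 s0 rate_nonneg[of q] by linarith+
  have N0: "real N > 0" using N1 by simp
  have ek: "\<bar>eigen q ^ k\<bar> \<le> 1" for k using eigen_bounds[of q] by (simp add: power_le_one)
  \<comment> \<open>Eigenvalue and exponential lie in the unit interval, so their
    \<open>k\<close>-th powers differ by at most \<open>k\<close> times their difference.\<close>
  have "\<bar>eigen q ^ k - exp (- (rate q / Lam)) ^ k\<bar> \<le> k * \<bar>eigen q - exp (- (rate q / Lam))\<bar>"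
    using norm_power_diff[of "eigen q" "exp (- (rate q / Lam))" k] eigen_bounds[of q] rate_nonneg[of q] Lam_pos by simp
  also have "\<dots> \<le> k * (cubic q / (N * Lam))" by (intro mult_left_mono eigen_exp) simp
  also have "\<dots> = cubic q * (k / Lam) / N" by (simp add: mult_ac)
  also have "\<dots> \<le> ?L * (k / Lam) / N"
    using L Lam_pos by (intro divide_right_mono mult_right_mono) auto
  finally have A: "\<bar>eigen q ^ k - exp (- (rate q / Lam)) ^ k\<bar> \<le> ?L * (k / Lam) / N" .
  have ex: "exp (- (rate q / Lam)) ^ k = exp (- rate q * (k / Lam))"
    by (simp add: exp_of_nat_mult[symmetric] mult.commute)
  have "\<bar>eigen q ^ k * ?w - exp (- rate q * (k / Lam)) * ?w\<bar> = \<bar>eigen q ^ k - exp (- (rate q / Lam)) ^ k\<bar> * \<bar>?w\<bar>"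
    unfolding ex by (simp add: left_diff_distrib[symmetric] abs_mult)
  also have "\<dots> \<le> \<bar>eigen q ^ k - exp (- (rate q / Lam)) ^ k\<bar> * 1" by (intro mult_left_mono wave_le_1) simp
  finally show "\<bar>S1.pow k (\<lambda>x. wave q \<theta> (loc N x)) x - heat_wave q \<theta> (loc N x) (k / Lam)\<bar> \<le> ?L * (k / Lam) / N"
    unfolding pow_wave[OF x] heat_wave_def using A by (simp only: mult_1_right)
  show "\<bar>S1.pow k (\<lambda>x. wave q \<theta> (loc N x)) (shift N l s x) - S1.pow k (\<lambda>x. wave q \<theta> (loc N x)) x\<bar> \<le> ?L / N" for l s
  proof -
    have "\<bar>wave q \<theta> (loc N (shift N l s x)) - ?w\<bar> \<le> \<bar>2 * pi * of_int (q l) * ((if s then 1 else - 1) / real N)\<bar>"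
      unfolding loc_shift[OF wave_periodic N1 x] wave_shift unfolding wave_def add.assoc[symmetric] by (rule cos_lipschitz)
    also have "\<dots> = \<bar>2 * pi * of_int (q l)\<bar> / N" by (simp add: abs_mult)
    also have "\<dots> \<le> (\<Sum>l\<in>UNIV. \<bar>2 * pi * of_int (q l)\<bar>) / N"
      by (intro divide_right_mono member_le_sum) auto
    also have "\<dots> \<le> ?L / N" using L by (intro divide_right_mono) auto
    finally have B: "\<bar>wave q \<theta> (loc N (shift N l s x)) - ?w\<bar> \<le> ?L / N" .
    have "\<bar>eigen q ^ k * wave q \<theta> (loc N (shift N l s x)) - eigen q ^ k * ?w\<bar> = \<bar>eigen q ^ k\<bar> * \<bar>wave q \<theta> (loc N (shift N l s x)) - ?w\<bar>"
      by (simp only: right_diff_distrib[symmetric] abs_mult)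
    also have "\<dots> \<le> 1 * \<bar>wave q \<theta> (loc N (shift N l s x)) - ?w\<bar>" by (intro mult_right_mono ek) simp
    finally show ?thesis unfolding pow_wave[OF x] pow_wave[OF shift_sites[OF N1 x]] using B by (simp only: mult_1_left)
  qed
  have "\<bar>eigen q ^ Suc k * ?w - eigen q ^ k * ?w\<bar> = \<bar>eigen q ^ k\<bar> * (1 - eigen q) * \<bar>?w\<bar>"
  proof -
    have "eigen q ^ Suc k * ?w - eigen q ^ k * ?w = - (eigen q ^ k * (1 - eigen q) * ?w)" by (simp add: algebra_simps)
    then show ?thesis using eigen_bounds[of q] by (simp add: abs_mult)
  qed
  also have "\<dots> \<le> 1 * (rate q / Lam) * 1"
    using eigen_bounds[of q] rate_nonneg[of q] Lam_pos by (intro mult_mono ek wave_le_1) auto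
  also have "\<dots> \<le> ?L / Lam" using L Lam_pos by (simp add: divide_right_mono)
  finally show "\<bar>S1.pow (Suc k) (\<lambda>x. wave q \<theta> (loc N x)) x - S1.pow k (\<lambda>x. wave q \<theta> (loc N x)) x\<bar> \<le> ?L / Lam"
    unfolding pow_wave[OF x] .
qed

lemma abs_lin_le:
  fixes a b :: real
  assumes "\<bar>u - u'\<bar> \<le> X" "\<bar>w - w'\<bar> \<le> Y"
  shows "\<bar>(a * u + b * w) - (a * u' + b * w')\<bar> \<le> \<bar>a\<bar> * X + \<bar>b\<bar> * Y"
proof -
  have "\<bar>(a * u + b * w) - (a * u' + b * w')\<bar> = \<bar>a * (u - u') + b * (w - w')\<bar>" by (simp add: algebra_simps)
  also have "\<dots> \<le> \<bar>a\<bar> * \<bar>u - u'\<bar> + \<bar>b\<bar> * \<bar>w - w'\<bar>" by (metis abs_mult abs_triangle_ineq)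
  also have "\<dots> \<le> \<bar>a\<bar> * X + \<bar>b\<bar> * Y" using assms by (intro add_mono mult_left_mono) auto
  finally show ?thesis .
qed

lemma approx_lin:
  assumes f: "approx_at p v L" and g: "approx_at p' v' L'"
  shows "approx_at (\<lambda>x. a * p x + b * p' x) (\<lambda>x t. a * v x t + b * v' x t) (\<bar>a\<bar> * L + \<bar>b\<bar> * L')"
proof -
  have pw: "S1.pow k (\<lambda>x. a * p (loc N x) + b * p' (loc N x)) = (\<lambda>x. a * S1.pow k (\<lambda>x. p (loc N x)) x + b * S1.pow k (\<lambda>x. p' (loc N x)) x)" for k
    by (simp only: S1.pow_add S1.pow_scale)
  have d: "(\<bar>a\<bar> * L + \<bar>b\<bar> * L') / c = \<bar>a\<bar> * (L / c) + \<bar>b\<bar> * (L' / c)" for c by (simp add: add_divide_distrib)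
  have d2: "(\<bar>a\<bar> * L + \<bar>b\<bar> * L') * t / c = \<bar>a\<bar> * (L * t / c) + \<bar>b\<bar> * (L' * t / c)" for t c
    by (simp add: add_divide_distrib distrib_right)
  show ?thesis
    unfolding approx_at_def pw d d2 using f g unfolding approx_at_def
    by (intro allI ballI conjI abs_lin_le) blast+
qed

end

text \<open>The order of the quantifiers matters: \<open>v\<close> and \<open>L\<close> are chosen
  before the lattice size, and \<open>v\<close> serves all time horizons.\<close>

definition good :: "(real^'d::finite \<Rightarrow> real) \<Rightarrow> bool" where
  "good p \<longleftrightarrow> (\<exists>v L. 0 \<le> L \<and> (\<forall>T. heat_sol T p v) \<and> (\<forall>N\<ge>3. torus.approx_at N p v L))"

lemma good_lin:
  assumes "good p" "good p'" shows "good (\<lambda>x. a * p x + b * p' x)"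
proof -
  obtain v L v' L' where 1: "0 \<le> L" "\<And>T. heat_sol T p v" "\<And>N. N \<ge> 3 \<Longrightarrow> torus.approx_at N p v L"
    and 2: "0 \<le> L'" "\<And>T. heat_sol T p' v'" "\<And>N. N \<ge> 3 \<Longrightarrow> torus.approx_at N p' v' L'"
    using assms unfolding good_def by blast
  have "torus.approx_at N (\<lambda>x. a * p x + b * p' x) (\<lambda>x t. a * v x t + b * v' x t) (\<bar>a\<bar> * L + \<bar>b\<bar> * L')" if "N \<ge> 3" for N
    by (rule torus.approx_lin[OF torus.intro[OF that] 1(3)[OF that] 2(3)[OF that]])
  then show ?thesis unfolding good_def using 1 2 heat_sol_lin[OF 1(2) 2(2)]
    by (intro exI[of _ "\<lambda>x t. a * v x t + b * v' x t"] exI[of _ "\<bar>a\<bar> * L + \<bar>b\<bar> * L'"]) auto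
qed

lemma good_wave: "good (wave q \<theta>)"
proof -
  have "torus 3" by (rule torus.intro) simp
  have i: "torus.cubic q + rate q + (\<Sum>l\<in>UNIV. \<bar>2 * pi * of_int (q l)\<bar>) \<ge> 0"
    unfolding torus.cubic_def[OF \<open>torus 3\<close>] rate_def by (intro add_nonneg_nonneg mult_nonneg_nonneg divide_nonneg_nonneg sum_nonneg) auto
  show ?thesis unfolding good_def using i heat_wave_sol torus.approx_wave[OF torus.intro, of _ q \<theta>] by blast
qed

lemma trig_good: "trig p \<Longrightarrow> good p"
proof (induction rule: trig.induct)
  case (trig_wave c q \<theta>)
  then show ?case using good_lin[OF good_wave good_wave, of c q \<theta> 0 q \<theta>] by simp
next
  case (trig_add f g)
  then show ?case using good_lin[of f g 1 1] by simp
qed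

section \<open>The mean flux\<close>

lemma abs_mult_diff_le:
  fixes a b c d :: real
  assumes "\<bar>a - c\<bar> \<le> e" "\<bar>b - d\<bar> \<le> f" "\<bar>b\<bar> \<le> R" "\<bar>c\<bar> \<le> S"
  shows "\<bar>a * b - c * d\<bar> \<le> e * R + S * f"
proof -
  have "a * b - c * d = (a - c) * b + c * (b - d)" by (simp add: algebra_simps)
  then have "\<bar>a * b - c * d\<bar> \<le> \<bar>a - c\<bar> * \<bar>b\<bar> + \<bar>c\<bar> * \<bar>b - d\<bar>" by (metis abs_mult abs_triangle_ineq)
  also have "\<dots> \<le> e * R + S * f"
    using assms abs_ge_zero[of "a - c"] abs_ge_zero[of c] by (intro add_mono mult_mono) linarith+
  finally show ?thesis .
qed

context torus
begin

text \<open>With about \<open>Lam * T\<close> rings the square root becomes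
  \<open>card pairsN * N * sqrt (T * M)\<close>, and \<open>card pairsN * N\<close> is
  \<open>Lam / N\<close>.\<close>

lemma ret_bound_le:
  assumes K: "real K \<le> Lam * T" and M: "1 \<le> M"
  shows "ret_bound M K \<le> real N ^ CARD('d) * (Lam * (T / M + 2 * sqrt (T * M) / N))"
proof -
  have N0: "real N > 0" using N1 by simp
  have T0: "0 \<le> T" using K Lam_pos by (metis mult_less_cancel_left_pos mult_zero_right not_less of_nat_0_le_iff order_trans)
  have a: "real K / M \<le> Lam * T / M" using K by (intro divide_right_mono) auto
  have "sqrt (K * M * card pairsN) \<le> sqrt (Lam * T * M * card pairsN)"
    unfolding of_nat_mult by (rule real_sqrt_le_mono[OF mult_right_mono[OF mult_right_mono[OF K]]]) simp_all
  also have "\<dots> = sqrt ((real (card pairsN) * N)\<^sup>2 * (T * M))"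
    by (simp add: Lam_def power2_eq_square mult_ac)
  also have "\<dots> = card pairsN * N * sqrt (T * M)"
    by (simp add: real_sqrt_mult)
  also have "\<dots> = Lam * sqrt (T * M) / N"
    using N0 by (simp add: Lam_def power2_eq_square)
  finally have "2 * sqrt (K * M * card pairsN) \<le> 2 * (Lam * sqrt (T * M) / N)" by (rule mult_left_mono) simp
  also have "\<dots> = Lam * (2 * sqrt (T * M) / N)" by simp
  finally have b: "2 * sqrt (K * M * card pairsN) \<le> Lam * (2 * sqrt (T * M) / N)" .
  show ?thesis unfolding ret_bound_def distrib_left[of Lam]
    using a b by (intro mult_left_mono add_mono) auto
qed

definition tens :: "('d site \<Rightarrow> real) \<Rightarrow> 'd site \<times> 'd site \<Rightarrow> real" where
  "tens w p = w (fst p) * w (snd p)"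

text \<open>The route is from \<open>w\<close> via \<open>\<rho>0\<close> to \<open>p\<close> at
  time 0, from the discrete flow of \<open>p\<close> to \<open>v\<close>, and from \<open>v\<close>
  to \<open>\<rho>\<close>. The initial approximation of \<open>\<rho>0\<close> by \<open>p\<close>
  is paid twice, since both flows contract the sup norm.\<close>

lemma pow_close:
  assumes T: "T > 0" and ap: "approx_at p v L" and L: "0 \<le> L"
    and \<rho>: "heat_sol T \<rho>0 \<rho>" and v: "heat_sol T p v"
    and p: "\<And>x. \<bar>\<rho>0 x - p x\<bar> \<le> \<delta>" and w: "\<And>x. x \<in> sitesN \<Longrightarrow> \<bar>w x - \<rho>0 (loc N x)\<bar> \<le> \<delta>'"
    and k: "real k \<le> Lam * T" and x: "x \<in> sitesN"
  shows "\<bar>S1.pow k w x - \<rho> (loc N x) (k / Lam)\<bar> \<le> 2 * \<delta> + \<delta>' + L * T / N"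
proof -
  have kT: "k / Lam \<le> T" using k Lam_pos by (simp add: pos_divide_le_eq mult.commute)
  have "\<bar>w x - p (loc N x)\<bar> \<le> \<delta> + \<delta>'" if "x \<in> sitesN" for x
    using w[OF that] p[of "loc N x"] by linarith
  then have 1: "\<bar>S1.pow k w x - S1.pow k (\<lambda>x. p (loc N x)) x\<bar> \<le> \<delta> + \<delta>'"
    using x by (intro S1.pow_abs_diff_le) auto
  have 2: "\<bar>S1.pow k (\<lambda>x. p (loc N x)) x - v (loc N x) (k / Lam)\<bar> \<le> L * (k / Lam) / N"
    using ap x unfolding approx_at_def by blast
  also have "\<dots> \<le> L * T / N" using kT L by (intro divide_right_mono mult_left_mono) auto
  finally have 2: "\<bar>S1.pow k (\<lambda>x. p (loc N x)) x - v (loc N x) (k / Lam)\<bar> \<le> L * T / N" .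
  have 3: "\<bar>\<rho> (loc N x) (k / Lam) - v (loc N x) (k / Lam)\<bar> \<le> \<delta>"
    using kT Lam_pos by (intro heat_sol_close[OF T \<rho> v p]) simp
  show ?thesis using 1 2 3 by linarith
qed

text \<open>No gradient bound is available for \<open>w\<close>. It is replaced by \<open>p\<close>
  in the pair flow and in the product of flows, at cost \<open>\<gamma> * (2 * R + 1)\<close> each,
  and \<open>product_error_sum\<close> is applied to \<open>p\<close>.\<close>

lemma tens_close:
  fixes L T :: real
  assumes ap: "approx_at p v L" and L: "0 \<le> L"
    and w: "\<And>x. x \<in> sitesN \<Longrightarrow> \<bar>w x - p (loc N x)\<bar> \<le> \<gamma>" and \<gamma>: "\<gamma> \<le> 1" and R: "\<And>x. x \<in> sitesN \<Longrightarrow> \<bar>w x\<bar> \<le> R"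
    and K: "real K \<le> Lam * T" and M: "1 \<le> M" "M < N"
  shows "(\<Sum>k<K. \<Sum>x\<in>sitesN. \<bar>S2.pow k (tens w) (x, shift N l s x) - S1.pow k w x * S1.pow k w (shift N l s x)\<bar>)
     \<le> real N ^ CARD('d) * Lam * T * (2 * \<gamma> * (2 * R + 1) + 2 * real CARD('d) * L\<^sup>2 * (T / M + 2 * sqrt (T * M) / N) + T * L\<^sup>2 / N)"
proof -
  let ?P = "\<lambda>x. p (loc N x)" let ?sh = "shift N l s"
  have g0: "0 \<le> \<gamma>" and R0: "0 \<le> R"
  proof -
    have "(\<lambda>_. 0) \<in> sitesN" using N1 by (simp add: sites_def)
    from w[OF this] R[OF this] show "0 \<le> \<gamma>" "0 \<le> R" by linarith+
  qed
  have N0: "real N > 0" using N1 by simp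
  have T0: "0 \<le> T" using K Lam_pos by (metis mult_less_cancel_left_pos mult_zero_right not_less of_nat_0_le_iff order_trans)
  have PR: "\<bar>?P x\<bar> \<le> R + 1" if "x \<in> sitesN" for x using w[OF that] R[OF that] \<gamma> by linarith
  let ?b = "\<gamma> * (2 * R + 1)"
  have be: "\<gamma> * R + (R + 1) * \<gamma> = ?b" by (simp add: algebra_simps)
  have sh: "?sh x \<in> sitesN" if "x \<in> sitesN" for x using that by (rule shift_sites[OF N1])
  have pt: "\<bar>S2.pow k (tens w) (x, ?sh x) - S1.pow k w x * S1.pow k w (?sh x)\<bar> \<le>
      2 * ?b + \<bar>S2.pow k (\<lambda>p. ?P (fst p) * ?P (snd p)) (x, ?sh x) - S1.pow k ?P x * S1.pow k ?P (?sh x)\<bar>" if x: "x \<in> sitesN" for k x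
  proof -
    have 1: "\<bar>S2.pow k (tens w) (x, ?sh x) - S2.pow k (\<lambda>p. ?P (fst p) * ?P (snd p)) (x, ?sh x)\<bar> \<le> ?b"
    proof (rule S2.pow_abs_diff_le)
      fix q :: "'d site \<times> 'd site" assume "q \<in> sitesN \<times> sitesN"
      then have q: "fst q \<in> sitesN" "snd q \<in> sitesN" by auto
      have "\<bar>w (fst q) * w (snd q) - ?P (fst q) * ?P (snd q)\<bar> \<le> \<gamma> * R + (R + 1) * \<gamma>"
        using q by (intro abs_mult_diff_le w R PR)
      then show "\<bar>tens w q - ?P (fst q) * ?P (snd q)\<bar> \<le> ?b" unfolding be tens_def .
    qed (use x sh in auto)
    have pw: "\<bar>S1.pow k w z - S1.pow k ?P z\<bar> \<le> \<gamma>" if "z \<in> sitesN" for z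
      using that by (intro S1.pow_abs_diff_le w)
    have pb: "\<bar>S1.pow k f z\<bar> \<le> c" if "z \<in> sitesN" "\<And>x. x \<in> sitesN \<Longrightarrow> \<bar>f x\<bar> \<le> c" for f c z
      using S1.pow_abs_diff_le[of f "\<lambda>_. 0" c z k] that by (simp add: S1.pow_const)
    have "\<bar>S1.pow k w x * S1.pow k w (?sh x) - S1.pow k ?P x * S1.pow k ?P (?sh x)\<bar> \<le> \<gamma> * R + (R + 1) * \<gamma>"
      using x by (intro abs_mult_diff_le pw pb R PR sh)
    then have 2: "\<bar>S1.pow k w x * S1.pow k w (?sh x) - S1.pow k ?P x * S1.pow k ?P (?sh x)\<bar> \<le> ?b" unfolding be .
    show ?thesis using 1 2 by linarith
  qed
  have gr: "\<bar>S1.pow k ?P (shift N l s x) - S1.pow k ?P x\<bar> \<le> L / N" "\<bar>S1.pow (Suc k) ?P x - S1.pow k ?P x\<bar> \<le> L / Lam"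
    if "x \<in> sitesN" for x k l s using ap that unfolding approx_at_def by blast+
  have "(\<Sum>k<K. \<Sum>x\<in>sitesN. \<bar>S2.pow k (tens w) (x, ?sh x) - S1.pow k w x * S1.pow k w (?sh x)\<bar>)
    \<le> (\<Sum>k<K. \<Sum>x\<in>sitesN. 2 * ?b + \<bar>S2.pow k (\<lambda>p. ?P (fst p) * ?P (snd p)) (x, ?sh x) - S1.pow k ?P x * S1.pow k ?P (?sh x)\<bar>)"
    by (intro sum_mono pt)
  also have "\<dots> = K * (real N ^ CARD('d) * (2 * ?b)) + (\<Sum>k<K. \<Sum>x\<in>sitesN. \<bar>S2.pow k (\<lambda>p. ?P (fst p) * ?P (snd p)) (x, ?sh x) - S1.pow k ?P x * S1.pow k ?P (?sh x)\<bar>)"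
    by (simp only: sum.distrib sum_constant card_sites card_lessThan of_nat_power)
  also have "\<dots> \<le> K * (real N ^ CARD('d) * (2 * ?b)) + K * ((L / N)\<^sup>2 / card pairsN * (2 * real CARD('d) * ret_bound M K) + real N ^ CARD('d) * K * (L / Lam)\<^sup>2)"
    using product_error_sum[where w="?P", OF gr(1) gr(2) M] by (simp only: of_nat_mult of_nat_numeral add_le_cancel_left)
  also have "\<dots> = K * (real N ^ CARD('d) * (2 * ?b) + ((L / N)\<^sup>2 / card pairsN * (2 * real CARD('d) * ret_bound M K) + real N ^ CARD('d) * K * (L / Lam)\<^sup>2))"
    by (simp only: distrib_left)
  also have "\<dots> \<le> (Lam * T) * (real N ^ CARD('d) * (2 * ?b) + (real N ^ CARD('d) * (2 * real CARD('d) * L\<^sup>2 * (T / M + 2 * sqrt (T * M) / N)) + real N ^ CARD('d) * (T * L\<^sup>2 / N)))"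
  proof (rule mult_mono[OF K], rule add_mono[OF order_refl], rule add_mono)
    have "(L / N)\<^sup>2 / card pairsN * (2 * real CARD('d) * ret_bound M K) \<le> (L / N)\<^sup>2 / card pairsN * (2 * real CARD('d) * (real N ^ CARD('d) * (Lam * (T / M + 2 * sqrt (T * M) / N))))"
      using ret_bound_le[OF K M(1)] by (intro mult_left_mono) auto
    also have "\<dots> = real N ^ CARD('d) * (2 * real CARD('d) * L\<^sup>2 * (T / M + 2 * sqrt (T * M) / N))"
    proof -
      have "(L / n)\<^sup>2 / c * (2 * d * (w * (c * n\<^sup>2 * y))) = w * (2 * d * L\<^sup>2 * y)" if "n > 0" "c > 0" for n c d w y :: real
        using that by (simp add: power_divide)
      from this[OF N0 S1.cardC] show ?thesis unfolding Lam_def .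
    qed
    finally show "(L / N)\<^sup>2 / card pairsN * (2 * real CARD('d) * ret_bound M K) \<le> real N ^ CARD('d) * (2 * real CARD('d) * L\<^sup>2 * (T / M + 2 * sqrt (T * M) / N))" .
    have "K * (L / Lam)\<^sup>2 \<le> (Lam * T) * (L / Lam)\<^sup>2" using K by (intro mult_right_mono) auto
    also have "\<dots> = T * L\<^sup>2 / Lam" using Lam_pos by (simp add: power2_eq_square)
    also have "\<dots> \<le> T * L\<^sup>2 / N" using T0 Lam_ge N0 by (intro divide_left_mono) (auto intro: mult_pos_pos Lam_pos)
    finally have "real N ^ CARD('d) * (K * (L / Lam)\<^sup>2) \<le> real N ^ CARD('d) * (T * L\<^sup>2 / N)"
      by (intro mult_left_mono) auto
    then show "real N ^ CARD('d) * K * (L / Lam)\<^sup>2 \<le> real N ^ CARD('d) * (T * L\<^sup>2 / N)" by (simp only: mult.assoc)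
    show "0 \<le> Lam * T" using T0 Lam_pos by simp
    have "0 \<le> real K / real M" by simp
    show "0 \<le> real N ^ CARD('d) * (2 * ?b) + ((L / N)\<^sup>2 / card pairsN * (2 * real CARD('d) * ret_bound M K) + real N ^ CARD('d) * K * (L / Lam)\<^sup>2)"
      unfolding ret_bound_def using g0 R0 by (intro add_nonneg_nonneg mult_nonneg_nonneg) auto
  qed
  also have "\<dots> = real N ^ CARD('d) * Lam * T * (2 * \<gamma> * (2 * R + 1) + 2 * real CARD('d) * L\<^sup>2 * (T / M + 2 * sqrt (T * M) / N) + T * L\<^sup>2 / N)"
  proof -
    have "(c * t) * (w * (2 * (g * r)) + (w * a + w * b)) = w * c * t * (2 * g * r + a + b)" for c t w g r a b :: real
      by (simp add: algebra_simps)
    then show ?thesis .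
  qed
  finally show ?thesis .
qed

text \<open>The normalization is the volume of a space-time cell: one ring and one site.\<close>

definition riem :: "nat \<Rightarrow> ('d site \<Rightarrow> nat \<Rightarrow> real) \<Rightarrow> real" where
  "riem K f = (\<Sum>k<K. \<Sum>x\<in>sitesN. f x k) / (Lam * real N ^ CARD('d))"

lemma riem_diff_le:
  assumes "\<And>x k. x \<in> sitesN \<Longrightarrow> k < K \<Longrightarrow> \<bar>f x k - g x k\<bar> \<le> e" and K: "real K \<le> Lam * T" and e: "0 \<le> e"
  shows "\<bar>riem K f - riem K g\<bar> \<le> T * e"
proof -
  have W: "Lam * real N ^ CARD('d) > 0" using Lam_pos N1 by simp
  have "\<bar>(\<Sum>k<K. \<Sum>x\<in>sitesN. f x k) - (\<Sum>k<K. \<Sum>x\<in>sitesN. g x k)\<bar> = \<bar>\<Sum>k<K. \<Sum>x\<in>sitesN. f x k - g x k\<bar>"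
    by (simp add: sum_subtractf)
  also have "\<dots> \<le> (\<Sum>k<K. \<Sum>x\<in>sitesN. e)"
    using assms(1) by (intro order_trans[OF sum_abs] sum_mono) auto
  also have "\<dots> = K * (real N ^ CARD('d) * e)" by (simp add: card_sites)
  also have "\<dots> \<le> (Lam * T) * (real N ^ CARD('d) * e)" using K e by (intro mult_right_mono) auto
  finally have "\<bar>(\<Sum>k<K. \<Sum>x\<in>sitesN. f x k) - (\<Sum>k<K. \<Sum>x\<in>sitesN. g x k)\<bar> \<le> (T * e) * (Lam * real N ^ CARD('d))"
    by (simp add: mult_ac)
  then have "\<bar>(\<Sum>k<K. \<Sum>x\<in>sitesN. f x k) - (\<Sum>k<K. \<Sum>x\<in>sitesN. g x k)\<bar> / (Lam * real N ^ CARD('d)) \<le> T * e"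
    using W by (simp only: pos_divide_le_eq)
  moreover have "riem K f - riem K g = ((\<Sum>k<K. \<Sum>x\<in>sitesN. f x k) - (\<Sum>k<K. \<Sum>x\<in>sitesN. g x k)) / (Lam * real N ^ CARD('d))"
    by (simp add: riem_def diff_divide_distrib)
  ultimately show ?thesis using W by (simp add: abs_divide)
qed

text \<open>The one-site flows are compared with the limit pointwise. The pair flow is compared with
  the product of flows only in the sum over sites and rings, because the return estimate controls
  nothing but this sum.\<close>

lemma mean_close:
  fixes L T :: real
  assumes T: "T > 0" and ap: "approx_at p v L" and L: "0 \<le> L"
    and \<rho>: "heat_sol T \<rho>0 \<rho>" and v: "heat_sol T p v"
    and p: "\<And>x. \<bar>\<rho>0 x - p x\<bar> \<le> \<delta>" and w: "\<And>x. x \<in> sitesN \<Longrightarrow> \<bar>w x - \<rho>0 (loc N x)\<bar> \<le> \<delta>'"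
    and R: "\<And>x. x \<in> sitesN \<Longrightarrow> \<bar>w x\<bar> \<le> R" and \<delta>: "\<delta> + \<delta>' \<le> 1"
    and \<rho>R: "\<And>x t. t \<in> {0..T} \<Longrightarrow> \<bar>\<rho> x t\<bar> \<le> R"
    and \<phi>: "\<And>x. x \<in> sitesN \<Longrightarrow> 0 \<le> \<phi> x \<and> \<phi> x \<le> B"
    and K: "real K \<le> Lam * T" and M: "1 \<le> M" "M < N" and c: "0 \<le> c"
  shows "\<bar>riem K (\<lambda>x k. \<phi> x * (S1.pow k w x - c * S2.pow k (tens w) (x, shift N l s x)))
     - riem K (\<lambda>x k. \<phi> x * (\<rho> (loc N x) (k / Lam) - c * (\<rho> (loc N x) (k / Lam))\<^sup>2))\<bar>
   \<le> T * (B * ((2 * \<delta> + \<delta>' + L * T / N) * (1 + 2 * c * R) + c * R * (2 * (\<delta> + \<delta>') + L / N)))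
     + T * (B * c * (2 * (\<delta> + \<delta>') * (2 * R + 1) + 2 * real CARD('d) * L\<^sup>2 * (T / M + 2 * sqrt (T * M) / N) + T * L\<^sup>2 / N))"
proof -
  let ?sh = "shift N l s"
  have z: "(\<lambda>_. 0) \<in> sitesN" using N1 by (simp add: sites_def)
  have B0: "0 \<le> B" using \<phi>[OF z] by linarith
  have d0: "0 \<le> \<delta>" "0 \<le> \<delta>'" using p[of 0] w[OF z] by linarith+
  have R0: "0 \<le> R" using R[OF z] by linarith
  have N0: "real N > 0" using N1 by simp
  have W: "Lam * real N ^ CARD('d) > 0" using Lam_pos N1 by simp
  have sh: "?sh x \<in> sitesN" if "x \<in> sitesN" for x using that by (rule shift_sites[OF N1])
  let ?a = "2 * \<delta> + \<delta>' + L * T / N" let ?b = "2 * (\<delta> + \<delta>') + L / N"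
  have a0: "0 \<le> ?a" "0 \<le> ?b" using d0 L T by auto
  have wp: "\<bar>w x - p (loc N x)\<bar> \<le> \<delta> + \<delta>'" if "x \<in> sitesN" for x
    using w[OF that] p[of "loc N x"] by linarith
  let ?f = "\<lambda>x k. \<phi> x * (S1.pow k w x - c * S2.pow k (tens w) (x, ?sh x))"
  let ?g = "\<lambda>x k. \<phi> x * (S1.pow k w x - c * (S1.pow k w x * S1.pow k w (?sh x)))"
  let ?h = "\<lambda>x k. \<phi> x * (\<rho> (loc N x) (k / Lam) - c * (\<rho> (loc N x) (k / Lam))\<^sup>2)"
  have 1: "\<bar>riem K ?g - riem K ?h\<bar> \<le> T * (B * (?a * (1 + 2 * c * R) + c * R * ?b))"
  proof (rule riem_diff_le[OF _ K])
    fix x k assume x: "x \<in> sitesN" and k: "k < K"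
    have kL: "real k \<le> Lam * T" using k K by linarith
    then have kT: "k / Lam \<in> {0..T}" using Lam_pos by (simp add: pos_divide_le_eq mult.commute)
    let ?r = "\<rho> (loc N x) (k / Lam)"
    have 1: "\<bar>S1.pow k w x - ?r\<bar> \<le> ?a" by (rule pow_close[OF T ap L \<rho> v p w kL x])
    have pb: "\<bar>S1.pow k w z\<bar> \<le> R" if "z \<in> sitesN" for z
      using S1.pow_abs_diff_le[of w "\<lambda>_. 0" R z k] that R by (simp add: S1.pow_const)
    have pp: "\<bar>S1.pow k w z - S1.pow k (\<lambda>x. p (loc N x)) z\<bar> \<le> \<delta> + \<delta>'" if "z \<in> sitesN" for z
      using that wp by (intro S1.pow_abs_diff_le)
    have "\<bar>S1.pow k (\<lambda>x. p (loc N x)) (?sh x) - S1.pow k (\<lambda>x. p (loc N x)) x\<bar> \<le> L / N"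
      using ap x unfolding approx_at_def by blast
    \<comment> \<open>The limit is evaluated at \<open>x\<close> also for the neighbour: pass to
      \<open>p\<close> at both ends, at cost \<open>\<delta> + \<delta>'\<close> each, and use the
      lattice gradient of its flow.\<close>
    then have 2: "\<bar>S1.pow k w (?sh x) - ?r\<bar> \<le> ?a + ?b"
      using 1 pp[OF x] pp[OF sh[OF x]] by (smt (verit))
    have 3: "\<bar>S1.pow k w x * S1.pow k w (?sh x) - ?r * ?r\<bar> \<le> ?a * R + R * (?a + ?b)"
      by (rule abs_mult_diff_le[OF 1 2 pb[OF sh[OF x]] \<rho>R[OF kT]])
    have "\<bar>(S1.pow k w x - c * (S1.pow k w x * S1.pow k w (?sh x))) - (?r - c * ?r\<^sup>2)\<bar>
       = \<bar>(S1.pow k w x - ?r) - c * (S1.pow k w x * S1.pow k w (?sh x) - ?r * ?r)\<bar>"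
      by (simp add: power2_eq_square algebra_simps)
    also have "\<dots> \<le> \<bar>S1.pow k w x - ?r\<bar> + c * \<bar>S1.pow k w x * S1.pow k w (?sh x) - ?r * ?r\<bar>"
      using c by (intro order_trans[OF abs_triangle_ineq4]) (simp add: abs_mult)
    also have "\<dots> \<le> ?a + c * (?a * R + R * (?a + ?b))"
      using c by (intro add_mono mult_left_mono 1 3)
    also have "\<dots> = ?a * (1 + 2 * c * R) + c * R * ?b"
    proof -
      have "a + c * (a * R + R * (a + b)) = a * (1 + 2 * c * R) + c * R * b" for a b by (simp add: algebra_simps)
      then show ?thesis .
    qed
    finally have 4: "\<bar>(S1.pow k w x - c * (S1.pow k w x * S1.pow k w (?sh x))) - (?r - c * ?r\<^sup>2)\<bar> \<le> ?a * (1 + 2 * c * R) + c * R * ?b" .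
    have "\<bar>?g x k - ?h x k\<bar> = \<phi> x * \<bar>(S1.pow k w x - c * (S1.pow k w x * S1.pow k w (?sh x))) - (?r - c * ?r\<^sup>2)\<bar>"
      using \<phi>[OF x] by (simp only: right_diff_distrib[symmetric] abs_mult) simp
    also have "\<dots> \<le> B * (?a * (1 + 2 * c * R) + c * R * ?b)"
      using \<phi>[OF x] 4 B0 by (intro mult_mono) auto
    finally show "\<bar>?g x k - ?h x k\<bar> \<le> B * (?a * (1 + 2 * c * R) + c * R * ?b)" .
  next
    show "0 \<le> B * (?a * (1 + 2 * c * R) + c * R * ?b)"
      by (rule mult_nonneg_nonneg[OF B0 add_nonneg_nonneg[OF mult_nonneg_nonneg[OF a0(1)] mult_nonneg_nonneg[OF _ a0(2)]]]) (use c R0 in auto)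
  qed
  let ?E = "2 * (\<delta> + \<delta>') * (2 * R + 1) + 2 * real CARD('d) * L\<^sup>2 * (T / M + 2 * sqrt (T * M) / N) + T * L\<^sup>2 / N"
  have S: "(\<Sum>k<K. \<Sum>x\<in>sitesN. \<bar>S2.pow k (tens w) (x, ?sh x) - S1.pow k w x * S1.pow k w (?sh x)\<bar>)
     \<le> real N ^ CARD('d) * Lam * T * ?E"
    by (rule tens_close[OF ap L wp \<delta> R K M])
  have "\<bar>(\<Sum>k<K. \<Sum>x\<in>sitesN. ?f x k) - (\<Sum>k<K. \<Sum>x\<in>sitesN. ?g x k)\<bar> = \<bar>\<Sum>k<K. \<Sum>x\<in>sitesN. ?f x k - ?g x k\<bar>"
    by (simp add: sum_subtractf)
  also have "\<dots> \<le> (\<Sum>k<K. \<Sum>x\<in>sitesN. \<bar>?f x k - ?g x k\<bar>)"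
    by (intro order_trans[OF sum_abs] sum_mono order_refl)
  also have "\<dots> \<le> (\<Sum>k<K. \<Sum>x\<in>sitesN. (B * c) * \<bar>S2.pow k (tens w) (x, ?sh x) - S1.pow k w x * S1.pow k w (?sh x)\<bar>)"
  proof (intro sum_mono)
    fix k x assume x: "x \<in> sitesN"
    have "\<bar>?f x k - ?g x k\<bar> = (\<phi> x * c) * \<bar>S2.pow k (tens w) (x, ?sh x) - S1.pow k w x * S1.pow k w (?sh x)\<bar>"
    proof -
      have "?f x k - ?g x k = - ((\<phi> x * c) * (S2.pow k (tens w) (x, ?sh x) - S1.pow k w x * S1.pow k w (?sh x)))"
        by (simp add: algebra_simps)
      then show ?thesis using \<phi>[OF x] c by (simp add: abs_mult)
    qed
    also have "\<dots> \<le> (B * c) * \<bar>S2.pow k (tens w) (x, ?sh x) - S1.pow k w x * S1.pow k w (?sh x)\<bar>"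
      using \<phi>[OF x] c by (intro mult_right_mono) auto
    finally show "\<bar>?f x k - ?g x k\<bar> \<le> (B * c) * \<bar>S2.pow k (tens w) (x, ?sh x) - S1.pow k w x * S1.pow k w (?sh x)\<bar>" .
  qed
  also have "\<dots> = (B * c) * (\<Sum>k<K. \<Sum>x\<in>sitesN. \<bar>S2.pow k (tens w) (x, ?sh x) - S1.pow k w x * S1.pow k w (?sh x)\<bar>)"
    by (simp only: sum_distrib_left)
  also have "\<dots> \<le> (B * c) * (real N ^ CARD('d) * Lam * T * ?E)"
    using B0 c by (intro mult_left_mono S) auto
  also have "\<dots> = (T * (B * c * ?E)) * (Lam * real N ^ CARD('d))" by (simp only: mult_ac)
  finally have "\<bar>(\<Sum>k<K. \<Sum>x\<in>sitesN. ?f x k) - (\<Sum>k<K. \<Sum>x\<in>sitesN. ?g x k)\<bar> \<le> (T * (B * c * ?E)) * (Lam * real N ^ CARD('d))" .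
  then have "\<bar>(\<Sum>k<K. \<Sum>x\<in>sitesN. ?f x k) - (\<Sum>k<K. \<Sum>x\<in>sitesN. ?g x k)\<bar> / (Lam * real N ^ CARD('d)) \<le> T * (B * c * ?E)"
    using W by (simp only: pos_divide_le_eq)
  moreover have "riem K ?f - riem K ?g = ((\<Sum>k<K. \<Sum>x\<in>sitesN. ?f x k) - (\<Sum>k<K. \<Sum>x\<in>sitesN. ?g x k)) / (Lam * real N ^ CARD('d))"
    by (simp add: riem_def diff_divide_distrib)
  ultimately have 2: "\<bar>riem K ?f - riem K ?g\<bar> \<le> T * (B * c * ?E)"
    using W by (simp only: abs_divide abs_of_pos)
  show ?thesis using 1 2 by linarith
qed

end

section \<open>Riemann sums\<close>

text \<open>Both points are translated by the same integer vector, which takes the first into the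
  unit cube; the second then lies in a fixed larger ball. Reducing each point separately would lose
  closeness across the boundary of the cube.\<close>

lemma periodic_uniform:
  fixes g :: "real^'d::finite \<Rightarrow> real \<Rightarrow> real"
  assumes c: "continuous_on (UNIV \<times> {0..T}) (\<lambda>(x, t). g x t)" and per: "\<And>t. periodic_fun (\<lambda>x. g x t)"
  shows "\<exists>R\<ge>0. \<forall>x. \<forall>t\<in>{0..T}. \<bar>g x t\<bar> \<le> R"
    and "e > 0 \<Longrightarrow> \<exists>\<delta>>0. \<forall>x y. \<forall>s\<in>{0..T}. \<forall>t\<in>{0..T}. dist x y < \<delta> \<longrightarrow> \<bar>s - t\<bar> < \<delta> \<longrightarrow> \<bar>g x s - g y t\<bar> < e"
proof -
  let ?Q = "cball (0 :: real^'d) (norm (One :: real^'d) + 1)"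
  have K: "compact (?Q \<times> {0..T})" by (intro compact_Times compact_cball compact_Icc)
  have cK: "continuous_on (?Q \<times> {0..T}) (\<lambda>(x, t). g x t)" by (rule continuous_on_subset[OF c]) auto
  have fQ: "norm (frac_vec x) \<le> norm (One :: real^'d)" for x :: "real^'d"
  proof (rule norm_le_componentwise_cart)
    fix i show "norm (frac_vec x $ i) \<le> norm ((One :: real^'d) $ i)"
      using frac_lt_1[of "x $ i"] by (simp add: frac_vec_def less_imp_le del: sum_component)
  qed
  have "bounded ((\<lambda>(x, t). g x t) ` (?Q \<times> {0..T}))"
    by (intro compact_imp_bounded compact_continuous_image cK K)
  then obtain R where R: "\<And>x t. x \<in> ?Q \<Longrightarrow> t \<in> {0..T} \<Longrightarrow> \<bar>g x t\<bar> \<le> R"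
    unfolding bounded_iff by fastforce
  have "\<bar>g x t\<bar> \<le> max R 0" if "t \<in> {0..T}" for x t
    using R[of "frac_vec x" t] fQ[of x] that periodic_frac[OF per[of t], of x] by simp
  then show "\<exists>R\<ge>0. \<forall>x. \<forall>t\<in>{0..T}. \<bar>g x t\<bar> \<le> R" by (intro exI[of _ "max R 0"]) auto
  assume e: "e > 0"
  have "uniformly_continuous_on (?Q \<times> {0..T}) (\<lambda>(x, t). g x t)"
    by (rule compact_uniformly_continuous[OF cK K])
  then obtain d where d: "d > 0" "\<And>p p'. p \<in> ?Q \<times> {0..T} \<Longrightarrow> p' \<in> ?Q \<times> {0..T} \<Longrightarrow> dist p p' < d \<Longrightarrow>
      dist ((\<lambda>(x, t). g x t) p) ((\<lambda>(x, t). g x t) p') < e"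
    unfolding uniformly_continuous_on_def using e by metis
  show "\<exists>\<delta>>0. \<forall>x y. \<forall>s\<in>{0..T}. \<forall>t\<in>{0..T}. dist x y < \<delta> \<longrightarrow> \<bar>s - t\<bar> < \<delta> \<longrightarrow> \<bar>g x s - g y t\<bar> < e"
  proof (intro exI[of _ "min (d / 2) 1"] conjI allI ballI impI)
    show "0 < min (d / 2) 1" using d by simp
    fix x y :: "real^'d" and s t :: real assume st: "s \<in> {0..T}" "t \<in> {0..T}" and xy: "dist x y < min (d / 2) 1" and st': "\<bar>s - t\<bar> < min (d / 2) 1"
    define m where "m i = - \<lfloor>x $ i\<rfloor>" for i
    let ?m = "\<chi> i. real_of_int (m i)"
    have x': "x + ?m = frac_vec x" by (simp add: vec_eq_iff m_def frac_vec_def frac_def)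
    have "dist (x + ?m) (y + ?m) = dist x y" by (simp add: dist_norm)
    then have dxy: "dist (frac_vec x) (y + ?m) < d / 2" "dist (frac_vec x) (y + ?m) < 1" using xy x' by auto
    have "norm (y + ?m) \<le> norm (frac_vec x) + dist (frac_vec x) (y + ?m)"
      by (metis add.commute dist_commute dist_norm norm_triangle_sub)
    then have q: "(frac_vec x, s) \<in> ?Q \<times> {0..T}" "(y + ?m, t) \<in> ?Q \<times> {0..T}"
      using fQ[of x] dxy(2) st by auto
    have "dist (frac_vec x, s) (y + ?m, t) \<le> dist (frac_vec x) (y + ?m) + dist s t"
      unfolding dist_prod_def by (simp add: sqrt_sum_squares_le_sum)
    also have "\<dots> < d" using dxy st' by (simp add: dist_real_def)
    finally have "\<bar>g (frac_vec x) s - g (y + ?m) t\<bar> < e"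
      using d(2)[OF q] by (simp add: dist_real_def)
    then show "\<bar>g x s - g y t\<bar> < e"
      using periodic_frac[OF per[of s], of x] periodic_int_vec[OF per[of t], of y m] by simp
  qed
qed

lemma periodic_uniform1:
  fixes f :: "real^'d::finite \<Rightarrow> real"
  assumes c: "continuous_on UNIV f" and per: "periodic_fun f"
  shows "\<exists>R\<ge>0. \<forall>x. \<bar>f x\<bar> \<le> R" and "e > 0 \<Longrightarrow> \<exists>\<delta>>0. \<forall>x y. dist x y < \<delta> \<longrightarrow> \<bar>f x - f y\<bar> < e"
proof -
  have c2: "continuous_on (UNIV \<times> {0..0::real}) (\<lambda>(x, t). f x)"
    unfolding case_prod_unfold by (intro continuous_on_compose2[OF c] continuous_intros) auto
  show "\<exists>R\<ge>0. \<forall>x. \<bar>f x\<bar> \<le> R" using periodic_uniform(1)[OF c2] per by auto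
  show "e > 0 \<Longrightarrow> \<exists>\<delta>>0. \<forall>x y. dist x y < \<delta> \<longrightarrow> \<bar>f x - f y\<bar> < e" using periodic_uniform(2)[OF c2] per by fastforce
qed

definition cell :: "real^'d::finite \<Rightarrow> real \<Rightarrow> (real^'d) set" where
  "cell a h = cbox a (a + h *\<^sub>R One)"

lemma mem_cell: "y \<in> cell a h \<longleftrightarrow> (\<forall>i. a $ i \<le> y $ i \<and> y $ i \<le> a $ i + h)"
  unfolding cell_def mem_box_cart vector_add_component vector_scaleR_component One_component by simp

lemma content_cell: "0 \<le> h \<Longrightarrow> measure lborel (cell a h) = h ^ CARD('d)" for a :: "real^'d::finite"
proof -
  assume h: "0 \<le> h"
  then have "cell a h \<noteq> {}" using mem_cell[of a a h] by auto
  then show ?thesis unfolding cell_def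
    by (subst content_cbox_cart) (auto simp del: sum_component)
qed

lemma cell_dist: "y \<in> cell a h \<Longrightarrow> z \<in> cell a h \<Longrightarrow> dist y z \<le> real CARD('d) * h" for a :: "real^'d::finite"
proof -
  assume "y \<in> cell a h" "z \<in> cell a h"
  then have "\<bar>(y - z) $ i\<bar> \<le> h" for i unfolding mem_cell by (auto simp: abs_le_iff dest!: spec[of _ i])
  then have "norm (y - z) \<le> (\<Sum>i\<in>(UNIV::'d set). h)"
    by (intro order_trans[OF norm_le_l1_cart] sum_mono)
  then show ?thesis by (simp add: dist_norm)
qed

lemma cell_integral:
  fixes f :: "real^'d::finite \<Rightarrow> real"
  assumes f: "continuous_on UNIV f" and h: "0 \<le> h" and e: "0 \<le> e"
    and le: "\<And>y. y \<in> cell a h \<Longrightarrow> \<bar>f y - v\<bar> \<le> e"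
  shows "\<bar>integral (cell a h) f - h ^ CARD('d) * v\<bar> \<le> e * h ^ CARD('d)"
proof -
  have fi: "f integrable_on cell a h" unfolding cell_def
    by (intro integrable_continuous continuous_on_subset[OF f]) auto
  have "integral (cell a h) (\<lambda>y. f y - v) = integral (cell a h) f - h ^ CARD('d) * v"
    using fi content_cell[OF h, of a] unfolding cell_def by (subst integral_diff) (auto simp: integral_const_real)
  moreover have "norm (integral (cell a h) (\<lambda>y. f y - v)) \<le> e * measure lborel (cell a h)"
    unfolding cell_def
    by (rule has_integral_bound[OF e integrable_integral]) (use le fi in \<open>auto simp: cell_def intro: integrable_diff\<close>)
  ultimately show ?thesis by (simp add: content_cell[OF h])
qed

lemma space_riemann:
  fixes f :: "real^'d::finite \<Rightarrow> real"
  assumes f: "continuous_on UNIV f" and N: "N \<ge> 1" and e: "0 \<le> e"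
    and le: "\<And>x y. dist x y \<le> real CARD('d) / N \<Longrightarrow> \<bar>f x - f y\<bar> \<le> e"
  shows "\<bar>(\<Sum>x\<in>sites N. f (loc N x)) / real N ^ CARD('d) - integral ucube f\<bar> \<le> e"
proof -
  have N0: "real N > 0" using N by simp
  let ?h = "1 / real N"
  let ?c = "\<lambda>x. cell (loc N x) ?h :: (real^'d) set"
  have lc: "loc N x $ i = x i / N" for x and i :: 'd by (simp add: loc_def)
  have un: "(\<Union>x\<in>sites N. ?c x) = ucube"
  proof (intro set_eqI iffI)
    fix y assume "y \<in> (\<Union>x\<in>sites N. ?c x)"
    then obtain x where x: "x \<in> sites N" "y \<in> ?c x" by blast
    show "y \<in> ucube" unfolding mem_ucube
    proof
      fix i
      have "x i + 1 \<le> N" using x(1) by (simp add: sites_def Suc_le_eq)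
      then have "real (x i) / N + ?h \<le> 1" using N0 by (simp add: add_divide_distrib[symmetric])
      moreover have "0 \<le> real (x i) / N" by simp
      ultimately show "0 \<le> y $ i \<and> y $ i \<le> 1" using x(2) unfolding mem_cell lc by (meson order_trans)
    qed
  next
    fix y :: "real^'d" assume y: "y \<in> ucube"
    \<comment> \<open>The \<open>min\<close> serves points with a coordinate equal to 1, which
      belong to the last cell.\<close>
    define x where "x i = min (nat \<lfloor>N * y $ i\<rfloor>) (N - 1)" for i
    have "x \<in> sites N" using N by (auto simp: sites_def x_def)
    moreover have "y \<in> ?c x" unfolding mem_cell lc
    proof
      fix i
      have yi: "0 \<le> y $ i" "y $ i \<le> 1" using y by (auto simp: mem_ucube)
      have "real (x i) \<le> N * y $ i"
      proof -
        have "real (x i) \<le> real (nat \<lfloor>N * y $ i\<rfloor>)" by (simp add: x_def)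
        also have "\<dots> \<le> N * y $ i" using yi N0 by simp
        finally show ?thesis .
      qed
      moreover have "N * y $ i \<le> real (x i) + 1"
      proof (cases "nat \<lfloor>N * y $ i\<rfloor> \<le> N - 1")
        case True
        then have "real (x i) = of_int \<lfloor>N * y $ i\<rfloor>" using yi N0 by (simp add: x_def)
        then show ?thesis by linarith
      next
        case False
        then have "real (x i) + 1 = N" using N by (simp add: x_def of_nat_diff)
        then show ?thesis using yi N0 by simp
      qed
      ultimately show "real (x i) / N \<le> y $ i \<and> y $ i \<le> real (x i) / N + ?h"
        using N0 by (simp add: add_divide_distrib[symmetric] pos_divide_le_eq pos_le_divide_eq mult.commute)
    qed
    ultimately show "y \<in> (\<Union>x\<in>sites N. ?c x)" by blast
  qed
  have fi: "f integrable_on ?c x" for x unfolding cell_def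
    by (intro integrable_continuous continuous_on_subset[OF f]) auto
  have neg: "negligible (?c x \<inter> ?c x')" if ne: "x \<noteq> x'" for x x'
  proof -
    obtain i where i: "x i \<noteq> x' i" using ne by (auto simp: fun_eq_iff)
    \<comment> \<open>In a coordinate where the indices differ, two cells share at most the lower
      face of the one with the larger index.\<close>
    define z where "z = max (x i) (x' i) / N"
    have "?c x \<inter> ?c x' \<subseteq> {y. y $ i = z}"
    proof
      fix y assume y: "y \<in> ?c x \<inter> ?c x'"
      then have "x i / N \<le> y $ i" "y $ i \<le> x i / N + ?h" "x' i / N \<le> y $ i" "y $ i \<le> x' i / N + ?h"
        unfolding Int_iff mem_cell lc by auto
      then have "x i \<le> N * y $ i" "N * y $ i \<le> x i + 1" "x' i \<le> N * y $ i" "N * y $ i \<le> x' i + 1"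
        using N0 by (simp_all add: add_divide_distrib[symmetric] pos_divide_le_eq pos_le_divide_eq mult.commute)
      moreover have "x i + 1 \<le> x' i \<or> x' i + 1 \<le> x i" using i by linarith
      then have "real (x i) + 1 \<le> x' i \<or> real (x' i) + 1 \<le> x i" by (metis of_nat_1 of_nat_add of_nat_le_iff)
      ultimately have "N * y $ i = max (x i) (x' i)" by (auto simp: max_def)
      then show "y \<in> {y. y $ i = z}" using N0 by (simp add: z_def field_simps)
    qed
    moreover have "negligible {y :: real^'d. y \<bullet> axis i 1 = z}"
      by (rule negligible_standard_hyperplane) simp
    then have "negligible {y :: real^'d. y $ i = z}" by (simp add: inner_axis)
    ultimately show ?thesis by (rule negligible_subset[rotated])
  qed
  have "(f has_integral (\<Sum>x\<in>sites N. integral (?c x) f)) (\<Union>x\<in>sites N. ?c x)"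
    by (rule has_integral_UN) (use fi neg in \<open>auto simp: pairwise_def integrable_integral\<close>)
  then have I: "integral ucube f = (\<Sum>x\<in>sites N. integral (?c x) f)" unfolding un by (rule integral_unique)
  have "\<bar>integral (?c x) f - ?h ^ CARD('d) * f (loc N x)\<bar> \<le> e * ?h ^ CARD('d)" for x
  proof (rule cell_integral[OF f _ e])
    fix y assume "y \<in> ?c x"
    then have "dist y (loc N x) \<le> real CARD('d) * ?h" by (rule cell_dist) (auto simp: mem_cell)
    then show "\<bar>f y - f (loc N x)\<bar> \<le> e" by (intro le) simp
  qed simp
  then have "(\<Sum>x\<in>sites N. \<bar>integral (?c x) f - ?h ^ CARD('d) * f (loc N x)\<bar>) \<le> (\<Sum>x\<in>(sites N :: 'd site set). e * ?h ^ CARD('d))"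
    by (intro sum_mono)
  also have "\<dots> = e" using N0 by (simp add: card_sites power_divide)
  finally have "\<bar>(\<Sum>x\<in>sites N. integral (?c x) f - ?h ^ CARD('d) * f (loc N x))\<bar> \<le> e"
    by (rule order_trans[OF sum_abs])
  moreover have "(\<Sum>x\<in>sites N. integral (?c x) f - ?h ^ CARD('d) * f (loc N x)) = integral ucube f - (\<Sum>x\<in>sites N. f (loc N x)) / real N ^ CARD('d)"
    unfolding I sum_subtractf sum_distrib_left[symmetric] by (simp add: power_divide)
  ultimately show ?thesis by (simp only: abs_minus_commute)
qed

text \<open>Each full step costs at most \<open>e / L\<close>; the incomplete last one has length at
  most \<open>1 / L\<close> and costs at most \<open>R / L\<close>.\<close>

lemma time_riemann:
  fixes g :: "real \<Rightarrow> real"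
  assumes g: "continuous_on {0..t} g" and L: "L > 0" and t: "0 \<le> t" and e: "0 \<le> e"
    and le: "\<And>r s. r \<in> {0..t} \<Longrightarrow> s \<in> {0..t} \<Longrightarrow> \<bar>r - s\<bar> \<le> 1 / L \<Longrightarrow> \<bar>g r - g s\<bar> \<le> e"
    and R: "\<And>r. r \<in> {0..t} \<Longrightarrow> \<bar>g r\<bar> \<le> R"
  shows "\<bar>(\<Sum>k<nat \<lfloor>L * t\<rfloor>. g (k / L)) / L - integral {0..t} g\<bar> \<le> e * t + R / L"
proof -
  have R0: "0 \<le> R" using R[of 0] t by auto
  have gi: "g integrable_on {a..b}" if "0 \<le> a" "b \<le> t" for a b
    by (intro integrable_continuous_interval continuous_on_subset[OF g]) (use that in auto)
  have step: "\<bar>(\<Sum>k<K. g (k / L)) / L - integral {0..K / L} g\<bar> \<le> e * (K / L)" if "K / L \<le> t" for K :: nat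
    using that
  proof (induction K)
    case (Suc K)
    have KL: "real K / L \<le> real (Suc K) / L" using L by (intro divide_right_mono) auto
    have K: "real K / L \<le> t" using Suc.prems KL by linarith
    have w: "real (Suc K) / L - real K / L = 1 / L" by (simp add: diff_divide_distrib[symmetric])
    have comb: "integral {0..Suc K / L} g = integral {0..K / L} g + integral {K / L..Suc K / L} g"
      using KL L gi[of 0 "Suc K / L"] Suc.prems by (intro Henstock_Kurzweil_Integration.integral_combine[symmetric]) auto
    have "norm (integral (cbox (K / L) (Suc K / L)) (\<lambda>r. g r - g (K / L))) \<le> e * measure lborel (cbox (real K / L) (Suc K / L))"
    proof (rule has_integral_bound[OF e integrable_integral])
      show "(\<lambda>r. g r - g (K / L)) integrable_on cbox (K / L) (Suc K / L)"
        using gi[of "K / L" "Suc K / L"] L Suc.prems by (intro integrable_diff) auto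
      fix r assume r: "r \<in> cbox (real K / L) (Suc K / L)"
      have "0 \<le> real K / L" using L by simp
      then have "r \<in> {0..t}" "K / L \<in> {0..t}" using r Suc.prems K by auto
      moreover have "\<bar>r - K / L\<bar> \<le> 1 / L" using r w by auto
      ultimately show "norm (g r - g (K / L)) \<le> e" using le by simp
    qed
    moreover have "integral (cbox (K / L) (Suc K / L)) (\<lambda>r. g r - g (K / L)) = integral {K / L..Suc K / L} g - g (K / L) / L"
      using gi[of "K / L" "Suc K / L"] L Suc.prems KL w by (subst integral_diff) auto
    moreover have "measure lborel (cbox (real K / L) (Suc K / L)) = 1 / L" using KL w by simp
    ultimately have s: "\<bar>integral {K / L..Suc K / L} g - g (K / L) / L\<bar> \<le> e / L" by simp
    have "(\<Sum>k<Suc K. g (k / L)) / L - integral {0..Suc K / L} g = ((\<Sum>k<K. g (k / L)) / L - integral {0..K / L} g) - (integral {K / L..Suc K / L} g - g (K / L) / L)"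
      unfolding comb by (simp add: add_divide_distrib)
    then have "\<bar>(\<Sum>k<Suc K. g (k / L)) / L - integral {0..Suc K / L} g\<bar> \<le> e * (K / L) + e / L"
      using Suc.IH[OF K] s abs_triangle_ineq4[of "(\<Sum>k<K. g (k / L)) / L - integral {0..K / L} g" "integral {K / L..Suc K / L} g - g (K / L) / L"] by linarith
    also have "\<dots> = e * (Suc K / L)" by (simp add: add_divide_distrib distrib_left)
    finally show ?case .
  qed simp
  let ?K = "nat \<lfloor>L * t\<rfloor>"
  have K1: "real ?K \<le> L * t" using L t by simp
  have K2: "L * t \<le> real ?K + 1" 
  proof -
    have "real ?K = of_int \<lfloor>L * t\<rfloor>" using L t by simp
    then show ?thesis using floor_correct[of "L * t"] by simp
  qed
  have KL: "?K / L \<le> t" "t - ?K / L \<le> 1 / L" "0 \<le> ?K / L"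
  proof -
    show "?K / L \<le> t" using K1 L by (simp add: pos_divide_le_eq mult.commute)
    have "t \<le> (real ?K + 1) / L" using K2 L by (simp add: pos_le_divide_eq mult.commute)
    then show "t - ?K / L \<le> 1 / L" by (simp add: add_divide_distrib)
    show "0 \<le> ?K / L" using L by simp
  qed
  have comb: "integral {0..t} g = integral {0..?K / L} g + integral {?K / L..t} g"
    using KL gi[of 0 t] by (intro Henstock_Kurzweil_Integration.integral_combine[symmetric]) auto
  have "norm (integral (cbox (?K / L) t) g) \<le> R * measure lborel (cbox (?K / L) t)"
    using gi[of "?K / L" t] KL R by (intro has_integral_bound[OF R0 integrable_integral]) auto
  also have "\<dots> \<le> R * (1 / L)" using KL R0 by (intro mult_left_mono) auto
  finally have "\<bar>integral {?K / L..t} g\<bar> \<le> R / L" by simp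
  moreover have "e * (?K / L) \<le> e * t" using KL e by (intro mult_left_mono) auto
  ultimately show ?thesis using step[OF KL(1)] unfolding comb by linarith
qed

text \<open>The scaling computation in isolation: \<open>w\<close> stands for the number of sites,
  \<open>C\<close> for the number of pairs, \<open>Nr\<close> for the side length, \<open>nr\<close>
  for the scaling parameter, \<open>a\<close> for the number of rings and \<open>occ\<close> for the
  return count. All terms come out of order \<open>1 / nr\<close> except the last, which is
  proportional to the return bound \<open>q\<close>.\<close>

lemma variance_algebra:
  fixes w C Nr nr c R k a occ B T q :: real
  assumes pos: "w > 0" "C > 0" "Nr \<ge> 1" "nr \<ge> 1" "0 \<le> c" "0 \<le> R" "0 \<le> a" "0 \<le> T" "0 \<le> q" "0 \<le> occ"
    and cw: "c * w = nr" and k: "k = c * R" and a: "a \<le> C * Nr\<^sup>2 * T" and occ: "occ \<le> w * (C * Nr\<^sup>2 * q)"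
  shows "(1 / (Nr\<^sup>2 * nr))\<^sup>2 * (2 * w * (a * B / C)\<^sup>2 * (k + 4 * k ^ 3 + 2 * k\<^sup>2)
      + a * (3 * B\<^sup>2 * (k * w / C + 4 * k * a * w / C\<^sup>2 + 32 * (k\<^sup>2 * w + k) * occ / C\<^sup>2)))
    \<le> B\<^sup>2 / nr * (2 * T\<^sup>2 * R * (1 + 2 * k + 4 * k\<^sup>2) + 3 * T * R + 12 * T\<^sup>2 * R) + 96 * B\<^sup>2 * T * (R\<^sup>2 + R) * q"
proof -
  \<comment> \<open>Rings per clock, at most \<open>Nr\<^sup>2 * T\<close>; the factor
    \<open>Nr\<^sup>2\<close> in the normalization of the flux balances exactly this.\<close>
  define y where "y = a / C"
  define x where "x = occ / C"
  have y: "0 \<le> y" "y \<le> Nr\<^sup>2 * T"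
    using a pos by (auto simp: y_def pos_divide_le_eq mult_ac)
  have x: "0 \<le> x" "x \<le> w * (Nr\<^sup>2 * q)"
    using occ pos by (auto simp: x_def pos_divide_le_eq mult_ac)
  have k0: "0 \<le> k" using k pos by simp
  have kw: "k * w = nr * R" using cw k by (simp add: mult_ac)
  have N2: "Nr\<^sup>2 > 0" "Nr\<^sup>2 \<ge> 1" using pos by (auto simp: one_le_power)
  define P where "P = (1 / (Nr\<^sup>2 * nr))\<^sup>2"
  have P0: "P \<ge> 0" by (simp add: P_def)
  have NP: "P * (Nr\<^sup>2)\<^sup>2 = 1 / nr\<^sup>2" using N2 pos by (simp add: P_def power_divide power_mult_distrib)
  have NP1: "P * Nr\<^sup>2 \<le> 1 / nr\<^sup>2"
  proof -
    have "P * Nr\<^sup>2 \<le> P * (Nr\<^sup>2)\<^sup>2" by (intro mult_left_mono self_le_power N2 P0) simp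
    then show ?thesis using NP by simp
  qed
  have e1: "(a * B / C)\<^sup>2 = y\<^sup>2 * B\<^sup>2" by (simp add: y_def power_divide power_mult_distrib)
  have e2: "a * (3 * B\<^sup>2 * (k * w / C + 4 * k * a * w / C\<^sup>2 + 32 * (k\<^sup>2 * w + k) * occ / C\<^sup>2))
     = 3 * B\<^sup>2 * (y * (nr * R) + 4 * (nr * R) * y\<^sup>2 + 32 * (k\<^sup>2 * w + k) * (y * x))"
    unfolding kw[symmetric] y_def x_def by (simp add: field_simps power2_eq_square)
  have y2: "y\<^sup>2 \<le> (Nr\<^sup>2)\<^sup>2 * T\<^sup>2" using power_mono[OF y(2) y(1), of 2] by (simp add: power_mult_distrib)
  have K3: "k + 4 * k ^ 3 + 2 * k\<^sup>2 = k * (1 + 2 * k + 4 * k\<^sup>2)" by (simp add: algebra_simps power2_eq_square power3_eq_cube)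
  have nr2: "nr / nr\<^sup>2 = 1 / nr" using pos by (simp add: power2_eq_square)
  have t1: "P * (2 * w * (y\<^sup>2 * B\<^sup>2) * (k + 4 * k ^ 3 + 2 * k\<^sup>2)) \<le> B\<^sup>2 / nr * (2 * T\<^sup>2 * R * (1 + 2 * k + 4 * k\<^sup>2))"
  proof -
    have "P * (2 * w * (y\<^sup>2 * B\<^sup>2) * (k + 4 * k ^ 3 + 2 * k\<^sup>2)) = (P * y\<^sup>2) * (2 * B\<^sup>2 * (k * w) * (1 + 2 * k + 4 * k\<^sup>2))"
      unfolding K3 by (simp only: mult_ac)
    also have "\<dots> \<le> (P * ((Nr\<^sup>2)\<^sup>2 * T\<^sup>2)) * (2 * B\<^sup>2 * (k * w) * (1 + 2 * k + 4 * k\<^sup>2))"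
      using P0 y2 k0 pos by (intro mult_right_mono mult_left_mono) auto
    also have "\<dots> = (P * (Nr\<^sup>2)\<^sup>2) * (T\<^sup>2 * (2 * B\<^sup>2 * (nr * R) * (1 + 2 * k + 4 * k\<^sup>2)))"
      unfolding kw by (simp only: mult_ac)
    also have "\<dots> = (nr / nr\<^sup>2) * (B\<^sup>2 * (2 * T\<^sup>2 * R * (1 + 2 * k + 4 * k\<^sup>2)))"
      unfolding NP by simp
    finally show ?thesis unfolding nr2 by simp
  qed
  have t2: "P * (3 * B\<^sup>2 * (y * (nr * R))) \<le> B\<^sup>2 / nr * (3 * T * R)"
  proof -
    have "P * (3 * B\<^sup>2 * (y * (nr * R))) \<le> P * (3 * B\<^sup>2 * ((Nr\<^sup>2 * T) * (nr * R)))"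
      using P0 y pos by (intro mult_left_mono mult_right_mono) auto
    also have "\<dots> = (P * Nr\<^sup>2) * (3 * B\<^sup>2 * T * nr * R)" by (simp only: mult_ac)
    also have "\<dots> \<le> (1 / nr\<^sup>2) * (3 * B\<^sup>2 * T * nr * R)" using NP1 pos by (intro mult_right_mono) auto
    also have "\<dots> = (nr / nr\<^sup>2) * (B\<^sup>2 * (3 * T * R))" by simp
    finally show ?thesis unfolding nr2 by simp
  qed
  have t3: "P * (3 * B\<^sup>2 * (4 * (nr * R) * y\<^sup>2)) \<le> B\<^sup>2 / nr * (12 * T\<^sup>2 * R)"
  proof -
    have "P * (3 * B\<^sup>2 * (4 * (nr * R) * y\<^sup>2)) \<le> P * (3 * B\<^sup>2 * (4 * (nr * R) * ((Nr\<^sup>2)\<^sup>2 * T\<^sup>2)))"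
      using P0 y2 pos by (intro mult_left_mono) auto
    also have "\<dots> = (P * (Nr\<^sup>2)\<^sup>2) * (12 * B\<^sup>2 * nr * R * T\<^sup>2)" by simp
    also have "\<dots> = (nr / nr\<^sup>2) * (B\<^sup>2 * (12 * T\<^sup>2 * R))" unfolding NP by simp
    finally show ?thesis unfolding nr2 by simp
  qed
  have t4: "P * (3 * B\<^sup>2 * (32 * (k\<^sup>2 * w + k) * (y * x))) \<le> 96 * B\<^sup>2 * T * (R\<^sup>2 + R) * q"
  proof -
    have v: "0 \<le> k\<^sup>2 * w + k" using k0 pos by simp
    have vw: "(k\<^sup>2 * w + k) * w = nr\<^sup>2 * R\<^sup>2 + nr * R"
    proof -
      have "(k\<^sup>2 * w + k) * w = (k * w)\<^sup>2 + k * w" by (simp add: algebra_simps power2_eq_square)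
      then show ?thesis unfolding kw by (simp add: power_mult_distrib)
    qed
    have "y * x \<le> (Nr\<^sup>2 * T) * (w * (Nr\<^sup>2 * q))" using x y pos by (intro mult_mono) auto
    then have "P * (3 * B\<^sup>2 * (32 * (k\<^sup>2 * w + k) * (y * x))) \<le> P * (3 * B\<^sup>2 * (32 * (k\<^sup>2 * w + k) * ((Nr\<^sup>2 * T) * (w * (Nr\<^sup>2 * q)))))"
      using P0 v by (intro mult_left_mono) auto
    also have "\<dots> = (P * (Nr\<^sup>2)\<^sup>2) * (96 * B\<^sup>2 * T * q * ((k\<^sup>2 * w + k) * w))"
      by (simp add: power2_eq_square[of "Nr\<^sup>2"])
    also have "\<dots> = 96 * B\<^sup>2 * T * q * ((nr\<^sup>2 * R\<^sup>2 + nr * R) / nr\<^sup>2)" unfolding NP vw by simp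
    also have "(nr\<^sup>2 * R\<^sup>2 + nr * R) / nr\<^sup>2 = R\<^sup>2 + R / nr" using pos by (simp add: add_divide_distrib power2_eq_square)
    also have "96 * B\<^sup>2 * T * q * (R\<^sup>2 + R / nr) \<le> 96 * B\<^sup>2 * T * q * (R\<^sup>2 + R)"
    proof -
      have "R / nr \<le> R / 1" using pos by (intro divide_left_mono) auto
      then show ?thesis using pos by (intro mult_left_mono) auto
    qed
    finally show ?thesis by (simp only: mult_ac)
  qed
  have "P * (2 * w * (a * B / C)\<^sup>2 * (k + 4 * k ^ 3 + 2 * k\<^sup>2)
      + a * (3 * B\<^sup>2 * (k * w / C + 4 * k * a * w / C\<^sup>2 + 32 * (k\<^sup>2 * w + k) * occ / C\<^sup>2)))
    = P * (2 * w * (y\<^sup>2 * B\<^sup>2) * (k + 4 * k ^ 3 + 2 * k\<^sup>2)) + P * (3 * B\<^sup>2 * (y * (nr * R)))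
      + P * (3 * B\<^sup>2 * (4 * (nr * R) * y\<^sup>2)) + P * (3 * B\<^sup>2 * (32 * (k\<^sup>2 * w + k) * (y * x)))"
    unfolding e1 e2 by (simp only: distrib_left add.assoc)
  also have "\<dots> \<le> B\<^sup>2 / nr * (2 * T\<^sup>2 * R * (1 + 2 * k + 4 * k\<^sup>2)) + B\<^sup>2 / nr * (3 * T * R) + B\<^sup>2 / nr * (12 * T\<^sup>2 * R)
      + 96 * B\<^sup>2 * T * (R\<^sup>2 + R) * q"
    by (intro add_mono t1 t2 t3 t4)
  finally show ?thesis unfolding P_def by (simp only: distrib_left)
qed

lemma (in ssep_flux) var_norm:
  assumes "\<kappa> = c * R" "0 \<le> c" "0 \<le> R" "n \<ge> 1" "c * real N ^ CARD('d) = real n"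
    and K: "real K \<le> Lam * T" and T: "0 \<le> T" and M: "1 \<le> M" "M < N"
  shows "(1 / ((real N)\<^sup>2 * n))\<^sup>2 * Ex (\<lambda>st. (flux st - mean_flux K)\<^sup>2) K \<le>
    B\<^sup>2 / n * (2 * T\<^sup>2 * R * (1 + 2 * \<kappa> + 4 * \<kappa>\<^sup>2) + 3 * T * R + 12 * T\<^sup>2 * R)
    + 96 * B\<^sup>2 * T * (R\<^sup>2 + R) * (T / M + 2 * sqrt (T * M) / N)"
proof -
  have "V1 = adj l s" by (rule ext) (simp add: V1_def adj_def)
  then have "occ_time K \<le> ret_bound M K"
    unfolding occ_time_def using adj_return[OF M, where K=K and l'=l and s'=s and l=l and s=s] by simp
  then have occ: "occ_time K \<le> real N ^ CARD('d) * (Lam * (T / M + 2 * sqrt (T * M) / N))"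
    using ret_bound_le[OF K M(1)] by linarith
  have o0: "0 \<le> occ_time K" unfolding occ_time_def
    by (intro sum_nonneg S2.pow_ge) (auto simp: V1_def shift_sites[OF N1])
  have "(1 / ((real N)\<^sup>2 * n))\<^sup>2 * Ex (\<lambda>st. (flux st - mean_flux K)\<^sup>2) K \<le>
    (1 / ((real N)\<^sup>2 * n))\<^sup>2 * (2 * real N ^ CARD('d) * (K * B / card pairsN)\<^sup>2 * (\<kappa> + 4 * \<kappa> ^ 3 + 2 * \<kappa>\<^sup>2) + K * step_var K)"
    by (intro mult_left_mono flux_variance) simp
  also have "\<dots> \<le> B\<^sup>2 / n * (2 * T\<^sup>2 * R * (1 + 2 * \<kappa> + 4 * \<kappa>\<^sup>2) + 3 * T * R + 12 * T\<^sup>2 * R)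
    + 96 * B\<^sup>2 * T * (R\<^sup>2 + R) * (T / M + 2 * sqrt (T * M) / N)"
    unfolding step_var_def flux_var_def of_nat_power
    by (rule variance_algebra[where c=c])
       (use assms S1.cardC N1 T o0 occ[unfolded Lam_def] K[unfolded Lam_def] in \<open>auto simp: mult.assoc\<close>)
  finally show ?thesis .
qed

text \<open>One factor \<open>c\<close> of the initial occupation is absorbed by the normalization,
  the other stays in front of the pair term; it becomes the coefficient of the squared
  density.\<close>

lemma (in ssep_flux) mean_flux_riem:
  assumes uw: "\<And>x. x \<in> sitesN \<Longrightarrow> u x = c * w x" and n: "n \<ge> 1" and cn: "c * real N ^ CARD('d) = real n"
  shows "1 / ((real N)\<^sup>2 * n) * mean_flux K = riem K (\<lambda>x k. \<phi> x * (S1.pow k w x - c * S2.pow k (tens w) (x, sh x)))"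
proof -
  have W: "real N ^ CARD('d) > 0" using N1 by simp
  have c: "c = real n / real N ^ CARD('d)" using cn W by (simp add: field_simps)
  have p1: "S1.pow k u x = c * S1.pow k w x" if "x \<in> sitesN" for k x
    using S1.pow_cong[of u "\<lambda>x. c * w x" x k] uw that by (simp add: S1.pow_scale)
  have p2: "S2.pow k (\<lambda>p. u (fst p) * u (snd p)) p = c\<^sup>2 * S2.pow k (tens w) p" if "p \<in> sitesN \<times> sitesN" for k p
  proof -
    have "S2.pow k (\<lambda>p. u (fst p) * u (snd p)) p = S2.pow k (\<lambda>p. c\<^sup>2 * tens w p) p"
      using that by (intro S2.pow_cong) (auto simp: tens_def uw power2_eq_square)
    then show ?thesis by (simp add: S2.pow_scale)
  qed
  have "mean_flux K = (\<Sum>k<K. \<Sum>x\<in>sitesN. c * (\<phi> x * (S1.pow k w x - c * S2.pow k (tens w) (x, sh x)))) / card pairsN"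
    unfolding mean_flux_def
    by (intro arg_cong2[where f=divide] refl sum.cong)
       (simp add: p1 p2 shift_sites[OF N1] power2_eq_square algebra_simps)
  also have "\<dots> = c * (\<Sum>k<K. \<Sum>x\<in>sitesN. \<phi> x * (S1.pow k w x - c * S2.pow k (tens w) (x, sh x))) / card pairsN"
    by (simp only: sum_distrib_left)
  finally have m: "mean_flux K = c * (\<Sum>k<K. \<Sum>x\<in>sitesN. \<phi> x * (S1.pow k w x - c * S2.pow k (tens w) (x, sh x))) / card pairsN" .
  have "1 / (a * nn) * ((nn / W) * S / C) = S / ((C * a) * W)" if "nn \<ge> 1" for a nn W S C :: real
    using that by simp
  from this[of "real n"] show ?thesis unfolding m riem_def Lam_def using n by (simp only: c)
qed

section \<open>The hydrodynamic limit\<close>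

lemma (in torus) total_rate_Lam: "total_rate N TYPE('d) = Lam"
  by (simp add: total_rate_def Lam_def)

locale hydro =
  fixes T :: real and Nseq :: "nat \<Rightarrow> nat"
    and \<rho>0 :: "real^'d::finite \<Rightarrow> real" and \<rho> :: "real^'d \<Rightarrow> real \<Rightarrow> real"
  assumes T: "T > 0" and Nseq1: "\<And>n. Nseq n \<ge> 1"
    and Nlim: "(\<lambda>n. 1 / real (Nseq n)) \<longlonglongrightarrow> 0"
    and \<rho>0c: "continuous_on UNIV \<rho>0" and \<rho>0p: "periodic_fun \<rho>0" and \<rho>0n: "\<And>x. \<rho>0 x \<ge> 0"
    and \<rho>0ne: "\<exists>x. \<rho>0 x \<noteq> 0"
    and ip1: "\<And>n x. x \<in> sites (Nseq n) \<Longrightarrow> init_param Nseq \<rho>0 n x \<le> 1"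
    and hs: "heat_sol T \<rho>0 \<rho>"
    and conv: "convergent (\<lambda>n. (1 / real (Nseq n)) ^ CARD('d) * real n)"
begin

definition kap :: "nat \<Rightarrow> real" where "kap n = (1 / real (Nseq n)) ^ CARD('d) * real n"
text \<open>In terms of the theorem, the parameter \<open>\<alpha>\<close> is
  \<open>kaplim * mass\<close>, so \<open>kaplim\<close> is the coefficient
  \<open>\<alpha> / mass\<close> of the limit.\<close>

definition kaplim :: real where "kaplim = lim kap"
definition mass :: real where "mass = integral ucube \<rho>0"
definition rateN :: "nat \<Rightarrow> real" where "rateN n = total_rate (Nseq n) TYPE('d)"

lemma kap_lim: "kap \<longlonglongrightarrow> kaplim"
  using conv unfolding kaplim_def kap_def[abs_def] by (simp add: convergent_LIMSEQ_iff)

lemma kap_nonneg: "0 \<le> kap n"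
  by (simp add: kap_def)

lemma kaplim_nonneg: "0 \<le> kaplim"
  by (rule LIMSEQ_le_const[OF kap_lim]) (auto intro: kap_nonneg)

lemma N_large: "eventually (\<lambda>n. M \<le> Nseq n) sequentially"
proof -
  have "eventually (\<lambda>n. 1 / real (Nseq n) < 1 / (real M + 1)) sequentially"
    by (rule order_tendstoD(2)[OF Nlim]) simp
  then show ?thesis
  proof eventually_elim
    case (elim n)
    have "0 < real (Nseq n)" using Nseq1[of n] by simp
    then have "real M + 1 < real (Nseq n)" using elim by (simp add: field_simps)
    then show ?case by linarith
  qed
qed

lemma mass_pos: "mass > 0"
proof (rule ccontr)
  assume neg: "\<not> mass > 0"
  have c: "continuous_on ucube \<rho>0" by (rule continuous_on_subset[OF \<rho>0c]) simp
  have i: "\<rho>0 integrable_on ucube" by (rule integrable_continuous[OF c])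
  have "0 \<le> mass" unfolding mass_def by (rule integral_nonneg[OF i]) (rule \<rho>0n)
  then have "mass = 0" using neg by simp
  then have h: "(\<rho>0 has_integral 0) ucube" using integrable_integral[OF i] by (simp add: mass_def)
  obtain x where x: "\<rho>0 x \<noteq> 0" using \<rho>0ne by blast
  have ne: "box (0 :: real^'d) One \<noteq> {}" by (simp add: box_ne_empty)
  have "\<rho>0 (frac_vec x) = 0"
    by (rule has_integral_0_cbox_imp_0[OF c _ h ne frac_vec_ucube]) (rule \<rho>0n)
  then show False using x periodic_frac[OF \<rho>0p] by simp
qed

lemma \<rho>_cont: "continuous_on (UNIV \<times> {0..T}) (\<lambda>(x, t). \<rho> x t)" and \<rho>_per: "periodic_fun (\<lambda>x. \<rho> x t)"
  and \<rho>_0: "\<rho> x 0 = \<rho>0 x"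
  using hs by (auto simp: heat_sol_def)

text \<open>One constant for the solution on the whole time interval and hence for the initial
  density; \<open>kap n * Rb\<close> then bounds the occupation probabilities.\<close>

definition Rb :: real where "Rb = (SOME R. R \<ge> 0 \<and> (\<forall>x. \<forall>t\<in>{0..T}. \<bar>\<rho> x t\<bar> \<le> R))"

lemma Rb: "0 \<le> Rb" "t \<in> {0..T} \<Longrightarrow> \<bar>\<rho> x t\<bar> \<le> Rb" "\<bar>\<rho>0 x\<bar> \<le> Rb"
proof -
  have "\<exists>R. R \<ge> 0 \<and> (\<forall>x. \<forall>t\<in>{0..T}. \<bar>\<rho> x t\<bar> \<le> R)" using periodic_uniform(1)[OF \<rho>_cont \<rho>_per] by blast
  from someI_ex[OF this] have R: "Rb \<ge> 0" "\<And>x t. t \<in> {0..T} \<Longrightarrow> \<bar>\<rho> x t\<bar> \<le> Rb" unfolding Rb_def by blast+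
  then show "0 \<le> Rb" "t \<in> {0..T} \<Longrightarrow> \<bar>\<rho> x t\<bar> \<le> Rb" by auto
  show "\<bar>\<rho>0 x\<bar> \<le> Rb" using R(2)[of 0 x] T \<rho>_0 by simp
qed

text \<open>Cell average of \<open>\<rho>0\<close>. It separates the part of order one from the
  scale \<open>kap n\<close> of the occupation probability.\<close>

definition uh :: "nat \<Rightarrow> 'd site \<Rightarrow> real" where
  "uh n x = real (Nseq n) ^ CARD('d) * integral (cell (loc (Nseq n) x - (1 / (2 * real (Nseq n))) *\<^sub>R One) (1 / real (Nseq n))) \<rho>0"

lemma init_uh: "init_param Nseq \<rho>0 n x = kap n * uh n x"
proof -
  have N0: "real (Nseq n) > 0" using Nseq1[of n] by simp
  have "a - h *\<^sub>R v + (h + h) *\<^sub>R v = a + h *\<^sub>R v" for a v :: "real^'d" and h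
    unfolding scaleR_left_distrib add.assoc[symmetric] diff_add_cancel ..
  moreover have "1 / real (Nseq n) = 1 / (2 * real (Nseq n)) + 1 / (2 * real (Nseq n))" using N0 by simp
  ultimately have E: "loc (Nseq n) x - (1 / (2 * real (Nseq n))) *\<^sub>R One + (1 / real (Nseq n)) *\<^sub>R One = (loc (Nseq n) x + (1 / (2 * real (Nseq n))) *\<^sub>R One :: real^'d)"
    by (simp only:)
  have c: "(1 / real (Nseq n)) ^ CARD('d) * real n * real (Nseq n) ^ CARD('d) = real n"
    using N0 by (simp add: power_divide)
  show ?thesis unfolding init_param_def kap_def uh_def cell_def E mult.assoc[symmetric] c ..
qed

lemma uh_bound:
  assumes "0 \<le> e" "\<And>y. y \<in> cell (loc (Nseq n) x - (1 / (2 * real (Nseq n))) *\<^sub>R One) (1 / real (Nseq n)) \<Longrightarrow> \<bar>\<rho>0 y - v\<bar> \<le> e"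
  shows "\<bar>uh n x - v\<bar> \<le> e"
proof -
  have N0: "real (Nseq n) ^ CARD('d) > 0" using Nseq1[of n] by simp
  let ?I = "integral (cell (loc (Nseq n) x - (1 / (2 * real (Nseq n))) *\<^sub>R One) (1 / real (Nseq n))) \<rho>0"
  have h: "\<bar>?I - (1 / real (Nseq n)) ^ CARD('d) * v\<bar> \<le> e * (1 / real (Nseq n)) ^ CARD('d)"
    by (rule cell_integral[OF \<rho>0c]) (use assms in auto)
  have "\<bar>uh n x - v\<bar> = \<bar>real (Nseq n) ^ CARD('d) * (?I - (1 / real (Nseq n)) ^ CARD('d) * v)\<bar>"
    using N0 by (simp add: uh_def right_diff_distrib power_divide)
  also have "\<dots> = real (Nseq n) ^ CARD('d) * \<bar>?I - (1 / real (Nseq n)) ^ CARD('d) * v\<bar>"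
    by (simp add: abs_mult)
  also have "\<dots> \<le> real (Nseq n) ^ CARD('d) * (e * (1 / real (Nseq n)) ^ CARD('d))"
    using h by (intro mult_left_mono) auto
  also have "\<dots> = e" using N0 by (simp add: power_divide)
  finally show ?thesis .
qed

lemma uh_le: "\<bar>uh n x\<bar> \<le> Rb"
  using uh_bound[OF Rb(1), of n x 0] Rb(3) by simp

lemma uh_nonneg: "0 \<le> uh n x"
proof -
  have "0 \<le> integral (cell (loc (Nseq n) x - (1 / (2 * real (Nseq n))) *\<^sub>R One) (1 / real (Nseq n))) \<rho>0"
    unfolding cell_def by (intro integral_nonneg integrable_continuous continuous_on_subset[OF \<rho>0c] \<rho>0n) auto
  then show ?thesis by (simp add: uh_def)
qed

lemma dist_small: "d > 0 \<Longrightarrow> eventually (\<lambda>n. C / real (Nseq n) < d) sequentially"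
proof -
  assume d: "d > 0"
  have "(\<lambda>n. C * (1 / real (Nseq n))) \<longlonglongrightarrow> C * 0" by (intro tendsto_intros Nlim)
  then have "eventually (\<lambda>n. C * (1 / real (Nseq n)) < d) sequentially"
    by (rule order_tendstoD(2)) (use d in simp)
  then show ?thesis by simp
qed

lemma uh_close: "e > 0 \<Longrightarrow> eventually (\<lambda>n. \<forall>x. \<bar>uh n x - \<rho>0 (loc (Nseq n) x)\<bar> \<le> e) sequentially"
proof -
  assume e: "e > 0"
  obtain d where d: "d > 0" "\<And>x y. dist x y < d \<Longrightarrow> \<bar>\<rho>0 x - \<rho>0 y\<bar> < e"
    using periodic_uniform1(2)[OF \<rho>0c \<rho>0p e] by blast
  show ?thesis using dist_small[OF d(1), of "real CARD('d)"]
  proof eventually_elim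
    case (elim n)
    show ?case
    proof (intro allI uh_bound)
      fix x y
      let ?a = "loc (Nseq n) x - (1 / (2 * real (Nseq n))) *\<^sub>R One :: real^'d" let ?h = "1 / real (Nseq n)"
      assume y: "y \<in> cell ?a ?h"
      have h2: "1 / (2 * real (Nseq n)) \<le> ?h" using Nseq1[of n] by (simp add: field_simps)
      have "loc (Nseq n) x \<in> cell ?a ?h"
        unfolding mem_cell vector_minus_component vector_scaleR_component One_component using h2 by simp
      from cell_dist[OF y this] have "dist y (loc (Nseq n) x) < d" using elim by simp
      from d(2)[OF this] show "\<bar>\<rho>0 y - \<rho>0 (loc (Nseq n) x)\<bar> \<le> e" by simp
    qed (use e in simp)
  qed
qed

lemma ssep_hydro: "Nseq n \<ge> 3 \<Longrightarrow> ssep (Nseq n) Nseq \<rho>0 n (kap n * Rb)"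
proof unfold_locales
  show "Nseq n \<ge> 3 \<Longrightarrow> 3 \<le> Nseq n" .
  show "Nseq n = Nseq n" ..
  show "x \<in> sites (Nseq n) \<Longrightarrow> 0 \<le> init_param Nseq \<rho>0 n x \<and> init_param Nseq \<rho>0 n x \<le> 1" for x
    using ip1 uh_nonneg kap_nonneg by (simp add: init_uh)
  show "x \<in> sites (Nseq n) \<Longrightarrow> init_param Nseq \<rho>0 n x \<le> kap n * Rb" for x
    unfolding init_uh using uh_le[of n x] by (intro mult_left_mono kap_nonneg) auto
qed

definition mid :: "nat \<Rightarrow> 'd \<Rightarrow> bool \<Rightarrow> 'd site \<Rightarrow> real^'d" where
  "mid n l s x = loc (Nseq n) x + (if s then (1 / real (Nseq n)) / 2 else - (1 / real (Nseq n)) / 2) *\<^sub>R axis l 1"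

text \<open>Rescaled flux in one direction as a function of the number of rings; the random clock
  enters only through the value inserted for \<open>k\<close>.\<close>

definition fl :: "nat \<Rightarrow> nat \<Rightarrow> 'd \<Rightarrow> bool \<Rightarrow> (real^'d \<Rightarrow> real) \<Rightarrow> (nat \<Rightarrow> real) \<Rightarrow> real" where
  "fl n k l s \<phi> \<omega> = 1 / ((real (Nseq n))\<^sup>2 * n) *
     (\<Sum>x\<in>sites (Nseq n). \<phi> (mid n l s x) * real (snd (chain Nseq \<rho>0 n \<omega> k) x (shift (Nseq n) l s x)))"

definition gg :: "real^'d \<Rightarrow> real \<Rightarrow> real" where
  "gg x r = \<rho> x r - kaplim * (\<rho> x r)\<^sup>2"

definition wl :: "(real^'d \<Rightarrow> real) \<Rightarrow> real \<Rightarrow> real" where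
  "wl \<phi> t = integral ucube (\<lambda>x. \<phi> x * integral {0..t} (gg x))"

lemma gg_cont: "continuous_on (UNIV \<times> {0..T}) (\<lambda>(x, t). gg x t)"
  using \<rho>_cont unfolding gg_def case_prod_unfold by (intro continuous_intros) auto

lemma gg_per: "periodic_fun (\<lambda>x. gg x t)"
  using \<rho>_per[of t] by (simp add: gg_def periodic_fun_def)

definition Gb :: real where "Gb = Rb + kaplim * Rb\<^sup>2"

lemma Gb: "0 \<le> Gb" "t \<in> {0..T} \<Longrightarrow> \<bar>gg x t\<bar> \<le> Gb"
proof -
  show "0 \<le> Gb" unfolding Gb_def using Rb(1) kaplim_nonneg by simp
  assume t: "t \<in> {0..T}"
  have "(\<rho> x t)\<^sup>2 \<le> Rb\<^sup>2" using power_mono[OF Rb(2)[OF t, of x], of 2] by simp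
  then have "kaplim * (\<rho> x t)\<^sup>2 \<le> kaplim * Rb\<^sup>2" by (intro mult_left_mono kaplim_nonneg)
  moreover have "0 \<le> kaplim * (\<rho> x t)\<^sup>2" using kaplim_nonneg by simp
  ultimately show "\<bar>gg x t\<bar> \<le> Gb" using Rb(2)[OF t, of x] unfolding gg_def Gb_def by linarith
qed

lemma gg_cont_t: "t \<le> T \<Longrightarrow> continuous_on {0..t} (gg x)"
proof -
  assume t: "t \<le> T"
  have "continuous_on {0..t} ((\<lambda>(x, t). gg x t) \<circ> (\<lambda>r. (x, r)))"
    by (intro continuous_on_compose continuous_intros continuous_on_subset[OF gg_cont]) (use t in auto)
  then show ?thesis by (simp add: o_def)
qed

definition ig :: "real \<Rightarrow> real^'d \<Rightarrow> real" where "ig t x = integral {0..t} (gg x)"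

lemma ig_diff:
  assumes t: "t \<in> {0..T}" and e: "0 \<le> e" and le: "\<And>r. r \<in> {0..T} \<Longrightarrow> \<bar>gg x r - gg y r\<bar> \<le> e"
  shows "\<bar>ig t x - ig t y\<bar> \<le> T * e"
proof -
  have c: "continuous_on {0..t} (gg z)" for z using t by (intro gg_cont_t) auto
  have "ig t x - ig t y = integral {0..t} (\<lambda>r. gg x r - gg y r)"
    unfolding ig_def by (intro integral_diff[symmetric] integrable_continuous_interval c)
  moreover have "norm (integral {0..t} (\<lambda>r. gg x r - gg y r)) \<le> e * (t - 0)"
    using t le by (intro integral_bound continuous_on_diff c) auto
  moreover have "e * (t - 0) \<le> T * e" using mult_right_mono[of t T e] t e by (simp add: mult.commute)
  ultimately show ?thesis by simp
qed

lemma ig_cont: "t \<in> {0..T} \<Longrightarrow> continuous_on UNIV (ig t)"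
proof -
  assume t: "t \<in> {0..T}"
  have "\<exists>d>0. \<forall>y. dist y x < d \<longrightarrow> dist (ig t y) (ig t x) < e" if e: "e > 0" for x e
  proof -
    have e': "e / (2 * T) > 0" using e T by simp
    obtain d where d: "d > 0" "\<And>x y s t. s \<in> {0..T} \<Longrightarrow> t \<in> {0..T} \<Longrightarrow> dist x y < d \<Longrightarrow> \<bar>s - t\<bar> < d \<Longrightarrow> \<bar>gg x s - gg y t\<bar> < e / (2 * T)"
      using periodic_uniform(2)[OF gg_cont gg_per e'] by blast
    show ?thesis
    proof (intro exI[of _ d] conjI d(1) allI impI)
      fix y assume y: "dist y x < d"
      have "\<bar>ig t y - ig t x\<bar> \<le> T * (e / (2 * T))"
        using d(2)[OF _ _ y] d(1) e' by (intro ig_diff[OF t]) (auto intro: less_imp_le)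
      also have "\<dots> < e" using T e by simp
      finally show "dist (ig t y) (ig t x) < e" by (simp add: dist_real_def)
    qed
  qed
  then show ?thesis unfolding continuous_on_iff by blast
qed

end

section \<open>Riemann sums of the limiting flux and convergence in mean square\<close>

context hydro
begin

lemma rateN_Lam: "Nseq n \<ge> 3 \<Longrightarrow> torus.Lam TYPE('d) (Nseq n) = rateN n"
  unfolding rateN_def by (rule torus.total_rate_Lam[symmetric]) (rule torus.intro)

lemma rateN_ge: "Nseq n \<ge> 3 \<Longrightarrow> rateN n \<ge> real (Nseq n)"
  using torus.Lam_ge[OF torus.intro, of "Nseq n", where 'd='d] by (simp add: rateN_Lam)

lemma ig_per: "periodic_fun (ig t)"
proof -
  have "gg (x + axis i 1) = gg x" for x i using gg_per by (auto simp: periodic_fun_def fun_eq_iff)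
  then show ?thesis by (simp add: periodic_fun_def ig_def)
qed

text \<open>Number of rings expected by time \<open>t\<close>. Negative times give 0 because of
  \<open>nat\<close>, which matters for arguments such as \<open>t - dl n\<close>.\<close>

definition Ks :: "nat \<Rightarrow> real \<Rightarrow> nat" where "Ks n t = nat \<lfloor>rateN n * t\<rfloor>"

lemma Ks_le: "Nseq n \<ge> 3 \<Longrightarrow> 0 \<le> t \<Longrightarrow> real (Ks n t) \<le> rateN n * t"
  using rateN_ge[of n] by (simp add: Ks_def)

lemma main_riemann:
  assumes \<phi>: "continuous_on UNIV \<phi>" "periodic_fun \<phi>" and t: "t \<in> {0..T}" and e: "e > 0"
  shows "eventually (\<lambda>n. \<bar>(\<Sum>k<Ks n t. \<Sum>x\<in>sites (Nseq n). \<phi> (loc (Nseq n) x) * gg (loc (Nseq n) x) (k / rateN n)) / (rateN n * real (Nseq n) ^ CARD('d)) - wl \<phi> t\<bar> < e) sequentially"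
proof -
  obtain B where B: "B \<ge> 0" "\<And>x. \<bar>\<phi> x\<bar> \<le> B" using periodic_uniform1(1)[OF \<phi>] by blast
  let ?f = "\<lambda>x. \<phi> x * ig t x"
  have fc: "continuous_on UNIV ?f" by (intro continuous_on_mult \<phi> ig_cont t)
  have fp: "periodic_fun ?f" using \<phi>(2) ig_per[of t] by (simp add: periodic_fun_def)
  \<comment> \<open>A quarter of \<open>e\<close> each for the time sums, the incomplete last step
    and the sum over space; the \<open>+ 1\<close> guards against a vanishing factor.\<close>
  define e1 where "e1 = e / (4 * (B * T + 1))"
  have BT: "B * T \<ge> 0" using B T by simp
  have e1: "e1 > 0" using e BT by (simp add: e1_def)
  obtain d where d: "d > 0" "\<And>x y s t. s \<in> {0..T} \<Longrightarrow> t \<in> {0..T} \<Longrightarrow> dist x y < d \<Longrightarrow> \<bar>s - t\<bar> < d \<Longrightarrow> \<bar>gg x s - gg y t\<bar> < e1"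
    using periodic_uniform(2)[OF gg_cont gg_per e1] by blast
  have e4: "e / 4 > 0" using e by simp
  obtain d' where d': "d' > 0" "\<And>x y. dist x y < d' \<Longrightarrow> \<bar>?f x - ?f y\<bar> < e / 4"
    using periodic_uniform1(2)[OF fc fp e4] by blast
  show ?thesis using N_large[of 3] dist_small[OF d(1), of 1] dist_small[OF d'(1), of "real CARD('d)"] dist_small[OF e4, of "B * Gb"]
  proof eventually_elim
    case (elim n)
    let ?N = "Nseq n" let ?L = "rateN n"
    have N0: "real ?N > 0" using elim by simp
    have L: "?L \<ge> ?N" "?L > 0" using rateN_ge[OF elim(1)] N0 by linarith+
    have iL: "1 / ?L \<le> 1 / ?N" using L N0 by (intro divide_left_mono) auto
    have tr: "\<bar>(\<Sum>k<Ks n t. gg x (k / ?L)) / ?L - ig t x\<bar> \<le> e1 * t + Gb / ?L" for x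
      unfolding Ks_def ig_def
    proof (rule time_riemann)
      show "continuous_on {0..t} (gg x)" using t by (intro gg_cont_t) auto
      fix r s assume "r \<in> {0..t}" "s \<in> {0..t}" "\<bar>r - s\<bar> \<le> 1 / ?L"
      then show "\<bar>gg x r - gg x s\<bar> \<le> e1" using d(2)[of r s x x] d(1) t iL elim(2) by fastforce
    qed (use L t e1 Gb in auto)
    have a: "\<bar>(\<Sum>x\<in>sites ?N. \<phi> (loc ?N x) * ((\<Sum>k<Ks n t. gg (loc ?N x) (k / ?L)) / ?L)) - (\<Sum>x\<in>sites ?N. ?f (loc ?N x))\<bar> \<le> real ?N ^ CARD('d) * (B * (e1 * t + Gb / ?L))"
    proof -
      have "\<bar>\<phi> (loc ?N x) * ((\<Sum>k<Ks n t. gg (loc ?N x) (k / ?L)) / ?L) - ?f (loc ?N x)\<bar> \<le> B * (e1 * t + Gb / ?L)" for x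
        unfolding right_diff_distrib[symmetric] abs_mult using B tr by (intro mult_mono) auto
      then have "(\<Sum>x\<in>sites ?N. \<bar>\<phi> (loc ?N x) * ((\<Sum>k<Ks n t. gg (loc ?N x) (k / ?L)) / ?L) - ?f (loc ?N x)\<bar>) \<le> (\<Sum>x\<in>(sites ?N :: 'd site set). B * (e1 * t + Gb / ?L))"
        by (intro sum_mono)
      also have "\<dots> = real ?N ^ CARD('d) * (B * (e1 * t + Gb / ?L))" by (simp add: card_sites)
      finally show ?thesis unfolding sum_subtractf[symmetric] by (rule order_trans[OF sum_abs])
    qed
    have sr: "\<bar>(\<Sum>x\<in>sites ?N. ?f (loc ?N x)) / real ?N ^ CARD('d) - integral ucube ?f\<bar> \<le> e / 4"
    proof (rule space_riemann[OF fc])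
      fix x y :: "real^'d" assume "dist x y \<le> real CARD('d) / ?N"
      then have "dist x y < d'" using elim(3) by linarith
      from d'(2)[OF this] show "\<bar>?f x - ?f y\<bar> \<le> e / 4" by simp
    qed (use elim e in auto)
    have "(\<Sum>k<Ks n t. \<Sum>x\<in>sites ?N. \<phi> (loc ?N x) * gg (loc ?N x) (k / ?L)) = (\<Sum>x\<in>sites ?N. \<Sum>k<Ks n t. \<phi> (loc ?N x) * gg (loc ?N x) (k / ?L))"
      by (rule sum.swap)
    also have "\<dots> = ?L * (\<Sum>x\<in>sites ?N. \<phi> (loc ?N x) * ((\<Sum>k<Ks n t. gg (loc ?N x) (k / ?L)) / ?L))"
      using L unfolding sum_distrib_left[where A="sites ?N"] by (intro sum.cong refl) (simp add: sum_distrib_left[symmetric])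
    finally have eq: "(\<Sum>k<Ks n t. \<Sum>x\<in>sites ?N. \<phi> (loc ?N x) * gg (loc ?N x) (k / ?L)) / (?L * real ?N ^ CARD('d)) =
      (\<Sum>x\<in>sites ?N. \<phi> (loc ?N x) * ((\<Sum>k<Ks n t. gg (loc ?N x) (k / ?L)) / ?L)) / real ?N ^ CARD('d)"
      using L by simp
    have W: "real ?N ^ CARD('d) > 0" using N0 by simp
    have "\<bar>(\<Sum>x\<in>sites ?N. \<phi> (loc ?N x) * ((\<Sum>k<Ks n t. gg (loc ?N x) (k / ?L)) / ?L)) / real ?N ^ CARD('d) - (\<Sum>x\<in>sites ?N. ?f (loc ?N x)) / real ?N ^ CARD('d)\<bar> \<le> B * (e1 * t + Gb / ?L)"
      using a W unfolding diff_divide_distrib[symmetric] abs_divide by (simp add: pos_divide_le_eq mult.commute)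
    moreover have "B * (e1 * t + Gb / ?L) \<le> e / 4 + e / 4"
    proof -
      have "B * (e1 * t) \<le> (B * T) * e1" using t B e1 by (simp add: mult_left_mono mult.assoc mult.left_commute[of _ e1] mult.commute[of e1])
      also have "\<dots> \<le> (B * T + 1) * e1" using e1 by (intro mult_right_mono) auto
      also have "\<dots> = e / 4"
      proof -
        have "z * (e / (4 * z)) = e / 4" if "z > 0" for z using that by simp
        from this[of "B * T + 1"] show ?thesis unfolding e1_def using BT by argo
      qed
      finally have "B * (e1 * t) \<le> e / 4" .
      moreover have "B * Gb / ?L \<le> B * Gb / ?N" using L N0 B Gb(1) by (intro divide_left_mono mult_nonneg_nonneg) auto
      moreover have "B * Gb / ?N < e / 4" by (rule elim(4))
      moreover have "B * (e1 * t + Gb / ?L) = B * (e1 * t) + B * Gb / ?L" by (simp add: distrib_left)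
      ultimately show ?thesis by argo
    qed
    ultimately show ?case unfolding eq wl_def using sr e unfolding ig_def by linarith
  qed
qed

text \<open>\<open>main_riemann\<close> after two perturbations: bond midpoints instead of sites,
  and \<open>kap n\<close> instead of its limit.\<close>

lemma riem_limit:
  assumes \<phi>: "continuous_on UNIV \<phi>" "periodic_fun \<phi>" and t: "t \<in> {0..T}" and e: "e > 0"
  shows "eventually (\<lambda>n. \<bar>torus.riem (Nseq n) (Ks n t) (\<lambda>x k. \<phi> (mid n l s x) * (\<rho> (loc (Nseq n) x) (k / rateN n) - kap n * (\<rho> (loc (Nseq n) x) (k / rateN n))\<^sup>2)) - wl \<phi> t\<bar> < e) sequentially"
proof -
  obtain B where B: "B \<ge> 0" "\<And>x. \<bar>\<phi> x\<bar> \<le> B" using periodic_uniform1(1)[OF \<phi>] by blast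
  define Q where "Q = Rb + (kaplim + 1) * Rb\<^sup>2"
  have Q0: "Q \<ge> 0" unfolding Q_def using Rb(1) kaplim_nonneg by simp
  define e1 where "e1 = e / (4 * T * (Q + 1))"
  have e1: "e1 > 0" using e T Q0 by (simp add: e1_def)
  define e2 where "e2 = min 1 (e / (4 * T * (B * Rb\<^sup>2 + 1)))"
  have BR: "B * Rb\<^sup>2 \<ge> 0" using B by simp
  have e2: "e2 > 0" using e T BR by (auto simp: e2_def intro!: divide_pos_pos mult_pos_pos)
  obtain d where d: "d > 0" "\<And>x y. dist x y < d \<Longrightarrow> \<bar>\<phi> x - \<phi> y\<bar> < e1"
    using periodic_uniform1(2)[OF \<phi> e1] by blast
  have kk: "eventually (\<lambda>n. \<bar>kap n - kaplim\<bar> < e2) sequentially"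
    using tendstoD[OF kap_lim e2] by (simp add: dist_real_def)
  have e2': "e / 2 > 0" using e by simp
  show ?thesis using N_large[of 3] dist_small[OF d(1), of 1] kk main_riemann[OF \<phi> t e2']
  proof eventually_elim
    case (elim n)
    let ?N = "Nseq n" let ?L = "rateN n"
    interpret torus "?N" "TYPE('d)" by (rule torus.intro) (use elim in simp)
    have LL: "Lam = ?L" using rateN_Lam elim(1) by simp
    have N0: "real ?N > 0" using elim by simp
    have K: "real (Ks n t) \<le> Lam * T"
    proof -
      have "real (Ks n t) \<le> ?L * t" using Ks_le elim(1) t by simp
      also have "\<dots> \<le> ?L * T" using t Lam_pos LL by (intro mult_left_mono) auto
      finally show ?thesis by (simp add: LL)
    qed
    have "\<bar>kap n - kaplim\<bar> < 1" using elim(3) unfolding e2_def min_less_iff_conj by (rule conjunct1)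
    then have kap1: "kap n \<le> kaplim + 1" by argo
    have "\<bar>riem (Ks n t) (\<lambda>x k. \<phi> (mid n l s x) * (\<rho> (loc ?N x) (k / ?L) - kap n * (\<rho> (loc ?N x) (k / ?L))\<^sup>2)) - riem (Ks n t) (\<lambda>x k. \<phi> (loc ?N x) * gg (loc ?N x) (k / ?L))\<bar>
      \<le> T * (e1 * Q + B * (e2 * Rb\<^sup>2))"
    proof (rule riem_diff_le[OF _ K])
      fix x k assume k: "k < Ks n t"
      have kT: "k / ?L \<in> {0..T}"
      proof -
        have "real k \<le> Lam * T" using k K by linarith
        then show ?thesis using Lam_pos LL by (simp add: pos_divide_le_eq mult.commute)
      qed
      let ?r = "\<rho> (loc ?N x) (k / ?L)"
      have r: "\<bar>?r\<bar> \<le> Rb" by (rule Rb(2)[OF kT])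
      have r2: "?r\<^sup>2 \<le> Rb\<^sup>2" using power_mono[OF r, of 2] by simp
      have "dist (mid n l s x) (loc ?N x) = 1 / ?N / 2" using N0 by (simp add: mid_def dist_norm)
      also have "\<dots> < d" using elim(2) N0 d(1) by (simp add: field_simps)
      finally have p: "\<bar>\<phi> (mid n l s x) - \<phi> (loc ?N x)\<bar> \<le> e1" using d(2) by (simp add: less_imp_le)
      have q: "\<bar>(?r - kap n * ?r\<^sup>2) - gg (loc ?N x) (k / ?L)\<bar> \<le> e2 * Rb\<^sup>2"
      proof -
        have "\<bar>(?r - kap n * ?r\<^sup>2) - gg (loc ?N x) (k / ?L)\<bar> = \<bar>kap n - kaplim\<bar> * ?r\<^sup>2"
          by (simp add: gg_def left_diff_distrib[symmetric] abs_mult abs_minus_commute)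
        also have "\<dots> \<le> e2 * Rb\<^sup>2" using elim(3) r2 e2 by (intro mult_mono) auto
        finally show ?thesis .
      qed
      have b: "\<bar>?r - kap n * ?r\<^sup>2\<bar> \<le> Q"
      proof -
        have "kap n * ?r\<^sup>2 \<le> (kaplim + 1) * Rb\<^sup>2" using kap1 r2 kaplim_nonneg by (intro mult_mono) auto
        moreover have "0 \<le> kap n * ?r\<^sup>2" using kap_nonneg by simp
        ultimately show ?thesis using r unfolding Q_def by linarith
      qed
      show "\<bar>\<phi> (mid n l s x) * (?r - kap n * ?r\<^sup>2) - \<phi> (loc ?N x) * gg (loc ?N x) (k / ?L)\<bar> \<le> e1 * Q + B * (e2 * Rb\<^sup>2)"
        by (rule abs_mult_diff_le[OF p q b B(2)])
    qed (use e1 Q0 B e2 in simp)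
    moreover have "T * (e1 * Q + B * (e2 * Rb\<^sup>2)) \<le> e / 4 + e / 4"
    proof -
      have "T * (e1 * Q) \<le> T * (e1 * (Q + 1))" using T e1 by (intro mult_left_mono) auto
      also have "\<dots> = e / 4" using T Q0 by (simp add: e1_def)
      finally have 1: "T * (e1 * Q) \<le> e / 4" .
      have "T * (B * (e2 * Rb\<^sup>2)) = (T * (B * Rb\<^sup>2)) * e2" by simp
      also have "\<dots> \<le> (T * (B * Rb\<^sup>2 + 1)) * e2" using T e2 by (intro mult_right_mono mult_left_mono) auto
      also have "\<dots> \<le> (T * (B * Rb\<^sup>2 + 1)) * (e / (4 * T * (B * Rb\<^sup>2 + 1)))"
        using T BR by (intro mult_left_mono) (auto simp: e2_def)
      also have "\<dots> = e / 4"
      proof -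
        have "(T * z) * (e / (4 * T * z)) = e / 4" if "z > 0" for z using T that by simp
        then show ?thesis using BR by simp
      qed
      finally show ?thesis using 1 by (simp add: distrib_left)
    qed
    moreover have "\<bar>riem (Ks n t) (\<lambda>x k. \<phi> (loc ?N x) * gg (loc ?N x) (k / ?L)) - wl \<phi> t\<bar> < e / 2"
      using elim(4) unfolding riem_def LL .
    ultimately show ?case by linarith
  qed
qed

end

text \<open>Exclusion only suppresses jumps, so the mean gain per ring is at most that of the linear
  statistic. This controls the flux within the uncertainty window of the random clock.\<close>

lemma (in ssep_flux) flux_incr: "Ex (\<lambda>st. flux st) (j + m) - Ex (\<lambda>st. flux st) j \<le> m * (B * \<kappa> * real N ^ CARD('d) / card pairsN)"
proof (induction m)
  case (Suc m)
  have C: "real (card pairsN) > 0" using card_pairs_ge1 by simp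
  have z: "(\<lambda>_. 0) \<in> sitesN" using N1 by (simp add: sites_def)
  have le: "(\<Sum>c\<in>pairsN. flux (clock_step st c)) / card pairsN \<le> flux st + q1 N \<phi> (fst st) / card pairsN" for st
  proof -
    have "(\<Sum>c\<in>pairsN. flux (clock_step st c)) - card pairsN * flux st \<le> q1 N \<phi> (fst st)"
    proof -
      have "(\<Sum>c\<in>pairsN. flux (clock_step st c)) - card pairsN * flux st = q1 N \<phi> (fst st) - q2 N V (fst st)"
        using sum_flux_step[of st] by (simp add: sum_subtractf)
      moreover have "0 \<le> q2 N V (fst st)"
        unfolding q2_V by (intro sum_nonneg) (use \<phi> in auto)
      ultimately show ?thesis by simp
    qed
    then show ?thesis using C by (simp add: field_simps)
  qed
  have "Ex (\<lambda>st. flux st) (Suc (j + m)) = Ex (\<lambda>st. (\<Sum>c\<in>pairsN. flux (clock_step st c)) / card pairsN) (j + m)"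
    by (rule Ex_step[OF obs_flux])
  also have "\<dots> \<le> Ex (\<lambda>st. flux st + q1 N \<phi> (fst st) / card pairsN) (j + m)"
    by (intro Ex_mono le obs_divide obs_add obs_sum obs_flux obs_q1 obs_clock finite_nbr_pairs)
  also have "\<dots> = Ex (\<lambda>st. flux st) (j + m) + Ex (\<lambda>st. q1 N \<phi> (fst st)) (j + m) / card pairsN"
    by (simp add: Ex_add Ex_divide obs_flux obs_divide obs_q1)
  also have "Ex (\<lambda>st. q1 N \<phi> (fst st)) (j + m) \<le> B * \<kappa> * real N ^ CARD('d)"
  proof -
    have "Ex (\<lambda>st. q1 N \<phi> (fst st)) (j + m) \<le> \<kappa> * (\<Sum>x\<in>sitesN. \<phi> x)" using \<phi> by (intro Ex_q1_le) auto
    also have "\<dots> \<le> \<kappa> * (\<Sum>x\<in>sitesN. B)" using \<phi> by (intro mult_left_mono sum_mono \<kappa>_nonneg) auto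
    finally show ?thesis by (simp add: card_sites mult_ac)
  qed
  finally have "Ex (\<lambda>st. flux st) (Suc (j + m)) \<le> Ex (\<lambda>st. flux st) (j + m) + B * \<kappa> * real N ^ CARD('d) / card pairsN"
    using C by (simp add: divide_right_mono)
  moreover have "a' - z \<le> real (Suc m) * c" if "a' \<le> a + c" "a - z \<le> real m * c" for a' a z c :: real
    using that by (simp add: distrib_right)
  ultimately show ?case using Suc.IH unfolding add_Suc_right by blast
qed simp

context hydro
begin

lemma ssep_flux_hydro:
  assumes "Nseq n \<ge> 3" "\<And>x. 0 \<le> \<phi> x \<and> \<phi> x \<le> B"
  shows "ssep_flux (Nseq n) Nseq \<rho>0 n (kap n * Rb) (\<lambda>x. \<phi> (mid n l s x)) B"
  using ssep_hydro[OF assms(1)] assms(2) by (intro ssep_flux.intro ssep_flux_axioms.intro) auto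

lemma kap_card: "kap n * real (Nseq n) ^ CARD('d) = real n"
  using Nseq1[of n] by (simp add: kap_def power_divide)

lemma Ks_le_T: "Nseq n \<ge> 3 \<Longrightarrow> t \<in> {0..T} \<Longrightarrow> real (Ks n t) \<le> rateN n * T"
proof -
  assume a: "Nseq n \<ge> 3" "t \<in> {0..T}"
  have "0 \<le> rateN n" using rateN_ge[OF a(1)] a(1) by linarith
  then have "rateN n * t \<le> rateN n * T" using a(2) by (intro mult_left_mono) auto
  then show ?thesis using Ks_le[OF a(1), of t] a(2) by auto
qed

lemma fl_incr:
  assumes N: "Nseq n \<ge> 3" and n: "n \<ge> 1" and \<phi>: "\<And>x. 0 \<le> \<phi> x \<and> \<phi> x \<le> B"
  shows "(\<integral>\<omega>. fl n (j + m) l s \<phi> \<omega> - fl n j l s \<phi> \<omega> \<partial>Omega) \<le> m * (B * Rb) / rateN n"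
proof -
  interpret ssep_flux "Nseq n" "TYPE('d)" Nseq \<rho>0 n "kap n * Rb" l s "\<lambda>x. \<phi> (mid n l s x)" B
    by (rule ssep_flux_hydro[OF N \<phi>])
  let ?a = "1 / ((real (Nseq n))\<^sup>2 * n)"
  have f: "fl n k l s \<phi> \<omega> = ?a * flux (chain Nseq \<rho>0 n \<omega> k)" for k \<omega> by (simp add: fl_def flux_def)
  have "(\<integral>\<omega>. fl n (j + m) l s \<phi> \<omega> - fl n j l s \<phi> \<omega> \<partial>Omega) = ?a * (Ex (\<lambda>st. flux st) (j + m) - Ex (\<lambda>st. flux st) j)"
    unfolding f Ex_def right_diff_distrib
    by (subst Bochner_Integration.integral_diff) (auto intro: obs_integrable[OF obs_flux])
  also have "\<dots> \<le> ?a * (m * (B * (kap n * Rb) * real (Nseq n) ^ CARD('d) / card pairsN))"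
    by (intro mult_left_mono flux_incr) simp
  also have "B * (kap n * Rb) * real (Nseq n) ^ CARD('d) = B * Rb * n" by (simp only: kap_card[of n, symmetric] mult_ac)
  also have "?a * (m * (B * Rb * n / card pairsN)) = m * (B * Rb) / rateN n"
    unfolding rateN_Lam[OF N, symmetric] Lam_def using n by simp
  finally show ?thesis .
qed

lemma fl_integrable: "integrable Omega (fl n k l s \<phi>)"
proof -
  have "obs (\<lambda>st. 1 / ((real (Nseq n))\<^sup>2 * n) * (\<Sum>x\<in>sites (Nseq n). \<phi> (mid n l s x) * real (snd st x (shift (Nseq n) l s x))))"
    by (intro obs_scale obs_sum obs_cnt) auto
  from obs_integrable[OF this, of Nseq \<rho>0 n k] show ?thesis unfolding fl_def[abs_def] .
qed

text \<open>The order of choices is forced: the tolerance \<open>\<delta>\<close> determines the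
  polynomial and its constant \<open>L\<close>, these determine the distance \<open>M\<close>, and
  only then does \<open>n\<close> grow. The error then splits into fluctuation about the mean and
  bias of the mean.\<close>

lemma fl_L2:
  assumes \<phi>: "continuous_on UNIV \<phi>" "periodic_fun \<phi>" and \<phi>B: "\<And>x. 0 \<le> \<phi> x \<and> \<phi> x \<le> B"
    and t: "t \<in> {0..T}" and e: "e > 0"
  shows "eventually (\<lambda>n. integrable Omega (\<lambda>\<omega>. (fl n (Ks n t) l s \<phi> \<omega> - wl \<phi> t)\<^sup>2) \<and>
     (\<integral>\<omega>. (fl n (Ks n t) l s \<phi> \<omega> - wl \<phi> t)\<^sup>2 \<partial>Omega) < e) sequentially"
proof -
  have B0: "0 \<le> B" using \<phi>B[of 0] by linarith
  note pos = B0 T Rb(1) kaplim_nonneg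
  let ?R = Rb let ?k = kaplim
  define a where "a = sqrt e / 2"
  have a: "a > 0" "2 * a\<^sup>2 = e / 2" using e by (auto simp: a_def power_divide)
  \<comment> \<open>The total coefficient of \<open>\<delta>\<close> in the limit of the bound from
    \<open>mean_close\<close>, with both of its tolerances equal to \<open>\<delta>\<close>.\<close>
  define C1 where "C1 = T * (B * (3 * (1 + 2 * ?k * ?R) + 4 * ?k * ?R)) + T * (B * ?k * (4 * (2 * ?R + 1)))"
  have C1: "C1 \<ge> 0" unfolding C1_def using pos by (intro add_nonneg_nonneg mult_nonneg_nonneg) auto
  define \<delta> where "\<delta> = min (1/2) (a / (4 * (C1 + 1)))"
  have \<delta>: "\<delta> > 0" "\<delta> + \<delta> \<le> 1" using a C1 by (auto simp: \<delta>_def)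
  have \<delta>C: "C1 * \<delta> \<le> a / 4"
  proof -
    have "C1 * \<delta> \<le> (C1 + 1) * (a / (4 * (C1 + 1)))" using C1 \<delta> by (intro mult_mono) (auto simp: \<delta>_def)
    moreover have "z * (a / (4 * z)) = a / 4" if "z > 0" for z using that by simp
    from this[of "C1 + 1"] have "(C1 + 1) * (a / (4 * (C1 + 1))) = a / 4" using C1 by argo
    ultimately show ?thesis by argo
  qed
  obtain p where p: "trig p" "\<And>x. \<bar>\<rho>0 x - p x\<bar> < \<delta>" using trig_dense[OF \<rho>0c \<rho>0p \<delta>(1)] by blast
  obtain v L where vL: "0 \<le> L" "\<And>T. heat_sol T p v" "\<And>N. N \<ge> 3 \<Longrightarrow> torus.approx_at N p v L"
    using trig_good[OF p(1)] unfolding good_def by blast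
  \<comment> \<open>\<open>C2\<close> and \<open>C3\<close> are the coefficients of
    \<open>1 / M\<close> in the limiting bounds for the mean and the variance.\<close>
  define C2 where "C2 = T * (B * ?k * (2 * real CARD('d) * L\<^sup>2 * T))"
  define C3 where "C3 = 96 * B\<^sup>2 * T * (?R\<^sup>2 + ?R) * T"
  have C23: "C2 \<ge> 0" "C3 \<ge> 0" using pos by (auto simp: C2_def C3_def)
  obtain M :: nat where M: "real M > 1 + C2 / (a / 4) + C3 / (e / 8)" using reals_Archimedean2 by blast
  have q: "0 \<le> C2 / (a / 4)" "0 \<le> C3 / (e / 8)" using C23 a e by auto
  have M1: "1 \<le> M" using M q by linarith
  have M0: "real M > 0" using M1 by simp
  have M2: "C2 / M < a / 4" "C3 / M < e / 8"
  proof -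
    have "C2 / (a / 4) < M" using M q by linarith
    then show "C2 / M < a / 4" using a M0 by (simp add: field_simps)
    have "C3 / (e / 8) < M" using M q by linarith
    then show "C3 / M < e / 8" using e M0 by (simp add: field_simps)
  qed
  let ?N = "\<lambda>n. real (Nseq n)"
  let ?mb = "\<lambda>n. T * (B * ((2 * \<delta> + \<delta> + L * T * (1 / ?N n)) * (1 + 2 * kap n * ?R) + kap n * ?R * (2 * (\<delta> + \<delta>) + L * (1 / ?N n))))
     + T * (B * kap n * (2 * (\<delta> + \<delta>) * (2 * ?R + 1) + 2 * real CARD('d) * L\<^sup>2 * (T / M + 2 * sqrt (T * M) * (1 / ?N n)) + T * L\<^sup>2 * (1 / ?N n)))"
  have 1: "?mb \<longlonglongrightarrow> T * (B * ((2 * \<delta> + \<delta> + L * T * 0) * (1 + 2 * ?k * ?R) + ?k * ?R * (2 * (\<delta> + \<delta>) + L * 0)))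
     + T * (B * ?k * (2 * (\<delta> + \<delta>) * (2 * ?R + 1) + 2 * real CARD('d) * L\<^sup>2 * (T / M + 2 * sqrt (T * M) * 0) + T * L\<^sup>2 * 0))"
    by (intro tendsto_intros Nlim kap_lim)
  have eq1: "T * (B * ((2 * \<delta> + \<delta> + L * T * 0) * (1 + 2 * ?k * ?R) + ?k * ?R * (2 * (\<delta> + \<delta>) + L * 0)))
     + T * (B * ?k * (2 * (\<delta> + \<delta>) * (2 * ?R + 1) + 2 * real CARD('d) * L\<^sup>2 * (T / M + 2 * sqrt (T * M) * 0) + T * L\<^sup>2 * 0)) = C1 * \<delta> + C2 / M"
    unfolding C1_def C2_def by (simp add: algebra_simps)
  have lt1: "C1 * \<delta> + C2 / M < a / 2" using \<delta>C M2 by argo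
  have mb: "eventually (\<lambda>n. ?mb n < a / 2) sequentially"
    by (rule order_tendstoD(2)[OF 1[unfolded eq1] lt1])
  let ?vb = "\<lambda>n. B\<^sup>2 * (1 / real n) * (2 * T\<^sup>2 * ?R * (1 + 2 * (kap n * ?R) + 4 * (kap n * ?R)\<^sup>2) + 3 * T * ?R + 12 * T\<^sup>2 * ?R)
    + 96 * B\<^sup>2 * T * (?R\<^sup>2 + ?R) * (T / M + 2 * sqrt (T * M) * (1 / ?N n))"
  have 2: "?vb \<longlonglongrightarrow> B\<^sup>2 * 0 * (2 * T\<^sup>2 * ?R * (1 + 2 * (?k * ?R) + 4 * (?k * ?R)\<^sup>2) + 3 * T * ?R + 12 * T\<^sup>2 * ?R)
    + 96 * B\<^sup>2 * T * (?R\<^sup>2 + ?R) * (T / M + 2 * sqrt (T * M) * 0)"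
    by (intro tendsto_intros Nlim kap_lim lim_1_over_n)
  have eq2: "B\<^sup>2 * 0 * (2 * T\<^sup>2 * ?R * (1 + 2 * (?k * ?R) + 4 * (?k * ?R)\<^sup>2) + 3 * T * ?R + 12 * T\<^sup>2 * ?R)
    + 96 * B\<^sup>2 * T * (?R\<^sup>2 + ?R) * (T / M + 2 * sqrt (T * M) * 0) = C3 / M"
    by (simp add: C3_def)
  have vb: "eventually (\<lambda>n. ?vb n < e / 8) sequentially"
    by (rule order_tendstoD(2)[OF 2[unfolded eq2] M2(2)])
  have a2: "a / 2 > 0" using a by simp
  show ?thesis using N_large[of 3] N_large[of "Suc M"] mb vb uh_close[OF \<delta>(1)] riem_limit[OF \<phi> t a2, of l s] eventually_ge_at_top[of 1]
  proof eventually_elim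
    case (elim n)
    interpret ssep_flux "Nseq n" "TYPE('d)" Nseq \<rho>0 n "kap n * Rb" l s "\<lambda>x. \<phi> (mid n l s x)" B
      by (rule ssep_flux_hydro[OF elim(1) \<phi>B])
    have MN: "M < Nseq n" using elim(2) by simp
    have LL: "Lam = rateN n" by (rule rateN_Lam[OF elim(1)])
    have K: "real (Ks n t) \<le> Lam * T" unfolding LL by (rule Ks_le_T[OF elim(1) t])
    let ?a = "1 / ((real (Nseq n))\<^sup>2 * n)"
    let ?m = "?a * mean_flux (Ks n t)"
    have f: "fl n k l s \<phi> \<omega> = ?a * flux (chain Nseq \<rho>0 n \<omega> k)" for k \<omega> by (simp add: fl_def flux_def)
    have "\<bar>?m - wl \<phi> t\<bar> < a"
    proof -
      have 1: "?m = riem (Ks n t) (\<lambda>x k. \<phi> (mid n l s x) * (S1.pow k (uh n) x - kap n * S2.pow k (tens (uh n)) (x, shift (Nseq n) l s x)))"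
        by (rule mean_flux_riem[OF init_uh elim(7) kap_card])
      have "\<bar>?m - riem (Ks n t) (\<lambda>x k. \<phi> (mid n l s x) * (\<rho> (loc (Nseq n) x) (k / Lam) - kap n * (\<rho> (loc (Nseq n) x) (k / Lam))\<^sup>2))\<bar> \<le>
         T * (B * ((2 * \<delta> + \<delta> + L * T / ?N n) * (1 + 2 * kap n * ?R) + kap n * ?R * (2 * (\<delta> + \<delta>) + L / ?N n)))
     + T * (B * kap n * (2 * (\<delta> + \<delta>) * (2 * ?R + 1) + 2 * real CARD('d) * L\<^sup>2 * (T / M + 2 * sqrt (T * M) / ?N n) + T * L\<^sup>2 / ?N n))"
        unfolding 1
        by (rule mean_close[OF T vL(3)[OF elim(1)] vL(1) hs vL(2)])
           (rule less_imp_le[OF p(2)] elim(5)[rule_format] uh_le \<delta>(2) Rb(2) \<phi>B K M1 MN kap_nonneg | assumption)+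
      moreover have "\<bar>m - w\<bar> < a" if "\<bar>m - r\<bar> \<le> b" "b < a / 2" "\<bar>r - w\<bar> < a / 2" for m w r b :: real using that by argo
      ultimately show ?thesis using elim(3)[unfolded times_divide_eq_right mult_1_right] elim(6) unfolding LL by blast
    qed
    then have m2: "(?m - wl \<phi> t)\<^sup>2 \<le> a\<^sup>2" using a power_mono[of "\<bar>?m - wl \<phi> t\<bar>" a 2] by simp
    have V: "?a\<^sup>2 * Ex (\<lambda>st. (flux st - mean_flux (Ks n t))\<^sup>2) (Ks n t) < e / 8"
      by (rule le_less_trans[OF var_norm[OF refl kap_nonneg Rb(1) elim(7) kap_card K less_imp_le[OF T] M1 MN]
          elim(4)[unfolded times_divide_eq_right mult_1_right]])
    have o1: "obs (\<lambda>st. (?a * flux st - wl \<phi> t)\<^sup>2)" by (intro obs_power2 obs_diff obs_scale obs_flux obs_const)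
    have o2: "obs (\<lambda>st. (2 * ?a\<^sup>2) * (flux st - mean_flux (Ks n t))\<^sup>2)" by (intro obs_power2 obs_diff obs_scale obs_flux obs_const)
    have o3: "obs (\<lambda>st. 2 * (?m - wl \<phi> t)\<^sup>2)" by (rule obs_const)
    have "Ex (\<lambda>st. (?a * flux st - wl \<phi> t)\<^sup>2) (Ks n t) \<le> Ex (\<lambda>st. (2 * ?a\<^sup>2) * (flux st - mean_flux (Ks n t))\<^sup>2 + 2 * (?m - wl \<phi> t)\<^sup>2) (Ks n t)"
    proof (rule Ex_mono[OF o1 obs_add[OF o2 o3]])
      fix st
      have "(b * x - w)\<^sup>2 \<le> 2 * b\<^sup>2 * (x - y)\<^sup>2 + 2 * (b * y - w)\<^sup>2" for b x y w :: real
      proof -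
        have "0 \<le> (b * x - b * y - (b * y - w))\<^sup>2" by simp
        then show ?thesis by (simp add: power2_eq_square algebra_simps)
      qed
      then show "(?a * flux st - wl \<phi> t)\<^sup>2 \<le> (2 * ?a\<^sup>2) * (flux st - mean_flux (Ks n t))\<^sup>2 + 2 * (?m - wl \<phi> t)\<^sup>2" .
    qed
    also have "\<dots> = 2 * (?a\<^sup>2 * Ex (\<lambda>st. (flux st - mean_flux (Ks n t))\<^sup>2) (Ks n t)) + 2 * (?m - wl \<phi> t)\<^sup>2"
      unfolding Ex_add[OF o2 o3] Ex_scale Ex_const by (simp only: mult.assoc)
    also have "\<dots> < e" using V m2 a(2) e by argo
    finally have "(\<integral>\<omega>. (fl n (Ks n t) l s \<phi> \<omega> - wl \<phi> t)\<^sup>2 \<partial>Omega) < e" unfolding Ex_def f .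
    moreover have "integrable Omega (\<lambda>\<omega>. (fl n (Ks n t) l s \<phi> \<omega> - wl \<phi> t)\<^sup>2)"
      unfolding f by (rule obs_integrable[OF o1])
    ultimately show ?case by blast
  qed
qed

end

section \<open>Convergence with high probability and the clocks\<close>

text \<open>The probability bound is put on a measurable subset, so \<open>P n\<close> may quantify
  over uncountably many times and test functions without a measurability proof.\<close>

definition whp :: "(nat \<Rightarrow> (nat \<Rightarrow> real) \<Rightarrow> bool) \<Rightarrow> bool" where
  "whp P \<longleftrightarrow> (\<forall>e>0. eventually (\<lambda>n. \<exists>E\<in>sets Omega. 1 - e \<le> Om.prob E \<and> (\<forall>\<omega>\<in>E. P n \<omega>)) sequentially)"

lemma compl_Omega: "A \<in> sets Omega \<Longrightarrow> UNIV - A \<in> sets Omega"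
  using sets.compl_sets[of A Omega] by simp

lemma whp_mono:
  assumes "whp P" "eventually (\<lambda>n. \<forall>\<omega>. P n \<omega> \<longrightarrow> Q n \<omega>) sequentially" shows "whp Q"
  unfolding whp_def
proof (intro allI impI)
  fix e :: real assume "e > 0"
  with assms(1) have "eventually (\<lambda>n. \<exists>E\<in>sets Omega. 1 - e \<le> Om.prob E \<and> (\<forall>\<omega>\<in>E. P n \<omega>)) sequentially"
    by (simp add: whp_def)
  then show "eventually (\<lambda>n. \<exists>E\<in>sets Omega. 1 - e \<le> Om.prob E \<and> (\<forall>\<omega>\<in>E. Q n \<omega>)) sequentially"
    using assms(2) by eventually_elim blast
qed

lemma whp_conj:
  assumes "whp P" "whp Q" shows "whp (\<lambda>n \<omega>. P n \<omega> \<and> Q n \<omega>)"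
  unfolding whp_def
proof (intro allI impI)
  fix e :: real assume "e > 0"
  then have e2: "e / 2 > 0" by simp
  show "eventually (\<lambda>n. \<exists>E\<in>sets Omega. 1 - e \<le> Om.prob E \<and> (\<forall>\<omega>\<in>E. P n \<omega> \<and> Q n \<omega>)) sequentially"
    using assms(1)[unfolded whp_def, rule_format, OF e2] assms(2)[unfolded whp_def, rule_format, OF e2]
  proof eventually_elim
    case (elim n)
    then obtain A B where A: "A \<in> sets Omega" "1 - e / 2 \<le> Om.prob A" "\<forall>\<omega>\<in>A. P n \<omega>"
      and B: "B \<in> sets Omega" "1 - e / 2 \<le> Om.prob B" "\<forall>\<omega>\<in>B. Q n \<omega>" by blast
    have "Om.prob (- (A \<inter> B)) \<le> Om.prob (- A) + Om.prob (- B)"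
      unfolding Compl_Int using A B sets.compl_sets[of A Omega] sets.compl_sets[of B Omega]
      by (intro measure_Un_le) (auto simp: Compl_eq_Diff_UNIV)
    moreover have "Om.prob (- X) = 1 - Om.prob X" if "X \<in> sets Omega" for X
      using Om.prob_compl[OF that] by (simp add: Compl_eq_Diff_UNIV)
    moreover have "Om.prob (- (A \<inter> B)) = 1 - Om.prob (A \<inter> B)"
      using Om.prob_compl[of "A \<inter> B"] A B by (simp add: Compl_eq_Diff_UNIV sets.Int)
    ultimately have "1 - e \<le> Om.prob (A \<inter> B)" using A B by (smt (verit) field_sum_of_halves)
    then show ?case using A B by (intro bexI[of _ "A \<inter> B"]) auto
  qed
qed

lemma whp_AE: assumes "\<And>n. AE \<omega> in Omega. P n \<omega>" shows "whp P"
  unfolding whp_def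
proof (intro allI impI always_eventually)
  fix e :: real and n assume e: "e > 0"
  from assms[of n] obtain N where N: "{\<omega> \<in> space Omega. \<not> P n \<omega>} \<subseteq> N" "emeasure Omega N = 0" "N \<in> sets Omega"
    by (rule AE_E)
  have "Om.prob (space Omega - N) = 1" using Om.prob_compl[OF N(3)] N(2) by (simp add: measure_def)
  then show "\<exists>E\<in>sets Omega. 1 - e \<le> Om.prob E \<and> (\<forall>\<omega>\<in>E. P n \<omega>)"
    using N e by (intro bexI[of _ "space Omega - N"]) (auto intro: compl_Omega)
qed

lemma whp_True: "whp (\<lambda>_ _. True)"
  by (rule whp_AE) simp

lemma whp_ball: "finite I \<Longrightarrow> (\<And>i. i \<in> I \<Longrightarrow> whp (P i)) \<Longrightarrow> whp (\<lambda>n \<omega>. \<forall>i\<in>I. P i n \<omega>)"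
proof (induction rule: finite_induct)
  case (insert i I)
  then show ?case using whp_conj[of "P i" "\<lambda>n \<omega>. \<forall>i\<in>I. P i n \<omega>"] by simp
qed (simp add: whp_True)

lemma whp_Markov:
  assumes "\<And>e. e > 0 \<Longrightarrow> eventually (\<lambda>n. integrable Omega (U n) \<and> (\<integral>\<omega>. U n \<omega> \<partial>Omega) < e) sequentially"
    and "\<And>n \<omega>. 0 \<le> U n \<omega>" and r: "r > (0 :: real)"
  shows "whp (\<lambda>n \<omega>. U n \<omega> < r)"
  unfolding whp_def
proof (intro allI impI)
  fix e :: real assume "e > 0"
  then have "r * e > 0" using r by simp
  from assms(1)[OF this] show "eventually (\<lambda>n. \<exists>E\<in>sets Omega. 1 - e \<le> Om.prob E \<and> (\<forall>\<omega>\<in>E. U n \<omega> < r)) sequentially"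
  proof eventually_elim
    case (elim n)
    then have [measurable]: "U n \<in> borel_measurable Omega" by auto
    have m: "{\<omega> \<in> space Omega. r \<le> U n \<omega>} \<in> sets Omega" by measurable
    have "Om.prob {\<omega> \<in> space Omega. r \<le> U n \<omega>} \<le> (\<integral>\<omega>. U n \<omega> \<partial>Omega) / r"
      by (rule integral_Markov_inequality_measure[where A="{}"]) (use elim assms(2) r in auto)
    also have "\<dots> \<le> e" using elim r by (simp add: pos_divide_le_eq mult.commute)
    finally have "1 - e \<le> Om.prob (space Omega - {\<omega> \<in> space Omega. r \<le> U n \<omega>})"
      unfolding Om.prob_compl[OF m] by simp
    then show ?case by (intro bexI[of _ "space Omega - {\<omega> \<in> space Omega. r \<le> U n \<omega>}"]) (use m compl_Omega[OF m[simplified]] in auto)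
  qed
qed

lemma whp_L2:
  assumes "\<And>e. e > 0 \<Longrightarrow> eventually (\<lambda>n. integrable Omega (\<lambda>\<omega>. (X n \<omega>)\<^sup>2) \<and> (\<integral>\<omega>. (X n \<omega>)\<^sup>2 \<partial>Omega) < e) sequentially"
    and r: "r > (0 :: real)"
  shows "whp (\<lambda>n \<omega>. \<bar>X n \<omega>\<bar> < r)"
proof -
  have "whp (\<lambda>n \<omega>. (X n \<omega>)\<^sup>2 < r\<^sup>2)" using assms(1) by (rule whp_Markov) (use r in simp_all)
  moreover have "\<bar>x\<bar> < r" if "x\<^sup>2 < r\<^sup>2" for x :: real
    by (rule power2_less_imp_less) (use that r in simp_all)
  ultimately show ?thesis by (elim whp_mono) (intro always_eventually allI impI)
qed

section \<open>Exponential holding times\<close>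

lemma Unif_exp: "distributed Unif lborel (\<lambda>x. - ln x) (exponential_density 1)"
  unfolding prob_space.exponential_distributed_iff[OF prob_space_Unif zero_less_one]
proof (intro conjI allI impI)
  fix a :: real assume a: "0 \<le> a"
  \<comment> \<open>The value \<open>ln 0 = 0\<close> puts the null point 0 into the set.\<close>
  have "{0..1} \<inter> {x. - ln x \<le> a} = insert 0 {exp (- a)..1}"
  proof -
    have "x \<in> {0..1} \<inter> {x. - ln x \<le> a} \<longleftrightarrow> x \<in> insert 0 {exp (- a)..1}" for x :: real
    proof -
      consider "x < 0" | "x = 0" | "x > 0" by linarith
      then show ?thesis
      proof cases
        case 1 then show ?thesis using exp_gt_zero[of "- a"] by (simp add: not_le less_trans)
      next
        case 2 then show ?thesis using a by simp
      next
        case 3 then show ?thesis using ln_ge_iff[of x "- a"] by auto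
      qed
    qed
    then show ?thesis by blast
  qed
  moreover have "measure lborel (insert 0 {exp (- a)..1}) = measure lborel {exp (- a)..1}"
    by (rule measure_eq_AE) (auto intro!: AE_I[where N="{0::real}"])
  moreover have "{x :: real. - ln x \<le> a} \<in> sets borel" by measurable
  ultimately show "measure Unif {x \<in> space Unif. - ln x \<le> a} = 1 - exp (- a * 1)"
    using a by (simp add: measure_Unif)
next
  have "(\<lambda>x. - ln x) \<in> borel_measurable (borel :: real measure)"
    by (intro borel_measurable_uminus borel_measurable_ln measurable_ident_sets refl)
  then show "(\<lambda>x. - ln x) \<in> borel_measurable Unif" by (simp cong: measurable_cong_sets)
qed

lemma exp_moments:
  defines "f \<equiv> \<lambda>x :: real. - ln x - 1"
  shows "integrable Unif f" "integral\<^sup>L Unif f = 0" "integrable Unif (\<lambda>x. (f x)\<^sup>2)" "(\<integral>x. (f x)\<^sup>2 \<partial>Unif) = 1"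
proof -
  interpret U: prob_space Unif by (rule prob_space_Unif)
  have 1: "(\<integral>x. - ln x \<partial>Unif) = 1" using U.exponential_distributed_expectation[OF _ Unif_exp] by simp
  have 2: "(\<integral>x. (f x)\<^sup>2 \<partial>Unif) = 1" using U.exponential_distributed_variance[OF _ Unif_exp] unfolding 1 f_def by simp
  \<comment> \<open>A function that is not integrable has integral 0 by convention, so the value 1
    certifies integrability; the same is used for the square below.\<close>
  have i: "integrable Unif (\<lambda>x. - ln x)" using 1 not_integrable_integral_eq by fastforce
  then show "integrable Unif f" unfolding f_def by simp
  show "integral\<^sup>L Unif f = 0" unfolding f_def using i 1 U.prob_space by (subst Bochner_Integration.integral_diff) (auto simp del: integral_minus)
  show "integrable Unif (\<lambda>x. (f x)\<^sup>2)" using 2 not_integrable_integral_eq by fastforce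
  show "(\<integral>x. (f x)\<^sup>2 \<partial>Unif) = 1" by (rule 2)
qed

definition clock_dev :: "nat \<Rightarrow> (nat \<Rightarrow> real) \<Rightarrow> real" where
  "clock_dev k \<omega> = (\<Sum>i<k. - ln (\<omega> (3 * i)) - 1)"

text \<open>Coordinate \<open>3 * k\<close> is fresh for the first \<open>k\<close> summands, so the
  mixed term integrates to 0 and each holding time adds variance 1.\<close>

lemma clock_dev_moment:
  "integrable Omega (clock_dev k)" "integrable Omega (\<lambda>\<omega>. (clock_dev k \<omega>)\<^sup>2)" "(\<integral>\<omega>. (clock_dev k \<omega>)\<^sup>2 \<partial>Omega) = k"
proof (induction k)
  case 0
  { case 1 show ?case by (simp add: clock_dev_def[abs_def]) next
    case 2 show ?case by (simp add: clock_dev_def) next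
    case 3 show ?case by (simp add: clock_dev_def) }
next
  case (Suc k)
  let ?f = "\<lambda>x :: real. - ln x - 1"
  have inv: "clock_dev k (fun_upd \<omega> (3 * k) x) = clock_dev k \<omega>" for \<omega> x
    unfolding clock_dev_def by (intro sum.cong) auto
  have S: "clock_dev (Suc k) \<omega> = clock_dev k \<omega> + ?f (\<omega> (3 * k))" for \<omega> by (simp add: clock_dev_def)
  note c1 = integral_coord[OF exp_moments(1), of "3 * k"] and c2 = integral_coord[OF exp_moments(3), of "3 * k"]
  note i = indep_coord[OF exp_moments(1) Suc(1) inv]
  have S2: "(clock_dev (Suc k) \<omega>)\<^sup>2 = (clock_dev k \<omega>)\<^sup>2 + (2 * (?f (\<omega> (3 * k)) * clock_dev k \<omega>) + (?f (\<omega> (3 * k)))\<^sup>2)" for \<omega>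
    unfolding S power2_sum by simp
  note ii = Bochner_Integration.integrable_add[OF integrable_mult_right[OF i(1), of 2] c2(1)]
  { case 1 show ?case using Suc(1) c1(1) unfolding S[abs_def] by (rule Bochner_Integration.integrable_add) next
    case 2 show ?case unfolding S2 by (rule Bochner_Integration.integrable_add[OF Suc(2) ii]) next
    case 3
    have "(\<integral>\<omega>. (clock_dev (Suc k) \<omega>)\<^sup>2 \<partial>Omega) = (\<integral>\<omega>. (clock_dev k \<omega>)\<^sup>2 \<partial>Omega) +
      (2 * (\<integral>\<omega>. ?f (\<omega> (3 * k)) * clock_dev k \<omega> \<partial>Omega) + (\<integral>\<omega>. (?f (\<omega> (3 * k)))\<^sup>2 \<partial>Omega))"
      unfolding S2 Bochner_Integration.integral_add[OF Suc(2) ii] Bochner_Integration.integral_add[OF integrable_mult_right[OF i(1), of 2] c2(1)]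
      by (simp only: integral_mult_right_zero)
    then show ?case unfolding i(2) c2(2) exp_moments(2,4) Suc(3) by simp }
qed

lemma AE_coord: "AE \<omega> in Omega. \<forall>i. 0 < \<omega> i \<and> \<omega> i < 1"
  unfolding AE_all_countable
proof
  fix i
  have "(\<integral>\<omega>. indicator {0<..<1::real} (\<omega> i) \<partial>Omega) = (\<integral>x. indicator {0<..<1::real} x \<partial>Unif :: real)"
    by (rule integral_coord) (auto intro!: integrable_real_indicator simp: less_top[symmetric] finite_measure.emeasure_finite[OF prob_space.finite_measure[OF prob_space_Unif]] simp del: emeasure_uniform_measure)
  also have "\<dots> = measure Unif {0<..<1}" by simp
  also have "\<dots> = 1"
  proof -
    have "{0..1} \<inter> {0<..<1::real} = {0<..<1}" by auto
    then show ?thesis by (subst measure_Unif) auto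
  qed
  finally have "(\<integral>\<omega>. indicator {0<..<1::real} (\<omega> i) \<partial>Omega) = (1 :: real)" .
  moreover have "(\<integral>\<omega>. indicator {0<..<1::real} (\<omega> i) \<partial>Omega) = Om.prob {\<omega>. \<omega> i \<in> {0<..<1::real}}"
  proof -
    have "(\<lambda>\<omega>. indicator {0<..<1::real} (\<omega> i) :: real) = indicator {\<omega>. \<omega> i \<in> {0<..<1::real}}" by (auto simp: indicator_def fun_eq_iff)
    then show ?thesis by simp
  qed
  ultimately have "Om.prob {\<omega>. \<omega> i \<in> {0<..<1::real}} = 1" by metis
  from Om.AE_prob_1[OF this] show "AE \<omega> in Omega. 0 < \<omega> i \<and> \<omega> i < 1" by simp
qed

text \<open>Index \<open>k\<close> denotes ring number \<open>k + 1\<close>, hence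
  \<open>Suc k\<close> holding times.\<close>

lemma ring_time_dev:
  "ring_time TYPE('d::finite) N \<omega> k = (clock_dev (Suc k) \<omega> + (real k + 1)) / total_rate N TYPE('d)"
  unfolding ring_time_def clock_dev_def lessThan_Suc_atMost by (simp add: sum_subtractf)

lemma ring_time_strict_mono:
  assumes "\<And>i. 0 < \<omega> i \<and> \<omega> i < (1 :: real)" "total_rate N TYPE('d::finite) > 0"
  shows "strict_mono (ring_time TYPE('d) N \<omega>)"
proof (rule strict_monoI_Suc)
  fix k
  have "ln (\<omega> (3 * Suc k)) < 0" using assms(1)[of "3 * Suc k"] by simp
  then show "ring_time TYPE('d) N \<omega> k < ring_time TYPE('d) N \<omega> (Suc k)"
    unfolding ring_time_def using assms(2) by (intro divide_strict_right_mono) auto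
qed

section \<open>The number of rings by a given time\<close>

context hydro
begin

definition J :: "nat \<Rightarrow> (nat \<Rightarrow> real) \<Rightarrow> real \<Rightarrow> nat" where
  "J n \<omega> t = card {k. ring_time TYPE('d) (Nseq n) \<omega> k \<le> t}"

text \<open>The window is \<open>N\<close> to the power -1/4: it tends to 0, while its square times
  \<open>rateN n\<close> is at least \<open>sqrt N\<close>, so Chebyshev's inequality places the
  clock within it.\<close>

definition dl :: "nat \<Rightarrow> real" where "dl n = 1 / sqrt (sqrt (Nseq n))"

lemma dl: "dl n > 0" "dl \<longlonglongrightarrow> 0"
proof -
  show "dl n > 0" using Nseq1[of n] by (simp add: dl_def)
  have "(\<lambda>n. sqrt (sqrt (1 / real (Nseq n)))) \<longlonglongrightarrow> sqrt (sqrt 0)" by (intro tendsto_intros Nlim)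
  then show "dl \<longlonglongrightarrow> 0" unfolding dl_def[abs_def] by (simp add: real_sqrt_divide)
qed

lemma inverse_N_small: "e > 0 \<Longrightarrow> eventually (\<lambda>n. C * sqrt (1 / real (Nseq n)) < e) sequentially"
proof -
  assume e: "e > 0"
  have "(\<lambda>n. C * sqrt (1 / real (Nseq n))) \<longlonglongrightarrow> C * sqrt 0" by (intro tendsto_intros Nlim)
  then show ?thesis by (rule order_tendstoD(2)) (use e in simp)
qed

lemma whp_dev:
  assumes K: "eventually (\<lambda>n. real (K n) \<le> C * rateN n) sequentially"
  shows "whp (\<lambda>n \<omega>. \<bar>clock_dev (K n) \<omega>\<bar> < dl n * rateN n)"
proof -
  have "whp (\<lambda>n \<omega>. \<bar>clock_dev (K n) \<omega> / (dl n * rateN n)\<bar> < 1)"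
  proof (rule whp_L2)
    fix e :: real assume e: "e > 0"
    show "eventually (\<lambda>n. integrable Omega (\<lambda>\<omega>. (clock_dev (K n) \<omega> / (dl n * rateN n))\<^sup>2) \<and> (\<integral>\<omega>. (clock_dev (K n) \<omega> / (dl n * rateN n))\<^sup>2 \<partial>Omega) < e) sequentially"
      using N_large[of 3] inverse_N_small[OF e, of "\<bar>C\<bar>"] K
    proof eventually_elim
      case (elim n)
      have N0: "real (Nseq n) > 0" using elim by simp
      have r: "rateN n \<ge> Nseq n" "rateN n > 0" using rateN_ge[OF elim(1)] N0 by linarith+
      have d2: "(dl n)\<^sup>2 = 1 / sqrt (Nseq n)" using N0 by (simp add: dl_def power_divide)
      have "real (K n) / (dl n * rateN n)\<^sup>2 \<le> (\<bar>C\<bar> * rateN n) / (dl n * rateN n)\<^sup>2"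
        using elim(3) r by (intro divide_right_mono) (auto intro: order_trans[OF _ mult_right_mono[OF abs_ge_self]])
      also have "\<dots> = \<bar>C\<bar> * (sqrt (Nseq n) / rateN n)" unfolding power_mult_distrib d2 power2_eq_square[of "rateN n"] using r N0 by simp
      also have "\<dots> \<le> \<bar>C\<bar> * (sqrt (Nseq n) / Nseq n)" using r N0 by (intro mult_left_mono divide_left_mono) auto
      also have "sqrt (Nseq n) / Nseq n = sqrt (1 / real (Nseq n))" using N0 by (simp add: real_sqrt_divide field_simps)
      finally have "real (K n) / (dl n * rateN n)\<^sup>2 < e" using elim(2) by linarith
      then show ?case unfolding power_divide using clock_dev_moment(2,3)[of "K n"] by simp
    qed
  qed simp
  then show ?thesis
  proof (rule whp_mono)
    show "eventually (\<lambda>n. \<forall>\<omega>. \<bar>clock_dev (K n) \<omega> / (dl n * rateN n)\<bar> < 1 \<longrightarrow> \<bar>clock_dev (K n) \<omega>\<bar> < dl n * rateN n) sequentially"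
      using N_large[of 3]
    proof eventually_elim
      case (elim n)
      have "dl n * rateN n > 0" using rateN_ge[OF elim] elim dl(1)[of n] by (intro mult_pos_pos) auto
      then show ?case by (simp add: abs_divide)
    qed
  qed
qed

lemma finite_rings:
  assumes "strict_mono (f :: nat \<Rightarrow> real)" "t < f k"
  shows "{k. f k \<le> t} \<subseteq> {..<k}"
proof
  fix j assume "j \<in> {k. f k \<le> t}"
  then have "f j < f k" using assms(2) by simp
  then show "j \<in> {..<k}" using strict_mono_less[OF assms(1)] by simp
qed

lemma J_mono: "finite {k. ring_time TYPE('d) (Nseq n) \<omega> k \<le> T} \<Longrightarrow> s \<le> t \<Longrightarrow> t \<le> T \<Longrightarrow> J n \<omega> s \<le> J n \<omega> t"
  unfolding J_def by (intro card_mono) (auto elim: rev_finite_subset)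

text \<open>Two ring times have to be controlled, those with indices near
  \<open>Ks n (t - dl n)\<close> and \<open>Ks n (t + dl n)\<close>; the ordering of the rings
  yields the rest.\<close>

lemma whp_J:
  assumes t: "t \<in> {0..T}"
  shows "whp (\<lambda>n \<omega>. finite {k. ring_time TYPE('d) (Nseq n) \<omega> k \<le> t} \<and> Ks n (t - dl n) \<le> J n \<omega> t \<and> J n \<omega> t \<le> Ks n (t + dl n))"
proof -
  have K: "eventually (\<lambda>n. real (Suc (Ks n (t + dl n))) \<le> (T + 2) * rateN n) sequentially"
    "eventually (\<lambda>n. real (Ks n (t - dl n)) \<le> (T + 2) * rateN n) sequentially"
  proof -
    have "eventually (\<lambda>n. dl n < 1) sequentially" by (rule order_tendstoD(2)[OF dl(2)]) simp
    with N_large[of 3] have "eventually (\<lambda>n. real (Suc (Ks n (t + dl n))) \<le> (T + 2) * rateN n \<and> real (Ks n (t - dl n)) \<le> (T + 2) * rateN n) sequentially"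
    proof eventually_elim
      case (elim n)
      have r: "rateN n \<ge> 1" using rateN_ge[OF elim(1)] elim(1) by linarith
      have "rateN n * (t + dl n) \<le> rateN n * (T + 1)" using r t elim by (intro mult_left_mono) auto
      then have "real (Ks n (t + dl n)) \<le> rateN n * (T + 1)" using Ks_le[OF elim(1), of "t + dl n"] t dl(1)[of n] by simp
      moreover have "rateN n * (T + 1) + rateN n = (T + 2) * rateN n" by (simp add: algebra_simps)
      moreover have "Ks n (t - dl n) \<le> Ks n (t + dl n)" unfolding Ks_def using r dl(1)[of n] by (intro nat_mono floor_mono mult_left_mono) auto
      ultimately show ?case using r by simp
    qed
    then show "eventually (\<lambda>n. real (Suc (Ks n (t + dl n))) \<le> (T + 2) * rateN n) sequentially"
      "eventually (\<lambda>n. real (Ks n (t - dl n)) \<le> (T + 2) * rateN n) sequentially" by (auto elim: eventually_mono)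
  qed
  have "whp (\<lambda>n \<omega>. (\<forall>i. 0 < \<omega> i \<and> \<omega> i < 1) \<and> \<bar>clock_dev (Suc (Ks n (t + dl n))) \<omega>\<bar> < dl n * rateN n \<and> \<bar>clock_dev (Ks n (t - dl n)) \<omega>\<bar> < dl n * rateN n)"
    by (intro whp_conj whp_AE AE_coord whp_dev[OF K(1)] whp_dev[OF K(2)])
  then show ?thesis
  proof (rule whp_mono)
    show "eventually (\<lambda>n. \<forall>\<omega>. (\<forall>i. 0 < \<omega> i \<and> \<omega> i < 1) \<and> \<bar>clock_dev (Suc (Ks n (t + dl n))) \<omega>\<bar> < dl n * rateN n \<and> \<bar>clock_dev (Ks n (t - dl n)) \<omega>\<bar> < dl n * rateN n \<longrightarrow>
      finite {k. ring_time TYPE('d) (Nseq n) \<omega> k \<le> t} \<and> Ks n (t - dl n) \<le> J n \<omega> t \<and> J n \<omega> t \<le> Ks n (t + dl n)) sequentially"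
      using N_large[of 3]
    proof eventually_elim
      case (elim n)
      have r: "rateN n > 0" using rateN_ge[OF elim(1)] elim(1) by linarith
      show ?case
      proof (intro allI impI, elim conjE)
        fix \<omega> :: "nat \<Rightarrow> real" assume o: "\<forall>i. 0 < \<omega> i \<and> \<omega> i < 1"
          and c1: "\<bar>clock_dev (Suc (Ks n (t + dl n))) \<omega>\<bar> < dl n * rateN n" and c2: "\<bar>clock_dev (Ks n (t - dl n)) \<omega>\<bar> < dl n * rateN n"
        let ?R = "ring_time TYPE('d) (Nseq n) \<omega>"
        have sm: "strict_mono ?R" by (rule ring_time_strict_mono) (use o r in \<open>auto simp: rateN_def\<close>)
        have rk: "?R k = (clock_dev (Suc k) \<omega> + (real k + 1)) / rateN n" for k unfolding ring_time_dev rateN_def ..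
        \<comment> \<open>Indices start at 0: if the ring with index \<open>Ks n (t + dl n)\<close>
          is later than \<open>t\<close>, only smaller indices have rung, and there are
          \<open>Ks n (t + dl n)\<close> of them.\<close>
        have "t < ?R (Ks n (t + dl n))"
        proof -
          have "rateN n * (t + dl n) < real (Ks n (t + dl n)) + 1" unfolding Ks_def by linarith
          then have "rateN n * t < clock_dev (Suc (Ks n (t + dl n))) \<omega> + (real (Ks n (t + dl n)) + 1)"
            using c1 by (simp add: distrib_left mult.commute)
          then show ?thesis unfolding rk using r by (simp add: pos_less_divide_eq mult.commute)
        qed
        from finite_rings[OF sm this] have sub: "{k. ?R k \<le> t} \<subseteq> {..<Ks n (t + dl n)}" .
        then have f: "finite {k. ?R k \<le> t}" by (rule finite_subset) simp
        have "J n \<omega> t \<le> Ks n (t + dl n)" unfolding J_def using card_mono[OF _ sub] by simp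
        moreover have "Ks n (t - dl n) \<le> J n \<omega> t"
        proof (cases "Ks n (t - dl n)")
          case (Suc k)
          \<comment> \<open>Since \<open>nat\<close> truncates, a positive \<open>Ks\<close> shows
            that its argument was positive and was not cut off.\<close>
          have "0 < rateN n * (t - dl n)" using Suc unfolding Ks_def by (rule_tac ccontr) (simp add: not_less)
          then have "real (Ks n (t - dl n)) \<le> rateN n * (t - dl n)" unfolding Ks_def by simp
          then have "clock_dev (Suc k) \<omega> + (real k + 1) \<le> rateN n * t"
            using c2 Suc by (simp add: right_diff_distrib mult.commute)
          then have "?R k \<le> t" unfolding rk using r by (simp add: pos_divide_le_eq mult.commute)
          then have "{..k} \<subseteq> {k. ?R k \<le> t}" using strict_mono_less_eq[OF sm] by (auto intro: order_trans)
          from card_mono[OF f this] show ?thesis unfolding J_def Suc by simp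
        qed simp
        ultimately show "finite {k. ?R k \<le> t} \<and> Ks n (t - dl n) \<le> J n \<omega> t \<and> J n \<omega> t \<le> Ks n (t + dl n)" using f by blast
      qed
    qed
  qed
qed

lemma fl_mono: "(\<And>x. 0 \<le> \<phi> x) \<Longrightarrow> j \<le> k \<Longrightarrow> fl n j l s \<phi> \<omega> \<le> fl n k l s \<phi> \<omega>"
proof -
  assume \<phi>: "\<And>x. 0 \<le> \<phi> x" and jk: "j \<le> k"
  have "snd (chain Nseq \<rho>0 n \<omega> j) x y \<le> snd (chain Nseq \<rho>0 n \<omega> (j + m)) x y" for m x y
    by (induction m) (auto simp: clock_step_snd intro: trans_le_add1)
  from this[of _ _ "k - j"] have "snd (chain Nseq \<rho>0 n \<omega> j) x y \<le> snd (chain Nseq \<rho>0 n \<omega> k) x y" for x y using jk by simp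
  then show ?thesis unfolding fl_def by (intro mult_left_mono sum_mono \<phi>) auto
qed

lemma Ks_mono: "Nseq n \<ge> 3 \<Longrightarrow> s \<le> t \<Longrightarrow> Ks n s \<le> Ks n t"
  unfolding Ks_def using rateN_ge[of n] by (intro nat_mono floor_mono mult_left_mono) auto

lemma Ks_gap: "Nseq n \<ge> 3 \<Longrightarrow> real (Ks n (t + dl n) - Ks n (t - dl n)) \<le> 2 * dl n * rateN n + 1"
proof -
  assume N: "Nseq n \<ge> 3"
  have m: "Ks n (t - dl n) \<le> Ks n (t + dl n)" using dl(1)[of n] by (intro Ks_mono N) simp
  have "real (nat \<lfloor>a\<rfloor>) \<le> real (nat \<lfloor>b\<rfloor>) + (a - b) + 1" if "b \<le> a" for a b :: real using that by linarith
  moreover have "rateN n * (t - dl n) \<le> rateN n * (t + dl n)" using dl(1)[of n] rateN_ge[OF N] by (intro mult_left_mono) auto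
  ultimately have "real (Ks n (t + dl n)) \<le> real (Ks n (t - dl n)) + (rateN n * (t + dl n) - rateN n * (t - dl n)) + 1"
    unfolding Ks_def by blast
  also have "rateN n * (t + dl n) - rateN n * (t - dl n) = 2 * dl n * rateN n" by (simp add: algebra_simps)
  finally show ?thesis using m by (simp add: of_nat_diff)
qed

text \<open>The random number of rings lies in the window with high probability, and the flux grows
  with the number of rings. So the error is at most the deviation at \<open>Ks n t\<close> plus the
  growth across the window, whose mean is small by \<open>fl_incr\<close>.\<close>

lemma flJ:
  assumes \<phi>: "continuous_on UNIV \<phi>" "periodic_fun \<phi>" and \<phi>B: "\<And>x. 0 \<le> \<phi> x \<and> \<phi> x \<le> B"
    and t: "t \<in> {0..T}" and r: "r > 0"
  shows "whp (\<lambda>n \<omega>. finite {k. ring_time TYPE('d) (Nseq n) \<omega> k \<le> t} \<and> \<bar>fl n (J n \<omega> t) l s \<phi> \<omega> - wl \<phi> t\<bar> < r)"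
proof -
  have B0: "0 \<le> B" using \<phi>B[of 0] by linarith
  have r2: "r / 2 > 0" using r by simp
  have \<phi>0: "0 \<le> \<phi> x" for x using \<phi>B by blast
  \<comment> \<open>Set to 0 on small tori so that \<open>U\<close> is nonnegative for every
    \<open>n\<close>, as \<open>whp_Markov\<close> asks.\<close>
  define U where "U n \<omega> = (if Nseq n \<ge> 3 then fl n (Ks n (t + dl n)) l s \<phi> \<omega> - fl n (Ks n (t - dl n)) l s \<phi> \<omega> else 0)" for n \<omega>
  have 1: "whp (\<lambda>n \<omega>. U n \<omega> < r / 2)"
  proof (rule whp_Markov[OF _ _ r2])
    show "0 \<le> U n \<omega>" for n \<omega>
    proof (cases "Nseq n \<ge> 3")
      case True
      have "Ks n (t - dl n) \<le> Ks n (t + dl n)" using dl(1)[of n] by (intro Ks_mono True) simp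
      from fl_mono[where \<phi>=\<phi>, OF \<phi>0 this, where n=n and l=l and s=s and \<omega>=\<omega>] show ?thesis unfolding U_def by simp
    qed (simp add: U_def)
    fix e :: real assume e: "e > 0"
    have "(\<lambda>n. (2 * dl n + 1 / real (Nseq n)) * (B * Rb)) \<longlonglongrightarrow> (2 * 0 + 0) * (B * Rb)" by (intro tendsto_intros dl Nlim)
    then have "eventually (\<lambda>n. (2 * dl n + 1 / real (Nseq n)) * (B * Rb) < e) sequentially"
      by (rule order_tendstoD(2)) (use e in simp)
    with N_large[of 3] eventually_ge_at_top[of 1]
    show "eventually (\<lambda>n. integrable Omega (U n) \<and> (\<integral>\<omega>. U n \<omega> \<partial>Omega) < e) sequentially"
    proof eventually_elim
      case (elim n)
      have N0: "real (Nseq n) > 0" using elim by simp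
      have rN: "rateN n \<ge> Nseq n" "rateN n > 0" using rateN_ge[OF elim(1)] N0 by linarith+
      let ?m = "Ks n (t + dl n) - Ks n (t - dl n)"
      have m: "Ks n (t + dl n) = Ks n (t - dl n) + ?m" using Ks_mono[OF elim(1), of "t - dl n" "t + dl n"] dl(1)[of n] by simp
      have U: "U n = (\<lambda>\<omega>. fl n (Ks n (t - dl n) + ?m) l s \<phi> \<omega> - fl n (Ks n (t - dl n)) l s \<phi> \<omega>)"
        using elim(1) m by (simp add: U_def fun_eq_iff)
      have "(\<integral>\<omega>. U n \<omega> \<partial>Omega) \<le> ?m * (B * Rb) / rateN n" unfolding U by (rule fl_incr[OF elim(1,2) \<phi>B])
      also have "\<dots> \<le> (2 * dl n * rateN n + 1) * (B * Rb) / rateN n"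
        using Ks_gap[OF elim(1), of t] rN B0 Rb(1) by (intro divide_right_mono mult_right_mono) auto
      also have "\<dots> = (2 * dl n + 1 / rateN n) * (B * Rb)" using rN by (simp add: field_simps)
      also have "\<dots> \<le> (2 * dl n + 1 / real (Nseq n)) * (B * Rb)"
        using rN N0 B0 Rb(1) by (intro mult_right_mono add_left_mono divide_left_mono) auto
      finally show ?case using elim(3) unfolding U using fl_integrable by auto
    qed
  qed
  have 2: "whp (\<lambda>n \<omega>. \<bar>fl n (Ks n t) l s \<phi> \<omega> - wl \<phi> t\<bar> < r / 2)"
    by (rule whp_L2[OF _ r2]) (rule fl_L2[OF \<phi> \<phi>B t])
  show ?thesis
  proof (rule whp_mono[OF whp_conj[OF whp_J[OF t] whp_conj[OF 1 2]]])
    show "eventually (\<lambda>n. \<forall>\<omega>. (finite {k. ring_time TYPE('d) (Nseq n) \<omega> k \<le> t} \<and> Ks n (t - dl n) \<le> J n \<omega> t \<and> J n \<omega> t \<le> Ks n (t + dl n)) \<and>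
       U n \<omega> < r / 2 \<and> \<bar>fl n (Ks n t) l s \<phi> \<omega> - wl \<phi> t\<bar> < r / 2 \<longrightarrow>
       finite {k. ring_time TYPE('d) (Nseq n) \<omega> k \<le> t} \<and> \<bar>fl n (J n \<omega> t) l s \<phi> \<omega> - wl \<phi> t\<bar> < r) sequentially"
      using N_large[of 3]
    proof eventually_elim
      case (elim n)
      have K: "Ks n (t - dl n) \<le> Ks n t" "Ks n t \<le> Ks n (t + dl n)" using dl(1)[of n] by (auto intro!: Ks_mono elim)
      show ?case
      proof (intro allI impI, elim conjE, intro conjI)
        fix \<omega> assume a: "Ks n (t - dl n) \<le> J n \<omega> t" "J n \<omega> t \<le> Ks n (t + dl n)" "U n \<omega> < r / 2" "\<bar>fl n (Ks n t) l s \<phi> \<omega> - wl \<phi> t\<bar> < r / 2"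
        note fl_mono[where \<phi>=\<phi>, OF \<phi>0 K(1), where n=n and l=l and s=s and \<omega>=\<omega>] fl_mono[where \<phi>=\<phi>, OF \<phi>0 K(2), where n=n and l=l and s=s and \<omega>=\<omega>] fl_mono[where \<phi>=\<phi>, OF \<phi>0 a(1), where n=n and l=l and s=s and \<omega>=\<omega>] fl_mono[where \<phi>=\<phi>, OF \<phi>0 a(2), where n=n and l=l and s=s and \<omega>=\<omega>]
        moreover have "U n \<omega> = fl n (Ks n (t + dl n)) l s \<phi> \<omega> - fl n (Ks n (t - dl n)) l s \<phi> \<omega>" using elim by (simp add: U_def)
        ultimately show "\<bar>fl n (J n \<omega> t) l s \<phi> \<omega> - wl \<phi> t\<bar> < r" using a(3,4) by argo
      qed
    qed
  qed
qed

section \<open>Uniformity in time\<close>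

lemma wl_lipschitz:
  assumes \<phi>: "continuous_on UNIV \<phi>" and B: "\<And>x. \<bar>\<phi> x\<bar> \<le> B" and st: "0 \<le> s" "s \<le> t" "t \<le> T"
  shows "\<bar>wl \<phi> t - wl \<phi> s\<bar> \<le> B * Gb * (t - s)"
proof -
  have B0: "0 \<le> B" using B[of 0] by linarith
  have I: "(\<lambda>x. \<phi> x * ig r x) integrable_on ucube" if "r \<in> {0..T}" for r
    by (intro integrable_continuous continuous_on_mult continuous_on_subset[OF \<phi>] continuous_on_subset[OF ig_cont[OF that]]) auto
  have d: "\<bar>ig t x - ig s x\<bar> \<le> Gb * (t - s)" for x
  proof -
    have c: "gg x integrable_on {0..t}" using gg_cont_t[of t x] st by (intro integrable_continuous_interval) auto
    have "ig s x + integral {s..t} (gg x) = ig t x"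
      unfolding ig_def using st c by (intro Henstock_Kurzweil_Integration.integral_combine) auto
    moreover have "norm (integral {s..t} (gg x)) \<le> Gb * (t - s)"
      using st Gb(2)[of _ x] by (intro integral_bound continuous_on_subset[OF gg_cont_t[of t x]]) auto
    ultimately show ?thesis by simp
  qed
  have "wl \<phi> t - wl \<phi> s = integral ucube (\<lambda>x. \<phi> x * ig t x - \<phi> x * ig s x)"
    unfolding wl_def ig_def[symmetric] using st by (intro Henstock_Kurzweil_Integration.integral_diff[symmetric] I) auto
  moreover have "norm (integral ucube (\<lambda>x. \<phi> x * ig t x - \<phi> x * ig s x)) \<le> integral ucube (\<lambda>x :: real^'d. B * Gb * (t - s))"
  proof (rule integral_norm_bound_integral)
    show "(\<lambda>x. \<phi> x * ig t x - \<phi> x * ig s x) integrable_on ucube" using st by (intro integrable_diff I) auto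
    fix x
    have "\<bar>\<phi> x\<bar> * \<bar>ig t x - ig s x\<bar> \<le> B * (Gb * (t - s))" using B d B0 by (intro mult_mono) auto
    then show "norm (\<phi> x * ig t x - \<phi> x * ig s x) \<le> B * Gb * (t - s)"
      unfolding right_diff_distrib[symmetric] by (simp add: abs_mult mult.assoc)
  qed auto
  ultimately show ?thesis by simp
qed

text \<open>Monotone functions that are close to a Lipschitz limit at finitely many grid points are
  close to it everywhere.\<close>

lemma flJ_unif_pos:
  assumes \<phi>: "continuous_on UNIV \<phi>" "periodic_fun \<phi>" and \<phi>B: "\<And>x. 0 \<le> \<phi> x \<and> \<phi> x \<le> B" and r: "r > 0"
  shows "whp (\<lambda>n \<omega>. finite {k. ring_time TYPE('d) (Nseq n) \<omega> k \<le> T} \<and> (\<forall>t\<in>{0..T}. \<bar>fl n (J n \<omega> t) l s \<phi> \<omega> - wl \<phi> t\<bar> < r))"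
proof -
  have B0: "0 \<le> B" using \<phi>B[of 0] by linarith
  have \<phi>0: "0 \<le> \<phi> x" and \<phi>a: "\<bar>\<phi> x\<bar> \<le> B" for x using \<phi>B[of x] by auto
  have r2: "r / 2 > 0" using r by simp
  \<comment> \<open>On a grid of width \<open>T / m\<close> the limit moves by less than
    \<open>r / 2\<close> between neighbouring points.\<close>
  obtain m :: nat where m: "B * Gb * T / (r / 2) < m" using reals_Archimedean2 by blast
  have "0 \<le> B * Gb * T / (r / 2)" using B0 Gb T r by (intro divide_nonneg_nonneg mult_nonneg_nonneg) auto
  then have m0: "real m > 0" using m by linarith
  define h where "h = T / m"
  have h: "h > 0" "real m * h = T" using m0 T by (auto simp: h_def)
  have Bh: "B * Gb * h < r / 2" using m m0 r unfolding h_def by (simp add: field_simps)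
  have ti: "real i * h \<in> {0..T}" if "i \<le> m" for i using that h mult_right_mono[of "real i" m h] by auto
  have "whp (\<lambda>n \<omega>. \<forall>i\<in>{..m}. finite {k. ring_time TYPE('d) (Nseq n) \<omega> k \<le> i * h} \<and> \<bar>fl n (J n \<omega> (i * h)) l s \<phi> \<omega> - wl \<phi> (i * h)\<bar> < r / 2)"
    by (intro whp_ball finite_atMost flJ[OF \<phi> \<phi>B _ r2] ti) auto
  then show ?thesis
  proof (rule whp_mono)
    show "eventually (\<lambda>n. \<forall>\<omega>. (\<forall>i\<in>{..m}. finite {k. ring_time TYPE('d) (Nseq n) \<omega> k \<le> i * h} \<and> \<bar>fl n (J n \<omega> (i * h)) l s \<phi> \<omega> - wl \<phi> (i * h)\<bar> < r / 2) \<longrightarrow>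
      finite {k. ring_time TYPE('d) (Nseq n) \<omega> k \<le> T} \<and> (\<forall>t\<in>{0..T}. \<bar>fl n (J n \<omega> t) l s \<phi> \<omega> - wl \<phi> t\<bar> < r)) sequentially"
    proof (intro always_eventually allI impI)
      fix n \<omega> assume a: "\<forall>i\<in>{..m}. finite {k. ring_time TYPE('d) (Nseq n) \<omega> k \<le> i * h} \<and> \<bar>fl n (J n \<omega> (i * h)) l s \<phi> \<omega> - wl \<phi> (i * h)\<bar> < r / 2"
      have f: "finite {k. ring_time TYPE('d) (Nseq n) \<omega> k \<le> T}" using a h(2) by fastforce
      have "\<bar>fl n (J n \<omega> t) l s \<phi> \<omega> - wl \<phi> t\<bar> < r" if t: "t \<in> {0..T}" for t
      proof -
        obtain i where i: "i < m" "i * h \<le> t" "t \<le> Suc i * h"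
        proof (cases "t = T")
          case True
          have "real (Suc (m - 1)) = m" using m0 by simp
          moreover have "real (m - 1) * h \<le> m * h" using h(1) by (intro mult_right_mono) auto
          ultimately show ?thesis using that[of "m - 1"] m0 h True by simp
        next
          case False
          define i where "i = nat \<lfloor>t / h\<rfloor>"
          have "0 \<le> t / h" using t h by simp
          then have "real i \<le> t / h" "t / h < real i + 1" unfolding i_def by linarith+
          then have "i * h \<le> t" "t \<le> Suc i * h" using h(1) by (simp_all add: field_simps)
          moreover have "real i * h < real m * h" using \<open>i * h \<le> t\<close> False t h(2) by simp
          then have "i < m" using h(1) by simp
          ultimately show ?thesis using that by blast
        qed
        have T': "0 \<le> i * h" "Suc i * h \<le> T" using ti[of "Suc i"] i(1) h(1) by auto
        have gap: "B * Gb * (v - u) \<le> B * Gb * h" if "v - u \<le> h" for u v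
          using that B0 Gb(1) by (intro mult_left_mono) auto
        have hh: "Suc i * h - i * h = h" by (simp add: algebra_simps)
        have "\<bar>wl \<phi> t - wl \<phi> (i * h)\<bar> < r / 2" "\<bar>wl \<phi> (Suc i * h) - wl \<phi> t\<bar> < r / 2"
        proof -
          have g: "t - i * h \<le> h" "Suc i * h - t \<le> h" using i(2,3) hh by linarith+
          have t': "t \<le> T" "0 \<le> t" using t by auto
          show "\<bar>wl \<phi> t - wl \<phi> (i * h)\<bar> < r / 2"
            by (rule le_less_trans[OF order_trans[OF wl_lipschitz[OF \<phi>(1) \<phi>a T'(1) i(2) t'(1)] gap[OF g(1)]] Bh])
          show "\<bar>wl \<phi> (Suc i * h) - wl \<phi> t\<bar> < r / 2"
            by (rule le_less_trans[OF order_trans[OF wl_lipschitz[OF \<phi>(1) \<phi>a t'(2) i(3) T'(2)] gap[OF g(2)]] Bh])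
        qed
        moreover have "fl n (J n \<omega> (i * h)) l s \<phi> \<omega> \<le> fl n (J n \<omega> t) l s \<phi> \<omega>" "fl n (J n \<omega> t) l s \<phi> \<omega> \<le> fl n (J n \<omega> (Suc i * h)) l s \<phi> \<omega>"
          using i T' t by (auto intro!: fl_mono \<phi>0 J_mono[OF f])
        moreover have "\<bar>fl n (J n \<omega> (i * h)) l s \<phi> \<omega> - wl \<phi> (i * h)\<bar> < r / 2" "\<bar>fl n (J n \<omega> (Suc i * h)) l s \<phi> \<omega> - wl \<phi> (Suc i * h)\<bar> < r / 2"
          using a i(1) by (metis atMost_iff less_imp_le Suc_le_eq)+
        ultimately show ?thesis by argo
      qed
      with f show "finite {k. ring_time TYPE('d) (Nseq n) \<omega> k \<le> T} \<and> (\<forall>t\<in>{0..T}. \<bar>fl n (J n \<omega> t) l s \<phi> \<omega> - wl \<phi> t\<bar> < r)" by blast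
    qed
  qed
qed

lemma fl_lin: "fl n k l s (\<lambda>x. a * \<phi> x + b * \<psi> x) \<omega> = a * fl n k l s \<phi> \<omega> + b * fl n k l s \<psi> \<omega>"
  unfolding fl_def by (simp add: sum_distrib_left sum.distrib algebra_simps)

lemma wl_lin:
  assumes "continuous_on UNIV \<phi>" "continuous_on UNIV \<psi>" "t \<in> {0..T}"
  shows "wl (\<lambda>x. a * \<phi> x + b * \<psi> x) t = a * wl \<phi> t + b * wl \<psi> t"
proof -
  have I: "(\<lambda>x. \<phi> x * ig t x) integrable_on ucube" if "continuous_on UNIV \<phi>" for \<phi>
    by (intro integrable_continuous continuous_on_mult continuous_on_subset[OF that] continuous_on_subset[OF ig_cont[OF assms(3)]]) auto
  have "wl (\<lambda>x. a * \<phi> x + b * \<psi> x) t = integral ucube (\<lambda>x. a * (\<phi> x * ig t x) + b * (\<psi> x * ig t x))"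
    unfolding wl_def ig_def by (simp add: algebra_simps)
  also have "\<dots> = a * wl \<phi> t + b * wl \<psi> t"
    unfolding wl_def ig_def[symmetric] using I[OF assms(1)] I[OF assms(2)]
    by (subst Henstock_Kurzweil_Integration.integral_add) (auto intro: integrable_on_mult_right)
  finally show ?thesis .
qed

text \<open>Adding the constant \<open>B\<close> makes the test function nonnegative; the flux of
  the constant converges for the same reason and is subtracted.\<close>

lemma flJ_unif:
  assumes \<phi>: "continuous_on UNIV \<phi>" "periodic_fun \<phi>" and r: "r > 0"
  shows "whp (\<lambda>n \<omega>. finite {k. ring_time TYPE('d) (Nseq n) \<omega> k \<le> T} \<and> (\<forall>t\<in>{0..T}. \<bar>fl n (J n \<omega> t) l s \<phi> \<omega> - wl \<phi> t\<bar> < r))"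
proof -
  obtain B where B: "B \<ge> 0" "\<And>x. \<bar>\<phi> x\<bar> \<le> B" using periodic_uniform1(1)[OF \<phi>] by blast
  have r2: "r / 2 > 0" using r by simp
  have c1: "continuous_on UNIV (\<lambda>x. \<phi> x + B)" by (intro continuous_intros \<phi>)
  have c2: "continuous_on UNIV (\<lambda>x :: real^'d. B)" by (intro continuous_intros)
  have p: "periodic_fun (\<lambda>x. \<phi> x + B)" "periodic_fun (\<lambda>x :: real^'d. B)" using \<phi>(2) by (auto simp: periodic_fun_def)
  have b: "0 \<le> \<phi> x + B \<and> \<phi> x + B \<le> 2 * B" "0 \<le> B \<and> B \<le> B" for x using B(2)[of x] B(1) by auto
  have e: "\<phi> = (\<lambda>x. 1 * (\<phi> x + B) + (-1) * B)" by simp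
  show ?thesis
  proof (rule whp_mono[OF whp_conj[OF flJ_unif_pos[OF c1 p(1) b(1) r2] flJ_unif_pos[OF c2 p(2) b(2) r2]]], intro always_eventually allI impI conjI ballI)
    fix n \<omega> t
    assume a: "(finite {k. ring_time TYPE('d) (Nseq n) \<omega> k \<le> T} \<and> (\<forall>t\<in>{0..T}. \<bar>fl n (J n \<omega> t) l s (\<lambda>x. \<phi> x + B) \<omega> - wl (\<lambda>x. \<phi> x + B) t\<bar> < r / 2)) \<and>
     finite {k. ring_time TYPE('d) (Nseq n) \<omega> k \<le> T} \<and> (\<forall>t\<in>{0..T}. \<bar>fl n (J n \<omega> t) l s (\<lambda>x. B) \<omega> - wl (\<lambda>x. B) t\<bar> < r / 2)"
    then show "finite {k. ring_time TYPE('d) (Nseq n) \<omega> k \<le> T}" by blast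
    assume t: "t \<in> {0..T}"
    have "fl n (J n \<omega> t) l s \<phi> \<omega> = fl n (J n \<omega> t) l s (\<lambda>x. \<phi> x + B) \<omega> - fl n (J n \<omega> t) l s (\<lambda>x. B) \<omega>"
      by (subst e, subst fl_lin) simp
    moreover have "wl \<phi> t = wl (\<lambda>x. \<phi> x + B) t - wl (\<lambda>x. B) t"
      by (subst e, subst wl_lin[OF c1 c2 t]) simp
    moreover have "\<bar>fl n (J n \<omega> t) l s (\<lambda>x. \<phi> x + B) \<omega> - wl (\<lambda>x. \<phi> x + B) t\<bar> < r / 2" "\<bar>fl n (J n \<omega> t) l s (\<lambda>x. B) \<omega> - wl (\<lambda>x. B) t\<bar> < r / 2"
      using a t by blast+
    ultimately show "\<bar>fl n (J n \<omega> t) l s \<phi> \<omega> - wl \<phi> t\<bar> < r" by argo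
  qed
qed

end

section \<open>Uniformity over bounded sets of test functions\<close>

lemma smooth_differentiable: "smooth_fun f \<Longrightarrow> f differentiable (at x)"
  by (cases rule: smooth_fun.cases) auto

lemma test_fun_cont: "test_fun \<phi> \<Longrightarrow> continuous_on UNIV (\<lambda>x. \<phi> x l s)"
  unfolding test_fun_def continuous_on_eq_continuous_at[OF open_UNIV]
  using smooth_differentiable differentiable_imp_continuous_within by blast

lemma test_fun_per: "test_fun \<phi> \<Longrightarrow> periodic_fun (\<lambda>x. \<phi> x l s)"
  unfolding test_fun_def by blast

text \<open>Derivatives of order 0 and 1 give a common bound and a common Lipschitz constant; the
  operator norm of the derivative is estimated by the sum of the bounds on the partial
  derivatives.\<close>

lemma bounded_tf_lip:
  fixes B :: "'d::finite tf set"
  assumes "bounded_tf B"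
  obtains C L where "C \<ge> 0" "L \<ge> 0" "\<And>\<phi> x l s. \<phi> \<in> B \<Longrightarrow> \<bar>\<phi> x l s\<bar> \<le> C"
    "\<And>\<phi> x y l s. \<phi> \<in> B \<Longrightarrow> \<bar>\<phi> x l s - \<phi> y l s\<bar> \<le> L * dist x y"
proof -
  have "\<exists>C. \<forall>\<phi>\<in>B. \<forall>x l s. \<bar>pdl \<alpha> (\<lambda>y. \<phi> y l s) x\<bar> \<le> C" for \<alpha> using assms by (simp add: bounded_tf_def)
  then obtain c where c: "\<And>\<alpha> \<phi> x l s. \<phi> \<in> B \<Longrightarrow> \<bar>pdl \<alpha> (\<lambda>y. \<phi> y l s) x\<bar> \<le> c \<alpha>" by metis
  define L where "L = (\<Sum>i\<in>(UNIV :: 'd set). \<bar>c [i]\<bar>)"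
  have L0: "L \<ge> 0" unfolding L_def by (intro sum_nonneg) auto
  have lip: "\<bar>\<phi> x l s - \<phi> y l s\<bar> \<le> L * dist x y" if \<phi>: "\<phi> \<in> B" for \<phi> x y l s
  proof -
    let ?f = "\<lambda>x. \<phi> x l s"
    have "test_fun \<phi>" using \<phi> assms by (auto simp: bounded_tf_def)
    then have d: "(?f has_derivative frechet_derivative ?f (at z)) (at z)" for z
      using smooth_differentiable[of ?f z] by (simp add: test_fun_def frechet_derivative_works)
    have "onorm (frechet_derivative ?f (at z)) \<le> L" for z
    proof (rule onorm_le)
      fix v :: "real^'d"
      let ?D = "frechet_derivative ?f (at z)"
      interpret linear ?D using d[of z] by (rule has_derivative_linear)
      have "?D v = ?D (\<Sum>i\<in>UNIV. (v $ i) *\<^sub>R axis i 1)" using basis_expansion[of v] by (simp add: scalar_mult_eq_scaleR)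
      also have "\<dots> = (\<Sum>i\<in>UNIV. (v $ i) * ?D (axis i 1))" by (simp add: sum scale)
      finally have "norm (?D v) \<le> (\<Sum>i\<in>UNIV. \<bar>v $ i\<bar> * \<bar>?D (axis i 1)\<bar>)"
        by (simp only: real_norm_def) (intro order_trans[OF sum_abs] sum_mono, simp add: abs_mult)
      also have "\<dots> \<le> (\<Sum>i\<in>UNIV. norm v * \<bar>c [i]\<bar>)"
      proof (intro sum_mono mult_mono)
        fix i show "\<bar>?D (axis i 1)\<bar> \<le> \<bar>c [i]\<bar>" using c[OF \<phi>, of "[i]" l s z] by (simp add: pdl_def pd_def)
      qed (auto simp: component_le_norm_cart)
      also have "\<dots> = L * norm v" by (simp add: L_def sum_distrib_left mult.commute)
      finally show "norm (?D v) \<le> L * norm v" .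
    qed
    from differentiable_bound[OF convex_UNIV, of ?f, OF d this] show ?thesis by (simp add: dist_norm)
  qed
  have b0: "\<bar>\<phi> x l s\<bar> \<le> \<bar>c []\<bar>" if "\<phi> \<in> B" for \<phi> x l s using c[OF that, of "[]" l s x] by (simp add: pdl_def)
  show ?thesis by (rule that[of "\<bar>c []\<bar>" L]) (blast intro: abs_ge_zero L0 b0 lip)+
qed

text \<open>A quantitative Arzela-Ascoli argument: record the values at a finite net of points,
  rounded to multiples of \<open>e / 4\<close>. Only finitely many records occur, and functions with
  the same record are uniformly close.\<close>

lemma sup_net:
  fixes B :: "'d::finite tf set"
  assumes per: "\<And>\<phi> l s. \<phi> \<in> B \<Longrightarrow> periodic_fun (\<lambda>x. \<phi> x l s)"
    and bd: "\<And>\<phi> x l s. \<phi> \<in> B \<Longrightarrow> \<bar>\<phi> x l s\<bar> \<le> C" and L: "L \<ge> 0"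
    and lip: "\<And>\<phi> x y l s. \<phi> \<in> B \<Longrightarrow> \<bar>\<phi> x l s - \<phi> y l s\<bar> \<le> L * dist x y" and e: "e > 0"
  shows "\<exists>B0. finite B0 \<and> B0 \<subseteq> B \<and> (\<forall>\<phi>\<in>B. \<exists>\<psi>\<in>B0. \<forall>x l s. \<bar>\<phi> x l s - \<psi> x l s\<bar> \<le> e)"
proof -
  define h where "h = e / (4 * (L + 1))"
  have h: "h > 0" using e L by (simp add: h_def)
  have Lh: "L * h \<le> e / 4"
  proof -
    have "L * h \<le> (L + 1) * h" using h by (intro mult_right_mono) auto
    moreover have "z * (e / (4 * z)) = e / 4" if "z > 0" for z using that by simp
    from this[of "L + 1"] have "(L + 1) * h = e / 4" using L unfolding h_def by argo
    ultimately show ?thesis by simp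
  qed
  obtain P where P: "finite P" "ucube \<subseteq> (\<Union>x\<in>P. ball (x :: real^'d) h)"
    using compact_cbox[of "0 :: real^'d" One] h unfolding compact_eq_totally_bounded by blast
  define K where "K = \<lceil>C / (e / 4)\<rceil> + 1"
  define I where "I = P \<times> (UNIV :: ('d \<times> bool) set)"
  define code where "code \<phi> = (\<lambda>q\<in>I. \<lfloor>\<phi> (fst q) (fst (snd q)) (snd (snd q)) / (e / 4)\<rfloor>)" for \<phi> :: "'d tf"
  have "code ` B \<subseteq> PiE I (\<lambda>_. {- K..K})"
  proof (intro image_subsetI PiE_I)
    fix \<phi> q assume \<phi>: "\<phi> \<in> B" and q: "q \<in> I"
    let ?y = "\<phi> (fst q) (fst (snd q)) (snd (snd q)) / (e / 4)"
    have "\<bar>?y\<bar> = \<bar>\<phi> (fst q) (fst (snd q)) (snd (snd q))\<bar> / (e / 4)" using e by (simp add: abs_divide)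
    also have "\<dots> \<le> C / (e / 4)" using bd[OF \<phi>] e by (intro divide_right_mono) auto
    finally have "- K \<le> \<lfloor>?y\<rfloor> \<and> \<lfloor>?y\<rfloor> \<le> K" unfolding K_def by linarith
    then show "code \<phi> q \<in> {- K..K}" using q by (simp only: code_def restrict_apply' atLeastAtMost_iff)
  qed (simp add: code_def)
  moreover have "finite (PiE I (\<lambda>_. {- K..K}))" using P(1) by (intro finite_PiE) (auto simp: I_def)
  ultimately have "finite (code ` B)" by (rule finite_subset)
  \<comment> \<open>One representative per record; the net consists of members of \<open>B\<close>,
    so its elements are test functions again.\<close>
  from finite_subset_image[OF this order_refl] obtain B0 where B0: "B0 \<subseteq> B" "finite B0" "code ` B = code ` B0" by blast
  have "\<exists>\<psi>\<in>B0. \<forall>x l s. \<bar>\<phi> x l s - \<psi> x l s\<bar> \<le> e" if \<phi>: "\<phi> \<in> B" for \<phi>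
  proof -
    obtain \<psi> where \<psi>: "\<psi> \<in> B0" "code \<phi> = code \<psi>" using B0(3) \<phi> by (metis imageE imageI)
    then have \<psi>B: "\<psi> \<in> B" using B0 by blast
    have "\<bar>\<phi> x l s - \<psi> x l s\<bar> \<le> e" for x l s
    proof -
      obtain p where p: "p \<in> P" "dist p (frac_vec x) < h" using P(2) frac_vec_ucube[of x] by auto
      have "\<lfloor>\<phi> p l s / (e / 4)\<rfloor> = \<lfloor>\<psi> p l s / (e / 4)\<rfloor>"
        using fun_cong[OF \<psi>(2), of "(p, l, s)"] p(1) by (simp add: code_def I_def)
      then have "\<bar>\<phi> p l s / (e / 4) - \<psi> p l s / (e / 4)\<bar> \<le> 1" by linarith
      then have 1: "\<bar>\<phi> p l s - \<psi> p l s\<bar> \<le> e / 4"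
        using e unfolding diff_divide_distrib[symmetric] abs_divide by (simp add: pos_divide_le_eq)
      have "L * dist p (frac_vec x) \<le> L * h" using p L by (intro mult_left_mono) auto
      then have "L * dist p (frac_vec x) \<le> e / 4" using Lh by simp
      then have 2: "\<bar>\<theta> p l s - \<theta> x l s\<bar> \<le> e / 4" if "\<theta> \<in> B" for \<theta>
        using lip[OF that, of p l s "frac_vec x"] periodic_frac[OF per[OF that, of l s], of x] by simp
      show ?thesis using 1 2[OF \<phi>] 2[OF \<psi>B] e by argo
    qed
    then show ?thesis using \<psi>(1) by blast
  qed
  then show ?thesis using B0 by blast
qed

context hydro
begin

definition wp :: "'d path" where "wp t \<phi> = (\<Sum>l\<in>UNIV. \<Sum>s\<in>UNIV. wl (\<lambda>x. \<phi> x l s) t)"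

lemma wlim_wp: "wlim \<rho> (kaplim * mass) mass = wp"
  using mass_pos by (simp add: wlim_def wp_def[abs_def] wl_def gg_def[abs_def] fun_eq_iff)

lemma Wflux_fl:
  assumes "finite {k. ring_time TYPE('d) (Nseq n) \<omega> k \<le> T}"
  shows "Wflux T Nseq \<rho>0 n \<omega> t \<phi> = (\<Sum>l\<in>UNIV. \<Sum>s\<in>UNIV. fl n (J n \<omega> t) l s (\<lambda>x. \<phi> x l s) \<omega>)"
proof -
  let ?S = "\<lambda>x l s. real (snd (chain Nseq \<rho>0 n \<omega> (J n \<omega> t)) x (shift (Nseq n) l s x)) * \<phi> (mid n l s x) l s"
  have "Wflux T Nseq \<rho>0 n \<omega> t \<phi> = ((1 / Nseq n)\<^sup>2 / real n) * (\<Sum>x\<in>sites (Nseq n). \<Sum>l\<in>UNIV. \<Sum>s\<in>UNIV. ?S x l s)"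
    unfolding Wflux_def Let_def Wtil_def J_def[symmetric] mid_def using assms by (simp only: simp_thms if_False)
  also have "(\<Sum>x\<in>sites (Nseq n). \<Sum>l\<in>UNIV. \<Sum>s\<in>UNIV. ?S x l s) = (\<Sum>l\<in>UNIV. \<Sum>s\<in>UNIV. \<Sum>x\<in>sites (Nseq n). ?S x l s)"
    by (subst sum.swap, intro sum.cong refl, rule sum.swap)
  also have "(1 / Nseq n)\<^sup>2 / real n = 1 / ((real (Nseq n))\<^sup>2 * n)" by (simp add: power_divide)
  finally show ?thesis unfolding fl_def by (simp only: sum_distrib_left mult_ac)
qed

lemma wl_bound:
  assumes "continuous_on UNIV \<phi>" "\<And>x. \<bar>\<phi> x\<bar> \<le> b" "t \<in> {0..T}"
  shows "\<bar>wl \<phi> t\<bar> \<le> b * (T * Gb)"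
proof -
  have b: "0 \<le> b" using assms(2)[of 0] by linarith
  have "\<bar>wl \<phi> t - wl \<phi> 0\<bar> \<le> b * Gb * (t - 0)" using assms by (intro wl_lipschitz) auto
  also have "b * Gb * (t - 0) \<le> b * Gb * T" using assms(3) b Gb(1) by (intro mult_left_mono) auto
  finally show ?thesis by (simp add: wl_def mult_ac)
qed

lemma fl_bound:
  assumes "\<And>x. \<bar>\<phi> x\<bar> \<le> b" shows "\<bar>fl n k l s \<phi> \<omega>\<bar> \<le> b * fl n k l s (\<lambda>_. 1) \<omega>"
proof -
  let ?c = "\<lambda>x. real (snd (chain Nseq \<rho>0 n \<omega> k) x (shift (Nseq n) l s x))"
  have "\<bar>\<Sum>x\<in>sites (Nseq n). \<phi> (mid n l s x) * ?c x\<bar> \<le> (\<Sum>x\<in>sites (Nseq n). b * ?c x)"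
    by (rule order_trans[OF sum_abs], rule sum_mono) (simp add: abs_mult mult_right_mono assms)
  then have h1: "\<bar>\<Sum>x\<in>sites (Nseq n). \<phi> (mid n l s x) * ?c x\<bar> \<le> b * (\<Sum>x\<in>sites (Nseq n). 1 * ?c x)"
    by (simp add: sum_distrib_left)
  have h2: "\<bar>a * S\<bar> \<le> b * (a * S')" if "\<bar>S\<bar> \<le> b * S'" "0 \<le> a" for a S S' :: real
    using mult_left_mono[OF that] that(2) by (simp add: abs_mult mult.left_commute)
  show ?thesis unfolding fl_def by (rule h2[OF h1]) simp
qed

text \<open>A test function differs from its partner in the net by at most \<open>e\<close>. This
  perturbs the flux by at most \<open>e\<close> times the flux of the constant 1, which is bounded
  with high probability because it converges too.\<close>

lemma whp_unif:
  assumes B: "bounded_tf B" and r: "r > 0"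
  shows "whp (\<lambda>n \<omega>. \<forall>t\<in>{0..T}. \<forall>\<phi>\<in>B. \<bar>wp t \<phi> - Wflux T Nseq \<rho>0 n \<omega> t \<phi>\<bar> \<le> r)"
proof -
  obtain C L where CL: "L \<ge> 0" "\<And>\<phi> x l s. \<phi> \<in> B \<Longrightarrow> \<bar>\<phi> x l s\<bar> \<le> C"
    "\<And>\<phi> x y l s. \<phi> \<in> B \<Longrightarrow> \<bar>\<phi> x l s - \<phi> y l s\<bar> \<le> L * dist x y"
    using bounded_tf_lip[OF B] by metis
  have tf: "test_fun \<phi>" if "\<phi> \<in> B" for \<phi> using B that by (auto simp: bounded_tf_def)
  define A where "A = T * Gb"
  have A: "A \<ge> 0" using T Gb(1) by (simp add: A_def)
  \<comment> \<open>Per direction there are three errors: of the flux, at the net point and of the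
    limit. Over the \<open>2 * CARD('d)\<close> directions they add up to \<open>r\<close>, see
    \<open>er\<close>.\<close>
  define e where "e = r / (2 * real CARD('d) * (2 * A + 2))"
  have d: "real CARD('d) > 0" by simp
  have e: "e > 0" unfolding e_def using r A d by (intro divide_pos_pos mult_pos_pos) auto
  have er: "2 * real CARD('d) * (e * (A + 1) + e + e * A) = r"
  proof -
    have "2 * real CARD('d) * (e * (A + 1) + e + e * A) = (2 * real CARD('d) * (2 * A + 2)) * e" by (simp add: algebra_simps)
    also have "\<dots> = r" unfolding e_def using A d by simp
    finally show ?thesis .
  qed
  obtain B0 where B0: "finite B0" "B0 \<subseteq> B" "\<And>\<phi>. \<phi> \<in> B \<Longrightarrow> \<exists>\<psi>\<in>B0. \<forall>x l s. \<bar>\<phi> x l s - \<psi> x l s\<bar> \<le> e"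
  proof -
    have "\<exists>B0. finite B0 \<and> B0 \<subseteq> B \<and> (\<forall>\<phi>\<in>B. \<exists>\<psi>\<in>B0. \<forall>x l s. \<bar>\<phi> x l s - \<psi> x l s\<bar> \<le> e)"
      by (rule sup_net[where C=C and L=L]) (use test_fun_per tf CL e in blast)+
    then show ?thesis using that by blast
  qed
  let ?F = "\<lambda>n \<omega>. finite {k. ring_time TYPE('d) (Nseq n) \<omega> k \<le> T}"
  let ?G = "\<lambda>\<phi> r l s n \<omega>. ?F n \<omega> \<and> (\<forall>t\<in>{0..T}. \<bar>fl n (J n \<omega> t) l s \<phi> \<omega> - wl \<phi> t\<bar> < r)"
  have one: "whp (?G (\<lambda>_. 1) 1 l s)" for l s
    by (rule flJ_unif) (auto simp: periodic_fun_def)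
  have net: "whp (?G (\<lambda>x. \<psi> x l s) e l s)" if "\<psi> \<in> B0" for \<psi> l s
    by (rule flJ_unif) (use that B0(2) tf test_fun_cont test_fun_per e in blast)+
  have "whp (\<lambda>n \<omega>. (\<forall>q\<in>UNIV. ?G (\<lambda>_. 1) 1 (fst q) (snd q) n \<omega>) \<and> (\<forall>p\<in>B0 \<times> UNIV. ?G (\<lambda>x. fst p x (fst (snd p)) (snd (snd p))) e (fst (snd p)) (snd (snd p)) n \<omega>))"
    by (rule whp_conj; rule whp_ball) (use B0(1) one net in auto)
  then show ?thesis
  proof (rule whp_mono, intro always_eventually allI impI ballI)
    fix n \<omega> t \<phi>
    assume H: "(\<forall>q\<in>UNIV. ?G (\<lambda>_. 1) 1 (fst q) (snd q) n \<omega>) \<and> (\<forall>p\<in>B0 \<times> UNIV. ?G (\<lambda>x. fst p x (fst (snd p)) (snd (snd p))) e (fst (snd p)) (snd (snd p)) n \<omega>)"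
      and t: "t \<in> {0..T}" and \<phi>: "\<phi> \<in> B"
    have F: "?F n \<omega>" and H1: "\<bar>fl n (J n \<omega> t) l s (\<lambda>_. 1) \<omega> - wl (\<lambda>_. 1) t\<bar> < 1" for l s using H t by (simp_all add: split_paired_all)
    obtain \<psi> where \<psi>: "\<psi> \<in> B0" "\<And>x l s. \<bar>\<phi> x l s - \<psi> x l s\<bar> \<le> e" using B0(3)[OF \<phi>] by blast
    have \<psi>B: "\<psi> \<in> B" using \<psi> B0 by blast
    have H2: "\<bar>fl n (J n \<omega> t) l s (\<lambda>x. \<psi> x l s) \<omega> - wl (\<lambda>x. \<psi> x l s) t\<bar> < e" for l s
      using conjunct2[OF H, rule_format, of "(\<psi>, l, s)"] \<psi>(1) t by simp
    have one: "\<bar>wl (\<lambda>x. \<phi> x l s) t - fl n (J n \<omega> t) l s (\<lambda>x. \<phi> x l s) \<omega>\<bar> \<le> e * (A + 1) + e + e * A" for l s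
    proof -
      note c = test_fun_cont[OF tf[OF \<phi>], of l s] test_fun_cont[OF tf[OF \<psi>B], of l s]
      have "\<bar>wl (\<lambda>_. 1) t\<bar> \<le> 1 * (T * Gb)" by (rule wl_bound) (use t in auto)
      then have "fl n (J n \<omega> t) l s (\<lambda>_. 1) \<omega> \<le> A + 1" using H1[of l s] unfolding A_def by argo
      then have "e * fl n (J n \<omega> t) l s (\<lambda>_. 1) \<omega> \<le> e * (A + 1)" using e by (intro mult_left_mono) auto
      moreover have "\<bar>fl n (J n \<omega> t) l s (\<lambda>x. 1 * \<phi> x l s + (-1) * \<psi> x l s) \<omega>\<bar> \<le> e * fl n (J n \<omega> t) l s (\<lambda>_. 1) \<omega>"
        by (rule fl_bound) (use \<psi>(2) in simp)
      moreover have "\<bar>wl (\<lambda>x. 1 * \<phi> x l s + (-1) * \<psi> x l s) t\<bar> \<le> e * (T * Gb)"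
        by (rule wl_bound) (use \<psi>(2) t c in \<open>auto intro!: continuous_intros\<close>)
      moreover have "\<bar>w - f\<bar> \<le> X + e + Y" if "\<bar>f' - w'\<bar> < e" "\<bar>1 * f + (-1) * f'\<bar> \<le> X'" "X' \<le> X" "\<bar>1 * w + (-1) * w'\<bar> \<le> Y"
        for w w' f f' X X' Y :: real using that by linarith
      ultimately show ?thesis using H2[of l s] unfolding fl_lin wl_lin[OF c t] A_def by blast
    qed
    have "wp t \<phi> - Wflux T Nseq \<rho>0 n \<omega> t \<phi> = (\<Sum>l\<in>UNIV. \<Sum>s\<in>UNIV. wl (\<lambda>x. \<phi> x l s) t - fl n (J n \<omega> t) l s (\<lambda>x. \<phi> x l s) \<omega>)"
      unfolding wp_def Wflux_fl[OF F] by (simp only: sum_subtractf)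
    also have "\<bar>\<dots>\<bar> \<le> (\<Sum>l\<in>(UNIV :: 'd set). \<Sum>s\<in>(UNIV :: bool set). e * (A + 1) + e + e * A)"
      by (intro order_trans[OF sum_abs] sum_mono one)
    also have "\<dots> = r" unfolding er[symmetric] by simp
    finally show "\<bar>wp t \<phi> - Wflux T Nseq \<rho>0 n \<omega> t \<phi>\<bar> \<le> r" .
  qed
qed

end

section \<open>The Skorohod-Mitoma topology\<close>

lemma normB_le: "0 \<le> r \<Longrightarrow> (\<And>\<phi>. \<phi> \<in> B \<Longrightarrow> \<bar>\<xi> \<phi>\<bar> \<le> r) \<Longrightarrow> normB B \<xi> \<le> ereal r"
  unfolding normB_def by (intro Sup_least) auto

lemma normB_nonneg: "0 \<le> normB B \<xi>"
  unfolding normB_def by (intro Sup_upper) auto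

lemma normB_0: "normB B (\<lambda>\<phi>. 0) = 0"
  using normB_le[of 0 B "\<lambda>_. 0"] normB_nonneg[of B "\<lambda>_. 0"] by (simp add: zero_ereal_def[symmetric])

text \<open>A functional bounded by the sup norm has order 0, so the seminorm without derivatives is
  enough. Periodicity and continuity bound the test function, which makes the supremum in
  \<open>seminorm_k\<close> meaningful.\<close>

lemma dual_elemI:
  assumes lin: "\<And>\<phi> \<psi> a b. test_fun \<phi> \<Longrightarrow> test_fun \<psi> \<Longrightarrow> \<xi> (\<lambda>x l s. a * \<phi> x l s + b * \<psi> x l s) = a * \<xi> \<phi> + b * \<xi> \<psi>"
    and bd: "\<And>\<phi> b. test_fun \<phi> \<Longrightarrow> (\<And>x l s. \<bar>\<phi> x l s\<bar> \<le> b) \<Longrightarrow> \<bar>\<xi> \<phi>\<bar> \<le> C * b"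
  shows "dual_elem (\<xi> :: 'd::finite tf \<Rightarrow> real)"
  unfolding dual_elem_def
proof (rule conjI, intro allI impI lin, assumption, assumption, rule exI[of _ 0], rule exI[of _ C], intro allI impI)
  fix \<phi> :: "'d tf" assume t: "test_fun \<phi>"
  have "\<exists>R\<ge>0. \<forall>x. \<bar>\<phi> x l s\<bar> \<le> R" for l s by (rule periodic_uniform1(1)[OF test_fun_cont[OF t] test_fun_per[OF t]])
  then obtain R where R: "\<And>x l s. \<bar>\<phi> x l s\<bar> \<le> R l s" by metis
  define m where "m = (\<Sum>l\<in>UNIV. \<Sum>s\<in>UNIV. \<bar>R l s\<bar>)"
  have "\<bar>\<phi> x l s\<bar> \<le> m" for x l s
  proof -
    have "\<bar>R l s\<bar> \<le> (\<Sum>s\<in>UNIV. \<bar>R l s\<bar>)" by (rule member_le_sum) auto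
    also have "\<dots> \<le> m" unfolding m_def by (rule member_le_sum[where f="\<lambda>l. \<Sum>s\<in>UNIV. \<bar>R l s\<bar>"]) (auto intro: sum_nonneg)
    finally show ?thesis using R[of x l s] by linarith
  qed
  then have "bdd_above {\<bar>pdl \<alpha> (\<lambda>y. \<phi> y l s) x\<bar> | \<alpha> x l s. length \<alpha> \<le> 0}"
    by (intro bdd_aboveI[of _ m]) (auto simp: pdl_def)
  then have "\<bar>\<phi> x l s\<bar> \<le> seminorm_k 0 \<phi>" for x l s
    unfolding seminorm_k_def by (intro cSup_upper) (auto intro!: exI[of _ "[]"] simp: pdl_def)
  from bd[OF t this] show "\<bar>\<xi> \<phi>\<bar> \<le> C * seminorm_k 0 \<phi>" .
qed

lemma istopology_SM: "istopology (SM_open T)"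
  unfolding istopology_def
proof (intro conjI allI impI)
  fix U V :: "'d::finite path set" assume U: "SM_open T U" and V: "SM_open T V"
  show "SM_open T (U \<inter> V)" unfolding SM_open_def
  proof (intro conjI ballI)
    show "U \<inter> V \<subseteq> Dspace T" using U by (auto simp: SM_open_def)
    fix \<xi> assume x: "\<xi> \<in> U \<inter> V"
    obtain Bs r where 1: "finite Bs" "\<forall>B\<in>Bs. bounded_tf B" "r > 0" "{\<eta>\<in>Dspace T. \<forall>B\<in>Bs. dSM T B \<xi> \<eta> < r} \<subseteq> U"
      using U x unfolding SM_open_def by blast
    obtain Bs' r' where 2: "finite Bs'" "\<forall>B\<in>Bs'. bounded_tf B" "r' > 0" "{\<eta>\<in>Dspace T. \<forall>B\<in>Bs'. dSM T B \<xi> \<eta> < r'} \<subseteq> V"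
      using V x unfolding SM_open_def by blast
    show "\<exists>Bs r. finite Bs \<and> (\<forall>B\<in>Bs. bounded_tf B) \<and> r > 0 \<and> {\<eta>\<in>Dspace T. \<forall>B\<in>Bs. dSM T B \<xi> \<eta> < r} \<subseteq> U \<inter> V"
      using 1 2 by (intro exI[of _ "Bs \<union> Bs'"] exI[of _ "min r r'"]) auto
  qed
next
  fix K :: "'d::finite path set set" assume K: "\<forall>U\<in>K. SM_open T U"
  show "SM_open T (\<Union>K)" unfolding SM_open_def
  proof (intro conjI ballI)
    show "\<Union>K \<subseteq> Dspace T" using K by (auto simp: SM_open_def)
    fix \<xi> assume "\<xi> \<in> \<Union>K"
    then obtain U where U: "U \<in> K" "\<xi> \<in> U" by blast
    then have "SM_open T U" using K by blast
    then obtain Bs r where 1: "finite Bs" "\<forall>B\<in>Bs. bounded_tf B" "r > 0" "{\<eta>\<in>Dspace T. \<forall>B\<in>Bs. dSM T B \<xi> \<eta> < r} \<subseteq> U"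
      using U(2) unfolding SM_open_def by blast
    show "\<exists>Bs r. finite Bs \<and> (\<forall>B\<in>Bs. bounded_tf B) \<and> r > 0 \<and> {\<eta>\<in>Dspace T. \<forall>B\<in>Bs. dSM T B \<xi> \<eta> < r} \<subseteq> \<Union>K"
      by (intro exI[of _ Bs] exI[of _ r] conjI 1(1-3) order_trans[OF 1(4) Union_upper[OF U(1)]])
  qed
qed

lemma openin_SM: "openin (SM_top T) = SM_open T"
  unfolding SM_top_def by (rule topology_inverse'[OF istopology_SM])

lemma topspace_SM: "topspace (SM_top T) = (Dspace T :: 'd::finite path set)"
proof -
  have "SM_open T (Dspace T :: 'd path set)" unfolding SM_open_def
    by (intro conjI ballI exI[of _ "{}"] exI[of _ 1]) auto
  moreover have "SM_open T U \<Longrightarrow> U \<subseteq> Dspace T" for U :: "'d path set" by (simp add: SM_open_def)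
  ultimately show ?thesis unfolding topspace_def openin_SM by blast
qed

text \<open>Radii in \<open>SM_open\<close> are extended reals and the inequality there is strict; a
  smaller real radius gives the form in which estimates are stated.\<close>

lemma continuous_SM:
  fixes F :: "'d::finite path \<Rightarrow> real"
  assumes F: "continuous_map (SM_top T) euclideanreal F" and w: "w \<in> Dspace T" and e: "e > 0"
  obtains Bs r where "finite Bs" "\<And>B. B \<in> Bs \<Longrightarrow> bounded_tf B" "(r :: real) > 0"
    "\<And>\<eta>. \<eta> \<in> Dspace T \<Longrightarrow> (\<And>B. B \<in> Bs \<Longrightarrow> dSM T B w \<eta> \<le> ereal r) \<Longrightarrow> \<bar>F \<eta> - F w\<bar> < e"
proof -
  have "openin (SM_top T) {\<xi> \<in> topspace (SM_top T). F \<xi> \<in> ball (F w) e}"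
    by (rule openin_continuous_map_preimage[OF F]) simp
  then have "SM_open T {\<xi> \<in> Dspace T. F \<xi> \<in> ball (F w) e}" unfolding openin_SM topspace_SM .
  moreover have "w \<in> {\<xi> \<in> Dspace T. F \<xi> \<in> ball (F w) e}" using w e by simp
  ultimately obtain Bs r where 1: "finite Bs" "\<forall>B\<in>Bs. bounded_tf B" "r > 0"
    "{\<eta>\<in>Dspace T. \<forall>B\<in>Bs. dSM T B w \<eta> < r} \<subseteq> {\<xi> \<in> Dspace T. F \<xi> \<in> ball (F w) e}"
    unfolding SM_open_def by blast
  obtain r' where r': "0 < ereal r'" "ereal r' < r" using ereal_dense2[OF 1(3)] by blast
  show ?thesis
  proof (rule that[of Bs r'])
    fix \<eta> assume \<eta>: "\<eta> \<in> Dspace T" and d: "\<And>B. B \<in> Bs \<Longrightarrow> dSM T B w \<eta> \<le> ereal r'"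
    have "\<forall>B\<in>Bs. dSM T B w \<eta> < r" using d r'(2) by (blast intro: le_less_trans)
    then have "F \<eta> \<in> ball (F w) e" using 1(4) \<eta> by blast
    then show "\<bar>F \<eta> - F w\<bar> < e" by (simp add: dist_real_def)
  qed (use 1 r' in auto)
qed

lemma dSM_le:
  fixes c :: real
  assumes T: "T > 0" and \<tau>: "\<tau> \<in> time_changes T" and r: "0 \<le> r" "\<And>t \<phi>. t \<in> {0..T} \<Longrightarrow> \<phi> \<in> B \<Longrightarrow> \<bar>\<xi> t \<phi> - \<eta> (\<tau> t) \<phi>\<bar> \<le> r"
    and c: "\<And>s t. s \<in> {0..T} \<Longrightarrow> t \<in> {0..T} \<Longrightarrow> s \<noteq> t \<Longrightarrow> \<bar>ln ((\<tau> t - \<tau> s) / (t - s))\<bar> \<le> c"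
  shows "dSM T B \<xi> \<eta> \<le> ereal (r + c)"
proof -
  have "dSM T B \<xi> \<eta> \<le> (SUP t\<in>{0..T}. normB B (\<lambda>\<phi>. \<xi> t \<phi> - \<eta> (\<tau> t) \<phi>)) +
      (SUP st\<in>{(s,t). s \<in> {0..T} \<and> t \<in> {0..T} \<and> s \<noteq> t}. ereal \<bar>ln ((\<tau> (snd st) - \<tau> (fst st)) / (snd st - fst st))\<bar>)"
    unfolding dSM_def by (rule INF_lower[OF \<tau>])
  also have "\<dots> \<le> ereal r + ereal c"
    by (intro add_mono SUP_least normB_le r) (use c in auto)
  finally show ?thesis by simp
qed

lemma dSM_sup:
  assumes T: "T > 0" and r: "0 \<le> r" "\<And>t \<phi>. t \<in> {0..T} \<Longrightarrow> \<phi> \<in> B \<Longrightarrow> \<bar>\<xi> t \<phi> - \<eta> t \<phi>\<bar> \<le> r"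
  shows "dSM T B \<xi> \<eta> \<le> ereal r"
proof -
  have "id \<in> time_changes T" by (auto simp: time_changes_def strict_mono_on_def)
  from dSM_le[OF T this r(1), of B \<xi> \<eta> 0] r(2) show ?thesis by simp
qed

section \<open>Piecewise constant paths and their time discretization\<close>

definition step_path :: "real \<Rightarrow> real set \<Rightarrow> 'd::finite path \<Rightarrow> bool" where
  "step_path T S X \<longleftrightarrow> finite S \<and> (\<forall>t\<in>{0..T}. dual_elem (X t)) \<and>
    (\<forall>s t. 0 \<le> s \<longrightarrow> s \<le> t \<longrightarrow> t \<le> T \<longrightarrow> S \<inter> {s<..t} = {} \<longrightarrow> X s = X t)"

lemma finite_gap:
  fixes S :: "real set"
  assumes "finite S" shows "\<exists>h>0. \<forall>x\<in>S. \<forall>y\<in>S. x \<noteq> y \<longrightarrow> h \<le> \<bar>x - y\<bar>"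
proof -
  let ?D = "(\<lambda>(x, y). \<bar>x - y\<bar>) ` {p \<in> S \<times> S. fst p \<noteq> snd p}"
  \<comment> \<open>The additional element 1 keeps the minimum meaningful when there are no two
    distinct points.\<close>
  have f: "finite (insert 1 ?D)" using assms by simp
  have "\<forall>d\<in>insert 1 ?D. 0 < d" by auto
  then have "0 < Min (insert 1 ?D)" using Min_gr_iff[OF f] by simp
  moreover have "Min (insert 1 ?D) \<le> \<bar>x - y\<bar>" if "x \<in> S" "y \<in> S" "x \<noteq> y" for x y
    using that by (intro Min_le f) (auto intro!: image_eqI[of _ _ "(x, y)"])
  ultimately show ?thesis by blast
qed

lemma step_path_Dspace:
  assumes X: "step_path T S X" shows "X \<in> Dspace T"
  unfolding Dspace_def
proof (intro CollectI conjI ballI allI impI)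
  have S: "finite S" and loc: "\<And>s t. 0 \<le> s \<Longrightarrow> s \<le> t \<Longrightarrow> t \<le> T \<Longrightarrow> S \<inter> {s<..t} = {} \<Longrightarrow> X s = X t"
    and dl: "\<And>t. t \<in> {0..T} \<Longrightarrow> dual_elem (X t)" using X by (auto simp: step_path_def)
  show "t \<in> {0..T} \<Longrightarrow> dual_elem (X t)" for t by (rule dl)
  {
    fix t B assume t: "t \<in> {0..<T}"
    obtain h where h: "h > 0" "\<And>x y. x \<in> insert t S \<Longrightarrow> y \<in> insert t S \<Longrightarrow> x \<noteq> y \<Longrightarrow> h \<le> \<bar>x - y\<bar>"
      using finite_gap[OF finite.insertI[OF S], of t] by blast
    have "eventually (\<lambda>s. normB B (\<lambda>\<phi>. X s \<phi> - X t \<phi>) = 0) (at t within {t<..T})"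
      unfolding eventually_at
    proof (intro exI[of _ h] conjI h(1) ballI impI)
      fix s assume s: "s \<in> {t<..T}" "s \<noteq> t \<and> dist s t < h"
      have "S \<inter> {t<..s} = {}" using h(2)[of _ t] s by (fastforce simp: dist_real_def)
      then have "X t = X s" using s t by (intro loc) auto
      then show "normB B (\<lambda>\<phi>. X s \<phi> - X t \<phi>) = 0" by (simp add: normB_0)
    qed
    then show "((\<lambda>s. normB B (\<lambda>\<phi>. X s \<phi> - X t \<phi>)) \<longlongrightarrow> 0) (at t within {t<..T})"
      by (rule tendsto_eventually)
  }
  {
    fix t assume t: "t \<in> {0<..T}"
    \<comment> \<open>Inserting 0 ensures \<open>h \<le> t\<close>, so that \<open>t - h / 2\<close>
      is a point of the time interval.\<close>
    obtain h where h: "h > 0" "\<And>x y. x \<in> insert 0 (insert t S) \<Longrightarrow> y \<in> insert 0 (insert t S) \<Longrightarrow> x \<noteq> y \<Longrightarrow> h \<le> \<bar>x - y\<bar>"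
      using finite_gap[OF finite.insertI[OF finite.insertI[OF S]], of 0 t] by blast
    have ht: "h \<le> t" using h(2)[of 0 t] t by auto
    \<comment> \<open>The path is constant just before \<open>t\<close>, so its value at
      \<open>t - h / 2\<close> is the left limit.\<close>
    show "\<exists>\<eta>. dual_elem \<eta> \<and> (\<forall>B. bounded_tf B \<longrightarrow> ((\<lambda>s. normB B (\<lambda>\<phi>. X s \<phi> - \<eta> \<phi>)) \<longlongrightarrow> 0) (at t within {0..<t}))"
    proof (intro exI[of _ "X (t - h / 2)"] conjI allI impI)
      show "dual_elem (X (t - h / 2))" using t ht h(1) by (intro dl) auto
      fix B
      have "eventually (\<lambda>s. normB B (\<lambda>\<phi>. X s \<phi> - X (t - h / 2) \<phi>) = 0) (at t within {0..<t})"
        unfolding eventually_at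
      proof (intro exI[of _ "h / 2"] conjI ballI impI)
        fix s assume s: "s \<in> {0..<t}" "s \<noteq> t \<and> dist s t < h / 2"
        have "S \<inter> {t - h / 2<..s} = {}" using h(1) h(2)[of _ t] s by (fastforce simp: dist_real_def)
        then have "X (t - h / 2) = X s" using s t ht h(1) by (intro loc) (auto simp: dist_real_def)
        then show "normB B (\<lambda>\<phi>. X s \<phi> - X (t - h / 2) \<phi>) = 0" by (simp add: normB_0)
      qed (use h in simp)
      then show "((\<lambda>s. normB B (\<lambda>\<phi>. X s \<phi> - X (t - h / 2) \<phi>)) \<longlongrightarrow> 0) (at t within {0..<t})"
        by (rule tendsto_eventually)
    qed
  }
qed

text \<open>Moves the points of a finite set by small amounts with slopes close to 1: each point carries a hat
  function whose support contains no other point.\<close>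
lemma hat_time_change:
  fixes S :: "real set" and \<sigma> :: "real \<Rightarrow> real"
  assumes T: "T > 0" and S: "finite S" "S \<subseteq> {0<..T}" and h: "h > 0"
    and gap: "\<And>x y. x \<in> insert 0 (insert T S) \<Longrightarrow> y \<in> insert 0 (insert T S) \<Longrightarrow> x \<noteq> y \<Longrightarrow> h \<le> \<bar>x - y\<bar>"
    and \<sigma>T: "T \<in> S \<Longrightarrow> \<sigma> T = T" and d: "\<And>x. x \<in> S \<Longrightarrow> \<bar>\<sigma> x - x\<bar> \<le> \<delta>" and c: "real (card S) * \<delta> / h \<le> c" "c \<le> 1 / 2" "0 \<le> c"
  obtains \<tau> where "\<tau> \<in> time_changes T" "\<And>x. x \<in> S \<Longrightarrow> \<tau> x = \<sigma> x"
    "\<And>s t. s \<noteq> t \<Longrightarrow> \<bar>ln ((\<tau> t - \<tau> s) / (t - s))\<bar> \<le> 2 * c" "strict_mono \<tau>"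
proof -
  define hat where "hat x t = max 0 (1 - \<bar>t - x\<bar> / h)" for x t :: real
  define g where "g t = (\<Sum>x\<in>S. (\<sigma> x - x) * hat x t)" for t
  define \<tau> where "\<tau> t = t + g t" for t
  have hat0: "hat x y = 0" if "x \<in> insert 0 (insert T S)" "y \<in> insert 0 (insert T S)" "x \<noteq> y" for x y
  proof -
    have "1 \<le> \<bar>y - x\<bar> / h" using gap[OF that] h by (simp add: pos_le_divide_eq abs_minus_commute)
    then show ?thesis by (simp add: hat_def)
  qed
  have hat1: "hat x x = 1" for x by (simp add: hat_def)
  have hat_lip: "\<bar>hat x t - hat x s\<bar> \<le> \<bar>t - s\<bar> / h" for x s t
  proof -
    have "\<bar>\<bar>t - x\<bar> / h - \<bar>s - x\<bar> / h\<bar> \<le> \<bar>t - s\<bar> / h"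
      unfolding diff_divide_distrib[symmetric] abs_divide using h by (simp add: divide_right_mono)
    then show ?thesis unfolding hat_def by (simp add: max_def) argo
  qed
  \<comment> \<open>Slopes add up over at most \<open>card S\<close> hats, each scaled by at most
    \<open>\<delta>\<close> and with slope at most \<open>1 / h\<close>.\<close>
  have g_lip: "\<bar>g t - g s\<bar> \<le> c * \<bar>t - s\<bar>" for s t
  proof -
    have "\<bar>g t - g s\<bar> = \<bar>\<Sum>x\<in>S. (\<sigma> x - x) * (hat x t - hat x s)\<bar>"
      unfolding g_def by (simp add: sum_subtractf[symmetric] right_diff_distrib)
    also have "\<dots> \<le> (\<Sum>x\<in>S. \<delta> * (\<bar>t - s\<bar> / h))"
      by (intro order_trans[OF sum_abs] sum_mono, unfold abs_mult) (intro mult_mono d hat_lip, auto intro: order_trans[OF abs_ge_zero d])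
    also have "\<dots> = (real (card S) * \<delta> / h) * \<bar>t - s\<bar>" by simp
    also have "\<dots> \<le> c * \<bar>t - s\<bar>" by (intro mult_right_mono c) simp
    finally show ?thesis .
  qed
  \<comment> \<open>The end points stay fixed: the other hats vanish there, and \<open>T\<close> is
    not displaced if it belongs to \<open>S\<close>.\<close>
  have g0: "g y = 0" if "y = 0 \<or> y = T" for y
    unfolding g_def
  proof (intro sum.neutral ballI)
    fix x assume x: "x \<in> S"
    show "(\<sigma> x - x) * hat x y = 0"
    proof (cases "x = y")
      case True
      then have "x = T" using that x S(2) by auto
      then show ?thesis using \<sigma>T x by simp
    qed (use hat0[of x y] x that in auto)
  qed
  have slope: "1 - c \<le> (\<tau> t - \<tau> s) / (t - s)" "(\<tau> t - \<tau> s) / (t - s) \<le> 1 + c" if "s \<noteq> t" for s t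
  proof -
    have "(\<tau> t - \<tau> s) / (t - s) = 1 + (g t - g s) / (t - s)" using that by (simp add: \<tau>_def field_simps)
    moreover have "\<bar>(g t - g s) / (t - s)\<bar> \<le> c" using g_lip[of t s] that by (simp add: abs_divide pos_divide_le_eq)
    ultimately show "1 - c \<le> (\<tau> t - \<tau> s) / (t - s)" "(\<tau> t - \<tau> s) / (t - s) \<le> 1 + c" by linarith+
  qed
  have sm: "strict_mono \<tau>"
  proof (rule strict_monoI)
    fix s t :: real assume st: "s < t"
    have "0 < (\<tau> t - \<tau> s) / (t - s)" using slope(1)[of s t] st c by linarith
    then show "\<tau> s < \<tau> t" using st by (simp add: zero_less_divide_iff)
  qed
  have cont: "continuous_on A \<tau>" for A
    unfolding \<tau>_def g_def hat_def using h by (intro continuous_intros) auto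
  have ends: "\<tau> 0 = 0" "\<tau> T = T" using g0 by (auto simp: \<tau>_def)
  have "\<tau> ` {0..T} = {0..T}"
  proof
    show "\<tau> ` {0..T} \<subseteq> {0..T}"
      using strict_mono_less_eq[OF sm] ends by (metis (no_types, lifting) atLeastAtMost_iff image_subsetI)
    show "{0..T} \<subseteq> \<tau> ` {0..T}"
    proof
      fix y assume "y \<in> {0..T}"
      then have "\<exists>x. 0 \<le> x \<and> x \<le> T \<and> \<tau> x = y" using ends T cont by (intro IVT') auto
      then show "y \<in> \<tau> ` {0..T}" by auto
    qed
  qed
  then have tc: "\<tau> \<in> time_changes T"
    using cont sm by (auto simp: time_changes_def strict_mono_on_def dest: strict_monoD)
  have ln: "\<bar>ln ((\<tau> t - \<tau> s) / (t - s))\<bar> \<le> 2 * c" if "s \<noteq> t" for s t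
  proof -
    let ?q = "(\<tau> t - \<tau> s) / (t - s)"
    have q: "1 - c \<le> ?q" "?q \<le> 1 + c" "?q > 0" using slope[OF that] c by linarith+
    have 1: "ln ?q \<le> ?q - 1" using q(3) by (rule ln_le_minus_one)
    have "ln (1 / ?q) \<le> 1 / ?q - 1" by (rule ln_le_minus_one) (rule divide_pos_pos[OF zero_less_one q(3)])
    moreover have "ln (1 / z) = - ln z" if "z > 0" for z :: real using that by (simp add: ln_div)
    ultimately have 2: "- ln ?q \<le> 1 / ?q - 1" using q(3) by metis
    \<comment> \<open>This product is \<open>1 + c - 2 * c\<^sup>2\<close>, at least 1 for
      \<open>c \<le> 1 / 2\<close>; it bounds the inverse slope and with it the logarithm from
      below.\<close>
    have "1 \<le> (1 + 2 * c) * (1 - c)" using c mult_left_mono[OF c(2) c(3)] by (simp add: algebra_simps)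
    also have "\<dots> \<le> (1 + 2 * c) * ?q" using q c by (intro mult_left_mono) auto
    finally have "1 / ?q \<le> 1 + 2 * c" using q(3) by (simp only: pos_divide_le_eq)
    then show ?thesis using 1 2 q c by linarith
  qed
  have "\<tau> x = \<sigma> x" if "x \<in> S" for x
  proof -
    have "g x = (\<Sum>y\<in>{x}. (\<sigma> y - y) * hat y x)"
      unfolding g_def using S(1) that hat0[of _ x] by (intro sum.mono_neutral_right) auto
    then show ?thesis by (simp add: \<tau>_def hat1)
  qed
  then show ?thesis using that[OF tc _ ln sm] by blast
qed

text \<open>Samples the path at the last grid point not after \<open>t\<close>. The
  \<open>min\<close> caps the index for every real argument, so that the result depends on
  \<open>m + 1\<close> sample values only.\<close>

definition discretize :: "real \<Rightarrow> nat \<Rightarrow> 'd::finite path \<Rightarrow> 'd path" where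
  "discretize T m X t = X (real (min m (nat \<lfloor>real m * t / T\<rfloor>)) * T / real m)"

text \<open>The second part says that no grid point separates \<open>t\<close> from its sample time;
  this is the fact by which jumps are compared later.\<close>

lemma discretize_le:
  assumes T: "T > 0" and m: "m > 0" and t: "t \<in> {0..T}"
  defines "v \<equiv> real (min m (nat \<lfloor>real m * t / T\<rfloor>)) * T / real m"
  shows "v \<in> {0..t}" "\<And>i. real i * T / real m \<le> t \<longleftrightarrow> real i * T / real m \<le> v"
proof -
  let ?y = "real m * t / T"
  have y: "0 \<le> ?y" "?y \<le> m" using t T m by (auto simp: pos_divide_le_eq intro: mult_left_mono)
  then have "nat \<lfloor>?y\<rfloor> \<le> m" by linarith
  then have v: "v = real (nat \<lfloor>?y\<rfloor>) * T / m" by (simp add: v_def min_def)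
  have le: "real i * T / real m \<le> t \<longleftrightarrow> real i \<le> ?y" for i using T m by (simp add: field_simps)
  have le2: "real i * T / real m \<le> v \<longleftrightarrow> i \<le> nat \<lfloor>?y\<rfloor>" for i unfolding v using T m by (simp add: divide_le_cancel)
  have "real (nat \<lfloor>?y\<rfloor>) \<le> ?y" using y by simp
  then have "v \<le> t" unfolding v using le by blast
  then show "v \<in> {0..t}" using T by (simp add: v_def)
  show "real i * T / real m \<le> t \<longleftrightarrow> real i * T / real m \<le> v" for i
    unfolding le le2 using y(1) by (simp add: le_nat_iff le_floor_iff)
qed

lemma step_path_discretize:
  assumes T: "T > 0" and m: "m > 0" and X: "step_path T S X"
  shows "step_path T ((\<lambda>i. real i * T / real m) ` {..m}) (discretize T m X)"
  unfolding step_path_def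
proof (intro conjI ballI allI impI)
  fix t assume t: "t \<in> {0..T}"
  show "dual_elem (discretize T m X t)"
    unfolding discretize_def using discretize_le(1)[OF T m t] t X by (auto simp: step_path_def)
next
  fix s t assume st: "0 \<le> s" "s \<le> t" "t \<le> T" and e: "(\<lambda>i. real i * T / real m) ` {..m} \<inter> {s<..t} = {}"
  let ?v = "\<lambda>t. real (min m (nat \<lfloor>real m * t / T\<rfloor>)) * T / real m"
  have s': "s \<in> {0..T}" and t': "t \<in> {0..T}" using st by auto
  have "?v t \<le> t" using discretize_le(1)[OF T m t'] by simp
  moreover have "?v t \<in> (\<lambda>i. real i * T / real m) ` {..m}" by (rule image_eqI[OF refl]) simp
  then have "?v t \<notin> {s<..t}" using e by blast
  ultimately have "?v t \<le> s" by (meson greaterThanAtMost_iff not_less)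
  then have 1: "?v t \<le> ?v s" using discretize_le(2)[OF T m s', of "min m (nat \<lfloor>real m * t / T\<rfloor>)"] by blast
  have "?v s \<le> t" using discretize_le(1)[OF T m s'] st by simp
  then have "?v s \<le> ?v t" using discretize_le(2)[OF T m t', of "min m (nat \<lfloor>real m * s / T\<rfloor>)"] by blast
  then show "discretize T m X s = discretize T m X t" using 1 unfolding discretize_def by (metis order_antisym)
qed simp

text \<open>Sampling delays each jump to the next grid point. The sup distance does not reflect that
  the delay is short, but a time change that carries the jumps onto the grid makes the two paths
  agree exactly.\<close>

lemma discretize_close:
  assumes T: "T > 0" and X: "step_path T S X" and e: "e > 0"
  shows "eventually (\<lambda>m. \<forall>B. dSM T B X (discretize T m X) \<le> ereal e) sequentially"
proof -
  define S' where "S' = S \<inter> {0<..T}"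
  have S': "finite S'" "S' \<subseteq> {0<..T}" using X by (auto simp: S'_def step_path_def)
  obtain h where h: "h > 0" "\<And>x y. x \<in> insert 0 (insert T S') \<Longrightarrow> y \<in> insert 0 (insert T S') \<Longrightarrow> x \<noteq> y \<Longrightarrow> h \<le> \<bar>x - y\<bar>"
    using finite_gap[OF finite.insertI[OF finite.insertI[OF S'(1)]], of 0 T] by blast
  define c where "c = min (1 / 2) (e / 2)"
  have c: "0 < c" "c \<le> 1 / 2" "2 * c \<le> e" using e by (auto simp: c_def)
  have "(\<lambda>m. real (card S') * T / h * (1 / real m)) \<longlonglongrightarrow> real (card S') * T / h * 0" by (intro tendsto_intros lim_1_over_n)
  then have "eventually (\<lambda>m. real (card S') * T / h * (1 / real m) < c) sequentially"
    by (rule order_tendstoD(2)) (use c in simp)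
  then show ?thesis using eventually_gt_at_top[of 0]
  proof eventually_elim
    case (elim m)
    then have m: "real m > 0" by simp
    \<comment> \<open>The first grid point at or after \<open>x\<close>, where the sampled path
      shows the jump.\<close>
    define \<sigma> where "\<sigma> x = real (nat \<lceil>real m * x / T\<rceil>) * T / real m" for x
    have \<sigma>le: "x \<le> real i * T / real m \<longleftrightarrow> \<sigma> x \<le> real i * T / real m" if "x \<in> S'" for x i
    proof -
      have "x \<le> real i * T / real m \<longleftrightarrow> real m * x / T \<le> real i" using T m by (simp add: field_simps)
      also have "\<dots> \<longleftrightarrow> nat \<lceil>real m * x / T\<rceil> \<le> i" by (simp add: nat_le_iff ceiling_le_iff)
      also have "\<dots> \<longleftrightarrow> \<sigma> x \<le> real i * T / real m" unfolding \<sigma>_def using T m by (simp add: divide_le_cancel)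
      finally show ?thesis .
    qed
    have \<sigma>d: "\<bar>\<sigma> x - x\<bar> \<le> T / m" if x: "x \<in> S'" for x
    proof -
      have y: "0 \<le> real m * x / T" using S'(2) x T by auto
      then have 1: "real m * x / T \<le> real (nat \<lceil>real m * x / T\<rceil>)" "real (nat \<lceil>real m * x / T\<rceil>) \<le> real m * x / T + 1" by linarith+
      have "real m * x / T * T / m \<le> \<sigma> x" unfolding \<sigma>_def using 1(1) T m by (intro divide_right_mono mult_right_mono) auto
      moreover have "\<sigma> x \<le> (real m * x / T + 1) * T / m" unfolding \<sigma>_def using 1(2) T m by (intro divide_right_mono mult_right_mono) auto
      moreover have "real m * x / T * T / m = x" "(real m * x / T + 1) * T / m = x + T / m" using T m by (auto simp: field_simps)
      ultimately show ?thesis by linarith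
    qed
    have \<sigma>T: "\<sigma> T = T" using T m by (simp add: \<sigma>_def)
    have cc: "real (card S') * (T / m) / h \<le> c" using elim by (simp add: mult.commute)
    obtain \<tau> where \<tau>: "\<tau> \<in> time_changes T" "\<And>x. x \<in> S' \<Longrightarrow> \<tau> x = \<sigma> x"
      "\<And>s t. s \<noteq> t \<Longrightarrow> \<bar>ln ((\<tau> t - \<tau> s) / (t - s))\<bar> \<le> 2 * c" "strict_mono \<tau>"
      using hat_time_change[OF T S' h \<sigma>T \<sigma>d cc c(2) less_imp_le[OF c(1)]] by blast
    have eq: "X t = discretize T m X (\<tau> t)" if t: "t \<in> {0..T}" for t
    proof -
      have \<tau>t: "\<tau> t \<in> {0..T}" using \<tau>(1) t by (auto simp: time_changes_def)
      define i where "i = min m (nat \<lfloor>real m * \<tau> t / T\<rfloor>)"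
      define v where "v = real i * T / m"
      note D = discretize_le[OF T elim(2) \<tau>t, folded i_def, folded v_def]
      \<comment> \<open>A jump has occurred by time \<open>t\<close> iff it has occurred by the
        sample time of \<open>\<tau> t\<close>: the time change carries it to a grid point, and no
        grid point separates \<open>\<tau> t\<close> from its sample time.\<close>
      have iff: "x \<le> t \<longleftrightarrow> x \<le> v" if x: "x \<in> S'" for x
      proof -
        have "x \<le> t \<longleftrightarrow> \<sigma> x \<le> \<tau> t" using strict_mono_less_eq[OF \<tau>(4)] \<tau>(2)[OF x] by metis
        also have "\<dots> \<longleftrightarrow> \<sigma> x \<le> v" unfolding \<sigma>_def by (rule D(2))
        also have "\<dots> \<longleftrightarrow> x \<le> v" using \<sigma>le[OF x, of i] by (simp add: v_def)
        finally show ?thesis .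
      qed
      have v: "0 \<le> v" "v \<le> T" using D(1) \<tau>t by auto
      have loc: "\<And>s t. 0 \<le> s \<Longrightarrow> s \<le> t \<Longrightarrow> t \<le> T \<Longrightarrow> S \<inter> {s<..t} = {} \<Longrightarrow> X s = X t" using X by (auto simp: step_path_def)
      have "X t = X v"
      proof (cases "t \<le> v")
        case True
        have "S \<inter> {t<..v} = {}" using iff v t by (force simp: S'_def)
        then show ?thesis using True t v by (intro loc) auto
      next
        case False
        have "S \<inter> {v<..t} = {}" using iff v t by (force simp: S'_def)
        then show ?thesis using False t v by (intro loc[symmetric]) auto
      qed
      then show ?thesis by (simp add: discretize_def v_def i_def)
    qed
    show ?case
    proof
      fix B
      have "dSM T B X (discretize T m X) \<le> ereal (0 + 2 * c)"
        by (rule dSM_le[OF T \<tau>(1)]) (use eq \<tau>(3) in auto)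
      then show "dSM T B X (discretize T m X) \<le> ereal e" using c(3) by (auto intro: order_trans)
    qed
  qed
qed

section \<open>Measurability and narrow convergence\<close>

lemma ring_time_measurable [measurable]: "(\<lambda>\<omega>. ring_time D N \<omega> k) \<in> borel_measurable Omega"
  unfolding ring_time_def by measurable

text \<open>The number of rings is a measurable random index with countably many values, so
  inserting it into the chain preserves measurability.\<close>

lemma Wtil_measurable:
  fixes \<rho>0 :: "real^'d::finite \<Rightarrow> real"
  shows "(\<lambda>\<omega>. Wtil T Nseq \<rho>0 n \<omega> t x y) \<in> measurable Omega (count_space UNIV)"
proof -
  note [measurable] = chain_measurable(2)
  have [measurable]: "(\<lambda>\<omega>. card {k. ring_time TYPE('d) (Nseq n) \<omega> k \<le> t}) \<in> measurable Omega (count_space UNIV)"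
    by (rule measurable_card) measurable
  have [measurable]: "Measurable.pred Omega (\<lambda>\<omega>. finite {k. ring_time TYPE('d) (Nseq n) \<omega> k \<le> T})"
    by (rule measurable_finite) measurable
  have [measurable]: "(\<lambda>\<omega>. snd (chain Nseq \<rho>0 n \<omega> (card {k. ring_time TYPE('d) (Nseq n) \<omega> k \<le> t})) x y) \<in> measurable Omega (count_space UNIV)"
    by (rule measurable_compose_countable[where g="\<lambda>\<omega>. card {k. ring_time TYPE('d) (Nseq n) \<omega> k \<le> t}"]) measurable
  have "(\<lambda>\<omega>. if finite {k. ring_time TYPE('d) (Nseq n) \<omega> k \<le> T}
      then snd (chain Nseq \<rho>0 n \<omega> (card {k. ring_time TYPE('d) (Nseq n) \<omega> k \<le> t})) x y else 0) \<in> measurable Omega (count_space UNIV)"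
    by measurable
  moreover have "(\<lambda>\<omega>. Wtil T Nseq \<rho>0 n \<omega> t x y) = (\<lambda>\<omega>. if finite {k. ring_time TYPE('d) (Nseq n) \<omega> k \<le> T}
      then snd (chain Nseq \<rho>0 n \<omega> (card {k. ring_time TYPE('d) (Nseq n) \<omega> k \<le> t})) x y else 0)"
    by (simp add: Wtil_def fun_eq_iff)
  ultimately show ?thesis by simp
qed

lemma Wflux_step_path:
  fixes \<rho>0 :: "real^'d::finite \<Rightarrow> real"
  shows "\<exists>S. step_path T S (Wflux T Nseq \<rho>0 n \<omega>)"
proof -
  let ?R = "ring_time TYPE('d) (Nseq n) \<omega>" and ?W = "Wflux T Nseq \<rho>0 n \<omega>"
  \<comment> \<open>On the exceptional event the path is constantly zero and has no jumps.\<close>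
  define S where "S = (if infinite {k. ?R k \<le> T} then {} else ?R ` {k. ?R k \<le> T})"
  have dual: "dual_elem (?W t)" for t
  proof (rule dual_elemI)
    show "?W t (\<lambda>x l s. a * \<phi> x l s + b * \<psi> x l s) = a * ?W t \<phi> + b * ?W t \<psi>" for \<phi> \<psi> a b
      unfolding Wflux_def Let_def by (simp add: sum_distrib_left sum.distrib distrib_left mult_ac)
  next
    let ?c = "(1 / real (Nseq n))\<^sup>2 / real n"
    let ?w = "\<lambda>x l s. real (Wtil T Nseq \<rho>0 n \<omega> t x (shift (Nseq n) l s x))"
    fix \<phi> :: "'d tf" and b assume b: "\<And>x l s. \<bar>\<phi> x l s\<bar> \<le> b"
    let ?p = "\<lambda>x l s. \<phi> (loc (Nseq n) x + (if s then 1 / real (Nseq n) / 2 else - (1 / real (Nseq n)) / 2) *\<^sub>R axis l 1) l s"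
    have "\<bar>?W t \<phi>\<bar> = ?c * \<bar>\<Sum>x\<in>sites (Nseq n). \<Sum>l\<in>UNIV. \<Sum>s\<in>UNIV. ?w x l s * ?p x l s\<bar>"
      unfolding Wflux_def Let_def abs_mult by simp
    also have "\<dots> \<le> ?c * (\<Sum>x\<in>sites (Nseq n). \<Sum>l\<in>UNIV. \<Sum>s\<in>UNIV. ?w x l s * b)"
    proof (rule mult_left_mono)
      have 1: "\<bar>?w x l s * ?p x l s\<bar> \<le> ?w x l s * b" for x l s
        unfolding abs_mult abs_of_nat by (intro mult_left_mono b) simp
      show "\<bar>\<Sum>x\<in>sites (Nseq n). \<Sum>l\<in>UNIV. \<Sum>s\<in>UNIV. ?w x l s * ?p x l s\<bar> \<le> (\<Sum>x\<in>sites (Nseq n). \<Sum>l\<in>UNIV. \<Sum>s\<in>UNIV. ?w x l s * b)"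
        by (intro order_trans[OF sum_abs] sum_mono 1)
    qed simp
    also have "\<dots> = ?c * (\<Sum>x\<in>sites (Nseq n). \<Sum>l\<in>UNIV. \<Sum>s\<in>UNIV. ?w x l s) * b"
      by (simp only: sum_distrib_right mult.assoc)
    finally show "\<bar>?W t \<phi>\<bar> \<le> ?c * (\<Sum>x\<in>sites (Nseq n). \<Sum>l\<in>UNIV. \<Sum>s\<in>UNIV. ?w x l s) * b" .
  qed
  have "?W s = ?W t" if st: "0 \<le> s" "s \<le> t" "t \<le> T" "S \<inter> {s<..t} = {}" for s t
  proof -
    have "Wtil T Nseq \<rho>0 n \<omega> s = Wtil T Nseq \<rho>0 n \<omega> t"
    proof (cases "infinite {k. ?R k \<le> T}")
      case False
      have "?R k \<le> s" if k: "?R k \<le> t" for k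
      proof (rule ccontr)
        assume "\<not> ?R k \<le> s"
        then have "?R k \<in> S \<inter> {s<..t}" using False k st(3) by (simp add: S_def)
        then show False using st(4) by blast
      qed
      then have "{k. ?R k \<le> s} = {k. ?R k \<le> t}" using st(2) by (auto intro: order_trans)
      then show ?thesis by (simp add: Wtil_def)
    qed (simp add: Wtil_def)
    then show ?thesis by (simp add: Wflux_def fun_eq_iff)
  qed
  then have "step_path T S ?W" using dual by (auto simp: step_path_def S_def)
  then show ?thesis ..
qed

text \<open>A functional of a discretized path only sees finitely many jump counts, which take countably many values.\<close>
lemma discretize_measurable:
  fixes \<rho>0 :: "real^'d::finite \<Rightarrow> real" and F :: "'d path \<Rightarrow> real"
  assumes N: "Nseq n \<ge> 1"
  shows "(\<lambda>\<omega>. F (discretize T m (Wflux T Nseq \<rho>0 n \<omega>))) \<in> borel_measurable Omega"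
proof -
  let ?N = "Nseq n"
  define A where "A = {..m} \<times> ((sites ?N :: 'd site set) \<times> (sites ?N :: 'd site set))"
  have fA: "finite A" by (simp add: A_def)
  \<comment> \<open>The finitely many sampled counts as one random element. Restriction to
    \<open>A\<close> makes its range countable, so every function of it is measurable, whatever
    \<open>F\<close> is.\<close>
  define Z where "Z \<omega> = (\<lambda>p\<in>A. Wtil T Nseq \<rho>0 n \<omega> (real (fst p) * T / real m) (fst (snd p)) (snd (snd p)))" for \<omega>
  define H where "H z t \<phi> = (1 / real ?N)\<^sup>2 / real n * (\<Sum>x\<in>sites ?N. \<Sum>l\<in>UNIV. \<Sum>s\<in>UNIV.
      real (z (min m (nat \<lfloor>real m * t / T\<rfloor>), x, shift ?N l s x)) * \<phi> (loc ?N x + (if s then 1 / real ?N / 2 else - (1 / real ?N) / 2) *\<^sub>R axis l 1) l s)"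
    for z :: "nat \<times> 'd site \<times> 'd site \<Rightarrow> nat" and t and \<phi> :: "'d tf"
  have eq: "discretize T m (Wflux T Nseq \<rho>0 n \<omega>) = H (Z \<omega>)" for \<omega>
  proof (intro ext)
    fix t \<phi>
    have "Z \<omega> (min m (nat \<lfloor>real m * t / T\<rfloor>), x, shift ?N l s x) = Wtil T Nseq \<rho>0 n \<omega> (real (min m (nat \<lfloor>real m * t / T\<rfloor>)) * T / real m) x (shift ?N l s x)"
      if "x \<in> sites ?N" for x l s
      unfolding Z_def using that shift_sites[OF N that] by (simp only: A_def restrict_apply' mem_Sigma_iff atMost_iff min.cobounded1 fst_conv snd_conv simp_thms)
    then show "discretize T m (Wflux T Nseq \<rho>0 n \<omega>) t \<phi> = H (Z \<omega>) t \<phi>"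
      unfolding discretize_def Wflux_def H_def Let_def
      by (intro arg_cong2[where f=times] refl sum.cong) simp
  qed
  have cP: "countable (PiE A (\<lambda>_. UNIV :: nat set))" by (rule countable_PiE[OF fA]) auto
  have "Z \<in> measurable Omega (count_space (PiE A (\<lambda>_. UNIV)))"
    unfolding measurable_count_space_eq_countable[OF cP]
  proof (intro conjI ballI)
    fix a :: "nat \<times> 'd site \<times> 'd site \<Rightarrow> nat" assume a: "a \<in> PiE A (\<lambda>_. UNIV)"
    note [measurable] = Wtil_measurable
    have "Z -` {a} \<inter> space Omega = {\<omega> \<in> space Omega. \<forall>p\<in>A. Wtil T Nseq \<rho>0 n \<omega> (real (fst p) * T / real m) (fst (snd p)) (snd (snd p)) = a p}"
    proof -
      have "Z \<omega> = a \<longleftrightarrow> (\<forall>p\<in>A. Z \<omega> p = a p)" for \<omega>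
        using PiE_ext[of "Z \<omega>" A "\<lambda>_. UNIV" a] a by (auto simp: Z_def)
      then show ?thesis by (auto simp: Z_def)
    qed
    also have "\<dots> \<in> sets Omega" using fA by measurable
    finally show "Z -` {a} \<inter> space Omega \<in> sets Omega" .
  qed (auto simp: Z_def)
  from measurable_compose[OF this, of "\<lambda>z. F (H z)" borel] show ?thesis unfolding eq by simp
qed

text \<open>Continuity of \<open>F\<close> is used along the discretized paths only, and pointwise
  limits of measurable functions are measurable. This avoids any description of the Borel sets of a
  topology generated by uncountably many distances.\<close>

lemma functional_measurable:
  fixes \<rho>0 :: "real^'d::finite \<Rightarrow> real"
  assumes T: "T > 0" and N: "Nseq n \<ge> 1" and F: "continuous_map (SM_top T) euclideanreal F"
  shows "(\<lambda>\<omega>. F (Wflux T Nseq \<rho>0 n \<omega>)) \<in> borel_measurable Omega"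
proof (rule borel_measurable_LIMSEQ_real)
  show "(\<lambda>\<omega>. F (discretize T m (Wflux T Nseq \<rho>0 n \<omega>))) \<in> borel_measurable Omega" for m
    by (rule discretize_measurable) (rule N)
  fix \<omega>
  let ?X = "Wflux T Nseq \<rho>0 n \<omega>"
  obtain S where S: "step_path T S ?X" using Wflux_step_path by blast
  show "(\<lambda>m. F (discretize T m ?X)) \<longlonglongrightarrow> F ?X"
  proof (rule tendstoI)
    fix e :: real assume e: "e > 0"
    obtain Bs r where Bs: "finite Bs" "\<And>B. B \<in> Bs \<Longrightarrow> bounded_tf B" "(r :: real) > 0"
      "\<And>\<eta>. \<eta> \<in> Dspace T \<Longrightarrow> (\<And>B. B \<in> Bs \<Longrightarrow> dSM T B ?X \<eta> \<le> ereal r) \<Longrightarrow> \<bar>F \<eta> - F ?X\<bar> < e"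
      using continuous_SM[OF F step_path_Dspace[OF S] e] by metis
    show "eventually (\<lambda>m. dist (F (discretize T m ?X)) (F ?X) < e) sequentially"
      using discretize_close[OF T S Bs(3)] eventually_gt_at_top[of 0]
    proof eventually_elim
      case (elim m)
      show ?case unfolding dist_real_def
        by (rule Bs(4)[OF step_path_Dspace[OF step_path_discretize[OF T elim(2) S]]]) (use elim(1) in blast)
    qed
  qed
qed

section \<open>Convergence of functionals of the flux\<close>

context hydro
begin

lemma wp_diff:
  assumes \<phi>: "test_fun \<phi>" "\<And>x l s. \<bar>\<phi> x l s\<bar> \<le> C" and st: "s \<in> {0..T}" "t \<in> {0..T}"
  shows "\<bar>wp s \<phi> - wp t \<phi>\<bar> \<le> 2 * real CARD('d) * (C * Gb * \<bar>s - t\<bar>)"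
proof -
  have 1: "\<bar>wl (\<lambda>x. \<phi> x l b) s - wl (\<lambda>x. \<phi> x l b) t\<bar> \<le> C * Gb * \<bar>s - t\<bar>" for l b
    using wl_lipschitz[OF test_fun_cont[OF \<phi>(1)] \<phi>(2), of s t l b] wl_lipschitz[OF test_fun_cont[OF \<phi>(1)] \<phi>(2), of t s l b] st
    by (cases "s \<le> t") (auto simp: abs_minus_commute)
  have "wp s \<phi> - wp t \<phi> = (\<Sum>l\<in>UNIV. \<Sum>b\<in>UNIV. wl (\<lambda>x. \<phi> x l b) s - wl (\<lambda>x. \<phi> x l b) t)"
    by (simp only: wp_def sum_subtractf)
  also have "\<bar>\<dots>\<bar> \<le> (\<Sum>l\<in>(UNIV :: 'd set). \<Sum>b\<in>(UNIV :: bool set). C * Gb * \<bar>s - t\<bar>)"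
    by (intro order_trans[OF sum_abs] sum_mono 1)
  finally show ?thesis by simp
qed

text \<open>The limit is Lipschitz in time uniformly over a bounded set of test functions, so it is
  its own one-sided limit.\<close>

lemma wp_Dspace: "wp \<in> Dspace T"
proof -
  have dual: "dual_elem (wp t)" if t: "t \<in> {0..T}" for t
  proof (rule dual_elemI)
    fix \<phi> \<psi> :: "'d tf" and a b assume p: "test_fun \<phi>" "test_fun \<psi>"
    have "wl (\<lambda>x. a * \<phi> x l s + b * \<psi> x l s) t = a * wl (\<lambda>x. \<phi> x l s) t + b * wl (\<lambda>x. \<psi> x l s) t" for l s
      by (rule wl_lin[OF test_fun_cont[OF p(1)] test_fun_cont[OF p(2)] t])
    then show "wp t (\<lambda>x l s. a * \<phi> x l s + b * \<psi> x l s) = a * wp t \<phi> + b * wp t \<psi>"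
      by (simp add: wp_def sum.distrib sum_distrib_left)
  next
    fix \<phi> :: "'d tf" and b assume p: "test_fun \<phi>" "\<And>x l s. \<bar>\<phi> x l s\<bar> \<le> b"
    have b: "0 \<le> b" using p(2)[of 0 undefined undefined] by linarith
    have "\<bar>wp t \<phi> - wp 0 \<phi>\<bar> \<le> 2 * real CARD('d) * (b * Gb * \<bar>t - 0\<bar>)"
      by (rule wp_diff) (use p t T in auto)
    also have "\<dots> \<le> 2 * real CARD('d) * (b * Gb * T)" using t b Gb(1) by (intro mult_left_mono) auto
    also have "\<dots> = (2 * real CARD('d) * Gb * T) * b" by simp
    finally show "\<bar>wp t \<phi>\<bar> \<le> (2 * real CARD('d) * Gb * T) * b" by (simp add: wp_def wl_def)
  qed
  have lim: "((\<lambda>s. normB B (\<lambda>\<phi>. wp s \<phi> - wp t \<phi>)) \<longlongrightarrow> 0) (at t within A)"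
    if B: "bounded_tf B" and t: "t \<in> {0..T}" and A: "A \<subseteq> {0..T}" for B t A
  proof -
    obtain C L where C: "C \<ge> 0" "\<And>\<phi> x l s. \<phi> \<in> B \<Longrightarrow> \<bar>\<phi> x l s\<bar> \<le> C" using bounded_tf_lip[OF B] by metis
    have tf: "test_fun \<phi>" if "\<phi> \<in> B" for \<phi> using B that by (auto simp: bounded_tf_def)
    let ?u = "\<lambda>s. 2 * real CARD('d) * (C * Gb * \<bar>s - t\<bar>)"
    have u: "((\<lambda>s. ereal (?u s)) \<longlongrightarrow> 0) (at t within A)"
    proof -
      have "(?u \<longlongrightarrow> 2 * real CARD('d) * (C * Gb * \<bar>t - t\<bar>)) (at t within A)" by (intro tendsto_intros)
      then show ?thesis by (simp add: zero_ereal_def del: ereal_eq_0)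
    qed
    show ?thesis
    proof (rule tendsto_sandwich[OF _ _ tendsto_const u])
      show "eventually (\<lambda>s. 0 \<le> normB B (\<lambda>\<phi>. wp s \<phi> - wp t \<phi>)) (at t within A)" by (simp add: normB_nonneg)
      show "eventually (\<lambda>s. normB B (\<lambda>\<phi>. wp s \<phi> - wp t \<phi>) \<le> ereal (?u s)) (at t within A)"
        unfolding eventually_at_filter
      proof (intro always_eventually allI impI normB_le)
        fix s \<phi> assume "s \<in> A" "\<phi> \<in> B"
        then show "\<bar>wp s \<phi> - wp t \<phi>\<bar> \<le> ?u s" using A t C(2) tf by (intro wp_diff) auto
      qed (use C Gb(1) in simp)
    qed
  qed
  show ?thesis unfolding Dspace_def
  proof (intro CollectI conjI ballI allI impI)
    show "\<exists>\<eta>. dual_elem \<eta> \<and> (\<forall>B. bounded_tf B \<longrightarrow> ((\<lambda>s. normB B (\<lambda>\<phi>. wp s \<phi> - \<eta> \<phi>)) \<longlongrightarrow> 0) (at t within {0..<t}))" if "t \<in> {0<..T}" for t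
      using that by (intro exI[of _ "wp t"] conjI allI impI dual lim) auto
  qed (auto intro!: dual lim)
qed

text \<open>Continuity at \<open>wp\<close> involves only finitely many bounded sets, so
  \<open>whp_unif\<close> can be applied to each of them simultaneously.\<close>

lemma whp_functional:
  assumes F: "continuous_map (SM_top T) euclideanreal F" and e: "e > 0"
  shows "whp (\<lambda>n \<omega>. \<bar>F (Wflux T Nseq \<rho>0 n \<omega>) - F wp\<bar> < e)"
proof -
  obtain Bs r where Bs: "finite Bs" "\<And>B. B \<in> Bs \<Longrightarrow> bounded_tf B" "(r :: real) > 0"
    "\<And>\<eta>. \<eta> \<in> Dspace T \<Longrightarrow> (\<And>B. B \<in> Bs \<Longrightarrow> dSM T B wp \<eta> \<le> ereal r) \<Longrightarrow> \<bar>F \<eta> - F wp\<bar> < e"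
    using continuous_SM[OF F wp_Dspace e] by metis
  have "whp (\<lambda>n \<omega>. \<forall>B\<in>Bs. \<forall>t\<in>{0..T}. \<forall>\<phi>\<in>B. \<bar>wp t \<phi> - Wflux T Nseq \<rho>0 n \<omega> t \<phi>\<bar> \<le> r)"
    by (intro whp_ball Bs(1) whp_unif Bs(2,3))
  then show ?thesis
  proof (rule whp_mono, intro always_eventually allI impI)
    fix n \<omega> assume H: "\<forall>B\<in>Bs. \<forall>t\<in>{0..T}. \<forall>\<phi>\<in>B. \<bar>wp t \<phi> - Wflux T Nseq \<rho>0 n \<omega> t \<phi>\<bar> \<le> r"
    obtain S where "step_path T S (Wflux T Nseq \<rho>0 n \<omega>)" using Wflux_step_path by blast
    from Bs(4)[OF step_path_Dspace[OF this]] show "\<bar>F (Wflux T Nseq \<rho>0 n \<omega>) - F wp\<bar> < e"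
      using dSM_sup[OF T less_imp_le[OF Bs(3)]] H by blast
  qed
qed

text \<open>Convergence in probability to a constant: on an event of probability at most
  \<open>e1\<close> the bound on \<open>F\<close> limits the error to \<open>2 * C\<close>,
  elsewhere it is below \<open>e / 2\<close>.\<close>

lemma narrow_conv: "narrow_conv_to_det T Omega (Wflux T Nseq \<rho>0) wp"
  unfolding narrow_conv_to_det_def
proof (intro conjI allI impI wp_Dspace, elim conjE)
  fix F :: "'d path \<Rightarrow> real" and n assume F: "continuous_map (SM_top T) euclideanreal F"
  show "(\<lambda>\<omega>. F (Wflux T Nseq \<rho>0 n \<omega>)) \<in> borel_measurable Omega"
    by (rule functional_measurable) (rule T Nseq1 F)+
next
  fix F :: "'d path \<Rightarrow> real" assume FF: "continuous_map (SM_top T) euclideanreal F \<and> bounded (F ` Dspace T)"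
  then have F: "continuous_map (SM_top T) euclideanreal F" by blast
  obtain C where C: "\<And>\<xi>. \<xi> \<in> Dspace T \<Longrightarrow> \<bar>F \<xi>\<bar> \<le> C" using FF by (auto simp: bounded_real)
  have C0: "C \<ge> 0" using C[OF wp_Dspace] by linarith
  have XD: "Wflux T Nseq \<rho>0 n \<omega> \<in> Dspace T" for n \<omega> using Wflux_step_path step_path_Dspace by blast
  show "(\<lambda>n. \<integral>\<omega>. F (Wflux T Nseq \<rho>0 n \<omega>) \<partial>Omega) \<longlonglongrightarrow> F wp"
  proof (rule tendstoI)
    fix e :: real assume e: "e > 0"
    define e1 where "e1 = e / (4 * (C + 1))"
    have e1: "e1 > 0" using e C0 by (simp add: e1_def)
    have Ce: "2 * C * e1 < e / 2"
    proof -
      have "2 * C * e1 < 2 * (C + 1) * e1" using e1 by (intro mult_strict_right_mono) auto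
      moreover have "2 * z * (e / (4 * z)) = e / 2" if "z > 0" for z using that by simp
      from this[of "C + 1"] have "2 * (C + 1) * e1 = e / 2" using C0 unfolding e1_def by argo
      ultimately show ?thesis by argo
    qed
    have e2: "e / 2 > 0" using e by simp
    show "eventually (\<lambda>n. dist (\<integral>\<omega>. F (Wflux T Nseq \<rho>0 n \<omega>) \<partial>Omega) (F wp) < e) sequentially"
      using whp_functional[OF F e2, unfolded whp_def, rule_format, OF e1]
    proof eventually_elim
      case (elim n)
      then obtain E where E: "E \<in> sets Omega" "1 - e1 \<le> Om.prob E" "\<And>\<omega>. \<omega> \<in> E \<Longrightarrow> \<bar>F (Wflux T Nseq \<rho>0 n \<omega>) - F wp\<bar> < e / 2" by blast
      let ?Y = "\<lambda>\<omega>. F (Wflux T Nseq \<rho>0 n \<omega>)"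
      have m: "?Y \<in> borel_measurable Omega" by (rule functional_measurable) (rule T Nseq1 F)+
      have i: "integrable Omega ?Y" by (rule Om.integrable_const_bound[OF _ m, where B=C]) (use C XD in auto)
      have cE: "UNIV - E \<in> sets Omega" by (rule compl_Omega[OF E(1)])
      have pE: "Om.prob (UNIV - E) \<le> e1" using Om.prob_compl[OF E(1)] E(2) by simp
      have i2: "integrable Omega (indicator (UNIV - E) :: _ \<Rightarrow> real)" using cE by (simp add: less_top[symmetric])
      have "(\<integral>\<omega>. ?Y \<omega> \<partial>Omega) - F wp = (\<integral>\<omega>. ?Y \<omega> - F wp \<partial>Omega)" using i by (simp add: Om.prob_space)
      also have "\<bar>\<dots>\<bar> \<le> (\<integral>\<omega>. \<bar>?Y \<omega> - F wp\<bar> \<partial>Omega)" by (rule integral_abs_bound)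
      also have "\<dots> \<le> (\<integral>\<omega>. e / 2 + 2 * C * indicator (UNIV - E) \<omega> \<partial>Omega)"
      proof (rule integral_mono)
        fix \<omega>
        show "\<bar>?Y \<omega> - F wp\<bar> \<le> e / 2 + 2 * C * indicator (UNIV - E) \<omega>"
        proof (cases "\<omega> \<in> E")
          case True then show ?thesis using E(3)[OF True] by simp
        next
          case False then show ?thesis using C[OF XD[of n \<omega>]] C[OF wp_Dspace] e by simp
        qed
      qed (use i i2 in auto)
      also have "\<dots> = e / 2 + 2 * C * Om.prob (UNIV - E)"
        using i2 cE by (subst Bochner_Integration.integral_add) (auto simp: Om.prob_space)
      also have "\<dots> \<le> e / 2 + 2 * C * e1" using pE C0 by (intro add_left_mono mult_left_mono) auto
      finally show ?case using Ce unfolding dist_real_def by argo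
    qed
  qed
qed

end

theorem theorem6p2:
  fixes T :: real and Nseq :: "nat \<Rightarrow> nat"
    and \<rho>0 :: "real^'d::finite \<Rightarrow> real" and \<rho> :: "real^'d \<Rightarrow> real \<Rightarrow> real"
  assumes "T > 0"
    and "\<forall>n. Nseq n \<ge> 1"
    and "(\<lambda>n. 1 / real (Nseq n)) \<longlonglongrightarrow> 0"
    and "continuous_on UNIV \<rho>0" and "periodic_fun \<rho>0" and "\<forall>x. \<rho>0 x \<ge> 0"
    and "\<exists>x. \<rho>0 x \<noteq> 0"
    and "\<forall>n. \<forall>x\<in>sites (Nseq n). init_param Nseq \<rho>0 n x \<le> 1"
    and "heat_sol T \<rho>0 \<rho>"
    and "convergent (\<lambda>n. (1 / real (Nseq n)) ^ CARD('d) * real n)"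
    and "lim (\<lambda>n. (1 / real (Nseq n)) ^ CARD('d) * real n) * integral (cbox 0 One) \<rho>0 < 1"
  shows "narrow_conv_to_det T Omega (Wflux T Nseq \<rho>0)
           (wlim \<rho> (lim (\<lambda>n. (1 / real (Nseq n)) ^ CARD('d) * real n) * integral (cbox 0 One) \<rho>0)
                 (integral (cbox 0 One) \<rho>0))"
proof -
  interpret hydro T Nseq \<rho>0 \<rho> by unfold_locales (use assms in blast)+
  \<comment> \<open>What remains is the naming of the limit, with \<open>\<alpha>\<close> in the
    form \<open>kaplim * mass\<close>.\<close>
  have "kap = (\<lambda>n. (1 / real (Nseq n)) ^ CARD('d) * real n)" by (simp add: kap_def fun_eq_iff)
  then have "lim (\<lambda>n. (1 / real (Nseq n)) ^ CARD('d) * real n) = kaplim" by (simp add: kaplim_def)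
  then show ?thesis using narrow_conv wlim_wp by (simp add: mass_def)
qed

end
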